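(* Let $k$ be a field, let $H$ be a Hopf algebra over $k$ and let $A, B$ be Hopf subalgebras of $H$ such that $A$ right normalizes $B$. Then the following hold: (i) The product $AB$ is a Hopf subalgebra of $H$. (ii) $A(A\cap B)^+$ is a Hopf ideal of $A$ and $AB^+$ is a Hopf ideal of $AB$. (iii) Suppose that $AB$ is left faithfully flat over $B$ and $A$ is right faithfully coflat over $AB/AB^+$. Then the inclusion $A \to AB$ induces canonically an isomorphism of Hopf algebras $A/A(A\cap B)^+ \cong AB/AB^+$.
   Context: $A$ right normalizes $B$ means that $B$ is stable under the right adjoint action of $A$: $\mathcal S(a_{(1)})\,b\,a_{(2)}\in B$ for all $a\in A$, $b\in B$. $AB$ denotes the linear span of products $ab$, $a\in A$, $b\in B$; for a subalgebra $K$, $K^+=K\cap\ker\epsilon$. $AB$ is left faithfully flat over $B$ if it is faithfully flat as a left $B$-module (by multiplication). If $\pi':A\to AB/AB^+$ denotes the Hopf algebra map obtained by composing the inclusion $A\to AB$ with the canonical projection $AB\to AB/AB^+$, then $A$ is right faithfully coflat over $AB/AB^+$ if $A$, viewed as a right $AB/AB^+$-comodule via $(\mathrm{id}\otimes\pi')\Delta$, is faithfully coflat, i.e. the cotensor functor $A\,\square_{AB/AB^+}\,-$ on left comodules preserves and reflects exact sequences. $H$ need not be finite dimensional. *)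

theory Defs
  imports "HOL-Algebra.Free_Abelian_Groups" "HOL-Algebra.QuotRing" "HOL-Algebra.Subrings"
begin

section \<open>Tensor products\<close>

text \<open>
  The tensor product of a right \<open>R\<close>-module \<open>M\<close> and a left \<open>R\<close>-module \<open>N\<close> is the free abelian group
  on \<open>carrier M \<times> carrier N\<close> modulo the usual relations; its elements are cosets. For both left and
  right modules the action is stored in the field \<^const>\<open>smult\<close>, i.e. in a right module
  \<open>smult M r m\<close> stands for \<open>m \<cdot> r\<close>. Over a commutative ring there is no difference.
\<close>

type_synonym ('m, 'n) tensor = "('m \<times> 'n \<Rightarrow>\<^sub>0 int) set"

definition tensor_rel ::
  "('r, 'x) ring_scheme \<Rightarrow> ('r, 'm, 'y) module_scheme \<Rightarrow> ('r, 'n, 'z) module_scheme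
    \<Rightarrow> ('m, 'n) tensor" where
  "tensor_rel R M N = generate (free_Abelian_group (carrier M \<times> carrier N))
     ({frag_of (m \<oplus>\<^bsub>M\<^esub> m', n) - frag_of (m, n) - frag_of (m', n) | m m' n.
         m \<in> carrier M \<and> m' \<in> carrier M \<and> n \<in> carrier N}
    \<union> {frag_of (m, n \<oplus>\<^bsub>N\<^esub> n') - frag_of (m, n) - frag_of (m, n') | m n n'.
         m \<in> carrier M \<and> n \<in> carrier N \<and> n' \<in> carrier N}
    \<union> {frag_of (r \<odot>\<^bsub>M\<^esub> m, n) - frag_of (m, r \<odot>\<^bsub>N\<^esub> n) | r m n.
         r \<in> carrier R \<and> m \<in> carrier M \<and> n \<in> carrier N})"

definition tensor_group ::
  "('r, 'x) ring_scheme \<Rightarrow> ('r, 'm, 'y) module_scheme \<Rightarrow> ('r, 'n, 'z) module_scheme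
    \<Rightarrow> ('m, 'n) tensor monoid" where
  "tensor_group R M N =
     free_Abelian_group (carrier M \<times> carrier N) Mod tensor_rel R M N"

definition pure_tensor ::
  "('r, 'x) ring_scheme \<Rightarrow> ('r, 'm, 'y) module_scheme \<Rightarrow> ('r, 'n, 'z) module_scheme
    \<Rightarrow> 'm \<Rightarrow> 'n \<Rightarrow> ('m, 'n) tensor" where
  "pure_tensor R M N m n =
     tensor_rel R M N #>\<^bsub>free_Abelian_group (carrier M \<times> carrier N)\<^esub> frag_of (m, n)"

text \<open>
  The group homomorphism \<open>m \<otimes> n \<mapsto> \<phi> m n\<close> into the (multiplicatively written) abelian group \<open>G\<close>
  induced by a balanced biadditive map \<open>\<phi>\<close>. Only used for such \<open>\<phi>\<close>, where the value does not
  depend on the representative \<open>c\<close>. Composed with a comultiplication it plays the role of Sweedler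
  notation: \<open>tensor_lift G \<phi> (\<Delta> h)\<close> is the sum of all \<open>\<phi> h\<^sub>1 h\<^sub>2\<close>.
\<close>
definition tensor_lift ::
  "('g, 'x) monoid_scheme \<Rightarrow> ('m \<Rightarrow> 'n \<Rightarrow> 'g) \<Rightarrow> ('m, 'n) tensor \<Rightarrow> 'g" where
  "tensor_lift G \<phi> t =
     (THE y. \<exists>c\<in>t. y = finprod G (\<lambda>(m, n). \<phi> m n [^]\<^bsub>G\<^esub> Poly_Mapping.lookup c (m, n))
                              (Poly_Mapping.keys c))"

text \<open>The map \<open>f \<otimes> g\<close> into \<open>M' \<otimes> N'\<close>.\<close>
definition tensor_map ::
  "('r, 'x) ring_scheme \<Rightarrow> ('r, 'm2, 'y) module_scheme \<Rightarrow> ('r, 'n2, 'z) module_scheme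
    \<Rightarrow> ('m \<Rightarrow> 'm2) \<Rightarrow> ('n \<Rightarrow> 'n2) \<Rightarrow> ('m, 'n) tensor \<Rightarrow> ('m2, 'n2) tensor" where
  "tensor_map R M' N' f g =
     tensor_lift (tensor_group R M' N') (\<lambda>m n. pure_tensor R M' N' (f m) (g n))"

text \<open>
  Over a commutative ring \<open>K\<close> the tensor product is a \<open>K\<close>-module, and a \<open>K\<close>-algebra if both factors
  are. The fields \<^const>\<open>mult\<close> and \<^const>\<open>one\<close> carry no meaning when \<open>M\<close>, \<open>N\<close> are mere modules.
\<close>
definition tensor_prod ::
  "('k, 'x) ring_scheme \<Rightarrow> ('k, 'm, 'y) module_scheme \<Rightarrow> ('k, 'n, 'z) module_scheme
    \<Rightarrow> ('k, ('m, 'n) tensor) module" where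
  "tensor_prod K M N =
     \<lparr>carrier = carrier (tensor_group K M N),
      mult = (\<lambda>s t. tensor_lift (tensor_group K M N)
                (\<lambda>a b. tensor_lift (tensor_group K M N)
                   (\<lambda>c d. pure_tensor K M N (a \<otimes>\<^bsub>M\<^esub> c) (b \<otimes>\<^bsub>N\<^esub> d)) t) s),
      one = pure_tensor K M N \<one>\<^bsub>M\<^esub> \<one>\<^bsub>N\<^esub>,
      zero = \<one>\<^bsub>tensor_group K M N\<^esub>,
      add = mult (tensor_group K M N),
      smult = (\<lambda>k. tensor_map K M N (\<lambda>m. k \<odot>\<^bsub>M\<^esub> m) (\<lambda>n. n))\<rparr>"

text \<open>The canonical map \<open>(L \<otimes> M) \<otimes> N \<rightarrow> L \<otimes> (M \<otimes> N)\<close>.\<close>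
definition tensor_assoc ::
  "('k, 'x) ring_scheme \<Rightarrow> ('k, 'l, 'w) module_scheme \<Rightarrow> ('k, 'm, 'y) module_scheme
    \<Rightarrow> ('k, 'n, 'z) module_scheme
    \<Rightarrow> (('l, 'm) tensor, 'n) tensor \<Rightarrow> ('l, ('m, 'n) tensor) tensor" where
  "tensor_assoc K L M N =
     (let T = tensor_group K L (tensor_prod K M N) in
      tensor_lift T (\<lambda>t n. tensor_lift T
        (\<lambda>l m. pure_tensor K L (tensor_prod K M N) l (pure_tensor K M N m n)) t))"

text \<open>For subspaces \<open>U\<close> of \<open>M\<close> and \<open>V\<close> of \<open>N\<close>: the image of \<open>U \<otimes> V\<close> in \<open>M \<otimes> N\<close>.\<close>
definition sub_tensor ::
  "('k, 'x) ring_scheme \<Rightarrow> ('k, 'm, 'y) module_scheme \<Rightarrow> ('k, 'n, 'z) module_scheme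
    \<Rightarrow> 'm set \<Rightarrow> 'n set \<Rightarrow> ('m, 'n) tensor set" where
  "sub_tensor K M N U V =
     generate (tensor_group K M N) {pure_tensor K M N u v | u v. u \<in> U \<and> v \<in> V}"

definition linear_maps ::
  "('k, 'x) ring_scheme \<Rightarrow> ('k, 'm, 'y) module_scheme \<Rightarrow> ('k, 'n, 'z) module_scheme
    \<Rightarrow> ('m \<Rightarrow> 'n) set" where
  "linear_maps R M N =
     {f \<in> carrier M \<rightarrow> carrier N.
        (\<forall>x\<in>carrier M. \<forall>y\<in>carrier M. f (x \<oplus>\<^bsub>M\<^esub> y) = f x \<oplus>\<^bsub>N\<^esub> f y) \<and>
        (\<forall>r\<in>carrier R. \<forall>x\<in>carrier M. f (r \<odot>\<^bsub>M\<^esub> x) = r \<odot>\<^bsub>N\<^esub> f x)}"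

definition linear_span ::
  "('k, 'x) ring_scheme \<Rightarrow> ('k, 'm, 'y) module_scheme \<Rightarrow> 'm set \<Rightarrow> 'm set" where
  "linear_span K M S = \<Inter>{W. submodule W K M \<and> S \<subseteq> W}"


section \<open>Hopf algebras\<close>

record ('k, 'c) coalg = "('k, 'c) module" +
  comult :: "'c \<Rightarrow> ('c, 'c) tensor"
  counit :: "'c \<Rightarrow> 'k"

record ('k, 'h) hopf_alg = "('k, 'h) coalg" +
  antipode :: "'h \<Rightarrow> 'h"

locale coalgebra = R?: field K + module K C
  for K :: "('k, 'w) ring_scheme" (structure) and C :: "('k, 'c, 'x) coalg_scheme" (structure) +
  assumes comult_linear: "comult C \<in> linear_maps K C (tensor_prod K C C)"
    and counit_closed: "x \<in> carrier C \<Longrightarrow> counit C x \<in> carrier K"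
    and counit_add: "x \<in> carrier C \<Longrightarrow> y \<in> carrier C \<Longrightarrow>
          counit C (x \<oplus>\<^bsub>C\<^esub> y) = counit C x \<oplus>\<^bsub>K\<^esub> counit C y"
    and counit_smult: "k \<in> carrier K \<Longrightarrow> x \<in> carrier C \<Longrightarrow>
          counit C (k \<odot>\<^bsub>C\<^esub> x) = k \<otimes>\<^bsub>K\<^esub> counit C x"
    and coassoc: "x \<in> carrier C \<Longrightarrow>
          tensor_assoc K C C C (tensor_map K (tensor_prod K C C) C (comult C) (\<lambda>y. y) (comult C x))
          = tensor_map K C (tensor_prod K C C) (\<lambda>y. y) (comult C) (comult C x)"
    and counit_left: "x \<in> carrier C \<Longrightarrow>
          tensor_lift (add_monoid C) (\<lambda>y z. counit C y \<odot>\<^bsub>C\<^esub> z) (comult C x) = x"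
    and counit_right: "x \<in> carrier C \<Longrightarrow>
          tensor_lift (add_monoid C) (\<lambda>y z. counit C z \<odot>\<^bsub>C\<^esub> y) (comult C x) = x"

locale hopf_algebra = coalgebra K H + M?: ring H
  for K :: "('k, 'w) ring_scheme" (structure) and H :: "('k, 'h, 'x) hopf_alg_scheme" (structure) +
  assumes smult_mult_left: "k \<in> carrier K \<Longrightarrow> x \<in> carrier H \<Longrightarrow> y \<in> carrier H \<Longrightarrow>
          (k \<odot>\<^bsub>H\<^esub> x) \<otimes>\<^bsub>H\<^esub> y = k \<odot>\<^bsub>H\<^esub> (x \<otimes>\<^bsub>H\<^esub> y)"
    and smult_mult_right: "k \<in> carrier K \<Longrightarrow> x \<in> carrier H \<Longrightarrow> y \<in> carrier H \<Longrightarrow>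
          x \<otimes>\<^bsub>H\<^esub> (k \<odot>\<^bsub>H\<^esub> y) = k \<odot>\<^bsub>H\<^esub> (x \<otimes>\<^bsub>H\<^esub> y)"
    and comult_ring_hom: "comult H \<in> ring_hom H (tensor_prod K H H)"
    and counit_ring_hom: "counit H \<in> ring_hom H K"
    and antipode_linear: "antipode H \<in> linear_maps K H H"
    and antipode_left: "x \<in> carrier H \<Longrightarrow>
          tensor_lift (add_monoid H) (\<lambda>y z. antipode H y \<otimes>\<^bsub>H\<^esub> z) (comult H x)
          = counit H x \<odot>\<^bsub>H\<^esub> \<one>\<^bsub>H\<^esub>"
    and antipode_right: "x \<in> carrier H \<Longrightarrow>
          tensor_lift (add_monoid H) (\<lambda>y z. y \<otimes>\<^bsub>H\<^esub> antipode H z) (comult H x)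
          = counit H x \<odot>\<^bsub>H\<^esub> \<one>\<^bsub>H\<^esub>"

definition hopf_hom ::
  "('k, 'x) ring_scheme \<Rightarrow> ('k, 'g, 'y) hopf_alg_scheme \<Rightarrow> ('k, 'h, 'z) hopf_alg_scheme
    \<Rightarrow> ('g \<Rightarrow> 'h) set" where
  "hopf_hom K G H =
     {f \<in> ring_hom G H \<inter> linear_maps K G H.
        \<forall>x\<in>carrier G.
          comult H (f x) = tensor_map K H H f f (comult G x) \<and>
          counit H (f x) = counit G x \<and>
          antipode H (f x) = f (antipode G x)}"

definition hopf_iso ::
  "('k, 'x) ring_scheme \<Rightarrow> ('k, 'g, 'y) hopf_alg_scheme \<Rightarrow> ('k, 'h, 'z) hopf_alg_scheme
    \<Rightarrow> ('g \<Rightarrow> 'h) set" where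
  "hopf_iso K G H = {f \<in> hopf_hom K G H. bij_betw f (carrier G) (carrier H)}"

definition hopf_subalgebra ::
  "('k, 'x) ring_scheme \<Rightarrow> ('k, 'h) hopf_alg \<Rightarrow> 'h set \<Rightarrow> bool" where
  "hopf_subalgebra K H A \<longleftrightarrow>
     subring A H \<and> submodule A K H \<and>
     (\<forall>a\<in>A. comult H a \<in> sub_tensor K H H A A) \<and>
     (\<forall>a\<in>A. antipode H a \<in> A)"

text \<open>
  A Hopf subalgebra as a Hopf algebra in its own right. The elements of \<open>A \<otimes> A\<close> are not literally
  elements of \<open>H \<otimes> H\<close>, so the comultiplication is pulled back along the canonical map
  \<open>A \<otimes> A \<rightarrow> H \<otimes> H\<close>, which is injective over a field.
\<close>
definition hopf_restrict ::
  "('k, 'x) ring_scheme \<Rightarrow> ('k, 'h) hopf_alg \<Rightarrow> 'h set \<Rightarrow> ('k, 'h) hopf_alg" where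
  "hopf_restrict K H A =
     H\<lparr>carrier := A,
       comult := (\<lambda>a. THE t. t \<in> carrier (tensor_group K (H\<lparr>carrier := A\<rparr>) (H\<lparr>carrier := A\<rparr>)) \<and>
                        tensor_map K H H (\<lambda>x. x) (\<lambda>x. x) t = comult H a)\<rparr>"

definition hopf_ideal ::
  "('k, 'x) ring_scheme \<Rightarrow> ('k, 'h) hopf_alg \<Rightarrow> 'h set \<Rightarrow> bool" where
  "hopf_ideal K H I \<longleftrightarrow>
     ideal I H \<and> submodule I K H \<and>
     (\<forall>x\<in>I. comult H x \<in>
        sub_tensor K H H I (carrier H) <+>\<^bsub>tensor_prod K H H\<^esub> sub_tensor K H H (carrier H) I) \<and>
     (\<forall>x\<in>I. counit H x = \<zero>\<^bsub>K\<^esub>) \<and>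
     (\<forall>x\<in>I. antipode H x \<in> I)"

definition quot_module :: "('k, 'h, 'y) module_scheme \<Rightarrow> 'h set \<Rightarrow> ('k, 'h set) module" where
  "quot_module H I =
     \<lparr>carrier = carrier (H Quot I), mult = mult (H Quot I), one = one (H Quot I),
      zero = zero (H Quot I), add = add (H Quot I),
      smult = (\<lambda>k X. \<Union>x\<in>X. I +>\<^bsub>H\<^esub> (k \<odot>\<^bsub>H\<^esub> x))\<rparr>"

text \<open>The quotient of a Hopf algebra by a Hopf ideal; all operations are induced on cosets.\<close>
definition hopf_quot ::
  "('k, 'x) ring_scheme \<Rightarrow> ('k, 'h) hopf_alg \<Rightarrow> 'h set \<Rightarrow> ('k, 'h set) hopf_alg" where
  "hopf_quot K H I =
     \<lparr>carrier = carrier (quot_module H I), mult = mult (quot_module H I),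
      one = one (quot_module H I), zero = zero (quot_module H I),
      add = add (quot_module H I), smult = smult (quot_module H I),
      comult = (\<lambda>X. THE t. \<exists>x\<in>X. t = tensor_map K (quot_module H I) (quot_module H I)
                                          (a_r_coset H I) (a_r_coset H I) (comult H x)),
      counit = (\<lambda>X. THE c. \<exists>x\<in>X. c = counit H x),
      antipode = (\<lambda>X. \<Union>x\<in>X. I +>\<^bsub>H\<^esub> antipode H x)\<rparr>"

text \<open>\<open>S(a\<^sub>1) b a\<^sub>2 \<in> B\<close>.\<close>
definition right_normalizes :: "('k, 'h) hopf_alg \<Rightarrow> 'h set \<Rightarrow> 'h set \<Rightarrow> bool" where
  "right_normalizes H A B \<longleftrightarrow>
     (\<forall>a\<in>A. \<forall>b\<in>B.
        tensor_lift (add_monoid H) (\<lambda>x y. antipode H x \<otimes>\<^bsub>H\<^esub> b \<otimes>\<^bsub>H\<^esub> y) (comult H a) \<in> B)"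

definition span_prod ::
  "('k, 'x) ring_scheme \<Rightarrow> ('k, 'h, 'y) module_scheme \<Rightarrow> 'h set \<Rightarrow> 'h set \<Rightarrow> 'h set" where
  "span_prod K H U V = linear_span K H {u \<otimes>\<^bsub>H\<^esub> v | u v. u \<in> U \<and> v \<in> V}"

text \<open>\<open>B\<^sup>+\<close>\<close>
definition augmentation ::
  "('k, 'x) ring_scheme \<Rightarrow> ('k, 'h) hopf_alg \<Rightarrow> 'h set \<Rightarrow> 'h set" where
  "augmentation K H B = {b \<in> B. counit H b = \<zero>\<^bsub>K\<^esub>}"


section \<open>Faithful flatness over a possibly noncommutative ring\<close>

locale left_module = R?: ring R + M?: abelian_group M
  for R :: "('r, 'w) ring_scheme" (structure) and M :: "('r, 'm, 'x) module_scheme" (structure) +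
  assumes lsmult_closed: "r \<in> carrier R \<Longrightarrow> x \<in> carrier M \<Longrightarrow> r \<odot>\<^bsub>M\<^esub> x \<in> carrier M"
    and lsmult_add_left: "r \<in> carrier R \<Longrightarrow> s \<in> carrier R \<Longrightarrow> x \<in> carrier M \<Longrightarrow>
          (r \<oplus>\<^bsub>R\<^esub> s) \<odot>\<^bsub>M\<^esub> x = r \<odot>\<^bsub>M\<^esub> x \<oplus>\<^bsub>M\<^esub> s \<odot>\<^bsub>M\<^esub> x"
    and lsmult_add_right: "r \<in> carrier R \<Longrightarrow> x \<in> carrier M \<Longrightarrow> y \<in> carrier M \<Longrightarrow>
          r \<odot>\<^bsub>M\<^esub> (x \<oplus>\<^bsub>M\<^esub> y) = r \<odot>\<^bsub>M\<^esub> x \<oplus>\<^bsub>M\<^esub> r \<odot>\<^bsub>M\<^esub> y"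
    and lsmult_mult: "r \<in> carrier R \<Longrightarrow> s \<in> carrier R \<Longrightarrow> x \<in> carrier M \<Longrightarrow>
          (r \<otimes>\<^bsub>R\<^esub> s) \<odot>\<^bsub>M\<^esub> x = r \<odot>\<^bsub>M\<^esub> (s \<odot>\<^bsub>M\<^esub> x)"
    and lsmult_one: "x \<in> carrier M \<Longrightarrow> \<one>\<^bsub>R\<^esub> \<odot>\<^bsub>M\<^esub> x = x"

text \<open>Here \<open>r \<odot> x\<close> stands for \<open>x \<cdot> r\<close>.\<close>
locale right_module = R?: ring R + M?: abelian_group M
  for R :: "('r, 'w) ring_scheme" (structure) and M :: "('r, 'm, 'x) module_scheme" (structure) +
  assumes rsmult_closed: "r \<in> carrier R \<Longrightarrow> x \<in> carrier M \<Longrightarrow> r \<odot>\<^bsub>M\<^esub> x \<in> carrier M"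
    and rsmult_add_left: "r \<in> carrier R \<Longrightarrow> s \<in> carrier R \<Longrightarrow> x \<in> carrier M \<Longrightarrow>
          (r \<oplus>\<^bsub>R\<^esub> s) \<odot>\<^bsub>M\<^esub> x = r \<odot>\<^bsub>M\<^esub> x \<oplus>\<^bsub>M\<^esub> s \<odot>\<^bsub>M\<^esub> x"
    and rsmult_add_right: "r \<in> carrier R \<Longrightarrow> x \<in> carrier M \<Longrightarrow> y \<in> carrier M \<Longrightarrow>
          r \<odot>\<^bsub>M\<^esub> (x \<oplus>\<^bsub>M\<^esub> y) = r \<odot>\<^bsub>M\<^esub> x \<oplus>\<^bsub>M\<^esub> r \<odot>\<^bsub>M\<^esub> y"
    and rsmult_mult: "r \<in> carrier R \<Longrightarrow> s \<in> carrier R \<Longrightarrow> x \<in> carrier M \<Longrightarrow>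
          (r \<otimes>\<^bsub>R\<^esub> s) \<odot>\<^bsub>M\<^esub> x = s \<odot>\<^bsub>M\<^esub> (r \<odot>\<^bsub>M\<^esub> x)"
    and rsmult_one: "x \<in> carrier M \<Longrightarrow> \<one>\<^bsub>R\<^esub> \<odot>\<^bsub>M\<^esub> x = x"

text \<open>Exactness of \<open>X \<rightarrow> Y \<rightarrow> Z\<close> at \<open>Y\<close>, where \<open>z\<close> is the zero of \<open>Z\<close>.\<close>
definition exact_at :: "'a set \<Rightarrow> ('a \<Rightarrow> 'b) \<Rightarrow> 'b set \<Rightarrow> ('b \<Rightarrow> 'c) \<Rightarrow> 'c \<Rightarrow> bool" where
  "exact_at X f Y g z \<longleftrightarrow> f ` X = {y \<in> Y. g y = z}"

text \<open>
  The functor \<open>- \<otimes>\<^sub>R N\<close> preserves and reflects exact sequences of right \<open>R\<close>-modules. A formula cannot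
  quantify over all types, so the modules live in the fixed universe \<open>(nat \<Rightarrow> 'r) set\<close>. It contains
  an isomorphic copy of every finitely (even countably) generated right module, as cosets of a
  submodule of a power of \<open>R\<close>, and in particular of all right ideals and all cyclic modules. By
  Baer's criterion (injectivity of \<open>I \<otimes> N \<rightarrow> R \<otimes> N\<close> for right ideals \<open>I\<close>, and \<open>R/I \<otimes> N \<noteq> 0\<close> for
  proper \<open>I\<close>) the condition is therefore equivalent to the one for modules of arbitrary size.
\<close>
definition left_faithfully_flat ::
  "('r, 'x) ring_scheme \<Rightarrow> ('r, 'n, 'y) module_scheme \<Rightarrow> bool" where
  "left_faithfully_flat R N \<longleftrightarrow>
     left_module R N \<and>
     (\<forall>(M1 :: ('r, (nat \<Rightarrow> 'r) set) module) (M2 :: ('r, (nat \<Rightarrow> 'r) set) module)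
       (M3 :: ('r, (nat \<Rightarrow> 'r) set) module) f g.
        right_module R M1 \<and> right_module R M2 \<and> right_module R M3 \<and>
        f \<in> linear_maps R M1 M2 \<and> g \<in> linear_maps R M2 M3 \<longrightarrow>
        (exact_at (carrier M1) f (carrier M2) g \<zero>\<^bsub>M3\<^esub> \<longleftrightarrow>
         exact_at (carrier (tensor_group R M1 N)) (tensor_map R M2 N f (\<lambda>n. n))
                  (carrier (tensor_group R M2 N)) (tensor_map R M3 N g (\<lambda>n. n))
                  \<one>\<^bsub>tensor_group R M3 N\<^esub>))"

text \<open>An overring viewed as a left module by multiplication.\<close>
definition left_mult_module :: "('h, 'x) ring_scheme \<Rightarrow> ('h, 'h) module" where
  "left_mult_module H =
     \<lparr>carrier = carrier H, mult = mult H, one = one H, zero = zero H, add = add H,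
      smult = mult H\<rparr>"


section \<open>Comodules and faithful coflatness\<close>

definition left_comodule ::
  "('k, 'x) ring_scheme \<Rightarrow> ('k, 'c, 'y) coalg_scheme \<Rightarrow> ('k, 'm, 'z) module_scheme
    \<Rightarrow> ('m \<Rightarrow> ('c, 'm) tensor) \<Rightarrow> bool" where
  "left_comodule K C M \<rho> \<longleftrightarrow>
     module K M \<and> \<rho> \<in> linear_maps K M (tensor_prod K C M) \<and>
     (\<forall>m\<in>carrier M.
        tensor_assoc K C C M (tensor_map K (tensor_prod K C C) M (comult C) (\<lambda>x. x) (\<rho> m))
          = tensor_map K C (tensor_prod K C M) (\<lambda>c. c) \<rho> (\<rho> m) \<and>
        tensor_lift (add_monoid M) (\<lambda>c x. counit C c \<odot>\<^bsub>M\<^esub> x) (\<rho> m) = m)"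

definition right_comodule ::
  "('k, 'x) ring_scheme \<Rightarrow> ('k, 'c, 'y) coalg_scheme \<Rightarrow> ('k, 'v, 'z) module_scheme
    \<Rightarrow> ('v \<Rightarrow> ('v, 'c) tensor) \<Rightarrow> bool" where
  "right_comodule K C V \<delta> \<longleftrightarrow>
     module K V \<and> \<delta> \<in> linear_maps K V (tensor_prod K V C) \<and>
     (\<forall>v\<in>carrier V.
        tensor_assoc K V C C (tensor_map K (tensor_prod K V C) C \<delta> (\<lambda>c. c) (\<delta> v))
          = tensor_map K V (tensor_prod K C C) (\<lambda>x. x) (comult C) (\<delta> v) \<and>
        tensor_lift (add_monoid V) (\<lambda>x c. counit C c \<odot>\<^bsub>V\<^esub> x) (\<delta> v) = v)"

definition left_comodule_hom ::
  "('k, 'x) ring_scheme \<Rightarrow> ('k, 'c, 'y) coalg_scheme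
    \<Rightarrow> ('k, 'm, 'z) module_scheme \<Rightarrow> ('m \<Rightarrow> ('c, 'm) tensor)
    \<Rightarrow> ('k, 'n, 'w) module_scheme \<Rightarrow> ('n \<Rightarrow> ('c, 'n) tensor) \<Rightarrow> ('m \<Rightarrow> 'n) set" where
  "left_comodule_hom K C M \<rho> N \<sigma> =
     {f \<in> linear_maps K M N.
        \<forall>m\<in>carrier M. \<sigma> (f m) = tensor_map K C N (\<lambda>c. c) f (\<rho> m)}"

text \<open>The cotensor product: the equalizer of \<open>\<delta> \<otimes> id\<close> and \<open>id \<otimes> \<rho>\<close> on \<open>V \<otimes> M\<close>.\<close>
definition cotensor ::
  "('k, 'x) ring_scheme \<Rightarrow> ('k, 'c, 'y) coalg_scheme
    \<Rightarrow> ('k, 'v, 'z) module_scheme \<Rightarrow> ('v \<Rightarrow> ('v, 'c) tensor)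
    \<Rightarrow> ('k, 'm, 'w) module_scheme \<Rightarrow> ('m \<Rightarrow> ('c, 'm) tensor) \<Rightarrow> ('v, 'm) tensor set" where
  "cotensor K C V \<delta> M \<rho> =
     {t \<in> carrier (tensor_prod K V M).
        tensor_assoc K V C M (tensor_map K (tensor_prod K V C) M \<delta> (\<lambda>m. m) t)
          = tensor_map K V (tensor_prod K C M) (\<lambda>v. v) \<rho> t}"

text \<open>
  The functor given by the cotensor product with \<open>V\<close> preserves and reflects exact sequences of left
  \<open>C\<close>-comodules. Again a universe has to be fixed; \<open>(nat \<Rightarrow> 'c) set\<close> contains an isomorphic copy of
  every finite-dimensional (even countably dimensional) comodule if \<open>C\<close> is nonzero. Every comodule
  is the directed union of its finite-dimensional subcomodules and the cotensor product commutes
  with directed colimits, so the condition is equivalent to the one for comodules of arbitrary size.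
\<close>
definition right_faithfully_coflat ::
  "('k, 'x) ring_scheme \<Rightarrow> ('k, 'c, 'y) coalg_scheme \<Rightarrow> ('k, 'v, 'z) module_scheme
    \<Rightarrow> ('v \<Rightarrow> ('v, 'c) tensor) \<Rightarrow> bool" where
  "right_faithfully_coflat K C V \<delta> \<longleftrightarrow>
     right_comodule K C V \<delta> \<and>
     (\<forall>(M1 :: ('k, (nat \<Rightarrow> 'c) set) module) \<rho>1 (M2 :: ('k, (nat \<Rightarrow> 'c) set) module) \<rho>2
       (M3 :: ('k, (nat \<Rightarrow> 'c) set) module) \<rho>3 f g.
        left_comodule K C M1 \<rho>1 \<and> left_comodule K C M2 \<rho>2 \<and> left_comodule K C M3 \<rho>3 \<and>
        f \<in> left_comodule_hom K C M1 \<rho>1 M2 \<rho>2 \<and> g \<in> left_comodule_hom K C M2 \<rho>2 M3 \<rho>3 \<longrightarrow>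
        (exact_at (carrier M1) f (carrier M2) g \<zero>\<^bsub>M3\<^esub> \<longleftrightarrow>
         exact_at (cotensor K C V \<delta> M1 \<rho>1) (tensor_map K V M2 (\<lambda>v. v) f)
                  (cotensor K C V \<delta> M2 \<rho>2) (tensor_map K V M3 (\<lambda>v. v) g)
                  \<zero>\<^bsub>tensor_prod K V M3\<^esub>))"

text \<open>For a Hopf algebra map \<open>\<pi>\<close> from \<open>A\<close> to \<open>C\<close>: the right \<open>C\<close>-coaction \<open>(id \<otimes> \<pi>) \<circ> \<Delta>\<close> on \<open>A\<close>.\<close>
definition induced_coaction ::
  "('k, 'x) ring_scheme \<Rightarrow> ('k, 'a, 'y) coalg_scheme \<Rightarrow> ('k, 'c, 'z) coalg_scheme
    \<Rightarrow> ('a \<Rightarrow> 'c) \<Rightarrow> 'a \<Rightarrow> ('a, 'c) tensor" where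
  "induced_coaction K A C \<pi> a = tensor_map K A C (\<lambda>x. x) \<pi> (comult A a)"

end

theory Submission
  imports Defs
begin

text \<open>
  Everything about products rests on the identity \<open>b a = \<Sum> a\<^sub>1 (S(a\<^sub>2) b a\<^sub>3)\<close> (\<open>mult_eq_right_adjoint\<close>). As \<open>A\<close>
  right normalizes \<open>B\<close>, it gives \<open>B A \<subseteq> A B\<close>, and since the right adjoint action also preserves the
  kernel of the counit, it gives \<open>B\<^sup>+ A \<subseteq> A B\<^sup>+\<close>. So \<open>A B\<close> is a subalgebra and \<open>A B\<^sup>+\<close> is an ideal of it. Both
  are stable under the antipode, which reverses products (\<open>antipode_mult\<close>), and the comultiplication of
  \<open>a b\<close> is computed from those of \<open>a\<close> and \<open>b\<close> (\<open>hopf_subalgebra_AB\<close>, \<open>hopf_ideal_J\<close>). The claim on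
  \<open>A (A \<inter> B)\<^sup>+\<close> is the same claim for the pair \<open>A\<close>, \<open>A \<inter> B\<close>: the intersection is normalized by \<open>A\<close>, its
  product with \<open>A\<close> is \<open>A\<close>, and it is a Hopf subalgebra because \<open>A \<otimes> A\<close> and \<open>B \<otimes> B\<close> meet in
  \<open>(A \<inter> B) \<otimes> (A \<inter> B)\<close> (\<open>sub_tensor_Int\<close>). The latter follows from the existence of a projection onto \<open>A\<close>
  that preserves \<open>B\<close>.

  For the isomorphism let \<open>C = A B / A B\<^sup>+\<close> and let \<open>p : A \<rightarrow> C\<close> be the canonical map. It is onto since
  \<open>a b - \<epsilon>(b) a\<close> lies in \<open>A B\<^sup>+\<close>, and it kills \<open>I = A (A \<inter> B)\<^sup>+\<close>. What has to be shown is that the kernel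
  of \<open>p\<close> is not larger than \<open>I\<close>.

  Faithful flatness shows that every left \<open>C\<close>-coinvariant \<open>t\<close> of \<open>A B\<close> lies in \<open>B\<close> (\<open>coinvariant_mem\<close>). The
  inverse of the canonical map \<open>A B \<otimes>\<^sub>B A B \<rightarrow> C \<otimes> A B\<close> turns the coinvariance of \<open>t\<close> into the equation
  \<open>t \<otimes> z = 1 \<otimes> t z\<close> in \<open>A B \<otimes>\<^sub>B A B\<close>. By flatness it already holds in \<open>(B + t B) \<otimes>\<^sub>B A B\<close>, where it says that
  the inclusion of \<open>B\<close> in \<open>B + t B\<close> becomes onto after tensoring with \<open>A B\<close>. So it is onto by faithfulness.
  All right modules in this argument are submodules of \<open>A B\<close>, and therefore have copies in the universe
  over which the definition of faithful flatness quantifies.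

  Faithful coflatness is applied to \<open>A \<rightarrow> A/I \<rightarrow> C\<close>. By means of the antipode an element of \<open>A \<box>\<^sub>C A\<close> can
  be written as a sum of elements \<open>a\<^sub>1 \<otimes> a\<^sub>2 b\<close> with coinvariant \<open>b\<close> (\<open>cotensor_element\<close>). These \<open>b\<close> lie in
  \<open>A \<inter> B\<close> by the preceding paragraph, so \<open>b\<close> is congruent to \<open>\<epsilon>(b) 1\<close> modulo \<open>I\<close>, and the image of the
  element in \<open>A \<otimes> A/I\<close> is the image of \<open>w\<^sub>1 \<otimes> w\<^sub>2\<close>, where \<open>w\<close> is the sum of all \<open>\<epsilon>(b) a\<close>. The counit
  recovers \<open>w\<close> from \<open>w\<^sub>1 \<otimes> p(w\<^sub>2)\<close>. Hence \<open>A \<box>\<^sub>C A/I \<rightarrow> A \<box>\<^sub>C C\<close> is injective, because \<open>A \<box>\<^sub>C A \<rightarrow> A \<box>\<^sub>C A/I\<close> is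
  onto by coflatness; and since the functor reflects exactness, \<open>A/I \<rightarrow> C\<close> is injective (\<open>kernel_eq\<close>).

  Sweedler notation is available in the form \<open>tlift P \<phi> (comult H x)\<close> for the sum of all \<open>\<phi> x\<^sub>1 x\<^sub>2\<close>, and
  \<open>tlift_coassoc\<close> regroups nested sums. Computations for a Hopf subalgebra, whose comultiplication is
  only given through an injection into \<open>H \<otimes> H\<close>, are reduced to computations in \<open>H\<close> by a linear projection
  (\<open>comult_restrict\<close>, \<open>tlift_comult_HA\<close>).
\<close>

section \<open>The universal property of the tensor product\<close>

text \<open>
  The target \<open>G\<close> is written multiplicatively, as \<^const>\<open>tensor_group\<close> is.
\<close>
definition balanced where
  "balanced R M N G \<phi> \<longleftrightarrow>
     (\<forall>m\<in>carrier M. \<forall>n\<in>carrier N. \<phi> m n \<in> carrier G) \<and>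
     (\<forall>m\<in>carrier M. \<forall>m'\<in>carrier M. \<forall>n\<in>carrier N. \<phi> (m \<oplus>\<^bsub>M\<^esub> m') n = \<phi> m n \<otimes>\<^bsub>G\<^esub> \<phi> m' n) \<and>
     (\<forall>m\<in>carrier M. \<forall>n\<in>carrier N. \<forall>n'\<in>carrier N. \<phi> m (n \<oplus>\<^bsub>N\<^esub> n') = \<phi> m n \<otimes>\<^bsub>G\<^esub> \<phi> m n') \<and>
     (\<forall>r\<in>carrier R. \<forall>m\<in>carrier M. \<forall>n\<in>carrier N. \<phi> (r \<odot>\<^bsub>M\<^esub> m) n = \<phi> m (r \<odot>\<^bsub>N\<^esub> n))"

text \<open>
  The product formula in the definition of \<^const>\<open>tensor_lift\<close> computes the homomorphism that the universal
  property of the free abelian group provides.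
\<close>
lemma (in comm_group) hom_free_Abelian_group_eq_finprod:
  assumes h: "h \<in> hom (free_Abelian_group S) G" and c: "Poly_Mapping.keys c \<subseteq> S"
    and f: "\<And>x. x \<in> S \<Longrightarrow> h (frag_of x) = f x"
  shows "h c = finprod G (\<lambda>x. f x [^] Poly_Mapping.lookup c x) (Poly_Mapping.keys c)"
proof -
  let ?F = "free_Abelian_group S"
  interpret h: group_hom ?F G h
    using h by (simp add: group_hom_def group_hom_axioms_def)
  have hf: "h (frag_of x) \<in> carrier G" if "x \<in> S" for x
    using that by (intro h.hom_closed) simp
  have "h (sum (\<lambda>x. frag_cmul (Poly_Mapping.lookup c x) (frag_of x)) X)
      = finprod G (\<lambda>x. f x [^] Poly_Mapping.lookup c x) X" if "finite X" "X \<subseteq> S" for X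
    using that
  proof (induction X)
    case empty
    then show ?case using h.hom_one by simp
  next
    case (insert x X)
    have k: "Poly_Mapping.keys (sum (\<lambda>x. frag_cmul (Poly_Mapping.lookup c x) (frag_of x)) X) \<subseteq> S"
      using sum_closed_free_Abelian_group[of X "\<lambda>x. frag_cmul (Poly_Mapping.lookup c x) (frag_of x)" S]
        insert.prems keys_cmul by fastforce
    have "h (frag_cmul (Poly_Mapping.lookup c x) (frag_of x)) = f x [^] Poly_Mapping.lookup c x"
      using h.hom_int_pow[of "frag_of x" "Poly_Mapping.lookup c x"] insert.prems f by simp
    moreover have "h (frag_cmul (Poly_Mapping.lookup c x) (frag_of x) + sum (\<lambda>x. frag_cmul (Poly_Mapping.lookup c x) (frag_of x)) X)
       = h (frag_cmul (Poly_Mapping.lookup c x) (frag_of x)) \<otimes> h (sum (\<lambda>x. frag_cmul (Poly_Mapping.lookup c x) (frag_of x)) X)"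
      using h.hom_mult[of "frag_cmul (Poly_Mapping.lookup c x) (frag_of x)"
          "sum (\<lambda>x. frag_cmul (Poly_Mapping.lookup c x) (frag_of x)) X"] k insert.prems keys_cmul
      by fastforce
    moreover have "finprod G (\<lambda>x. f x [^] Poly_Mapping.lookup c x) (insert x X)
      = f x [^] Poly_Mapping.lookup c x \<otimes> finprod G (\<lambda>x. f x [^] Poly_Mapping.lookup c x) X"
      using insert.hyps insert.prems hf f by (intro finprod_insert) auto
    ultimately show ?case
      using insert by simp
  qed
  from this[of "Poly_Mapping.keys c"] c show ?thesis
    using arg_cong[OF frag_expansion[of c], of h] by (simp add: frag_extend_def)
qed

lemma foldSetD_eqI:
  "(B, y) \<in> foldSetD D (h \<circ> f) e \<Longrightarrow> (\<And>x. x \<in> B \<Longrightarrow> f x = g x) \<Longrightarrow> (B, y) \<in> foldSetD D (h \<circ> g) e"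
proof (induction rule: foldSetD.induct)
  case emptyI
  then show ?case by (intro foldSetD.emptyI)
next
  case (insertI x B y)
  then have eq: "(h \<circ> f) x y = (h \<circ> g) x y" by simp
  show ?case
    unfolding eq
  proof (rule foldSetD.insertI[OF insertI.hyps(1)])
    show "(h \<circ> g) x y \<in> D" using insertI.hyps(2) eq by metis
    show "(B, y) \<in> foldSetD D (h \<circ> g) e" by (rule insertI(4)) (use insertI.prems in blast)
  qed
qed

text \<open>
  A finite product is defined by a fold relation that mentions \<open>f\<close> only through its values on \<open>B\<close>.
  Therefore \<^const>\<open>tensor_lift\<close> depends only on the values of its map on the carriers, and Sweedler
  sums can be rewritten term by term.
\<close>
lemma finprod_eqI:
  assumes "\<And>x. x \<in> B \<Longrightarrow> f x = g x"
  shows "finprod G f B = finprod G g B"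
proof -
  have "(B, y) \<in> foldSetD (carrier G) (mult G \<circ> f) \<one>\<^bsub>G\<^esub> \<longleftrightarrow> (B, y) \<in> foldSetD (carrier G) (mult G \<circ> g) \<one>\<^bsub>G\<^esub>" for y
    using assms foldSetD_eqI[of B y _ _ f _ g] foldSetD_eqI[of B y _ _ g _ f] by auto
  then show ?thesis by (simp add: finprod_def foldD_def)
qed

text \<open>
  Abelian groups with operators: this covers two modules over a commutative ring as well as a right
  and a left module over a noncommutative one.
\<close>
locale tensor_pair = M: abelian_group M + N: abelian_group N
  for R :: "('r, 'w) ring_scheme" and M :: "('r, 'm, 'x) module_scheme"
    and N :: "('r, 'n, 'y) module_scheme" +
  assumes actM: "\<And>r m. r \<in> carrier R \<Longrightarrow> m \<in> carrier M \<Longrightarrow> r \<odot>\<^bsub>M\<^esub> m \<in> carrier M"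
    and actN: "\<And>r n. r \<in> carrier R \<Longrightarrow> n \<in> carrier N \<Longrightarrow> r \<odot>\<^bsub>N\<^esub> n \<in> carrier N"
begin

abbreviation "F \<equiv> free_Abelian_group (carrier M \<times> carrier N)"
abbreviation "T \<equiv> tensor_group R M N"
abbreviation "pt \<equiv> pure_tensor R M N"

lemma rel_gens_carrier:
  "{frag_of (m \<oplus>\<^bsub>M\<^esub> m', n) - frag_of (m, n) - frag_of (m', n) | m m' n.
         m \<in> carrier M \<and> m' \<in> carrier M \<and> n \<in> carrier N}
    \<union> {frag_of (m, n \<oplus>\<^bsub>N\<^esub> n') - frag_of (m, n) - frag_of (m, n') | m n n'.
         m \<in> carrier M \<and> n \<in> carrier N \<and> n' \<in> carrier N}
    \<union> {frag_of (r \<odot>\<^bsub>M\<^esub> m, n) - frag_of (m, r \<odot>\<^bsub>N\<^esub> n) | r m n.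
         r \<in> carrier R \<and> m \<in> carrier M \<and> n \<in> carrier N} \<subseteq> carrier F"
  (is "?X \<subseteq> _")
proof -
  have d: "a \<in> carrier F \<Longrightarrow> b \<in> carrier F \<Longrightarrow> a - b \<in> carrier F" for a b
    by (metis (no_types, lifting) Un_least carrier_free_Abelian_group_iff keys_diff subset_trans)
  show ?thesis
    by (auto simp del: carrier_free_Abelian_group_iff intro!: d simp: actM actN)
qed

lemma rel_subgroup: "subgroup (tensor_rel R M N) F"
  unfolding tensor_rel_def
  by (rule group.generate_is_subgroup[OF group_free_Abelian_group rel_gens_carrier])

lemma rel_normal: "tensor_rel R M N \<lhd> F"
  using rel_subgroup abelian_free_Abelian_group
  by (metis comm_group.normal_iff_subgroup)

lemma comm_group_T: "comm_group T"
  unfolding tensor_group_def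
  by (rule comm_group.abelian_FactGroup[OF abelian_free_Abelian_group rel_subgroup])

lemma group_T: "group T"
  using comm_group_T by (simp add: comm_group_def)

lemma pure_closed: "m \<in> carrier M \<Longrightarrow> n \<in> carrier N \<Longrightarrow> pt m n \<in> carrier T"
  by (auto simp: pure_tensor_def tensor_group_def carrier_FactGroup simp del: carrier_free_Abelian_group_iff)

lemma coset_hom: "(\<lambda>c. tensor_rel R M N #>\<^bsub>F\<^esub> c) \<in> hom F T"
  unfolding tensor_group_def by (rule normal.r_coset_hom_Mod[OF rel_normal])

lemma hom_kills_rel:
  assumes h: "h \<in> hom F G" and G: "comm_group G" and b: "balanced R M N G \<phi>"
    and f: "\<And>m n. m \<in> carrier M \<Longrightarrow> n \<in> carrier N \<Longrightarrow> h (frag_of (m, n)) = \<phi> m n"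
    and c: "c \<in> tensor_rel R M N"
  shows "h c = \<one>\<^bsub>G\<^esub>"
proof -
  interpret G: comm_group G by fact
  interpret h: group_hom F G h
    using h by (simp add: group_hom_def group_hom_axioms_def)
  have hd: "h (a - b) = h a \<otimes>\<^bsub>G\<^esub> inv\<^bsub>G\<^esub> h b" if "a \<in> carrier F" "b \<in> carrier F" for a b
  proof -
    have "h (a \<otimes>\<^bsub>F\<^esub> inv\<^bsub>F\<^esub> b) = h a \<otimes>\<^bsub>G\<^esub> inv\<^bsub>G\<^esub> h b"
      using that by (simp del: inv_free_Abelian_group mult_free_Abelian_group carrier_free_Abelian_group_iff)
    then show ?thesis using that by simp
  qed
  have d: "a \<in> carrier F \<Longrightarrow> b \<in> carrier F \<Longrightarrow> a - b \<in> carrier F" for a b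
    by (metis (no_types, lifting) Un_least carrier_free_Abelian_group_iff keys_diff subset_trans)
  have bc: "\<And>m n. m \<in> carrier M \<Longrightarrow> n \<in> carrier N \<Longrightarrow> \<phi> m n \<in> carrier G"
    using b by (simp add: balanced_def)
  have sub: "subgroup (kernel F G h) F" by (rule h.subgroup_kernel)
  have aux: "(x \<otimes>\<^bsub>G\<^esub> y) \<otimes>\<^bsub>G\<^esub> inv\<^bsub>G\<^esub> x \<otimes>\<^bsub>G\<^esub> inv\<^bsub>G\<^esub> y = \<one>\<^bsub>G\<^esub>" if "x \<in> carrier G" "y \<in> carrier G" for x y
    using that by (metis G.m_comm G.inv_closed G.m_assoc G.m_closed G.r_inv G.r_one)
  have "tensor_rel R M N \<subseteq> kernel F G h"
    unfolding tensor_rel_def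
  proof (rule group.generate_subgroup_incl[OF _ _ sub], simp, intro Un_least subsetI)
    fix x assume "x \<in> {frag_of (m \<oplus>\<^bsub>M\<^esub> m', n) - frag_of (m, n) - frag_of (m', n) | m m' n.
         m \<in> carrier M \<and> m' \<in> carrier M \<and> n \<in> carrier N}"
    then obtain m m' n where x: "x = frag_of (m \<oplus>\<^bsub>M\<^esub> m', n) - frag_of (m, n) - frag_of (m', n)"
      and c: "m \<in> carrier M" "m' \<in> carrier M" "n \<in> carrier N" by blast
    have "h x = \<one>\<^bsub>G\<^esub>"
      unfolding x using c b bc
      by (subst hd; (subst hd)?) (auto intro!: d simp: f aux balanced_def simp del: carrier_free_Abelian_group_iff)
    then show "x \<in> kernel F G h"
      unfolding kernel_def x using c by (auto intro!: d simp del: carrier_free_Abelian_group_iff)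
  next
    fix x assume "x \<in> {frag_of (m, n \<oplus>\<^bsub>N\<^esub> n') - frag_of (m, n) - frag_of (m, n') | m n n'.
         m \<in> carrier M \<and> n \<in> carrier N \<and> n' \<in> carrier N}"
    then obtain m n n' where x: "x = frag_of (m, n \<oplus>\<^bsub>N\<^esub> n') - frag_of (m, n) - frag_of (m, n')"
      and c: "m \<in> carrier M" "n \<in> carrier N" "n' \<in> carrier N" by blast
    have "h x = \<one>\<^bsub>G\<^esub>"
      unfolding x using c b bc
      by (subst hd; (subst hd)?) (auto intro!: d simp: f aux balanced_def simp del: carrier_free_Abelian_group_iff)
    then show "x \<in> kernel F G h"
      unfolding kernel_def x using c by (auto intro!: d simp del: carrier_free_Abelian_group_iff)
  next
    fix x assume "x \<in> {frag_of (r \<odot>\<^bsub>M\<^esub> m, n) - frag_of (m, r \<odot>\<^bsub>N\<^esub> n) | r m n.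
         r \<in> carrier R \<and> m \<in> carrier M \<and> n \<in> carrier N}"
    then obtain r m n where x: "x = frag_of (r \<odot>\<^bsub>M\<^esub> m, n) - frag_of (m, r \<odot>\<^bsub>N\<^esub> n)"
      and c: "r \<in> carrier R" "m \<in> carrier M" "n \<in> carrier N" by blast
    have "h x = \<one>\<^bsub>G\<^esub>"
      unfolding x using c b bc
      by (subst hd) (auto simp: f balanced_def actM actN simp del: carrier_free_Abelian_group_iff)
    then show "x \<in> kernel F G h"
      unfolding kernel_def x using c actM actN by (auto intro!: d simp del: carrier_free_Abelian_group_iff)
  qed
  then show ?thesis using c by (auto simp: kernel_def)
qed

text \<open>
  The universal property. The homomorphism of the free abelian group given by \<open>\<phi>\<close> kills the defining
  relations, so the value of \<^const>\<open>tensor_lift\<close> does not depend on the representative.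
\<close>
lemma lift_ex:
  assumes G: "comm_group G" and b: "balanced R M N G \<phi>"
  shows "\<exists>h. h \<in> hom F G \<and> (\<forall>m\<in>carrier M. \<forall>n\<in>carrier N. h (frag_of (m, n)) = \<phi> m n) \<and>
     (\<forall>c\<in>carrier F. tensor_lift G \<phi> (tensor_rel R M N #>\<^bsub>F\<^esub> c) = h c)"
proof -
  interpret G: comm_group G by fact
  have im: "(\<lambda>(m,n). \<phi> m n) ` (carrier M \<times> carrier N) \<subseteq> carrier G"
    using b by (auto simp: balanced_def)
  obtain h where h: "h \<in> hom F G" and hf: "\<And>x. x \<in> carrier M \<times> carrier N \<Longrightarrow> h (frag_of x) = (\<lambda>(m,n). \<phi> m n) x"
    using G.free_Abelian_group_universal[OF im] by blast
  interpret h: group_hom F G h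
    using h by (simp add: group_hom_def group_hom_axioms_def)
  have fin: "h c = finprod G (\<lambda>(m, n). \<phi> m n [^]\<^bsub>G\<^esub> Poly_Mapping.lookup c (m, n)) (Poly_Mapping.keys c)"
    if "c \<in> carrier F" for c
  proof -
    have "h c = finprod G (\<lambda>x. (\<lambda>(m,n). \<phi> m n) x [^]\<^bsub>G\<^esub> Poly_Mapping.lookup c x) (Poly_Mapping.keys c)"
      using G.hom_free_Abelian_group_eq_finprod[OF h _ hf] that by simp
    moreover have "(\<lambda>x. (\<lambda>(m,n). \<phi> m n) x [^]\<^bsub>G\<^esub> Poly_Mapping.lookup c x)
       = (\<lambda>(m, n). \<phi> m n [^]\<^bsub>G\<^esub> Poly_Mapping.lookup c (m, n))"
      by (auto simp: fun_eq_iff)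
    ultimately show ?thesis by simp
  qed
  have "tensor_lift G \<phi> (tensor_rel R M N #>\<^bsub>F\<^esub> c) = h c" if c: "c \<in> carrier F" for c
  proof -
    have mem: "d \<in> carrier F \<and> h d = h c" if "d \<in> tensor_rel R M N #>\<^bsub>F\<^esub> c" for d
    proof -
      from that obtain k where k: "k \<in> tensor_rel R M N" and d: "d = k \<otimes>\<^bsub>F\<^esub> c"
        by (auto simp: r_coset_def)
      have kc: "k \<in> carrier F" using k rel_subgroup subgroup.subset by blast
      have "h d = h k \<otimes>\<^bsub>G\<^esub> h c" unfolding d using kc c by (rule h.hom_mult)
      also have "\<dots> = h c" using hom_kills_rel[OF h G b _ k] hf c h.hom_closed by simp
      finally have "h d = h c" .
      moreover have "d \<in> carrier F" unfolding d using kc c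
        by (meson group.is_monoid group_free_Abelian_group monoid.m_closed)
      ultimately show ?thesis by blast
    qed
    have cc: "c \<in> tensor_rel R M N #>\<^bsub>F\<^esub> c"
      by (rule group.rcos_self[OF group_free_Abelian_group c rel_subgroup])
    show ?thesis
      unfolding tensor_lift_def
    proof (rule the_equality)
      show "\<exists>ca\<in>tensor_rel R M N #>\<^bsub>F\<^esub> c. h c = finprod G (\<lambda>(m, n). \<phi> m n [^]\<^bsub>G\<^esub> Poly_Mapping.lookup ca (m, n)) (Poly_Mapping.keys ca)"
        using cc fin[OF c] by blast
      show "y = h c" if "\<exists>ca\<in>tensor_rel R M N #>\<^bsub>F\<^esub> c. y = finprod G (\<lambda>(m, n). \<phi> m n [^]\<^bsub>G\<^esub> Poly_Mapping.lookup ca (m, n)) (Poly_Mapping.keys ca)" for y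
      proof -
        from that obtain d where d: "d \<in> tensor_rel R M N #>\<^bsub>F\<^esub> c"
          and y: "y = finprod G (\<lambda>(m, n). \<phi> m n [^]\<^bsub>G\<^esub> Poly_Mapping.lookup d (m, n)) (Poly_Mapping.keys d)"
          by (rule bexE)
        show ?thesis
          unfolding y using fin[of d] mem[OF d] by (simp del: carrier_free_Abelian_group_iff)
      qed
    qed
  qed
  with h hf show ?thesis by (intro exI[of _ h]) (simp del: carrier_free_Abelian_group_iff)
qed

lemma lift_hom:
  assumes G: "comm_group G" and b: "balanced R M N G \<phi>"
  shows "tensor_lift G \<phi> \<in> hom T G"
proof -
  obtain h where h: "h \<in> hom F G"
    and L: "\<And>c. c\<in>carrier F \<Longrightarrow> tensor_lift G \<phi> (tensor_rel R M N #>\<^bsub>F\<^esub> c) = h c"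
    using lift_ex[OF assms] by blast
  have T: "carrier T = (\<lambda>c. tensor_rel R M N #>\<^bsub>F\<^esub> c) ` carrier F"
    unfolding tensor_group_def by (rule carrier_FactGroup)
  show ?thesis
  proof (rule homI)
    show "tensor_lift G \<phi> x \<in> carrier G" if "x \<in> carrier T" for x
      using that h L unfolding T by (auto simp: hom_in_carrier simp del: carrier_free_Abelian_group_iff)
    fix x y assume "x \<in> carrier T" "y \<in> carrier T"
    then obtain c d where c: "c \<in> carrier F" "x = tensor_rel R M N #>\<^bsub>F\<^esub> c"
      and d: "d \<in> carrier F" "y = tensor_rel R M N #>\<^bsub>F\<^esub> d"
      unfolding T by blast
    have cd: "c \<otimes>\<^bsub>F\<^esub> d \<in> carrier F"
      using c d by (meson group.is_monoid group_free_Abelian_group monoid.m_closed)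
    have "x \<otimes>\<^bsub>T\<^esub> y = tensor_rel R M N #>\<^bsub>F\<^esub> (c \<otimes>\<^bsub>F\<^esub> d)"
      using coset_hom c d by (simp add: hom_mult del: mult_free_Abelian_group carrier_free_Abelian_group_iff)
    then show "tensor_lift G \<phi> (x \<otimes>\<^bsub>T\<^esub> y) = tensor_lift G \<phi> x \<otimes>\<^bsub>G\<^esub> tensor_lift G \<phi> y"
      using L cd c d h by (simp add: hom_mult del: mult_free_Abelian_group carrier_free_Abelian_group_iff)
  qed
qed

lemma lift_cong:
  assumes t: "t \<in> carrier T" and e: "\<And>m n. m \<in> carrier M \<Longrightarrow> n \<in> carrier N \<Longrightarrow> \<phi> m n = \<psi> m n"
  shows "tensor_lift G \<phi> t = tensor_lift G \<psi> t"
proof -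
  have k: "Poly_Mapping.keys c \<subseteq> carrier M \<times> carrier N" if "c \<in> t" for c
  proof -
    obtain d where "d \<in> carrier F" "t = tensor_rel R M N #>\<^bsub>F\<^esub> d"
      using t unfolding tensor_group_def carrier_FactGroup by blast
    then have "c \<in> carrier F"
      using that monoid.r_coset_subset_G[OF group.is_monoid[OF group_free_Abelian_group] subgroup.subset[OF rel_subgroup]] by blast
    then show ?thesis by simp
  qed
  have "finprod G (\<lambda>(m, n). \<phi> m n [^]\<^bsub>G\<^esub> Poly_Mapping.lookup c (m, n)) (Poly_Mapping.keys c)
      = finprod G (\<lambda>(m, n). \<psi> m n [^]\<^bsub>G\<^esub> Poly_Mapping.lookup c (m, n)) (Poly_Mapping.keys c)" if "c \<in> t" for c
    using k[OF that] e by (intro finprod_eqI) auto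
  then show ?thesis by (simp add: tensor_lift_def)
qed

lemma lift_pure:
  assumes G: "comm_group G" and b: "balanced R M N G \<phi>" and "m \<in> carrier M" "n \<in> carrier N"
  shows "tensor_lift G \<phi> (pt m n) = \<phi> m n"
  using lift_ex[OF G b] assms unfolding pure_tensor_def by (auto simp del: carrier_free_Abelian_group_iff)

lemma coset_eqI:
  assumes a: "a \<in> carrier F" and b: "b \<in> carrier F" and ab: "a - b \<in> tensor_rel R M N"
  shows "tensor_rel R M N #>\<^bsub>F\<^esub> a = tensor_rel R M N #>\<^bsub>F\<^esub> b"
proof -
  have "a \<otimes>\<^bsub>F\<^esub> inv\<^bsub>F\<^esub> b \<in> tensor_rel R M N"
    using ab b by simp
  moreover have "a = (a \<otimes>\<^bsub>F\<^esub> inv\<^bsub>F\<^esub> b) \<otimes>\<^bsub>F\<^esub> b" using b by simp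
  ultimately have "a \<in> tensor_rel R M N #>\<^bsub>F\<^esub> b" unfolding r_coset_def by blast
  then show ?thesis
    using group.repr_independence[OF group_free_Abelian_group _ b rel_subgroup] by blast
qed

lemma coset_pure:
  "m \<in> carrier M \<Longrightarrow> n \<in> carrier N \<Longrightarrow> m' \<in> carrier M \<Longrightarrow> n' \<in> carrier N \<Longrightarrow>
    tensor_rel R M N #>\<^bsub>F\<^esub> (frag_of (m, n) + frag_of (m', n')) = pt m n \<otimes>\<^bsub>T\<^esub> pt m' n'"
  using hom_mult[OF coset_hom, of "frag_of (m,n)" "frag_of (m', n')"]
  by (simp add: pure_tensor_def)

lemma pure_balanced: "balanced R M N T pt"
proof -
  have s: "a \<in> carrier F \<Longrightarrow> b \<in> carrier F \<Longrightarrow> a + b \<in> carrier F" for a b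
    by (metis group.is_monoid group_free_Abelian_group monoid.m_closed mult_free_Abelian_group)
  have 1: "pt (m \<oplus>\<^bsub>M\<^esub> m') n = pt m n \<otimes>\<^bsub>T\<^esub> pt m' n"
    if "m \<in> carrier M" "m' \<in> carrier M" "n \<in> carrier N" for m m' n
  proof -
    have "frag_of (m \<oplus>\<^bsub>M\<^esub> m', n) - (frag_of (m, n) + frag_of (m', n)) \<in> tensor_rel R M N"
      unfolding tensor_rel_def diff_diff_add[symmetric] using that by (intro generate.incl) blast
    then have "tensor_rel R M N #>\<^bsub>F\<^esub> frag_of (m \<oplus>\<^bsub>M\<^esub> m', n) = tensor_rel R M N #>\<^bsub>F\<^esub> (frag_of (m, n) + frag_of (m', n))"
      using that by (intro coset_eqI s) auto
    then show ?thesis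
      using that by (subst coset_pure[symmetric]) (simp_all add: pure_tensor_def)
  qed
  have 2: "pt m (n \<oplus>\<^bsub>N\<^esub> n') = pt m n \<otimes>\<^bsub>T\<^esub> pt m n'"
    if "m \<in> carrier M" "n \<in> carrier N" "n' \<in> carrier N" for m n n'
  proof -
    have "frag_of (m, n \<oplus>\<^bsub>N\<^esub> n') - (frag_of (m, n) + frag_of (m, n')) \<in> tensor_rel R M N"
      unfolding tensor_rel_def diff_diff_add[symmetric] using that by (intro generate.incl) blast
    then have "tensor_rel R M N #>\<^bsub>F\<^esub> frag_of (m, n \<oplus>\<^bsub>N\<^esub> n') = tensor_rel R M N #>\<^bsub>F\<^esub> (frag_of (m, n) + frag_of (m, n'))"
      using that by (intro coset_eqI s) auto
    then show ?thesis
      using that by (subst coset_pure[symmetric]) (simp_all add: pure_tensor_def)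
  qed
  have 3: "pt (r \<odot>\<^bsub>M\<^esub> m) n = pt m (r \<odot>\<^bsub>N\<^esub> n)"
    if "r \<in> carrier R" "m \<in> carrier M" "n \<in> carrier N" for r m n
  proof -
    have "frag_of (r \<odot>\<^bsub>M\<^esub> m, n) - frag_of (m, r \<odot>\<^bsub>N\<^esub> n) \<in> tensor_rel R M N"
      unfolding tensor_rel_def using that by (intro generate.incl) blast
    moreover have "frag_of (r \<odot>\<^bsub>M\<^esub> m, n) \<in> carrier F" "frag_of (m, r \<odot>\<^bsub>N\<^esub> n) \<in> carrier F"
      using that actM actN by simp_all
    ultimately have "tensor_rel R M N #>\<^bsub>F\<^esub> frag_of (r \<odot>\<^bsub>M\<^esub> m, n) = tensor_rel R M N #>\<^bsub>F\<^esub> frag_of (m, r \<odot>\<^bsub>N\<^esub> n)"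
      using coset_eqI by blast
    then show ?thesis
      by (simp only: pure_tensor_def)
  qed
  show ?thesis unfolding balanced_def by (simp add: 1 2 3 pure_closed)
qed

lemma pure_zero_left: "n \<in> carrier N \<Longrightarrow> pt \<zero>\<^bsub>M\<^esub> n = \<one>\<^bsub>T\<^esub>"
proof -
  assume n: "n \<in> carrier N"
  interpret T: comm_group T by (rule comm_group_T)
  have "pt \<zero>\<^bsub>M\<^esub> n \<otimes>\<^bsub>T\<^esub> pt \<zero>\<^bsub>M\<^esub> n = pt \<zero>\<^bsub>M\<^esub> n"
    using pure_balanced n unfolding balanced_def by (metis M.l_zero M.zero_closed)
  then show ?thesis using pure_closed[OF M.zero_closed n] by (metis T.r_cancel_one')
qed

lemma pure_inv: "m \<in> carrier M \<Longrightarrow> n \<in> carrier N \<Longrightarrow> inv\<^bsub>T\<^esub> pt m n = pt (\<ominus>\<^bsub>M\<^esub> m) n"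
proof -
  assume c: "m \<in> carrier M" "n \<in> carrier N"
  interpret T: comm_group T by (rule comm_group_T)
  have "pt (\<ominus>\<^bsub>M\<^esub> m) n \<otimes>\<^bsub>T\<^esub> pt m n = \<one>\<^bsub>T\<^esub>"
    using pure_balanced c pure_zero_left unfolding balanced_def by (metis M.a_inv_closed M.l_neg)
  then show ?thesis using pure_closed c T.inv_equality M.a_inv_closed by metis
qed

text \<open>
  Every element is a sum of pure tensors because \<open>- (m \<otimes> n) = (- m) \<otimes> n\<close>.
\<close>
lemma tensor_induct [consumes 1, case_names pure add]:
  assumes t: "t \<in> carrier T"
    and P: "\<And>m n. m \<in> carrier M \<Longrightarrow> n \<in> carrier N \<Longrightarrow> P (pt m n)"
    and A: "\<And>s t. s \<in> carrier T \<Longrightarrow> t \<in> carrier T \<Longrightarrow> P s \<Longrightarrow> P t \<Longrightarrow> P (s \<otimes>\<^bsub>T\<^esub> t)"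
  shows "P t"
proof -
  interpret T: comm_group T by (rule comm_group_T)
  let ?q = "\<lambda>c. tensor_rel R M N #>\<^bsub>F\<^esub> c"
  interpret q: group_hom F T ?q
    using coset_hom T.is_group by (simp add: group_hom_def group_hom_axioms_def)
  from t obtain c where c: "Poly_Mapping.keys c \<subseteq> carrier M \<times> carrier N" and tc: "t = ?q c"
    unfolding tensor_group_def carrier_FactGroup by auto
  have d: "a \<in> carrier F \<Longrightarrow> b \<in> carrier F \<Longrightarrow> ?q (a - b) = ?q a \<otimes>\<^bsub>T\<^esub> inv\<^bsub>T\<^esub> ?q b" for a b
    using q.hom_mult[of a "inv\<^bsub>F\<^esub> b"] q.hom_inv[of b] by simp
  have "P (?q c) \<and> P (inv\<^bsub>T\<^esub> ?q c)"
  proof (rule free_Abelian_group_induct[OF c, where P = "\<lambda>c. P (?q c) \<and> P (inv\<^bsub>T\<^esub> ?q c)"], goal_cases)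
    case 1
    have "?q 0 = \<one>\<^bsub>T\<^esub>" using q.hom_one by simp
    moreover have "P \<one>\<^bsub>T\<^esub>" using P[of "\<zero>\<^bsub>M\<^esub>" "\<zero>\<^bsub>N\<^esub>"] pure_zero_left by auto
    ultimately show ?case by simp
  next
    case (2 x y)
    then have xy: "x \<in> carrier F" "y \<in> carrier F" by auto
    show ?case
      using 2 d[OF xy] q.hom_closed[OF xy(1)] q.hom_closed[OF xy(2)]
      by (auto intro!: A simp: T.inv_mult_group)
  next
    case (3 a)
    then obtain m n where a: "a = (m,n)" "m \<in> carrier M" "n \<in> carrier N" by auto
    then show ?case using P[of m n] P[of "\<ominus>\<^bsub>M\<^esub> m" n] pure_inv[of m n]
      by (simp add: pure_tensor_def)
  qed
  then show ?thesis using tc by blast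
qed

lemma hom_eqI:
  assumes G: "group G" and h: "h \<in> hom T G" "h' \<in> hom T G"
    and e: "\<And>m n. m \<in> carrier M \<Longrightarrow> n \<in> carrier N \<Longrightarrow> h (pt m n) = h' (pt m n)"
    and t: "t \<in> carrier T"
  shows "h t = h' t"
  using t
proof (induction rule: tensor_induct)
  case (pure m n) then show ?case using e by blast
next
  case (add s t) then show ?case using h by (simp add: hom_mult)
qed

end

section \<open>Linear and bilinear maps\<close>

text \<open>
  Introduction rules for the linearity of maps that are given by expressions. Resolution with them
  reduces the multilinearity of an iterated Sweedler sum to statements \<open>x \<in> carrier M\<close>, which the
  simplifier proves.
\<close>
named_theorems mlin

definition bilinear_map where
  "bilinear_map K M N P \<phi> \<longleftrightarrow>
     (\<forall>n\<in>carrier N. (\<lambda>m. \<phi> m n) \<in> linear_maps K M P) \<and>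
     (\<forall>m\<in>carrier M. (\<lambda>n. \<phi> m n) \<in> linear_maps K N P)"

lemma linearI:
  assumes "\<And>x. x \<in> carrier M \<Longrightarrow> f x \<in> carrier P"
    and "\<And>x y. x \<in> carrier M \<Longrightarrow> y \<in> carrier M \<Longrightarrow> f (x \<oplus>\<^bsub>M\<^esub> y) = f x \<oplus>\<^bsub>P\<^esub> f y"
    and "\<And>r x. r \<in> carrier K \<Longrightarrow> x \<in> carrier M \<Longrightarrow> f (r \<odot>\<^bsub>M\<^esub> x) = r \<odot>\<^bsub>P\<^esub> f x"
  shows "f \<in> linear_maps K M P"
  using assms by (auto simp: linear_maps_def)

lemma linearD:
  assumes "f \<in> linear_maps K M P"
  shows linear_closed: "x \<in> carrier M \<Longrightarrow> f x \<in> carrier P"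
    and linear_add: "x \<in> carrier M \<Longrightarrow> y \<in> carrier M \<Longrightarrow> f (x \<oplus>\<^bsub>M\<^esub> y) = f x \<oplus>\<^bsub>P\<^esub> f y"
    and linear_smult: "r \<in> carrier K \<Longrightarrow> x \<in> carrier M \<Longrightarrow> f (r \<odot>\<^bsub>M\<^esub> x) = r \<odot>\<^bsub>P\<^esub> f x"
  using assms by (auto simp: linear_maps_def)

lemma linear_cong:
  assumes "f \<in> linear_maps K M P" and "\<And>x. x \<in> carrier M \<Longrightarrow> f x = g x" and "module K M"
  shows "g \<in> linear_maps K M P"
proof -
  interpret M: module K M by fact
  show ?thesis
    using assms(1,2) by (auto simp: linear_maps_def Pi_iff)
qed

lemma bilinearI [mlin]:
  "(\<And>n. n \<in> carrier N \<Longrightarrow> (\<lambda>m. \<phi> m n) \<in> linear_maps K M P) \<Longrightarrow>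
   (\<And>m. m \<in> carrier M \<Longrightarrow> (\<lambda>n. \<phi> m n) \<in> linear_maps K N P) \<Longrightarrow> bilinear_map K M N P \<phi>"
  by (simp add: bilinear_map_def)

lemma bilinear_left: "bilinear_map K M N P \<phi> \<Longrightarrow> n \<in> carrier N \<Longrightarrow> (\<lambda>m. \<phi> m n) \<in> linear_maps K M P"
  by (simp add: bilinear_map_def)

lemma bilinear_right: "bilinear_map K M N P \<phi> \<Longrightarrow> m \<in> carrier M \<Longrightarrow> \<phi> m \<in> linear_maps K N P"
  by (simp add: bilinear_map_def)

lemma linear_id [mlin, simp]: "(\<lambda>x. x) \<in> linear_maps K M M"
  by (auto simp: linear_maps_def)

lemma linear_comp:
  "f \<in> linear_maps K M P \<Longrightarrow> g \<in> linear_maps K X M \<Longrightarrow> (\<lambda>x. f (g x)) \<in> linear_maps K X P"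
  by (auto simp: linear_maps_def Pi_iff)

lemma bilinear_left_comp:
  "bilinear_map K M N P \<phi> \<Longrightarrow> g \<in> linear_maps K X M \<Longrightarrow> n \<in> carrier N \<Longrightarrow>
    (\<lambda>x. \<phi> (g x) n) \<in> linear_maps K X P"
  by (rule linear_comp[OF bilinear_left])

lemma bilinear_right_comp:
  "bilinear_map K M N P \<phi> \<Longrightarrow> g \<in> linear_maps K X N \<Longrightarrow> m \<in> carrier M \<Longrightarrow>
    (\<lambda>x. \<phi> m (g x)) \<in> linear_maps K X P"
  by (rule linear_comp[OF bilinear_right])

lemma bilinear_closed:
  "bilinear_map K M N P \<phi> \<Longrightarrow> m \<in> carrier M \<Longrightarrow> n \<in> carrier N \<Longrightarrow> \<phi> m n \<in> carrier P"
  by (rule linear_closed[OF bilinear_right])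

lemma linear_smult_left [mlin]:
  assumes "module K P" "f \<in> linear_maps K X P" "k \<in> carrier K"
  shows "(\<lambda>x. k \<odot>\<^bsub>P\<^esub> f x) \<in> linear_maps K X P"
proof -
  interpret P: module K P by fact
  show ?thesis
    using assms(2,3) P.R.m_comm
    by (auto simp: linear_maps_def Pi_iff P.smult_r_distr P.smult_assoc1[symmetric])
qed

lemma linear_sum:
  assumes "module K P" "f \<in> linear_maps K X P" "g \<in> linear_maps K X P"
  shows "(\<lambda>x. f x \<oplus>\<^bsub>P\<^esub> g x) \<in> linear_maps K X P"
proof -
  interpret P: module K P by fact
  show ?thesis
    using assms(2,3)
    by (auto simp: linear_maps_def Pi_iff P.smult_r_distr P.M.add.m_ac)
qed

lemma linear_zero:
  assumes "f \<in> linear_maps K M P" "module K M" "module K P"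
  shows "f \<zero>\<^bsub>M\<^esub> = \<zero>\<^bsub>P\<^esub>"
proof -
  interpret M: module K M by fact
  interpret P: module K P by fact
  have "f (\<zero>\<^bsub>K\<^esub> \<odot>\<^bsub>M\<^esub> \<zero>\<^bsub>M\<^esub>) = \<zero>\<^bsub>K\<^esub> \<odot>\<^bsub>P\<^esub> f \<zero>\<^bsub>M\<^esub>"
    using assms(1) by (intro linear_smult) auto
  then show ?thesis using linear_closed[OF assms(1)] by simp
qed

lemma linear_minus:
  assumes "f \<in> linear_maps K M P" "module K M" "module K P" "x \<in> carrier M"
  shows "f (\<ominus>\<^bsub>M\<^esub> x) = \<ominus>\<^bsub>P\<^esub> f x"
proof -
  interpret M: module K M by fact
  interpret P: module K P by fact
  have "f x \<oplus>\<^bsub>P\<^esub> f (\<ominus>\<^bsub>M\<^esub> x) = \<zero>\<^bsub>P\<^esub>"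
    using linear_add[OF assms(1), of x "\<ominus>\<^bsub>M\<^esub> x"] assms(4) linear_zero[OF assms(1-3)] by (simp add: M.r_neg)
  then show ?thesis
    using linear_closed[OF assms(1)] assms(4) by (metis M.a_inv_closed P.M.add.m_comm P.minus_equality)
qed

lemma linear_diff:
  assumes "f \<in> linear_maps K M P" "module K M" "module K P" "x \<in> carrier M" "y \<in> carrier M"
  shows "f (x \<ominus>\<^bsub>M\<^esub> y) = f x \<ominus>\<^bsub>P\<^esub> f y"
proof -
  interpret M: module K M by fact
  show ?thesis using assms by (simp add: a_minus_def linear_add[OF assms(1)] linear_minus)
qed

lemma linear_submodule_vimage:
  assumes f: "f \<in> linear_maps K M P" and M: "module K M" and W: "submodule W K P" "module K P"
  shows "submodule {x \<in> carrier M. f x \<in> W} K M"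
proof -
  interpret M: module K M by fact
  interpret P: module K P by fact
  note E = P.submoduleE[OF W(1)]
  have z: "\<zero>\<^bsub>P\<^esub> \<in> W"
    using W(1) by (metis monoid.simps(2) submodule.axioms(1) subgroup.one_closed)
  show ?thesis
    using E z f M by (intro M.submoduleI)
      (auto simp: linear_zero[OF f M W(2)] linear_minus[OF f M W(2)] linear_add[OF f] linear_smult[OF f])
qed

section \<open>Tensor products of modules over a commutative ring\<close>

lemma tensor_pairI: "module K M \<Longrightarrow> module K N \<Longrightarrow> tensor_pair K M N"
  by (simp add: tensor_pair_def tensor_pair_axioms_def module_def module_axioms_def)

text \<open>
  The additive monoid of \<open>tensor_prod K M N\<close> and \<open>tensor_group K M N\<close> have the same carrier,
  product and unit but are records of different types.
\<close>
lemma tensor_lift_monoid_cong: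
  assumes "carrier G = carrier G'" "mult G = mult G'" "one G = one G'"
  shows "tensor_lift G = tensor_lift G'"
proof -
  have i: "m_inv G = m_inv G'" using assms by (simp add: m_inv_def fun_eq_iff)
  have p: "(pow G :: _ \<Rightarrow> int \<Rightarrow> _) = pow G'" by (intro ext) (simp add: int_pow_def nat_pow_def i assms Let_def)
  have f: "finprod G = finprod G'" by (intro ext) (simp add: finprod_def assms)
  show ?thesis by (intro ext) (simp only: tensor_lift_def p f)
qed

lemma tensor_lift_add_monoid: "tensor_lift (add_monoid (tensor_prod K M N)) = tensor_lift (tensor_group K M N)"
  by (rule tensor_lift_monoid_cong) (simp_all add: tensor_prod_def)

lemma add_tensor_prod: "add (tensor_prod K M N) = mult (tensor_group K M N)"
  by (simp add: tensor_prod_def)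

lemma zero_tensor_prod: "zero (tensor_prod K M N) = one (tensor_group K M N)"
  by (simp add: tensor_prod_def)

lemma smult_tensor_prod: "smult (tensor_prod K M N) = (\<lambda>k. tensor_map K M N (\<lambda>m. k \<odot>\<^bsub>M\<^esub> m) (\<lambda>n. n))"
  by (simp add: tensor_prod_def)

lemma module_comm_group: "module K P \<Longrightarrow> comm_group (add_monoid P)"
  by (simp add: module_def abelian_group_def abelian_group_axioms_def)

text \<open>
  The left factor may carry an action \<open>\<sigma>\<close> of a commutative ring \<open>K\<close> that commutes with that of \<open>R\<close>;
  the tensor product over \<open>R\<close> is then a \<open>K\<close>-module. Besides \<open>R = K\<close> this covers the tensor square of
  an algebra over a noncommutative subalgebra.
\<close>
lemma (in tensor_pair) tensor_module:
  fixes K :: "('k, 'u) ring_scheme" and \<sigma> :: "'k \<Rightarrow> 'm \<Rightarrow> 'm"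
  assumes K: "cring K"
    and sc: "\<And>k m. k \<in> carrier K \<Longrightarrow> m \<in> carrier M \<Longrightarrow> \<sigma> k m \<in> carrier M"
    and sa: "\<And>k m m'. k \<in> carrier K \<Longrightarrow> m \<in> carrier M \<Longrightarrow> m' \<in> carrier M \<Longrightarrow> \<sigma> k (m \<oplus>\<^bsub>M\<^esub> m') = \<sigma> k m \<oplus>\<^bsub>M\<^esub> \<sigma> k m'"
    and sr: "\<And>k r m. k \<in> carrier K \<Longrightarrow> r \<in> carrier R \<Longrightarrow> m \<in> carrier M \<Longrightarrow> \<sigma> k (r \<odot>\<^bsub>M\<^esub> m) = r \<odot>\<^bsub>M\<^esub> \<sigma> k m"
    and sk: "\<And>k l m. k \<in> carrier K \<Longrightarrow> l \<in> carrier K \<Longrightarrow> m \<in> carrier M \<Longrightarrow> \<sigma> (k \<oplus>\<^bsub>K\<^esub> l) m = \<sigma> k m \<oplus>\<^bsub>M\<^esub> \<sigma> l m"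
    and sm: "\<And>k l m. k \<in> carrier K \<Longrightarrow> l \<in> carrier K \<Longrightarrow> m \<in> carrier M \<Longrightarrow> \<sigma> (k \<otimes>\<^bsub>K\<^esub> l) m = \<sigma> k (\<sigma> l m)"
    and s1: "\<And>m. m \<in> carrier M \<Longrightarrow> \<sigma> \<one>\<^bsub>K\<^esub> m = m"
    and P: "carrier P = carrier T" "add P = mult T" "zero P = one T"
      "smult P = (\<lambda>k. tensor_map R M N (\<sigma> k) (\<lambda>n. n))"
  shows "module K P" and "\<And>k m n. k \<in> carrier K \<Longrightarrow> m \<in> carrier M \<Longrightarrow> n \<in> carrier N \<Longrightarrow> k \<odot>\<^bsub>P\<^esub> pt m n = pt (\<sigma> k m) n"
proof -
  interpret T: comm_group T by (rule comm_group_T)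
  have bal: "balanced R M N T (\<lambda>m n. pt (\<sigma> k m) n)" if "k \<in> carrier K" for k
    using pure_balanced that by (simp add: balanced_def sc sa sr)
  have hom: "smult P k \<in> hom T T" if "k \<in> carrier K" for k
    using lift_hom[OF comm_group_T bal[OF that]] by (simp add: P(4) tensor_map_def)
  show pu: "k \<odot>\<^bsub>P\<^esub> pt m n = pt (\<sigma> k m) n" if "k \<in> carrier K" "m \<in> carrier M" "n \<in> carrier N" for k m n
    using lift_pure[OF comm_group_T bal] that by (simp add: P(4) tensor_map_def)
  show "module K P"
  proof (rule moduleI[OF K])
    show "abelian_group P"
    proof (rule abelian_groupI)
      show "\<exists>y\<in>carrier P. y \<oplus>\<^bsub>P\<^esub> x = \<zero>\<^bsub>P\<^esub>" if "x \<in> carrier P" for x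
        using that P T.l_inv T.inv_closed by metis
    qed (use P T.m_assoc T.m_comm in simp_all)
    fix a x assume "a \<in> carrier K" "x \<in> carrier P"
    then show "a \<odot>\<^bsub>P\<^esub> x \<in> carrier P" using hom[of a] P(1) by (auto simp: hom_def)
  next
    fix a b x assume ab: "a \<in> carrier K" "b \<in> carrier K" and x: "x \<in> carrier P"
    interpret K: cring K by fact
    have h: "(\<lambda>x. (a \<odot>\<^bsub>P\<^esub> x) \<otimes>\<^bsub>T\<^esub> (b \<odot>\<^bsub>P\<^esub> x)) \<in> hom T T"
      using hom[OF ab(1)] hom[OF ab(2)]
      by (intro homI) (simp_all add: hom_in_carrier[where G = T and H = T] hom_mult[where G = T and H = T] T.m_ac)
    show "(a \<oplus>\<^bsub>K\<^esub> b) \<odot>\<^bsub>P\<^esub> x = a \<odot>\<^bsub>P\<^esub> x \<oplus>\<^bsub>P\<^esub> b \<odot>\<^bsub>P\<^esub> x"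
      unfolding P(2)
      by (rule hom_eqI[OF group_T hom h]) (use ab x P(1) pure_balanced in \<open>auto simp: pu sk sc balanced_def\<close>)
    have h2: "(\<lambda>x. a \<odot>\<^bsub>P\<^esub> (b \<odot>\<^bsub>P\<^esub> x)) \<in> hom T T"
      using hom[OF ab(1)] hom[OF ab(2)] by (auto simp: hom_def Pi_iff)
    show "(a \<otimes>\<^bsub>K\<^esub> b) \<odot>\<^bsub>P\<^esub> x = a \<odot>\<^bsub>P\<^esub> (b \<odot>\<^bsub>P\<^esub> x)"
      by (rule hom_eqI[OF group_T hom h2]) (use ab x P(1) in \<open>auto simp: pu sm sc\<close>)
  next
    fix a x y assume "a \<in> carrier K" "x \<in> carrier P" "y \<in> carrier P"
    then show "a \<odot>\<^bsub>P\<^esub> (x \<oplus>\<^bsub>P\<^esub> y) = a \<odot>\<^bsub>P\<^esub> x \<oplus>\<^bsub>P\<^esub> a \<odot>\<^bsub>P\<^esub> y"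
      using hom[of a] P by (auto simp: hom_def)
  next
    fix x assume x: "x \<in> carrier P"
    interpret K: cring K by fact
    have i: "(\<lambda>x. x) \<in> hom T T" by (auto simp: hom_def)
    show "\<one>\<^bsub>K\<^esub> \<odot>\<^bsub>P\<^esub> x = x"
      by (rule hom_eqI[OF group_T hom i]) (use x P(1) in \<open>auto simp: pu s1\<close>)
  qed
qed

lemma carrier_tensor_group [simp]: "carrier (tensor_group K M N) = carrier (tensor_prod K M N)"
  by (simp add: tensor_prod_def)

lemma
  assumes M: "module K M" and N: "module K N"
  shows module_tensor_prod [simp, mlin]: "module K (tensor_prod K M N)"
    and smult_pure: "k \<in> carrier K \<Longrightarrow> m \<in> carrier M \<Longrightarrow> n \<in> carrier N \<Longrightarrow>
      k \<odot>\<^bsub>tensor_prod K M N\<^esub> pure_tensor K M N m n = pure_tensor K M N (k \<odot>\<^bsub>M\<^esub> m) n"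
    and smult_pure': "k \<in> carrier K \<Longrightarrow> m \<in> carrier M \<Longrightarrow> n \<in> carrier N \<Longrightarrow>
      k \<odot>\<^bsub>tensor_prod K M N\<^esub> pure_tensor K M N m n = pure_tensor K M N m (k \<odot>\<^bsub>N\<^esub> n)"
proof -
  interpret M: module K M by fact
  interpret tensor_pair K M N by (rule tensor_pairI[OF M N])
  have *: "module K (tensor_prod K M N)" "\<And>k m n. k \<in> carrier K \<Longrightarrow> m \<in> carrier M \<Longrightarrow> n \<in> carrier N \<Longrightarrow>
      k \<odot>\<^bsub>tensor_prod K M N\<^esub> pt m n = pt (k \<odot>\<^bsub>M\<^esub> m) n"
    by (rule tensor_module[where K = K and \<sigma> = "smult M"];
        (simp add: M.is_cring M.smult_r_distr M.smult_l_distr M.smult_assoc1 add_tensor_prod zero_tensor_prod smult_tensor_prod)?,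
        (simp add: M.smult_assoc1[symmetric] M.R.m_comm)?)+
  show "module K (tensor_prod K M N)" by fact
  show 1: "k \<odot>\<^bsub>tensor_prod K M N\<^esub> pt m n = pt (k \<odot>\<^bsub>M\<^esub> m) n" if "k \<in> carrier K" "m \<in> carrier M" "n \<in> carrier N" for k m n
    using *(2) that .
  show "k \<odot>\<^bsub>tensor_prod K M N\<^esub> pt m n = pt m (k \<odot>\<^bsub>N\<^esub> n)" if "k \<in> carrier K" "m \<in> carrier M" "n \<in> carrier N" for k m n
    using 1[OF that] pure_balanced that by (simp add: balanced_def)
qed

text \<open>
  In a coalgebra \<open>tlift P \<phi> (comult C x)\<close> is the Sweedler sum \<open>\<Sum> \<phi> x\<^sub>1 x\<^sub>2\<close>; iterated
  comultiplications become nested sums.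
\<close>
definition tlift :: "('k, 'p, 'y) module_scheme \<Rightarrow> ('m \<Rightarrow> 'n \<Rightarrow> 'p) \<Rightarrow> ('m, 'n) tensor \<Rightarrow> 'p" where
  "tlift P \<phi> = tensor_lift (add_monoid P) \<phi>"

lemma bilinear_balanced:
  assumes "module K M" "module K N" "module K P" "bilinear_map K M N P \<phi>"
  shows "balanced K M N (add_monoid P) \<phi>"
  using assms(4) by (auto simp: balanced_def bilinear_map_def linear_maps_def Pi_iff)

lemma bilinear_pure [mlin]:
  assumes M: "module K M" and N: "module K N"
  shows "bilinear_map K M N (tensor_prod K M N) (pure_tensor K M N)"
proof -
  interpret tensor_pair K M N by (rule tensor_pairI[OF M N])
  show ?thesis
    using pure_balanced
    by (auto simp: bilinear_map_def linear_maps_def balanced_def add_tensor_prod smult_pure[OF M N] smult_pure'[OF M N, symmetric])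
qed

lemma pure_closed [mlin]:
  assumes "module K M" "module K N" "m \<in> carrier M" "n \<in> carrier N"
  shows "pure_tensor K M N m n \<in> carrier (tensor_prod K M N)"
  using bilinear_closed[OF bilinear_pure] assms by fastforce

lemmas linear_pure_left [mlin] = bilinear_left_comp[OF bilinear_pure]
lemmas linear_pure_right [mlin] = bilinear_right_comp[OF bilinear_pure]

lemma linear_lift:
  assumes M: "module K M" and N: "module K N" and P: "module K P" and b: "bilinear_map K M N P \<phi>"
  shows "tlift P \<phi> \<in> linear_maps K (tensor_prod K M N) P"
    and lift_pure: "m \<in> carrier M \<Longrightarrow> n \<in> carrier N \<Longrightarrow> tlift P \<phi> (pure_tensor K M N m n) = \<phi> m n"
proof -
  interpret tp: tensor_pair K M N by (rule tensor_pairI[OF M N])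
  interpret MN: module K "tensor_prod K M N" by (rule module_tensor_prod[OF M N])
  interpret M: module K M by fact
  interpret P: module K P by fact
  note bb = bilinear_balanced[OF M N P b]
  note h = tp.lift_hom[OF module_comm_group[OF P] bb, folded tlift_def]
  show pu: "tlift P \<phi> (pure_tensor K M N m n) = \<phi> m n" if "m \<in> carrier M" "n \<in> carrier N" for m n
    by (unfold tlift_def, rule tp.lift_pure[OF module_comm_group[OF P] bb that])
  show "tlift P \<phi> \<in> linear_maps K (tensor_prod K M N) P"
  proof (rule linearI)
    show "tlift P \<phi> x \<in> carrier P" if "x \<in> carrier (tensor_prod K M N)" for x
      using h that by (auto simp: hom_def)
    show "tlift P \<phi> (x \<oplus>\<^bsub>tensor_prod K M N\<^esub> y) = tlift P \<phi> x \<oplus>\<^bsub>P\<^esub> tlift P \<phi> y"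
      if "x \<in> carrier (tensor_prod K M N)" "y \<in> carrier (tensor_prod K M N)" for x y
      using h that by (auto simp: hom_def add_tensor_prod)
    fix k t assume k: "k \<in> carrier K" and t: "t \<in> carrier (tensor_prod K M N)"
    have 1: "(\<lambda>t. tlift P \<phi> (k \<odot>\<^bsub>tensor_prod K M N\<^esub> t)) \<in> hom (tensor_group K M N) (add_monoid P)"
      using h MN.smult_closed[OF k] MN.smult_r_distr[OF k] by (auto simp: hom_def Pi_iff add_tensor_prod)
    have 2: "(\<lambda>t. k \<odot>\<^bsub>P\<^esub> tlift P \<phi> t) \<in> hom (tensor_group K M N) (add_monoid P)"
      using h P.smult_r_distr k by (auto simp: hom_def Pi_iff)
    have "group (add_monoid P)" using module_comm_group[OF P] by (simp add: comm_group_def)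
    from tp.hom_eqI[OF this 1 2] k t pu linear_smult[OF bilinear_left[OF b]]
    show "tlift P \<phi> (k \<odot>\<^bsub>tensor_prod K M N\<^esub> t) = k \<odot>\<^bsub>P\<^esub> tlift P \<phi> t"
      by (simp add: smult_pure[OF M N])
  qed
qed

lemma linear_eq_on_tensors:
  assumes M: "module K M" and N: "module K N" and P: "module K P"
    and f: "f \<in> linear_maps K (tensor_prod K M N) P" and g: "g \<in> linear_maps K (tensor_prod K M N) P"
    and e: "\<And>m n. m \<in> carrier M \<Longrightarrow> n \<in> carrier N \<Longrightarrow> f (pure_tensor K M N m n) = g (pure_tensor K M N m n)"
    and t: "t \<in> carrier (tensor_prod K M N)"
  shows "f t = g t"
proof -
  interpret tensor_pair K M N by (rule tensor_pairI[OF M N])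
  have "group (add_monoid P)" using module_comm_group[OF P] by (simp add: comm_group_def)
  then show ?thesis
    by (rule hom_eqI[where h = f and h' = g, OF _ _ _ e]) (use f g t in \<open>auto simp: linear_maps_def hom_def add_tensor_prod\<close>)
qed

lemma lift_closed:
  assumes "module K M" "module K N" "module K P" "bilinear_map K M N P \<phi>" "t \<in> carrier (tensor_prod K M N)"
  shows "tlift P \<phi> t \<in> carrier P"
  using linear_closed[OF linear_lift(1)[OF assms(1-4)]] assms(5) by simp

lemma linear_lift_arg:
  assumes "module K M" "module K N" "module K P" "bilinear_map K M N P \<phi>" "f \<in> linear_maps K X (tensor_prod K M N)"
  shows "(\<lambda>x. tlift P \<phi> (f x)) \<in> linear_maps K X P"
  by (rule linear_comp[OF linear_lift(1) assms(5)]) fact+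

lemma linear_lift_lift:
  assumes "module K M" "module K N" "module K P" "module K Q" "bilinear_map K M N P \<phi>" "f \<in> linear_maps K P Q"
    "t \<in> carrier (tensor_prod K M N)"
  shows "f (tlift P \<phi> t) = tlift Q (\<lambda>m n. f (\<phi> m n)) t"
proof -
  have b: "bilinear_map K M N Q (\<lambda>m n. f (\<phi> m n))"
    using assms(5,6) by (intro bilinearI linear_comp[OF assms(6)]) (auto simp: bilinear_map_def)
  show ?thesis
    by (rule linear_eq_on_tensors[OF assms(1,2,4) linear_comp[OF assms(6) linear_lift(1)] linear_lift(1)[OF assms(1,2,4) b] _ assms(7)])
      (use assms b in \<open>simp_all add: lift_pure\<close>)
qed

lemma lift_cong:
  assumes "module K M" "module K N" "t \<in> carrier (tensor_prod K M N)"
    and "\<And>m n. m \<in> carrier M \<Longrightarrow> n \<in> carrier N \<Longrightarrow> \<phi> m n = \<psi> m n"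
  shows "tlift P \<phi> t = tlift P \<psi> t"
  unfolding tlift_def
  by (rule tensor_pair.lift_cong[OF tensor_pairI[OF assms(1,2)]]) (use assms(3,4) in simp_all)

lemma lift_pure_id:
  assumes M: "module K M" and N: "module K N" and t: "t \<in> carrier (tensor_prod K M N)"
  shows "tlift (tensor_prod K M N) (pure_tensor K M N) t = t"
  by (rule linear_eq_on_tensors[OF M N module_tensor_prod[OF M N] linear_lift(1) linear_id _ t])
      (use M N in \<open>simp_all only: lift_pure bilinear_pure module_tensor_prod\<close>)

lemma tensor_map_lift: "tensor_map K M' N' f g = tlift (tensor_prod K M' N') (\<lambda>m n. pure_tensor K M' N' (f m) (g n))"
  by (simp add: tensor_map_def tlift_def tensor_lift_add_monoid)

lemma bilinear_tensor_map:
  assumes "module K M'" "module K N'"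
    "f \<in> linear_maps K M M'" "g \<in> linear_maps K N N'"
  shows "bilinear_map K M N (tensor_prod K M' N') (\<lambda>m n. pure_tensor K M' N' (f m) (g n))"
  using assms by (intro bilinearI linear_pure_left linear_pure_right) (auto simp: linear_closed)

lemma linear_tensor_map:
  assumes "module K M" "module K N" "module K M'" "module K N'"
    "f \<in> linear_maps K M M'" "g \<in> linear_maps K N N'"
  shows "tensor_map K M' N' f g \<in> linear_maps K (tensor_prod K M N) (tensor_prod K M' N')"
    and tensor_map_pure: "m \<in> carrier M \<Longrightarrow> n \<in> carrier N \<Longrightarrow>
       tensor_map K M' N' f g (pure_tensor K M N m n) = pure_tensor K M' N' (f m) (g n)"
  unfolding tensor_map_lift
  using linear_lift[OF assms(1,2) module_tensor_prod[OF assms(3,4)] bilinear_tensor_map[OF assms(3-6)]] by blast+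

lemma tensor_map_closed [mlin]:
  assumes "module K M" "module K N" "module K M'" "module K N'"
    "f \<in> linear_maps K M M'" "g \<in> linear_maps K N N'" "t \<in> carrier (tensor_prod K M N)"
  shows "tensor_map K M' N' f g t \<in> carrier (tensor_prod K M' N')"
  using linear_closed[OF linear_tensor_map(1)[OF assms(1-6)]] assms(7) by simp

lemma linear_tensor_map_arg [mlin]:
  assumes "module K M" "module K N" "module K M'" "module K N'"
    "f \<in> linear_maps K M M'" "g \<in> linear_maps K N N'" "h \<in> linear_maps K X (tensor_prod K M N)"
  shows "(\<lambda>x. tensor_map K M' N' f g (h x)) \<in> linear_maps K X (tensor_prod K M' N')"
  by (rule linear_comp[OF linear_tensor_map(1) assms(7)]) fact+

lemma lift_tensor_map:
  assumes "module K M" "module K N" "module K M'" "module K N'" "module K P"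
    "f \<in> linear_maps K M M'" "g \<in> linear_maps K N N'" "bilinear_map K M' N' P \<phi>"
    "t \<in> carrier (tensor_prod K M N)"
  shows "tlift P \<phi> (tensor_map K M' N' f g t) = tlift P (\<lambda>m n. \<phi> (f m) (g n)) t"
proof -
  have b: "bilinear_map K M N P (\<lambda>m n. \<phi> (f m) (g n))"
    using assms by (intro bilinearI bilinear_left_comp[OF assms(8)] bilinear_right_comp[OF assms(8)]) (auto simp: linear_closed)
  show ?thesis
    by (rule linear_eq_on_tensors[OF assms(1,2,5) linear_comp[OF linear_lift(1) linear_tensor_map(1)] linear_lift(1)[OF assms(1,2,5) b] _ assms(9)])
      (use assms b in \<open>simp_all add: lift_pure tensor_map_pure[of K M N] linear_closed\<close>)
qed

lemma tensor_map_comp: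
  assumes "module K M" "module K N" "module K M'" "module K N'" "module K M''" "module K N''"
    "f \<in> linear_maps K M M'" "g \<in> linear_maps K N N'" "f' \<in> linear_maps K M' M''" "g' \<in> linear_maps K N' N''"
    "t \<in> carrier (tensor_prod K M N)"
  shows "tensor_map K M'' N'' f' g' (tensor_map K M' N' f g t) = tensor_map K M'' N'' (\<lambda>x. f' (f x)) (\<lambda>x. g' (g x)) t"
  unfolding tensor_map_lift[of K M'' N'']
  by (rule lift_tensor_map[OF assms(1-4) module_tensor_prod[OF assms(5,6)] assms(7,8) bilinear_tensor_map[OF assms(5,6,9,10)] assms(11)])

lemma tensor_map_cong:
  assumes M: "module K M" and N: "module K N" "module K M'" "module K N'"
    "f \<in> linear_maps K M M'" "g \<in> linear_maps K N N'"
    and e: "\<And>m. m \<in> carrier M \<Longrightarrow> f m = f' m" "\<And>n. n \<in> carrier N \<Longrightarrow> g n = g' n"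
    and t: "t \<in> carrier (tensor_prod K M N)"
  shows "tensor_map K M' N' f g t = tensor_map K M' N' f' g' t"
  unfolding tensor_map_lift
  by (rule lift_cong[OF M N(1) t]) (simp add: e)

lemma tensor_map_id:
  assumes M: "module K M" and N: "module K N"
    and e: "\<And>m. m \<in> carrier M \<Longrightarrow> f m = m" "\<And>n. n \<in> carrier N \<Longrightarrow> g n = n"
    and t: "t \<in> carrier (tensor_prod K M N)"
  shows "tensor_map K M N f g t = t"
proof -
  have "f \<in> linear_maps K M M" "g \<in> linear_maps K N N"
    by (rule linear_cong[OF linear_id]; use e M N in simp)+
  then have "tensor_map K M N f g t = tensor_map K M N (\<lambda>m. m) (\<lambda>n. n) t"
    by (intro tensor_map_cong[OF M N M N _ _ _ _ t]) (simp_all add: e)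
  then show ?thesis using lift_pure_id[OF M N t] by (simp add: tensor_map_lift)
qed

text \<open>
  Linearity in a parameter of the summand, needed when a Sweedler sum is nested in another one.
\<close>
lemma linear_lift_param:
  assumes M: "module K M" and N: "module K N" and P: "module K P" and X: "module K X"
    and l: "\<And>m n. m \<in> carrier M \<Longrightarrow> n \<in> carrier N \<Longrightarrow> (\<lambda>x. \<phi> x m n) \<in> linear_maps K X P"
    and b: "\<And>x. x \<in> carrier X \<Longrightarrow> bilinear_map K M N P (\<phi> x)"
    and t: "t \<in> carrier (tensor_prod K M N)"
  shows "(\<lambda>x. tlift P (\<phi> x) t) \<in> linear_maps K X P"
proof -
  interpret X: module K X by fact
  interpret P: module K P by fact
  note el = linear_eq_on_tensors[OF M N P]
  show ?thesis
  proof (rule linearI)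
    show "tlift P (\<phi> x) t \<in> carrier P" if "x \<in> carrier X" for x
      by (rule lift_closed[OF M N P b[OF that] t])
    fix x y assume x: "x \<in> carrier X" and y: "y \<in> carrier X"
    show "tlift P (\<phi> (x \<oplus>\<^bsub>X\<^esub> y)) t = tlift P (\<phi> x) t \<oplus>\<^bsub>P\<^esub> tlift P (\<phi> y) t"
      by (rule el[OF linear_lift(1)[OF M N P b] linear_sum[OF P linear_lift(1)[OF M N P b] linear_lift(1)[OF M N P b]] _ t])
       (use x y in \<open>simp_all add: lift_pure[OF M N P b] linear_add[OF l]\<close>)
  next
    fix r x assume r: "r \<in> carrier K" and x: "x \<in> carrier X"
    show "tlift P (\<phi> (r \<odot>\<^bsub>X\<^esub> x)) t = r \<odot>\<^bsub>P\<^esub> tlift P (\<phi> x) t"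
      by (rule el[OF linear_lift(1)[OF M N P b] linear_smult_left[OF P linear_lift(1)[OF M N P b]] _ t])
       (use x r in \<open>simp_all add: lift_pure[OF M N P b] linear_smult[OF l]\<close>)
  qed
qed

text \<open>
  Sums over two unrelated tensors can be interchanged: both sides are linear in \<open>t\<close> and agree on pure
  tensors.
\<close>
lemma lift_fubini:
  assumes M: "module K M" and N: "module K N" and U: "module K U" and V: "module K V" and P: "module K P"
    and l: "\<And>u v. u \<in> carrier U \<Longrightarrow> v \<in> carrier V \<Longrightarrow> bilinear_map K M N P (\<lambda>m n. \<phi> m n u v)"
    and b: "\<And>m n. m \<in> carrier M \<Longrightarrow> n \<in> carrier N \<Longrightarrow> bilinear_map K U V P (\<phi> m n)"
    and t: "t \<in> carrier (tensor_prod K M N)" and s: "s \<in> carrier (tensor_prod K U V)"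
  shows "tlift P (\<lambda>m n. tlift P (\<phi> m n) s) t
       = tlift P (\<lambda>u v. tlift P (\<lambda>m n. \<phi> m n u v) t) s"
proof -
  note el = linear_eq_on_tensors[OF M N P]
  have b1: "bilinear_map K M N P (\<lambda>m n. tlift P (\<phi> m n) s)"
    using l b by (intro bilinearI linear_lift_param[OF U V P _ _ _ s] M N) (auto simp: bilinear_map_def)
  have b2: "(\<lambda>t. tlift P (\<lambda>u v. tlift P (\<lambda>m n. \<phi> m n u v) t) s)
      \<in> linear_maps K (tensor_prod K M N) P"
  proof (intro linear_lift_param[OF U V P _ _ _ s] module_tensor_prod M N linear_lift(1) l P)
    fix x assume x: "x \<in> carrier (tensor_prod K M N)"
    show "bilinear_map K U V P (\<lambda>u v. tlift P (\<lambda>m n. \<phi> m n u v) x)"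
      using l b x by (intro bilinearI linear_lift_param[OF M N P] U V) (auto simp: bilinear_map_def)
  qed
  show ?thesis
  proof (rule el[OF linear_lift(1)[OF M N P b1] b2 _ t])
    fix m n assume mn: "m \<in> carrier M" "n \<in> carrier N"
    have "tlift P (\<phi> m n) s
      = tlift P (\<lambda>u v. tlift P (\<lambda>m n. \<phi> m n u v) (pure_tensor K M N m n)) s"
      by (rule lift_cong[OF U V s]) (simp add: lift_pure[OF M N P l] mn)
    then show "tlift P (\<lambda>m n. tlift P (\<phi> m n) s) (pure_tensor K M N m n)
     = tlift P (\<lambda>u v. tlift P (\<lambda>m n. \<phi> m n u v) (pure_tensor K M N m n)) s"
      by (simp add: lift_pure[OF M N P b1] mn)
  qed
qed

section \<open>Complements of subspaces\<close>

lemma (in module) submodule_minus_mem: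
  assumes "submodule W R M" "x \<in> W" "y \<in> W" shows "x \<ominus>\<^bsub>M\<^esub> y \<in> W"
  using submoduleE[OF assms(1)] assms by (simp add: a_minus_def)

lemma (in module) minus_eq_zero_iff:
  assumes "x \<in> carrier M" "y \<in> carrier M" shows "x \<ominus>\<^bsub>M\<^esub> y = \<zero>\<^bsub>M\<^esub> \<longleftrightarrow> x = y"
  using assms by (metis M.add.inv_closed M.add.inv_equality M.add.inv_inv M.r_neg a_minus_def)

lemma submodule_zero: "submodule W K M \<Longrightarrow> \<zero>\<^bsub>M\<^esub> \<in> W"
  by (metis monoid.simps(2) submodule.axioms(1) subgroup.one_closed)

text \<open>
  By Zorn's lemma. A maximal \<open>W\<close> that meets \<open>U\<close> only in zero could be enlarged by any \<open>x \<in> V\<close>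
  outside \<open>U + W\<close>. Prescribing a part \<open>W0\<close> of the complement makes it possible to nest complements.
\<close>
lemma exists_complement:
  assumes K: "field K" and M: "module K M"
    and U: "submodule U K M" and V: "submodule V K M" and W0: "submodule W0 K M" "W0 \<subseteq> V" "W0 \<inter> U \<subseteq> {\<zero>\<^bsub>M\<^esub>}"
  shows "\<exists>W. submodule W K M \<and> W0 \<subseteq> W \<and> W \<subseteq> V \<and> W \<inter> U \<subseteq> {\<zero>\<^bsub>M\<^esub>} \<and> (\<forall>x\<in>V. \<exists>u\<in>U. \<exists>w\<in>W. x = u \<oplus>\<^bsub>M\<^esub> w)"
proof -
  interpret K: field K by fact
  interpret M: module K M by fact
  note sE = M.submoduleE
  let ?S = "{W. submodule W K M \<and> W0 \<subseteq> W \<and> W \<subseteq> V \<and> W \<inter> U \<subseteq> {\<zero>\<^bsub>M\<^esub>}}"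
  have "\<exists>W\<in>?S. \<forall>X\<in>?S. W \<subseteq> X \<longrightarrow> X = W"
  proof (rule subset_Zorn_nonempty)
    show "?S \<noteq> {}" using W0 by blast
    fix C assume C: "C \<noteq> {}" "subset.chain ?S C"
    have sub: "submodule X K M" if "X \<in> C" for X
      using C that by (auto simp: subset_chain_def)
    have dir: "\<exists>Z\<in>C. x \<in> Z \<and> y \<in> Z" if "X \<in> C" "x \<in> X" "Y \<in> C" "y \<in> Y" for X Y x y
    proof -
      have "\<forall>X\<in>C. \<forall>Y\<in>C. X \<subseteq> Y \<or> Y \<subseteq> X" using C(2)[unfolded subset_chain_def] by (rule conjunct2)
      then have "X \<subseteq> Y \<or> Y \<subseteq> X" using that(1,3) by simp
      then show ?thesis using that by (elim disjE) auto
    qed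
    have "submodule (\<Union>C) K M"
    proof (rule M.submoduleI)
      show "\<Union>C \<subseteq> carrier M" using sub sE(1) by blast
      show "\<zero>\<^bsub>M\<^esub> \<in> \<Union>C" using C(1) sub submodule_zero by blast
      show "\<ominus>\<^bsub>M\<^esub> a \<in> \<Union>C" if "a \<in> \<Union>C" for a using that sub sE(3) by blast
      show "k \<odot>\<^bsub>M\<^esub> a \<in> \<Union>C" if "k \<in> carrier K" "a \<in> \<Union>C" for k a using that sub sE(4) by blast
      show "a \<oplus>\<^bsub>M\<^esub> b \<in> \<Union>C" if ab: "a \<in> \<Union>C" "b \<in> \<Union>C" for a b
      proof -
        from ab obtain Z where "Z \<in> C" "a \<in> Z" "b \<in> Z" using dir by blast
        then show ?thesis using sub sE(5) by blast
      qed
    qed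
    moreover obtain X where "X \<in> C" using C(1) by blast
    ultimately show "\<Union>C \<in> ?S" using C(2)[unfolded subset_chain_def, THEN conjunct1] by blast
  qed
  then obtain W where WS: "W \<in> ?S" and WX: "\<forall>X\<in>?S. W \<subseteq> X \<longrightarrow> X = W" by (rule bexE)
  from WS have W: "submodule W K M" "W0 \<subseteq> W" "W \<subseteq> V" "W \<inter> U \<subseteq> {\<zero>\<^bsub>M\<^esub>}" by auto
  have max: "X = W" if "submodule X K M" "X \<subseteq> V" "X \<inter> U \<subseteq> {\<zero>\<^bsub>M\<^esub>}" "W \<subseteq> X" for X
    using WX[rule_format, of X] that W(2) by auto
  note eW = sE[OF W(1)] and eU = sE[OF U] and eV = sE[OF V]
  have "\<exists>u\<in>U. \<exists>w\<in>W. x = u \<oplus>\<^bsub>M\<^esub> w" if x: "x \<in> V" for x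
  proof (rule ccontr)
    assume no: "\<not> ?thesis"
    have xc: "x \<in> carrier M" using x eV(1) by blast
    have wc: "\<And>w. w \<in> W \<Longrightarrow> w \<in> carrier M" and uc: "\<And>u. u \<in> U \<Longrightarrow> u \<in> carrier M" using eW(1) eU(1) by blast+
    let ?X = "{w \<oplus>\<^bsub>M\<^esub> k \<odot>\<^bsub>M\<^esub> x | w k. w \<in> W \<and> k \<in> carrier K}"
    have memX: "w \<oplus>\<^bsub>M\<^esub> k \<odot>\<^bsub>M\<^esub> x \<in> ?X" if "w \<in> W" "k \<in> carrier K" for w k using that by blast
    have subX: "submodule ?X K M"
    proof (rule M.submoduleI)
      show "?X \<subseteq> carrier M" using wc xc by auto
      show "\<zero>\<^bsub>M\<^esub> \<in> ?X" using memX[OF submodule_zero[OF W(1)] K.zero_closed] xc by simp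
    next
      fix a assume "a \<in> ?X"
      then obtain w k where a: "a = w \<oplus>\<^bsub>M\<^esub> k \<odot>\<^bsub>M\<^esub> x" "w \<in> W" "k \<in> carrier K" by blast
      show "\<ominus>\<^bsub>M\<^esub> a \<in> ?X"
        using memX[of "\<ominus>\<^bsub>M\<^esub> w" "\<ominus>\<^bsub>K\<^esub> k"] a wc xc eW(3) by (simp add: M.smult_l_minus M.minus_add)
    next
      fix a b assume "a \<in> ?X" "b \<in> ?X"
      then obtain w k w' k' where ab: "a = w \<oplus>\<^bsub>M\<^esub> k \<odot>\<^bsub>M\<^esub> x" "w \<in> W" "k \<in> carrier K"
        "b = w' \<oplus>\<^bsub>M\<^esub> k' \<odot>\<^bsub>M\<^esub> x" "w' \<in> W" "k' \<in> carrier K" by blast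
      show "a \<oplus>\<^bsub>M\<^esub> b \<in> ?X"
        using memX[of "w \<oplus>\<^bsub>M\<^esub> w'" "k \<oplus>\<^bsub>K\<^esub> k'"] ab wc xc eW(5) by (simp add: M.smult_l_distr M.a_ac)
    next
      fix r a assume r: "r \<in> carrier K" and "a \<in> ?X"
      then obtain w k where a: "a = w \<oplus>\<^bsub>M\<^esub> k \<odot>\<^bsub>M\<^esub> x" "w \<in> W" "k \<in> carrier K" by blast
      show "r \<odot>\<^bsub>M\<^esub> a \<in> ?X"
        using memX[of "r \<odot>\<^bsub>M\<^esub> w" "r \<otimes>\<^bsub>K\<^esub> k"] a r wc xc eW(4) by (simp add: M.smult_r_distr M.smult_assoc1)
    qed
    have "?X \<inter> U \<subseteq> {\<zero>\<^bsub>M\<^esub>}"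
    proof
      fix u assume "u \<in> ?X \<inter> U"
      then obtain w k where u: "u = w \<oplus>\<^bsub>M\<^esub> k \<odot>\<^bsub>M\<^esub> x" "w \<in> W" "k \<in> carrier K" "u \<in> U" by blast
      show "u \<in> {\<zero>\<^bsub>M\<^esub>}"
      proof (cases "k = \<zero>\<^bsub>K\<^esub>")
        case True
        then have "u = w" using u wc xc by simp
        then show ?thesis using u W(4) by blast
      next
        case False
        then have kU: "k \<in> Units K" using u K.field_Units by blast
        let ?i = "inv\<^bsub>K\<^esub> k"
        have i: "?i \<in> carrier K" using kU by simp
        have "x = ?i \<odot>\<^bsub>M\<^esub> (k \<odot>\<^bsub>M\<^esub> x)"
          using kU u xc i by (simp add: M.smult_assoc1[symmetric])
        also have "k \<odot>\<^bsub>M\<^esub> x = u \<oplus>\<^bsub>M\<^esub> \<ominus>\<^bsub>M\<^esub> w"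
          using u wc xc uc by (metis M.M.add.inv_solve_right M.M.add.m_comm M.M.add.inv_closed M.smult_closed)
        also have "?i \<odot>\<^bsub>M\<^esub> (u \<oplus>\<^bsub>M\<^esub> \<ominus>\<^bsub>M\<^esub> w) = ?i \<odot>\<^bsub>M\<^esub> u \<oplus>\<^bsub>M\<^esub> ?i \<odot>\<^bsub>M\<^esub> (\<ominus>\<^bsub>M\<^esub> w)"
          using i u uc wc by (simp add: M.smult_r_distr)
        finally show ?thesis using no i u eU(4) eW(3,4) by blast
      qed
    qed
    moreover have "?X \<subseteq> V" using x W(3) eV(4,5) by blast
    moreover have "W \<subseteq> ?X"
    proof
      fix w assume w: "w \<in> W"
      show "w \<in> ?X" using memX[OF w K.zero_closed] wc[OF w] xc by simp
    qed
    ultimately have "?X = W" using max subX by blast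
    moreover have "\<zero>\<^bsub>M\<^esub> \<oplus>\<^bsub>M\<^esub> \<one>\<^bsub>K\<^esub> \<odot>\<^bsub>M\<^esub> x \<in> ?X" using submodule_zero[OF W(1)] by blast
    ultimately have "x \<in> W" using xc by simp
    then show False using no submodule_zero[OF U] xc M.l_zero by metis
  qed
  with W show ?thesis by blast
qed

text \<open>
  A complement of \<open>U\<close> containing a complement of \<open>U \<inter> V\<close> in \<open>V\<close> gives a projection onto \<open>U\<close> that
  maps \<open>V\<close> into itself. Tensored with itself it shows that \<open>U \<otimes> U\<close> and \<open>V \<otimes> V\<close> meet in
  \<open>(U \<inter> V) \<otimes> (U \<inter> V)\<close>.
\<close>
lemma exists_projection:
  assumes K: "field K" and M: "module K M"
    and U: "submodule U K M" and V: "submodule V K M"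
  shows "\<exists>p\<in>linear_maps K M M. (\<forall>x\<in>carrier M. p x \<in> U) \<and> (\<forall>x\<in>U. p x = x) \<and> (\<forall>x\<in>V. p x \<in> V) \<and>
    (\<exists>W. submodule W K M \<and> (\<forall>x\<in>carrier M. x \<ominus>\<^bsub>M\<^esub> p x \<in> W) \<and> W \<inter> U \<subseteq> {\<zero>\<^bsub>M\<^esub>})"
proof -
  interpret K: field K by fact
  interpret M: module K M by fact
  note sE = M.submoduleE
  have z: "submodule {\<zero>\<^bsub>M\<^esub>} K M" by (rule M.submoduleI) auto
  obtain W0 where W0: "submodule W0 K M" "W0 \<subseteq> V" "W0 \<inter> U \<subseteq> {\<zero>\<^bsub>M\<^esub>}"
    and V0: "\<And>x. x \<in> V \<Longrightarrow> \<exists>u\<in>U \<inter> V. \<exists>w\<in>W0. x = u \<oplus>\<^bsub>M\<^esub> w"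
  proof -
    have "submodule (U \<inter> V) K M"
      using sE[OF U] sE[OF V] submodule_zero[OF U] submodule_zero[OF V] by (intro M.submoduleI) auto
    from exists_complement[OF K M this V z] submodule_zero[OF V]
    obtain W where W: "submodule W K M" "W \<subseteq> V" "W \<inter> (U \<inter> V) \<subseteq> {\<zero>\<^bsub>M\<^esub>}" "\<forall>x\<in>V. \<exists>u\<in>U \<inter> V. \<exists>w\<in>W. x = u \<oplus>\<^bsub>M\<^esub> w"
      by auto
    show thesis
      by (rule that[OF W(1,2) _ bspec[OF W(4)]]) (use W(2,3) in auto)
  qed
  obtain W where W: "submodule W K M" "W0 \<subseteq> W" "W \<inter> U \<subseteq> {\<zero>\<^bsub>M\<^esub>}"
    and Wd: "\<And>x. x \<in> carrier M \<Longrightarrow> \<exists>u\<in>U. \<exists>w\<in>W. x = u \<oplus>\<^bsub>M\<^esub> w"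
    using exists_complement[OF K M U M.carrier_is_submodule W0(1) _ W0(3)] sE(1)[OF W0(1)] by blast
  have uc: "\<And>x. x \<in> U \<Longrightarrow> x \<in> carrier M" and wc: "\<And>x. x \<in> W \<Longrightarrow> x \<in> carrier M"
    using sE(1)[OF U] sE(1)[OF W(1)] by auto
  have un: "u = u'" if "u \<in> U" "w \<in> W" "u' \<in> U" "w' \<in> W" "u \<oplus>\<^bsub>M\<^esub> w = u' \<oplus>\<^bsub>M\<^esub> w'" for u w u' w'
  proof -
    have c: "u \<in> carrier M" "u' \<in> carrier M" "w \<in> carrier M" "w' \<in> carrier M" using that uc wc by auto
    have "u \<ominus>\<^bsub>M\<^esub> u' = (u \<oplus>\<^bsub>M\<^esub> w) \<ominus>\<^bsub>M\<^esub> w \<ominus>\<^bsub>M\<^esub> u'"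
      using c by (simp add: a_minus_def M.a_assoc M.r_neg)
    also have "\<dots> = w' \<ominus>\<^bsub>M\<^esub> w"
    proof -
      have "(u' \<oplus>\<^bsub>M\<^esub> w') \<ominus>\<^bsub>M\<^esub> w \<ominus>\<^bsub>M\<^esub> u' = w' \<oplus>\<^bsub>M\<^esub> (\<ominus>\<^bsub>M\<^esub> w \<oplus>\<^bsub>M\<^esub> (u' \<oplus>\<^bsub>M\<^esub> \<ominus>\<^bsub>M\<^esub> u'))"
        using c by (simp only: a_minus_def M.a_ac M.a_inv_closed M.a_closed)
      then show ?thesis unfolding that(5) using c by (simp add: a_minus_def M.r_neg)
    qed
    finally have "u \<ominus>\<^bsub>M\<^esub> u' \<in> W \<inter> U"
      using M.submodule_minus_mem[OF U that(1,3)] M.submodule_minus_mem[OF W(1) that(4,2)] by simp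
    then have "u \<ominus>\<^bsub>M\<^esub> u' = \<zero>\<^bsub>M\<^esub>" using W(3) by blast
    then show ?thesis using c by (simp add: M.minus_eq_zero_iff)
  qed
  \<comment> \<open>the component in \<open>U\<close> along the complement \<open>W\<close>\<close>
  define p where "p = (\<lambda>x. THE u. u \<in> U \<and> (\<exists>w\<in>W. x = u \<oplus>\<^bsub>M\<^esub> w))"
  have pI: "p x = u" if "u \<in> U" "w \<in> W" "x = u \<oplus>\<^bsub>M\<^esub> w" for x u w
    unfolding p_def by (rule the_equality) (use that un in blast)+
  have pd: "\<exists>w\<in>W. x = p x \<oplus>\<^bsub>M\<^esub> w \<and> p x \<in> U" if x: "x \<in> carrier M" for x
    using Wd[OF x] pI by metis
  have lin: "p \<in> linear_maps K M M"
  proof (rule linearI)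
    show "p x \<in> carrier M" if "x \<in> carrier M" for x using pd[OF that] uc by blast
    fix x y assume xy: "x \<in> carrier M" "y \<in> carrier M"
    obtain w w' where w: "w \<in> W" "x = p x \<oplus>\<^bsub>M\<^esub> w" "w' \<in> W" "y = p y \<oplus>\<^bsub>M\<^esub> w'" and pu: "p x \<in> U" "p y \<in> U"
      using pd xy by metis
    have "x \<oplus>\<^bsub>M\<^esub> y = (p x \<oplus>\<^bsub>M\<^esub> w) \<oplus>\<^bsub>M\<^esub> (p y \<oplus>\<^bsub>M\<^esub> w')" using w by simp
    also have "\<dots> = (p x \<oplus>\<^bsub>M\<^esub> p y) \<oplus>\<^bsub>M\<^esub> (w \<oplus>\<^bsub>M\<^esub> w')"
      using w(1,3) pu uc wc by (simp add: M.a_ac)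
    finally show "p (x \<oplus>\<^bsub>M\<^esub> y) = p x \<oplus>\<^bsub>M\<^esub> p y"
      by (rule pI[of "p x \<oplus>\<^bsub>M\<^esub> p y" "w \<oplus>\<^bsub>M\<^esub> w'", OF sE(5)[OF U pu] sE(5)[OF W(1) w(1,3)]])
  next
    fix r x assume r: "r \<in> carrier K" and x: "x \<in> carrier M"
    obtain w where w: "w \<in> W" "x = p x \<oplus>\<^bsub>M\<^esub> w" and pu: "p x \<in> U" using pd[OF x] by metis
    have "r \<odot>\<^bsub>M\<^esub> x = r \<odot>\<^bsub>M\<^esub> (p x \<oplus>\<^bsub>M\<^esub> w)" using w by simp
    also have "\<dots> = r \<odot>\<^bsub>M\<^esub> p x \<oplus>\<^bsub>M\<^esub> r \<odot>\<^bsub>M\<^esub> w"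
      using w(1) pu uc wc r by (simp add: M.smult_r_distr)
    finally show "p (r \<odot>\<^bsub>M\<^esub> x) = r \<odot>\<^bsub>M\<^esub> p x"
      by (rule pI[of "r \<odot>\<^bsub>M\<^esub> p x" "r \<odot>\<^bsub>M\<^esub> w", OF sE(4)[OF U r pu] sE(4)[OF W(1) r w(1)]])
  qed
  show ?thesis
  proof (intro bexI[OF _ lin] conjI ballI exI[of _ W] W)
    show "p x \<in> U" if "x \<in> carrier M" for x using pd[OF that] by blast
    show "p x = x" if "x \<in> U" for x
      using pI[OF that submodule_zero[OF W(1)]] uc[OF that] by simp
    show "p x \<in> V" if "x \<in> V" for x
    proof -
      obtain u w where u: "u \<in> U \<inter> V" "w \<in> W0" "x = u \<oplus>\<^bsub>M\<^esub> w" using V0[OF \<open>x \<in> V\<close>] by (elim bexE)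
      then have "p x = u" using W(2) by (intro pI) auto
      then show ?thesis using u by simp
    qed
    show "x \<ominus>\<^bsub>M\<^esub> p x \<in> W" if "x \<in> carrier M" for x
    proof -
      obtain w where w: "w \<in> W" "x = p x \<oplus>\<^bsub>M\<^esub> w" "p x \<in> U" using pd[OF \<open>x \<in> carrier M\<close>] by blast
      have "x \<ominus>\<^bsub>M\<^esub> p x = (p x \<oplus>\<^bsub>M\<^esub> w) \<ominus>\<^bsub>M\<^esub> p x" using w by simp
      also have "\<dots> = w" using w(1,3) wc uc by (simp add: a_minus_def M.a_ac M.r_neg1 M.r_neg)
      finally show ?thesis using w by simp
    qed
  qed
qed

lemma submodule_image:
  assumes h: "h \<in> linear_maps K M N" and M: "module K M" and N: "module K N"
  shows "submodule (h ` carrier M) K N"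
proof -
  interpret M: module K M by fact
  interpret N: module K N by fact
  have hz: "h \<zero>\<^bsub>M\<^esub> = \<zero>\<^bsub>N\<^esub>" by (rule linear_zero[OF h M N])
  show ?thesis
  proof (rule N.submoduleI)
    show "h ` carrier M \<subseteq> carrier N" using linear_closed[OF h] by auto
    show "\<zero>\<^bsub>N\<^esub> \<in> h ` carrier M" using hz by (metis M.zero_closed imageI)
    show "\<ominus>\<^bsub>N\<^esub> a \<in> h ` carrier M" if "a \<in> h ` carrier M" for a
      using that linear_minus[OF h M N] by (auto simp: image_iff) (metis M.a_inv_closed)
    show "a \<oplus>\<^bsub>N\<^esub> b \<in> h ` carrier M" if "a \<in> h ` carrier M" "b \<in> h ` carrier M" for a b
      using that linear_add[OF h] by (auto simp: image_iff) (metis M.a_closed)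
    show "r \<odot>\<^bsub>N\<^esub> b \<in> h ` carrier M" if "r \<in> carrier K" "b \<in> h ` carrier M" for r b
      using that linear_smult[OF h] by (auto simp: image_iff) (metis M.smult_closed)
  qed
qed

text \<open>
  \<open>p\<close> is a projection onto the kernel of \<open>h\<close>, and \<open>q\<close> inverts \<open>h\<close> from its image to a complement of the
  kernel. An identity between linear maps survives tensoring with a space, which is how exactness
  of the tensor product is obtained from it.
\<close>
lemma exists_generalized_inverse:
  assumes K: "field K" and M: "module K M" and N: "module K N" and h: "h \<in> linear_maps K M N"
  shows "\<exists>p\<in>linear_maps K M M. \<exists>q\<in>linear_maps K N M. \<forall>x\<in>carrier M. h (p x) = \<zero>\<^bsub>N\<^esub> \<and> x = p x \<oplus>\<^bsub>M\<^esub> q (h x)"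
proof -
  interpret M: module K M by fact
  interpret N: module K N by fact
  have zN: "submodule {\<zero>\<^bsub>N\<^esub>} K N" by (rule N.submoduleI) auto
  let ?U = "{x \<in> carrier M. h x \<in> {\<zero>\<^bsub>N\<^esub>}}"
  have U: "submodule ?U K M" by (rule linear_submodule_vimage[OF h M zN N])
  have Y: "submodule (h ` carrier M) K N" by (rule submodule_image[OF h M N])
  obtain p W where p: "p \<in> linear_maps K M M" and pU: "\<forall>x\<in>carrier M. p x \<in> ?U"
    and W1: "submodule W K M" and W2: "\<forall>x\<in>carrier M. x \<ominus>\<^bsub>M\<^esub> p x \<in> W" and W3: "W \<inter> ?U \<subseteq> {\<zero>\<^bsub>M\<^esub>}"
    using exists_projection[OF K M U M.carrier_is_submodule] by (elim bexE conjE exE)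
  note p = p bspec[OF pU] and W = W1 bspec[OF W2] W3
  obtain e where e: "e \<in> linear_maps K N N" and e2: "\<forall>y\<in>carrier N. e y \<in> h ` carrier M" and e3: "\<forall>y\<in>h ` carrier M. e y = y"
    using exists_projection[OF K N Y N.carrier_is_submodule] by (elim bexE conjE)
  note e = e bspec[OF e2] bspec[OF e3]
  note eW = M.submoduleE[OF W(1)]
  have un: "w = w'" if "w \<in> W" "w' \<in> W" "h w = h w'" for w w'
  proof -
    have c: "w \<in> carrier M" "w' \<in> carrier M" using that eW(1) by auto
    have "h (w \<ominus>\<^bsub>M\<^esub> w') = \<zero>\<^bsub>N\<^esub>"
      using linear_diff[OF h M N c] that linear_closed[OF h] c by (simp add: a_minus_def N.r_neg)
    then have "w \<ominus>\<^bsub>M\<^esub> w' \<in> W \<inter> ?U" using that c M.submodule_minus_mem[OF W(1)] by simp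
    then have "w \<ominus>\<^bsub>M\<^esub> w' = \<zero>\<^bsub>M\<^esub>" using W(3) by blast
    then show ?thesis using c by (simp add: M.minus_eq_zero_iff)
  qed
  define q where "q = (\<lambda>y. THE w. w \<in> W \<and> h w = e y)"
  have qI: "q y = w" if "w \<in> W" "h w = e y" for w y
    unfolding q_def by (rule the_equality) (use that un in auto)
  have hW: "h (x \<ominus>\<^bsub>M\<^esub> p x) = h x" if x: "x \<in> carrier M" for x
    using linear_diff[OF h M N x linear_closed[OF p(1) x]] p(2)[OF x] linear_closed[OF h x] by (simp add: a_minus_def)
  have qd: "q y \<in> W \<and> h (q y) = e y" if y: "y \<in> carrier N" for y
  proof -
    obtain x where x: "x \<in> carrier M" "e y = h x" using e(2)[OF y] by blast
    have "q y = x \<ominus>\<^bsub>M\<^esub> p x" using qI[OF W(2)[OF x(1)]] hW x by simp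
    then show ?thesis using W(2)[OF x(1)] hW x by simp
  qed
  have q: "q \<in> linear_maps K N M"
  proof (rule linearI)
    show "q y \<in> carrier M" if "y \<in> carrier N" for y using qd[OF that] eW(1) by blast
    show "q (x \<oplus>\<^bsub>N\<^esub> y) = q x \<oplus>\<^bsub>M\<^esub> q y" if "x \<in> carrier N" "y \<in> carrier N" for x y
      using that qd[OF that(1)] qd[OF that(2)] eW(1,5)
      by (intro qI) (auto simp: linear_add[OF h] linear_add[OF e(1)] subset_iff)
    show "q (r \<odot>\<^bsub>N\<^esub> x) = r \<odot>\<^bsub>M\<^esub> q x" if "r \<in> carrier K" "x \<in> carrier N" for r x
      using that qd[OF that(2)] eW(1,4)
      by (intro qI) (auto simp: linear_smult[OF h] linear_smult[OF e(1)] subset_iff)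
  qed
  have "h (p x) = \<zero>\<^bsub>N\<^esub> \<and> x = p x \<oplus>\<^bsub>M\<^esub> q (h x)" if x: "x \<in> carrier M" for x
  proof -
    have "q (h x) = x \<ominus>\<^bsub>M\<^esub> p x"
      using hW[OF x] e(3)[of "h x"] x by (intro qI W(2)) auto
    moreover have "p x \<oplus>\<^bsub>M\<^esub> (x \<ominus>\<^bsub>M\<^esub> p x) = x"
      using x linear_closed[OF p(1) x] by (simp add: a_minus_def M.a_ac M.r_neg1 M.r_neg2 M.r_neg)
    ultimately show ?thesis using p(2)[OF x] by simp
  qed
  then show ?thesis using p(1) q by blast
qed

text \<open>Exactness of \<open>X \<otimes> -\<close> over a field, in the form: the kernel of \<open>id \<otimes> h\<close> is \<open>X \<otimes> ker h\<close>.\<close>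
lemma exists_kernel_projection:
  assumes K: "field K" and M: "module K M" and N: "module K N" and X: "module K X" and h: "h \<in> linear_maps K M N"
  shows "\<exists>p\<in>linear_maps K M M. (\<forall>x\<in>carrier M. h (p x) = \<zero>\<^bsub>N\<^esub>) \<and>
    (\<forall>t\<in>carrier (tensor_prod K X M). tensor_map K X N (\<lambda>x. x) h t = \<zero>\<^bsub>tensor_prod K X N\<^esub> \<longrightarrow>
       tensor_map K X M (\<lambda>x. x) p t = t)"
proof -
  obtain p q where p: "p\<in>linear_maps K M M" and q: "q\<in>linear_maps K N M"
    and pq: "\<And>x. x\<in>carrier M \<Longrightarrow> h (p x) = \<zero>\<^bsub>N\<^esub> \<and> x = p x \<oplus>\<^bsub>M\<^esub> q (h x)"
    using exists_generalized_inverse[OF K M N h] by blast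
  interpret XM: module K "tensor_prod K X M" by (rule module_tensor_prod[OF X M])
  note id = linear_id[where K = K and M = X]
  have l: "(\<lambda>t. tensor_map K X M (\<lambda>x. x) p t \<oplus>\<^bsub>tensor_prod K X M\<^esub> tensor_map K X M (\<lambda>x. x) q (tensor_map K X N (\<lambda>x. x) h t))
     \<in> linear_maps K (tensor_prod K X M) (tensor_prod K X M)"
    by (intro linear_sum XM.module_axioms linear_tensor_map_arg[OF X N X M id q] linear_tensor_map(1) X M N id p h)
  have dec: "tensor_map K X M (\<lambda>x. x) p t \<oplus>\<^bsub>tensor_prod K X M\<^esub> tensor_map K X M (\<lambda>x. x) q (tensor_map K X N (\<lambda>x. x) h t) = t"
    if t: "t \<in> carrier (tensor_prod K X M)" for t
  proof (rule linear_eq_on_tensors[OF X M XM.module_axioms l linear_id _ t])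
    fix x m assume x: "x \<in> carrier X" and m: "m \<in> carrier M"
    have "tensor_map K X M (\<lambda>x. x) p (pure_tensor K X M x m) \<oplus>\<^bsub>tensor_prod K X M\<^esub>
        tensor_map K X M (\<lambda>x. x) q (tensor_map K X N (\<lambda>x. x) h (pure_tensor K X M x m))
      = pure_tensor K X M x (p m) \<oplus>\<^bsub>tensor_prod K X M\<^esub> pure_tensor K X M x (q (h m))"
      using x m linear_closed[OF h m] by (simp add: tensor_map_pure[OF X M X M id p] tensor_map_pure[OF X M X N id h] tensor_map_pure[OF X N X M id q])
    also have "\<dots> = pure_tensor K X M x (p m \<oplus>\<^bsub>M\<^esub> q (h m))"
      using linear_add[OF bilinear_right[OF bilinear_pure[OF X M] x]] linear_closed[OF p m] linear_closed[OF q linear_closed[OF h m]] by simp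
    also have "\<dots> = pure_tensor K X M x m" using pq[OF m] by simp
    finally show "tensor_map K X M (\<lambda>x. x) p (pure_tensor K X M x m) \<oplus>\<^bsub>tensor_prod K X M\<^esub>
        tensor_map K X M (\<lambda>x. x) q (tensor_map K X N (\<lambda>x. x) h (pure_tensor K X M x m)) = pure_tensor K X M x m" .
  qed
  have "tensor_map K X M (\<lambda>x. x) p t = t"
    if t: "t \<in> carrier (tensor_prod K X M)" and z: "tensor_map K X N (\<lambda>x. x) h t = \<zero>\<^bsub>tensor_prod K X N\<^esub>" for t
  proof -
    have "tensor_map K X M (\<lambda>x. x) q \<zero>\<^bsub>tensor_prod K X N\<^esub> = \<zero>\<^bsub>tensor_prod K X M\<^esub>"
      by (rule linear_zero[OF linear_tensor_map(1)[OF X N X M id q]]) (simp_all add: X M N)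
    then show ?thesis
      using dec[OF t] z tensor_map_closed[OF X M X M id p t] by simp
  qed
  then show ?thesis using p pq by blast
qed

section \<open>Calculating with comultiplications\<close>

definition trilinear_map where
  "trilinear_map K L M N P \<phi> \<longleftrightarrow>
     (\<forall>m\<in>carrier M. \<forall>n\<in>carrier N. (\<lambda>l. \<phi> l m n) \<in> linear_maps K L P) \<and>
     (\<forall>l\<in>carrier L. \<forall>n\<in>carrier N. (\<lambda>m. \<phi> l m n) \<in> linear_maps K M P) \<and>
     (\<forall>l\<in>carrier L. \<forall>m\<in>carrier M. (\<lambda>n. \<phi> l m n) \<in> linear_maps K N P)"

lemma trilinearI [mlin]:
  "(\<And>m n. m \<in> carrier M \<Longrightarrow> n \<in> carrier N \<Longrightarrow> (\<lambda>l. \<phi> l m n) \<in> linear_maps K L P) \<Longrightarrow>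
   (\<And>l n. l \<in> carrier L \<Longrightarrow> n \<in> carrier N \<Longrightarrow> (\<lambda>m. \<phi> l m n) \<in> linear_maps K M P) \<Longrightarrow>
   (\<And>l m. l \<in> carrier L \<Longrightarrow> m \<in> carrier M \<Longrightarrow> (\<lambda>n. \<phi> l m n) \<in> linear_maps K N P) \<Longrightarrow>
   trilinear_map K L M N P \<phi>"
  by (simp add: trilinear_map_def)

lemma trilinearD:
  assumes "trilinear_map K L M N P \<phi>"
  shows "l \<in> carrier L \<Longrightarrow> bilinear_map K M N P (\<phi> l)"
    and "m \<in> carrier M \<Longrightarrow> bilinear_map K L N P (\<lambda>l. \<phi> l m)"
    and "n \<in> carrier N \<Longrightarrow> bilinear_map K L M P (\<lambda>l m. \<phi> l m n)"
  using assms by (simp_all add: trilinear_map_def bilinear_map_def)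

lemma tensor_assoc_tlift:
  "tensor_assoc K L M N = tlift (tensor_prod K L (tensor_prod K M N))
     (\<lambda>t n. tlift (tensor_prod K L (tensor_prod K M N))
        (\<lambda>l m. pure_tensor K L (tensor_prod K M N) l (pure_tensor K M N m n)) t)"
  by (simp add: fun_eq_iff tensor_assoc_def tlift_def tensor_lift_add_monoid Let_def)

lemma bilinear_tlift_left:
  assumes L: "module K L" and M: "module K M" and N: "module K N" and P: "module K P"
    and "trilinear_map K L M N P \<phi>"
  shows "bilinear_map K (tensor_prod K L M) N P (\<lambda>t n. tlift P (\<lambda>l m. \<phi> l m n) t)"
  using assms(5) trilinearD[OF assms(5)]
  by (intro bilinearI linear_lift_arg[OF L M P] linear_lift_param[OF L M P N] linear_id) (auto simp: trilinear_map_def)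

lemma bilinear_tlift_right:
  assumes L: "module K L" and M: "module K M" and N: "module K N" and P: "module K P"
    and "trilinear_map K L M N P \<phi>"
  shows "bilinear_map K L (tensor_prod K M N) P (\<lambda>l. tlift P (\<phi> l))"
  using assms(5) trilinearD[OF assms(5)]
  by (intro bilinearI linear_lift_arg[OF M N P] linear_lift_param[OF M N P L] linear_id) (auto simp: trilinear_map_def)

lemma trilinear_pure:
  assumes L: "module K L" and M: "module K M" and N: "module K N"
  shows "trilinear_map K L M N (tensor_prod K L (tensor_prod K M N))
        (\<lambda>l m n. pure_tensor K L (tensor_prod K M N) l (pure_tensor K M N m n))"
  by (intro mlin L M N; simp add: L M N)

lemma linear_assoc:
  assumes L: "module K L" and M: "module K M" and N: "module K N"
  shows "tensor_assoc K L M N \<in> linear_maps K (tensor_prod K (tensor_prod K L M) N) (tensor_prod K L (tensor_prod K M N))"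
  unfolding tensor_assoc_tlift
  using linear_lift(1)[OF module_tensor_prod[OF L M] N _ bilinear_tlift_left[OF L M N _ trilinear_pure[OF L M N]]] assms
  by simp

text \<open>
  Lets the associativity isomorphism disappear: a trilinear map has the same sum over both
  bracketings of a threefold tensor.
\<close>
lemma tlift_assoc:
  assumes L: "module K L" and M: "module K M" and N: "module K N" and P: "module K P"
    and \<phi>: "trilinear_map K L M N P \<phi>" and s: "s \<in> carrier (tensor_prod K (tensor_prod K L M) N)"
  shows "tlift P (\<lambda>l. tlift P (\<phi> l)) (tensor_assoc K L M N s) = tlift P (\<lambda>t n. tlift P (\<lambda>l m. \<phi> l m n) t) s"
proof -
  let ?T = "tensor_prod K L (tensor_prod K M N)"
  have MN: "module K (tensor_prod K M N)" and LM: "module K (tensor_prod K L M)" and T: "module K ?T"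
    using L M N by simp_all
  let ?\<tau> = "\<lambda>l m n. pure_tensor K L (tensor_prod K M N) l (pure_tensor K M N m n)"
  let ?\<Psi> = "tlift P (\<lambda>l. tlift P (\<phi> l))"
  note b = bilinear_tlift_right[OF L M N P \<phi>]
  have \<Psi>: "?\<Psi> \<in> linear_maps K ?T P" by (rule linear_lift(1)[OF L MN P b])
  note tri = trilinear_pure[OF L M N]
  note bT = bilinear_tlift_left[OF L M N T tri]
  have "?\<Psi> (tensor_assoc K L M N s) = tlift P (\<lambda>t n. ?\<Psi> (tlift ?T (\<lambda>l m. ?\<tau> l m n) t)) s"
    unfolding tensor_assoc_tlift by (rule linear_lift_lift[OF LM N T P bT \<Psi> s])
  also have "\<dots> = tlift P (\<lambda>t n. tlift P (\<lambda>l m. \<phi> l m n) t) s"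
  proof (rule lift_cong[OF LM N s, symmetric])
    fix t n assume t: "t \<in> carrier (tensor_prod K L M)" and n: "n \<in> carrier N"
    have "?\<Psi> (tlift ?T (\<lambda>l m. ?\<tau> l m n) t) = tlift P (\<lambda>l m. ?\<Psi> (?\<tau> l m n)) t"
      by (rule linear_lift_lift[OF L M T P trilinearD(3)[OF tri n] \<Psi> t])
    also have "\<dots> = tlift P (\<lambda>l m. \<phi> l m n) t"
    proof (rule lift_cong[OF L M t, symmetric])
      fix l m assume l: "l \<in> carrier L" and m: "m \<in> carrier M"
      show "\<phi> l m n = ?\<Psi> (?\<tau> l m n)"
        using lift_pure[OF L MN P b l pure_closed[OF M N m n, simplified]] lift_pure[OF M N P trilinearD(1)[OF \<phi> l] m n] by simp
    qed
    finally show "tlift P (\<lambda>l m. \<phi> l m n) t = ?\<Psi> (tlift ?T (\<lambda>l m. ?\<tau> l m n) t)" by simp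
  qed
  finally show ?thesis .
qed

text \<open>
  This and the next lemma express the two sides of the coassociativity law of a comodule, and of
  the equation that defines the cotensor product, by iterated sums.
\<close>
lemma assoc_coaction_tlift:
  assumes V: "module K V" and C: "module K C" and M: "module K M"
    and \<delta>: "\<delta> \<in> linear_maps K V (tensor_prod K V' C)" and V': "module K V'" and t: "t \<in> carrier (tensor_prod K V M)"
  shows "tensor_assoc K V' C M (tensor_map K (tensor_prod K V' C) M \<delta> (\<lambda>m. m) t) =
    tlift (tensor_prod K V' (tensor_prod K C M))
      (\<lambda>v m. tlift (tensor_prod K V' (tensor_prod K C M))
         (\<lambda>x c. pure_tensor K V' (tensor_prod K C M) x (pure_tensor K C M c m)) (\<delta> v)) t"
proof -
  have VC: "module K (tensor_prod K V' C)" and T: "module K (tensor_prod K V' (tensor_prod K C M))"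
    using V' C M by simp_all
  show ?thesis
    unfolding tensor_assoc_tlift
    by (rule lift_tensor_map[OF V M VC M T \<delta> linear_id bilinear_tlift_left[OF V' C M T trilinear_pure[OF V' C M]] t])
qed

lemma tensor_map_coaction_tlift:
  assumes V: "module K V" and C: "module K C" and M: "module K M" and M': "module K M'"
    and \<rho>: "\<rho> \<in> linear_maps K M (tensor_prod K C M')" and t: "t \<in> carrier (tensor_prod K V M)"
  shows "tensor_map K V (tensor_prod K C M') (\<lambda>v. v) \<rho> t =
    tlift (tensor_prod K V (tensor_prod K C M'))
      (\<lambda>v m. tlift (tensor_prod K V (tensor_prod K C M'))
         (\<lambda>c y. pure_tensor K V (tensor_prod K C M') v (pure_tensor K C M' c y)) (\<rho> m)) t"
proof -
  have CM: "module K (tensor_prod K C M')" and T: "module K (tensor_prod K V (tensor_prod K C M'))"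
    using V C M' by simp_all
  show ?thesis
    unfolding tensor_map_lift
  proof (rule lift_cong[OF V M t])
    fix v m assume v: "v \<in> carrier V" and m: "m \<in> carrier M"
    have \<rho>m: "\<rho> m \<in> carrier (tensor_prod K C M')" by (rule linear_closed[OF \<rho> m])
    have "tlift (tensor_prod K V (tensor_prod K C M')) (\<lambda>c y. pure_tensor K V (tensor_prod K C M') v (pure_tensor K C M' c y)) (\<rho> m)
       = pure_tensor K V (tensor_prod K C M') v (tlift (tensor_prod K C M') (pure_tensor K C M') (\<rho> m))"
      by (rule linear_lift_lift[OF C M' CM T bilinear_pure[OF C M'] bilinear_right[OF bilinear_pure[OF V CM] v] \<rho>m, symmetric])
    then show "pure_tensor K V (tensor_prod K C M') v (\<rho> m)
      = tlift (tensor_prod K V (tensor_prod K C M')) (\<lambda>c y. pure_tensor K V (tensor_prod K C M') v (pure_tensor K C M' c y)) (\<rho> m)"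
      using lift_pure_id[OF C M' \<rho>m] by simp
  qed
qed

lemma linear_smult_scalar [mlin]:
  assumes "module K P" "p \<in> carrier P"
    and "\<And>x. x \<in> carrier X \<Longrightarrow> e x \<in> carrier K"
    and "\<And>x y. x \<in> carrier X \<Longrightarrow> y \<in> carrier X \<Longrightarrow> e (x \<oplus>\<^bsub>X\<^esub> y) = e x \<oplus>\<^bsub>K\<^esub> e y"
    and "\<And>k x. k \<in> carrier K \<Longrightarrow> x \<in> carrier X \<Longrightarrow> e (k \<odot>\<^bsub>X\<^esub> x) = k \<otimes>\<^bsub>K\<^esub> e x"
  shows "(\<lambda>x. e x \<odot>\<^bsub>P\<^esub> p) \<in> linear_maps K X P"
proof -
  interpret P: module K P by fact
  show ?thesis using assms by (intro linearI) (simp_all add: P.smult_l_distr P.smult_assoc1)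
qed

context coalgebra
begin

declare counit_closed [simp, mlin]

lemma module_C [simp, mlin]: "module K C" by (rule module_axioms)

lemma comult_closed [simp, mlin]: "x \<in> carrier C \<Longrightarrow> comult C x \<in> carrier (tensor_prod K C C)"
  by (rule linear_closed[OF comult_linear])

lemmas linear_comult [mlin] = linear_comp[OF comult_linear]

lemma linear_counit_smult [mlin]:
  assumes P: "module K P" and p: "p \<in> carrier P" and f: "f \<in> linear_maps K X C"
  shows "(\<lambda>x. counit C (f x) \<odot>\<^bsub>P\<^esub> p) \<in> linear_maps K X P"
  by (rule linear_smult_scalar[OF P p])
    (simp_all add: linear_closed[OF f] linear_add[OF f] linear_smult[OF f] counit_closed counit_add counit_smult)

lemma bilinear_counit_left: "module K P \<Longrightarrow> f \<in> linear_maps K C P \<Longrightarrow> bilinear_map K C C P (\<lambda>y z. counit C y \<odot>\<^bsub>P\<^esub> f z)"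
  by (intro mlin) (simp_all add: counit_closed linear_closed)

lemma bilinear_counit_right: "module K P \<Longrightarrow> f \<in> linear_maps K C P \<Longrightarrow> bilinear_map K C C P (\<lambda>y z. counit C z \<odot>\<^bsub>P\<^esub> f y)"
  by (intro mlin) (simp_all add: counit_closed linear_closed)

lemma tlift_comult_closed [mlin]:
  assumes "module K P" "bilinear_map K C C P \<phi>" "x \<in> carrier C"
  shows "tlift P \<phi> (comult C x) \<in> carrier P"
  by (rule lift_closed[OF module_C module_C assms(1,2) comult_closed[OF assms(3)]])

lemma linear_tlift_comult [mlin]:
  assumes "module K P" "bilinear_map K C C P \<phi>" "f \<in> linear_maps K X C"
  shows "(\<lambda>x. tlift P \<phi> (comult C (f x))) \<in> linear_maps K X P"
  by (rule linear_lift_arg[OF module_C module_C assms(1,2) linear_comult[OF assms(3)]])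

lemma linear_tlift_comult_param [mlin]:
  assumes "module K P" "module K X" "x \<in> carrier C"
    and "\<And>m n. m \<in> carrier C \<Longrightarrow> n \<in> carrier C \<Longrightarrow> (\<lambda>y. \<phi> y m n) \<in> linear_maps K X P"
    and "\<And>y. y \<in> carrier X \<Longrightarrow> bilinear_map K C C P (\<phi> y)"
  shows "(\<lambda>y. tlift P (\<phi> y) (comult C x)) \<in> linear_maps K X P"
  by (rule linear_lift_param[OF module_C module_C assms(1,2,4,5) comult_closed[OF assms(3)]])

text \<open>
  \<open>\<Sum> \<phi> x\<^sub>1\<^sub>1 x\<^sub>1\<^sub>2 x\<^sub>2 = \<Sum> \<phi> x\<^sub>1 x\<^sub>2\<^sub>1 x\<^sub>2\<^sub>2\<close>: the rule by which all computations with three or more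
  Sweedler indices regroup their sums.
\<close>
lemma tlift_coassoc:
  assumes P: "module K P" and \<phi>: "trilinear_map K C C C P \<phi>" and x: "x \<in> carrier C"
  shows "tlift P (\<lambda>y z. tlift P (\<lambda>u v. \<phi> u v z) (comult C y)) (comult C x) = tlift P (\<lambda>y z. tlift P (\<phi> y) (comult C z)) (comult C x)"
proof -
  have CC: "module K (tensor_prod K C C)" by simp
  note id = linear_id[where K = K and M = C]
  let ?\<Psi> = "tlift P (\<lambda>l. tlift P (\<phi> l))"
  have 1: "?\<Psi> (tensor_map K C (tensor_prod K C C) (\<lambda>y. y) (comult C) (comult C x))
      = tlift P (\<lambda>y z. tlift P (\<phi> y) (comult C z)) (comult C x)"
    by (rule lift_tensor_map[OF module_C module_C module_C CC P id comult_linear bilinear_tlift_right[OF module_C module_C module_C P \<phi>] comult_closed[OF x]])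
  have "?\<Psi> (tensor_assoc K C C C (tensor_map K (tensor_prod K C C) C (comult C) (\<lambda>y. y) (comult C x)))
     = tlift P (\<lambda>t n. tlift P (\<lambda>l m. \<phi> l m n) t) (tensor_map K (tensor_prod K C C) C (comult C) (\<lambda>y. y) (comult C x))"
    by (rule tlift_assoc[OF module_C module_C module_C P \<phi> tensor_map_closed[OF module_C module_C CC module_C comult_linear id comult_closed[OF x], simplified]])
  also have "\<dots> = tlift P (\<lambda>y z. tlift P (\<lambda>u v. \<phi> u v z) (comult C y)) (comult C x)"
    by (rule lift_tensor_map[OF module_C module_C CC module_C P comult_linear id bilinear_tlift_left[OF module_C module_C module_C P \<phi>] comult_closed[OF x]])
  finally show ?thesis using 1 coassoc[OF x] by simp
qed

lemma tlift_counit_left: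
  assumes P: "module K P" and f: "f \<in> linear_maps K C P" and x: "x \<in> carrier C"
  shows "tlift P (\<lambda>y z. counit C y \<odot>\<^bsub>P\<^esub> f z) (comult C x) = f x"
proof -
  have b: "bilinear_map K C C C (\<lambda>y z. counit C y \<odot>\<^bsub>C\<^esub> z)" by (rule bilinear_counit_left[OF module_C linear_id])
  have "f (tlift C (\<lambda>y z. counit C y \<odot>\<^bsub>C\<^esub> z) (comult C x)) = tlift P (\<lambda>y z. f (counit C y \<odot>\<^bsub>C\<^esub> z)) (comult C x)"
    by (rule linear_lift_lift[OF module_C module_C module_C P b f comult_closed[OF x]])
  also have "\<dots> = tlift P (\<lambda>y z. counit C y \<odot>\<^bsub>P\<^esub> f z) (comult C x)"
    by (rule lift_cong[OF module_C module_C comult_closed[OF x], symmetric])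
      (simp add: linear_smult[OF f] counit_closed)
  finally show ?thesis using counit_left[OF x] by (simp add: tlift_def)
qed

lemma tlift_counit_right:
  assumes P: "module K P" and f: "f \<in> linear_maps K C P" and x: "x \<in> carrier C"
  shows "tlift P (\<lambda>y z. counit C z \<odot>\<^bsub>P\<^esub> f y) (comult C x) = f x"
proof -
  have b: "bilinear_map K C C C (\<lambda>y z. counit C z \<odot>\<^bsub>C\<^esub> y)" by (rule bilinear_counit_right[OF module_C linear_id])
  have "f (tlift C (\<lambda>y z. counit C z \<odot>\<^bsub>C\<^esub> y) (comult C x)) = tlift P (\<lambda>y z. f (counit C z \<odot>\<^bsub>C\<^esub> y)) (comult C x)"
    by (rule linear_lift_lift[OF module_C module_C module_C P b f comult_closed[OF x]])
  also have "\<dots> = tlift P (\<lambda>y z. counit C z \<odot>\<^bsub>P\<^esub> f y) (comult C x)"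
    by (rule lift_cong[OF module_C module_C comult_closed[OF x], symmetric])
      (simp add: linear_smult[OF f] counit_closed)
  finally show ?thesis using counit_right[OF x] by (simp add: tlift_def)
qed

end

lemma linear_mult_left:
  assumes "hopf_algebra K H" "f \<in> linear_maps K X H" "y \<in> carrier H"
  shows "(\<lambda>x. f x \<otimes>\<^bsub>H\<^esub> y) \<in> linear_maps K X H"
proof -
  interpret hopf_algebra K H by fact
  show ?thesis using assms by (intro linearI) (simp_all add: linear_closed linear_add linear_smult M.l_distr smult_mult_left)
qed

lemma linear_mult_right:
  assumes "hopf_algebra K H" "f \<in> linear_maps K X H" "y \<in> carrier H"
  shows "(\<lambda>x. y \<otimes>\<^bsub>H\<^esub> f x) \<in> linear_maps K X H"
proof -
  interpret hopf_algebra K H by fact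
  show ?thesis using assms by (intro linearI) (simp_all add: linear_closed linear_add linear_smult M.r_distr smult_mult_right)
qed

lemma mult_tensor_prod: "s \<otimes>\<^bsub>tensor_prod K M N\<^esub> t =
  tlift (tensor_prod K M N) (\<lambda>a b. tlift (tensor_prod K M N) (\<lambda>c d. pure_tensor K M N (a \<otimes>\<^bsub>M\<^esub> c) (b \<otimes>\<^bsub>N\<^esub> d)) t) s"
  unfolding tlift_def tensor_lift_add_monoid by (simp add: tensor_prod_def del: carrier_tensor_group)

lemma one_tensor_prod: "one (tensor_prod K M N) = pure_tensor K M N \<one>\<^bsub>M\<^esub> \<one>\<^bsub>N\<^esub>"
  by (simp add: tensor_prod_def del: carrier_tensor_group)

context hopf_algebra
begin

lemmas linear_mult [mlin] = linear_mult_left[OF hopf_algebra_axioms] linear_mult_right[OF hopf_algebra_axioms]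
lemmas linear_antipode [mlin] = linear_comp[OF antipode_linear]
lemmas antipode_closed [simp, mlin] = linear_closed[OF antipode_linear]
declare M.m_closed [mlin]

lemma tlift_antipode_left:
  assumes P: "module K P" and f: "f \<in> linear_maps K H P" and x: "x \<in> carrier H"
  shows "tlift P (\<lambda>y z. f (antipode H y \<otimes>\<^bsub>H\<^esub> z)) (comult H x) = counit H x \<odot>\<^bsub>P\<^esub> f \<one>\<^bsub>H\<^esub>"
proof -
  have b: "bilinear_map K H H H (\<lambda>y z. antipode H y \<otimes>\<^bsub>H\<^esub> z)" by (intro mlin; simp)
  have "f (tlift H (\<lambda>y z. antipode H y \<otimes>\<^bsub>H\<^esub> z) (comult H x)) = tlift P (\<lambda>y z. f (antipode H y \<otimes>\<^bsub>H\<^esub> z)) (comult H x)"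
    by (rule linear_lift_lift[OF module_C module_C module_C P b f comult_closed[OF x]])
  then show ?thesis using antipode_left[OF x] by (simp add: tlift_def linear_smult[OF f] counit_closed x)
qed

lemma tlift_antipode_right:
  assumes P: "module K P" and f: "f \<in> linear_maps K H P" and x: "x \<in> carrier H"
  shows "tlift P (\<lambda>y z. f (y \<otimes>\<^bsub>H\<^esub> antipode H z)) (comult H x) = counit H x \<odot>\<^bsub>P\<^esub> f \<one>\<^bsub>H\<^esub>"
proof -
  have b: "bilinear_map K H H H (\<lambda>y z. y \<otimes>\<^bsub>H\<^esub> antipode H z)" by (intro mlin; simp)
  have "f (tlift H (\<lambda>y z. y \<otimes>\<^bsub>H\<^esub> antipode H z) (comult H x)) = tlift P (\<lambda>y z. f (y \<otimes>\<^bsub>H\<^esub> antipode H z)) (comult H x)"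
    by (rule linear_lift_lift[OF module_C module_C module_C P b f comult_closed[OF x]])
  then show ?thesis using antipode_right[OF x] by (simp add: tlift_def linear_smult[OF f] counit_closed x)
qed

lemma tlift_comult_one:
  assumes P: "module K P" and b: "bilinear_map K H H P \<phi>"
  shows "tlift P \<phi> (comult H \<one>\<^bsub>H\<^esub>) = \<phi> \<one>\<^bsub>H\<^esub> \<one>\<^bsub>H\<^esub>"
  using lift_pure[OF module_C module_C P b M.one_closed M.one_closed] ring_hom_one[OF comult_ring_hom]
  by (simp add: one_tensor_prod)

lemma bilinear_pure_mult:
  "bilinear_map K H H (tensor_prod K H H) (\<lambda>a b. tlift (tensor_prod K H H) (\<lambda>c d. pure_tensor K H H (a \<otimes>\<^bsub>H\<^esub> c) (b \<otimes>\<^bsub>H\<^esub> d)) t)"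
  if "t \<in> carrier (tensor_prod K H H)"
  using that by (intro mlin linear_lift_param[OF module_C module_C]; simp)

lemma tlift_mult:
  assumes P: "module K P" and b: "bilinear_map K H H P \<phi>" and s: "s \<in> carrier (tensor_prod K H H)" and t: "t \<in> carrier (tensor_prod K H H)"
  shows "tlift P \<phi> (s \<otimes>\<^bsub>tensor_prod K H H\<^esub> t) = tlift P (\<lambda>a b. tlift P (\<lambda>c d. \<phi> (a \<otimes>\<^bsub>H\<^esub> c) (b \<otimes>\<^bsub>H\<^esub> d)) t) s"
proof -
  let ?T = "tensor_prod K H H"
  have T: "module K ?T" by simp
  note C = module_C
  have l: "tlift P \<phi> \<in> linear_maps K ?T P" by (rule linear_lift(1)[OF C C P b])
  have inner: "tlift P \<phi> (tlift ?T (\<lambda>c d. pure_tensor K H H (a \<otimes>\<^bsub>H\<^esub> c) (b \<otimes>\<^bsub>H\<^esub> d)) t) = tlift P (\<lambda>c d. \<phi> (a \<otimes>\<^bsub>H\<^esub> c) (b \<otimes>\<^bsub>H\<^esub> d)) t"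
    if ab: "a \<in> carrier H" "b \<in> carrier H" for a b
  proof -
    have 1: "bilinear_map K H H ?T (\<lambda>c d. pure_tensor K H H (a \<otimes>\<^bsub>H\<^esub> c) (b \<otimes>\<^bsub>H\<^esub> d))"
      using ab by (intro mlin; simp)
    show ?thesis
      using ab by (subst linear_lift_lift[OF C C T P 1 l t]) (intro lift_cong[OF C C t, symmetric], simp add: lift_pure[OF C C P b])
  qed
  show ?thesis
    unfolding mult_tensor_prod
    by (subst linear_lift_lift[OF C C T P bilinear_pure_mult[OF t] l s], rule lift_cong[OF C C s, symmetric]) (simp add: inner)
qed

lemma tlift_comult_mult:
  assumes "module K P" "bilinear_map K H H P \<phi>" "x \<in> carrier H" "y \<in> carrier H"
  shows "tlift P \<phi> (comult H (x \<otimes>\<^bsub>H\<^esub> y)) = tlift P (\<lambda>a b. tlift P (\<lambda>c d. \<phi> (a \<otimes>\<^bsub>H\<^esub> c) (b \<otimes>\<^bsub>H\<^esub> d)) (comult H y)) (comult H x)"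
  using tlift_mult[OF assms(1,2) comult_closed[OF assms(3)] comult_closed[OF assms(4)]] ring_hom_mult[OF comult_ring_hom assms(3,4)] by simp

end

section \<open>Images of subspaces in tensor products\<close>

lemma subgroup_monoid_cong:
  assumes "carrier G = carrier G'" "mult G = mult G'" "one G = one G'"
  shows "subgroup W G = subgroup W G'"
  using assms by (simp add: subgroup_def m_inv_def)

lemma subgroup_tensor_prod: "subgroup W (add_monoid (tensor_prod K M N)) = subgroup W (tensor_group K M N)"
  by (rule subgroup_monoid_cong) (simp_all add: tensor_prod_def del: carrier_tensor_group)

lemma (in group_hom) subgroup_vimage:
  assumes "subgroup W H" shows "subgroup {x \<in> carrier G. h x \<in> W} G"
  using subgroup.one_closed[OF assms] subgroup.m_inv_closed[OF assms] subgroup.m_closed[OF assms]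
  by (intro G.subgroupI) auto

lemma subset_linear_span: "S \<subseteq> linear_span K M S"
  by (auto simp: linear_span_def)

lemma linear_span_least: "submodule W K M \<Longrightarrow> S \<subseteq> W \<Longrightarrow> linear_span K M S \<subseteq> W"
  by (auto simp: linear_span_def)

lemma submodule_linear_span:
  assumes M: "module K M" and S: "S \<subseteq> carrier M" shows "submodule (linear_span K M S) K M"
proof -
  interpret M: module K M by fact
  note E = M.submoduleE
  have "linear_span K M S \<subseteq> carrier M" by (rule linear_span_least[OF M.carrier_is_submodule S])
  then show ?thesis
    by (intro M.submoduleI) (auto simp: linear_span_def submodule_zero intro: E(3-5))
qed

lemma submodule_Int: "module K M \<Longrightarrow> submodule U K M \<Longrightarrow> submodule V K M \<Longrightarrow> submodule (U \<inter> V) K M"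
  using module.submoduleE[of K M U] module.submoduleE[of K M V] submodule_zero[of U K M] submodule_zero[of V K M]
  by (intro module.submoduleI) auto

lemma submodule_set_add:
  assumes M: "module K M" and U: "submodule U K M" and V: "submodule V K M"
  shows "submodule (U <+>\<^bsub>M\<^esub> V) K M"
proof -
  interpret M: module K M by fact
  note eU = M.submoduleE[OF U] and eV = M.submoduleE[OF V]
  have mem: "x \<in> U <+>\<^bsub>M\<^esub> V \<longleftrightarrow> (\<exists>u\<in>U. \<exists>v\<in>V. x = u \<oplus>\<^bsub>M\<^esub> v)" for x by (auto simp: set_add_def set_mult_def)
  have uc: "\<And>u. u \<in> U \<Longrightarrow> u \<in> carrier M" and vc: "\<And>v. v \<in> V \<Longrightarrow> v \<in> carrier M" using eU(1) eV(1) by auto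
  have I: "u \<in> U \<Longrightarrow> v \<in> V \<Longrightarrow> x = u \<oplus>\<^bsub>M\<^esub> v \<Longrightarrow> x \<in> U <+>\<^bsub>M\<^esub> V" for u v x using mem by blast
  show ?thesis
  proof (rule M.submoduleI)
    show "U <+>\<^bsub>M\<^esub> V \<subseteq> carrier M" using mem uc vc by auto
    show "\<zero>\<^bsub>M\<^esub> \<in> U <+>\<^bsub>M\<^esub> V" by (rule I[OF submodule_zero[OF U] submodule_zero[OF V]]) simp
  next
    fix a assume "a \<in> U <+>\<^bsub>M\<^esub> V"
    then obtain u v where a: "u \<in> U" "v \<in> V" "a = u \<oplus>\<^bsub>M\<^esub> v" using mem by blast
    show "\<ominus>\<^bsub>M\<^esub> a \<in> U <+>\<^bsub>M\<^esub> V" by (rule I[OF eU(3)[OF a(1)] eV(3)[OF a(2)]]) (simp add: a uc vc M.minus_add)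
    show "r \<odot>\<^bsub>M\<^esub> a \<in> U <+>\<^bsub>M\<^esub> V" if r: "r \<in> carrier K" for r
      by (rule I[OF eU(4)[OF r a(1)] eV(4)[OF r a(2)]]) (simp add: a uc vc M.smult_r_distr r)
    fix b assume "b \<in> U <+>\<^bsub>M\<^esub> V"
    then obtain u' v' where b: "u' \<in> U" "v' \<in> V" "b = u' \<oplus>\<^bsub>M\<^esub> v'" using mem by blast
    show "a \<oplus>\<^bsub>M\<^esub> b \<in> U <+>\<^bsub>M\<^esub> V"
      by (rule I[OF eU(5)[OF a(1) b(1)] eV(5)[OF a(2) b(2)]]) (simp add: a b uc vc M.a_ac)
  qed
qed

lemma subset_set_add:
  assumes M: "module K M" and U: "submodule U K M" and V: "submodule V K M"
  shows "U \<subseteq> U <+>\<^bsub>M\<^esub> V" "V \<subseteq> U <+>\<^bsub>M\<^esub> V"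
proof -
  interpret M: module K M by fact
  note eU = M.submoduleE[OF U] and eV = M.submoduleE[OF V]
  have mem: "x \<in> U <+>\<^bsub>M\<^esub> V \<longleftrightarrow> (\<exists>u\<in>U. \<exists>v\<in>V. x = u \<oplus>\<^bsub>M\<^esub> v)" for x by (auto simp: set_add_def set_mult_def)
  show "U \<subseteq> U <+>\<^bsub>M\<^esub> V"
  proof
    fix u assume u: "u \<in> U"
    then have "u = u \<oplus>\<^bsub>M\<^esub> \<zero>\<^bsub>M\<^esub>" using eU(1) by auto
    then show "u \<in> U <+>\<^bsub>M\<^esub> V" using u submodule_zero[OF V] mem by blast
  qed
  show "V \<subseteq> U <+>\<^bsub>M\<^esub> V"
  proof
    fix v assume v: "v \<in> V"
    then have "v = \<zero>\<^bsub>M\<^esub> \<oplus>\<^bsub>M\<^esub> v" using eV(1) by auto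
    then show "v \<in> U <+>\<^bsub>M\<^esub> V" using v submodule_zero[OF U] mem by blast
  qed
qed

context
  fixes K M N U V
  assumes M: "module K M" and N: "module K N" and UM: "U \<subseteq> carrier M" and VN: "V \<subseteq> carrier N"
begin

lemma sub_tensor_least:
  assumes W: "submodule W K (tensor_prod K M N)" and uv: "\<And>u v. u \<in> U \<Longrightarrow> v \<in> V \<Longrightarrow> pure_tensor K M N u v \<in> W"
  shows "sub_tensor K M N U V \<subseteq> W"
proof -
  interpret tp: tensor_pair K M N by (rule tensor_pairI[OF M N])
  have "subgroup W (tensor_group K M N)"
    using submodule.axioms(1)[OF W] by (simp only: subgroup_tensor_prod)
  then show ?thesis
    unfolding sub_tensor_def using uv by (intro group.generate_subgroup_incl[OF tp.group_T]) auto
qed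

lemma pure_in_sub_tensor: "u \<in> U \<Longrightarrow> v \<in> V \<Longrightarrow> pure_tensor K M N u v \<in> sub_tensor K M N U V"
  unfolding sub_tensor_def by (intro generate.incl) blast

lemma submodule_sub_tensor:
  assumes sc: "\<And>k u. k \<in> carrier K \<Longrightarrow> u \<in> U \<Longrightarrow> k \<odot>\<^bsub>M\<^esub> u \<in> U"
  shows "submodule (sub_tensor K M N U V) K (tensor_prod K M N)"
proof -
  interpret tp: tensor_pair K M N by (rule tensor_pairI[OF M N])
  interpret MN: module K "tensor_prod K M N" by (rule module_tensor_prod[OF M N])
  let ?X = "{pure_tensor K M N u v |u v. u \<in> U \<and> v \<in> V}"
  have X: "?X \<subseteq> carrier (tensor_group K M N)"
    using UM VN by (auto intro!: pure_closed[OF M N, simplified])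
  have sg: "subgroup (sub_tensor K M N U V) (add_monoid (tensor_prod K M N))"
    unfolding subgroup_tensor_prod sub_tensor_def by (rule group.generate_is_subgroup[OF tp.group_T X])
  show ?thesis
  proof (intro submodule.intro sg submodule_axioms.intro)
    fix k x assume k: "k \<in> carrier K" and x: "x \<in> sub_tensor K M N U V"
    have l: "(\<lambda>t. k \<odot>\<^bsub>tensor_prod K M N\<^esub> t) \<in> linear_maps K (tensor_prod K M N) (tensor_prod K M N)"
      by (rule linear_smult_left[OF module_tensor_prod[OF M N] linear_id k])
    have h: "group_hom (add_monoid (tensor_prod K M N)) (add_monoid (tensor_prod K M N)) (\<lambda>t. k \<odot>\<^bsub>tensor_prod K M N\<^esub> t)"
      using l MN.a_group by (auto simp: group_hom_def group_hom_axioms_def hom_def linear_maps_def)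
    have "subgroup {t \<in> carrier (add_monoid (tensor_prod K M N)). k \<odot>\<^bsub>tensor_prod K M N\<^esub> t \<in> sub_tensor K M N U V} (add_monoid (tensor_prod K M N))"
      by (rule group_hom.subgroup_vimage[OF h sg])
    then have "subgroup {t \<in> carrier (tensor_prod K M N). k \<odot>\<^bsub>tensor_prod K M N\<^esub> t \<in> sub_tensor K M N U V} (tensor_group K M N)"
      unfolding subgroup_tensor_prod by simp
    then have "generate (tensor_group K M N) ?X \<subseteq> {t \<in> carrier (tensor_prod K M N). k \<odot>\<^bsub>tensor_prod K M N\<^esub> t \<in> sub_tensor K M N U V}"
      using X UM VN by (intro group.generate_subgroup_incl[OF tp.group_T])
        (auto simp: smult_pure[OF M N k] subset_iff intro!: pure_in_sub_tensor sc k)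
    then show "k \<odot>\<^bsub>tensor_prod K M N\<^esub> x \<in> sub_tensor K M N U V" using x by (auto simp: sub_tensor_def)
  qed
qed

lemma tlift_sub_tensor_mem:
  assumes P: "module K P" and b: "bilinear_map K M N P \<phi>" and W: "submodule W K P"
    and uv: "\<And>u v. u \<in> U \<Longrightarrow> v \<in> V \<Longrightarrow> \<phi> u v \<in> W" and t: "t \<in> sub_tensor K M N U V"
  shows "tlift P \<phi> t \<in> W"
proof -
  have "sub_tensor K M N U V \<subseteq> {t \<in> carrier (tensor_prod K M N). tlift P \<phi> t \<in> W}"
    by (intro sub_tensor_least linear_submodule_vimage[OF linear_lift(1)[OF M N P b]] module_tensor_prod M N W P)
      (use UM VN uv in \<open>auto simp: lift_pure[OF M N P b] subset_iff intro!: pure_closed[OF M N, simplified]\<close>)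
  then show ?thesis using t by auto
qed

lemma linear_eq_on_sub_tensor:
  assumes P: "module K P" and f: "f \<in> linear_maps K (tensor_prod K M N) P" and g: "g \<in> linear_maps K (tensor_prod K M N) P"
    and e: "\<And>u v. u \<in> U \<Longrightarrow> v \<in> V \<Longrightarrow> f (pure_tensor K M N u v) = g (pure_tensor K M N u v)"
    and t: "t \<in> sub_tensor K M N U V"
  shows "f t = g t"
proof -
  interpret MN: module K "tensor_prod K M N" by (rule module_tensor_prod[OF M N])
  interpret P: module K P by fact
  have "submodule {t \<in> carrier (tensor_prod K M N). f t = g t} K (tensor_prod K M N)"
    using linear_zero[OF f MN.module_axioms P] linear_zero[OF g MN.module_axioms P]
    by (intro MN.submoduleI) (auto simp: linear_add[OF f] linear_add[OF g] linear_smult[OF f] linear_smult[OF g]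
        linear_minus[OF f MN.module_axioms P] linear_minus[OF g MN.module_axioms P])
  then have "sub_tensor K M N U V \<subseteq> {t \<in> carrier (tensor_prod K M N). f t = g t}"
    by (rule sub_tensor_least) (use UM VN e in \<open>auto intro!: pure_closed[OF M N, simplified]\<close>)
  then show ?thesis using t by auto
qed

end

lemma tensor_map_mem_sub_tensor:
  assumes M: "module K M" and N: "module K N" and M': "module K M'" and N': "module K N'"
    and f: "f \<in> linear_maps K M M'" and g: "g \<in> linear_maps K N N'"
    and UM: "U \<subseteq> carrier M" "V \<subseteq> carrier N"
    and UM': "submodule U' K M'" "V' \<subseteq> carrier N'"
    and uv: "\<And>u. u \<in> U \<Longrightarrow> f u \<in> U'" "\<And>v. v \<in> V \<Longrightarrow> g v \<in> V'" and t: "t \<in> sub_tensor K M N U V"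
  shows "tensor_map K M' N' f g t \<in> sub_tensor K M' N' U' V'"
  unfolding tensor_map_lift
  by (rule tlift_sub_tensor_mem[OF M N UM module_tensor_prod[OF M' N'] bilinear_tensor_map[OF M' N' f g] submodule_sub_tensor _ t])
   (use M' N' UM' module.submoduleE[OF M' UM'(1)] uv in \<open>auto intro!: pure_in_sub_tensor\<close>)

lemma tensor_map_sub_tensor_id:
  assumes M: "module K M" and N: "module K N"
    and f: "f \<in> linear_maps K M M" and g: "g \<in> linear_maps K N N"
    and UM: "U \<subseteq> carrier M" "V \<subseteq> carrier N"
    and uv: "\<And>u. u \<in> U \<Longrightarrow> f u = u" "\<And>v. v \<in> V \<Longrightarrow> g v = v" and t: "t \<in> sub_tensor K M N U V"
  shows "tensor_map K M N f g t = t"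
  by (rule linear_eq_on_sub_tensor[OF M N UM module_tensor_prod[OF M N] linear_tensor_map(1)[OF M N M N f g] linear_id _ t])
    (use UM uv in \<open>simp add: tensor_map_pure[OF M N M N f g] subset_iff\<close>)

text \<open>
  Let \<open>p\<close> be a projection onto \<open>U\<close> that maps \<open>V\<close> into itself. Then \<open>p \<otimes> p\<close> fixes \<open>t\<close>, as \<open>t\<close> comes
  from \<open>U \<otimes> U\<close>, and maps it into the image of \<open>(U \<inter> V) \<otimes> (U \<inter> V)\<close>, as \<open>t\<close> comes from \<open>V \<otimes> V\<close>.
\<close>
lemma sub_tensor_Int:
  assumes K: "field K" and M: "module K M" and U: "submodule U K M" and V: "submodule V K M"
    and tU: "t \<in> sub_tensor K M M U U" and tV: "t \<in> sub_tensor K M M V V"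
  shows "t \<in> sub_tensor K M M (U \<inter> V) (U \<inter> V)"
proof -
  obtain p where p: "p\<in>linear_maps K M M" and pU: "\<forall>x\<in>carrier M. p x \<in> U" and pi: "\<forall>x\<in>U. p x = x" and pV: "\<forall>x\<in>V. p x \<in> V"
    using exists_projection[OF K M U V] by (elim bexE conjE)
  note eU = module.submoduleE(1)[OF M U] and eV = module.submoduleE(1)[OF M V]
  have "tensor_map K M M p p t = t"
    by (rule tensor_map_sub_tensor_id[OF M M p p eU eU _ _ tU]) (use pi in auto)
  moreover have "tensor_map K M M p p t \<in> sub_tensor K M M (U \<inter> V) (U \<inter> V)"
    by (rule tensor_map_mem_sub_tensor[OF M M M M p p eV eV submodule_Int[OF M U V] _ _ _ tV]) (use pU pV eV eU in auto)
  ultimately show ?thesis by simp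
qed

section \<open>The antipode\<close>

context hopf_algebra
begin

lemma counit_one [simp]: "counit H \<one>\<^bsub>H\<^esub> = \<one>\<^bsub>K\<^esub>" by (rule ring_hom_one[OF counit_ring_hom])

lemma counit_mult [simp]: "x \<in> carrier H \<Longrightarrow> y \<in> carrier H \<Longrightarrow> counit H (x \<otimes>\<^bsub>H\<^esub> y) = counit H x \<otimes>\<^bsub>K\<^esub> counit H y"
  by (rule ring_hom_mult[OF counit_ring_hom])

text \<open>
  Both sides are convolution inverse to the multiplication. Concretely, the sum of
  \<open>S(x\<^sub>1 y\<^sub>1) x\<^sub>2 y\<^sub>2 S(y\<^sub>3) S(x\<^sub>3)\<close> is \<open>S(x y)\<close> when the factors with indices 2 and 3 are
  cancelled, and \<open>S(y) S(x)\<close> when those with indices 1 and 2 are.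
\<close>
lemma antipode_mult:
  assumes x: "x \<in> carrier H" and y: "y \<in> carrier H"
  shows "antipode H (x \<otimes>\<^bsub>H\<^esub> y) = antipode H y \<otimes>\<^bsub>H\<^esub> antipode H x"
proof -
  note C = module_C
  let ?S = "antipode H" and ?D = "comult H"
  let ?G = "\<lambda>x1 y1 x2 y2 y3 x3. ?S (x1 \<otimes>\<^bsub>H\<^esub> y1) \<otimes>\<^bsub>H\<^esub> (x2 \<otimes>\<^bsub>H\<^esub> y2) \<otimes>\<^bsub>H\<^esub> (?S y3 \<otimes>\<^bsub>H\<^esub> ?S x3)"
  let ?R = "\<lambda>x1 x2 x3. tlift H (\<lambda>y1 s. tlift H (\<lambda>y2 y3. ?G x1 y1 x2 y2 y3 x3) (?D s)) (?D y)"
  \<comment> \<open>cancel \<open>y\<^sub>2 S(y\<^sub>3)\<close>, and below \<open>x\<^sub>2 S(x\<^sub>3)\<close>\<close>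
  have R: "?R x1 x2 x3 = ?S (x1 \<otimes>\<^bsub>H\<^esub> y) \<otimes>\<^bsub>H\<^esub> (x2 \<otimes>\<^bsub>H\<^esub> ?S x3)"
    if c: "x1 \<in> carrier H" "x2 \<in> carrier H" "x3 \<in> carrier H" for x1 x2 x3
  proof -
    have "?R x1 x2 x3 = tlift H (\<lambda>y1 s. counit H s \<odot>\<^bsub>H\<^esub> (?S (x1 \<otimes>\<^bsub>H\<^esub> y1) \<otimes>\<^bsub>H\<^esub> (x2 \<otimes>\<^bsub>H\<^esub> ?S x3))) (?D y)"
    proof (rule lift_cong[OF C C comult_closed[OF y]])
      fix y1 s assume c': "y1 \<in> carrier H" "s \<in> carrier H"
      have "tlift H (\<lambda>y2 y3. ?G x1 y1 x2 y2 y3 x3) (?D s)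
        = tlift H (\<lambda>y2 y3. ?S (x1 \<otimes>\<^bsub>H\<^esub> y1) \<otimes>\<^bsub>H\<^esub> (x2 \<otimes>\<^bsub>H\<^esub> ((y2 \<otimes>\<^bsub>H\<^esub> ?S y3) \<otimes>\<^bsub>H\<^esub> ?S x3))) (?D s)"
        by (rule lift_cong[OF C C comult_closed[OF c'(2)]]) (use c c' in \<open>simp add: M.m_assoc\<close>)
      also have "\<dots> = counit H s \<odot>\<^bsub>H\<^esub> (?S (x1 \<otimes>\<^bsub>H\<^esub> y1) \<otimes>\<^bsub>H\<^esub> (x2 \<otimes>\<^bsub>H\<^esub> (\<one>\<^bsub>H\<^esub> \<otimes>\<^bsub>H\<^esub> ?S x3)))"
        by (rule tlift_antipode_right[OF C _ c'(2), where f = "\<lambda>z. ?S (x1 \<otimes>\<^bsub>H\<^esub> y1) \<otimes>\<^bsub>H\<^esub> (x2 \<otimes>\<^bsub>H\<^esub> (z \<otimes>\<^bsub>H\<^esub> ?S x3))"])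
          (use c c' in \<open>intro mlin; simp\<close>)
      finally show "tlift H (\<lambda>y2 y3. ?G x1 y1 x2 y2 y3 x3) (?D s) = counit H s \<odot>\<^bsub>H\<^esub> (?S (x1 \<otimes>\<^bsub>H\<^esub> y1) \<otimes>\<^bsub>H\<^esub> (x2 \<otimes>\<^bsub>H\<^esub> ?S x3))"
        using c by simp
    qed
    also have "\<dots> = ?S (x1 \<otimes>\<^bsub>H\<^esub> y) \<otimes>\<^bsub>H\<^esub> (x2 \<otimes>\<^bsub>H\<^esub> ?S x3)"
      by (rule tlift_counit_right[OF C _ y]) (use c in \<open>intro mlin; simp\<close>)
    finally show ?thesis .
  qed
  have "tlift H (\<lambda>x1 r. tlift H (\<lambda>x2 x3. ?R x1 x2 x3) (?D r)) (?D x)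
     = tlift H (\<lambda>x1 r. counit H r \<odot>\<^bsub>H\<^esub> (?S (x1 \<otimes>\<^bsub>H\<^esub> y) \<otimes>\<^bsub>H\<^esub> \<one>\<^bsub>H\<^esub>)) (?D x)"
  proof (rule lift_cong[OF C C comult_closed[OF x]])
    fix x1 r assume c: "x1 \<in> carrier H" "r \<in> carrier H"
    have "tlift H (\<lambda>x2 x3. ?R x1 x2 x3) (?D r) = tlift H (\<lambda>x2 x3. ?S (x1 \<otimes>\<^bsub>H\<^esub> y) \<otimes>\<^bsub>H\<^esub> (x2 \<otimes>\<^bsub>H\<^esub> ?S x3)) (?D r)"
      by (rule lift_cong[OF C C comult_closed[OF c(2)]]) (use c R in simp)
    also have "\<dots> = counit H r \<odot>\<^bsub>H\<^esub> (?S (x1 \<otimes>\<^bsub>H\<^esub> y) \<otimes>\<^bsub>H\<^esub> \<one>\<^bsub>H\<^esub>)"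
      by (rule tlift_antipode_right[OF C _ c(2)]) (use c y in \<open>intro mlin; simp\<close>)
    finally show "tlift H (\<lambda>x2 x3. ?R x1 x2 x3) (?D r) = counit H r \<odot>\<^bsub>H\<^esub> (?S (x1 \<otimes>\<^bsub>H\<^esub> y) \<otimes>\<^bsub>H\<^esub> \<one>\<^bsub>H\<^esub>)" .
  qed
  also have "\<dots> = ?S (x \<otimes>\<^bsub>H\<^esub> y) \<otimes>\<^bsub>H\<^esub> \<one>\<^bsub>H\<^esub>"
    by (rule tlift_counit_right[OF C _ x]) (use y in \<open>intro mlin; simp\<close>)
  finally have 1: "tlift H (\<lambda>x1 r. tlift H (\<lambda>x2 x3. ?R x1 x2 x3) (?D r)) (?D x) = ?S (x \<otimes>\<^bsub>H\<^esub> y)"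
    using x y by simp
  \<comment> \<open>the other grouping: \<open>S(x\<^sub>1 y\<^sub>1) x\<^sub>2 y\<^sub>2 = \<epsilon>(x y)\<close>\<close>
  let ?L = "\<lambda>x' x3. tlift H (\<lambda>x1 x2. ?R x1 x2 x3) (?D x')"
  have 2: "tlift H ?L (?D x) = tlift H (\<lambda>x1 r. tlift H (\<lambda>x2 x3. ?R x1 x2 x3) (?D r)) (?D x)"
    by (rule tlift_coassoc[OF C _ x]) (use y in \<open>intro mlin; simp\<close>)
  have L: "?L x' x3 = counit H x' \<odot>\<^bsub>H\<^esub> (?S y \<otimes>\<^bsub>H\<^esub> ?S x3)" if c: "x' \<in> carrier H" "x3 \<in> carrier H" for x' x3
  proof -
    have "?L x' x3 = tlift H (\<lambda>x1 x2. tlift H (\<lambda>y' y3. tlift H (\<lambda>y1 y2. ?G x1 y1 x2 y2 y3 x3) (?D y')) (?D y)) (?D x')"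
    proof (rule lift_cong[OF C C comult_closed[OF c(1)]])
      show "?R x1 x2 x3 = tlift H (\<lambda>y' y3. tlift H (\<lambda>y1 y2. ?G x1 y1 x2 y2 y3 x3) (?D y')) (?D y)"
        if "x1 \<in> carrier H" "x2 \<in> carrier H" for x1 x2
        by (rule tlift_coassoc[OF C _ y, symmetric]) (use c that in \<open>intro mlin; simp\<close>)
    qed
    also have "\<dots> = tlift H (\<lambda>y' y3. tlift H (\<lambda>x1 x2. tlift H (\<lambda>y1 y2. ?G x1 y1 x2 y2 y3 x3) (?D y')) (?D x')) (?D y)"
      by (rule lift_fubini[OF C C C C C _ _ comult_closed[OF c(1)] comult_closed[OF y]]) (use c in \<open>intro mlin; simp\<close>)+
    also have "\<dots> = tlift H (\<lambda>y' y3. counit H y' \<odot>\<^bsub>H\<^esub> (counit H x' \<odot>\<^bsub>H\<^esub> (?S y3 \<otimes>\<^bsub>H\<^esub> ?S x3))) (?D y)"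
    proof (rule lift_cong[OF C C comult_closed[OF y]])
      fix y' y3 assume c': "y' \<in> carrier H" "y3 \<in> carrier H"
      have "tlift H (\<lambda>x1 x2. tlift H (\<lambda>y1 y2. ?G x1 y1 x2 y2 y3 x3) (?D y')) (?D x')
         = tlift H (\<lambda>a b. (?S a \<otimes>\<^bsub>H\<^esub> b) \<otimes>\<^bsub>H\<^esub> (?S y3 \<otimes>\<^bsub>H\<^esub> ?S x3)) (?D (x' \<otimes>\<^bsub>H\<^esub> y'))"
        by (rule tlift_comult_mult[OF C _ c(1) c'(1), symmetric]) (use c c' in \<open>intro mlin; simp\<close>)
      also have "\<dots> = counit H (x' \<otimes>\<^bsub>H\<^esub> y') \<odot>\<^bsub>H\<^esub> (\<one>\<^bsub>H\<^esub> \<otimes>\<^bsub>H\<^esub> (?S y3 \<otimes>\<^bsub>H\<^esub> ?S x3))"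
        by (rule tlift_antipode_left[OF C _ M.m_closed[OF c(1) c'(1)]]) (use c c' in \<open>intro mlin; simp\<close>)
      finally show "tlift H (\<lambda>x1 x2. tlift H (\<lambda>y1 y2. ?G x1 y1 x2 y2 y3 x3) (?D y')) (?D x')
        = counit H y' \<odot>\<^bsub>H\<^esub> (counit H x' \<odot>\<^bsub>H\<^esub> (?S y3 \<otimes>\<^bsub>H\<^esub> ?S x3))"
        using c c' by (simp add: smult_assoc1[symmetric] R.m_comm)
    qed
    also have "\<dots> = counit H x' \<odot>\<^bsub>H\<^esub> (?S y \<otimes>\<^bsub>H\<^esub> ?S x3)"
      by (rule tlift_counit_left[OF C _ y]) (use c in \<open>intro mlin; simp\<close>)
    finally show ?thesis .
  qed
  have "tlift H ?L (?D x) = tlift H (\<lambda>x' x3. counit H x' \<odot>\<^bsub>H\<^esub> (?S y \<otimes>\<^bsub>H\<^esub> ?S x3)) (?D x)"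
    by (rule lift_cong[OF C C comult_closed[OF x]]) (rule L)
  also have "\<dots> = ?S y \<otimes>\<^bsub>H\<^esub> ?S x"
    by (rule tlift_counit_left[OF C _ x]) (use y in \<open>intro mlin; simp\<close>)
  finally show ?thesis using 1 2 by simp
qed

text \<open>
  Apply \<open>\<epsilon>\<close> to \<open>\<Sum> S(x\<^sub>1) x\<^sub>2 = \<epsilon>(x) 1\<close>; the left side becomes \<open>\<epsilon>(S(x\<^sub>1)) \<epsilon>(x\<^sub>2)\<close>, which sums to \<open>\<epsilon>(S(x))\<close>.
  Scalars are multiplied by \<open>1\<close> so that the sums have values in the \<open>K\<close>-module \<open>H\<close>.
\<close>
lemma counit_antipode [simp]:
  assumes x: "x \<in> carrier H" shows "counit H (antipode H x) = counit H x"
proof -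
  note C = module_C
  have "tlift H (\<lambda>y z. counit H (antipode H y \<otimes>\<^bsub>H\<^esub> z) \<odot>\<^bsub>H\<^esub> \<one>\<^bsub>H\<^esub>) (comult H x) = counit H x \<odot>\<^bsub>H\<^esub> (counit H \<one>\<^bsub>H\<^esub> \<odot>\<^bsub>H\<^esub> \<one>\<^bsub>H\<^esub>)"
    by (rule tlift_antipode_left[OF C _ x]) (intro mlin; simp)
  moreover have "tlift H (\<lambda>y z. counit H (antipode H y \<otimes>\<^bsub>H\<^esub> z) \<odot>\<^bsub>H\<^esub> \<one>\<^bsub>H\<^esub>) (comult H x)
     = tlift H (\<lambda>y z. counit H z \<odot>\<^bsub>H\<^esub> (counit H (antipode H y) \<odot>\<^bsub>H\<^esub> \<one>\<^bsub>H\<^esub>)) (comult H x)"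
    by (rule lift_cong[OF C C comult_closed[OF x]]) (simp add: smult_assoc1[symmetric] R.m_comm)
  moreover have "\<dots> = counit H (antipode H x) \<odot>\<^bsub>H\<^esub> \<one>\<^bsub>H\<^esub>"
    by (rule tlift_counit_right[OF C _ x]) (intro mlin; simp)
  ultimately have "counit H (antipode H x) \<odot>\<^bsub>H\<^esub> \<one>\<^bsub>H\<^esub> = counit H x \<odot>\<^bsub>H\<^esub> \<one>\<^bsub>H\<^esub>" by simp
  then have "counit H (counit H (antipode H x) \<odot>\<^bsub>H\<^esub> \<one>\<^bsub>H\<^esub>) = counit H (counit H x \<odot>\<^bsub>H\<^esub> \<one>\<^bsub>H\<^esub>)" by simp
  then show ?thesis using x by (simp add: counit_smult)
qed

text \<open>
  \<open>b a = \<Sum> a\<^sub>1 (S(a\<^sub>2) b a\<^sub>3)\<close>, because \<open>a\<^sub>1 S(a\<^sub>2)\<close> cancels. This moves \<open>b\<close> past \<open>a\<close> at the cost of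
  the right adjoint action on \<open>b\<close>, under which a right normalized subalgebra is stable.
\<close>
lemma mult_eq_right_adjoint:
  assumes a: "a \<in> carrier H" and b: "b \<in> carrier H"
  shows "tlift H (\<lambda>x y. x \<otimes>\<^bsub>H\<^esub> tlift H (\<lambda>u v. antipode H u \<otimes>\<^bsub>H\<^esub> b \<otimes>\<^bsub>H\<^esub> v) (comult H y)) (comult H a) = b \<otimes>\<^bsub>H\<^esub> a"
proof -
  note C = module_C
  let ?S = "antipode H" and ?D = "comult H"
  let ?G = "\<lambda>x u v. x \<otimes>\<^bsub>H\<^esub> (?S u \<otimes>\<^bsub>H\<^esub> b \<otimes>\<^bsub>H\<^esub> v)"
  have "tlift H (\<lambda>x y. x \<otimes>\<^bsub>H\<^esub> tlift H (\<lambda>u v. ?S u \<otimes>\<^bsub>H\<^esub> b \<otimes>\<^bsub>H\<^esub> v) (?D y)) (?D a) = tlift H (\<lambda>x y. tlift H (?G x) (?D y)) (?D a)"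
  proof (rule lift_cong[OF C C comult_closed[OF a]])
    show "x \<otimes>\<^bsub>H\<^esub> tlift H (\<lambda>u v. ?S u \<otimes>\<^bsub>H\<^esub> b \<otimes>\<^bsub>H\<^esub> v) (?D y) = tlift H (?G x) (?D y)" if "x \<in> carrier H" "y \<in> carrier H" for x y
      by (rule linear_lift_lift[where f = "\<lambda>z. x \<otimes>\<^bsub>H\<^esub> z", OF C C C C _ _ comult_closed[OF that(2)]]; intro mlin; simp add: b that)
  qed
  also have "\<dots> = tlift H (\<lambda>y v. tlift H (\<lambda>x u. ?G x u v) (?D y)) (?D a)"
    by (rule tlift_coassoc[OF C _ a, symmetric]) (use b in \<open>intro mlin; simp\<close>)
  also have "\<dots> = tlift H (\<lambda>y v. counit H y \<odot>\<^bsub>H\<^esub> (b \<otimes>\<^bsub>H\<^esub> v)) (?D a)"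
  proof (rule lift_cong[OF C C comult_closed[OF a]])
    fix y v assume c: "y \<in> carrier H" "v \<in> carrier H"
    have "tlift H (\<lambda>x u. ?G x u v) (?D y) = tlift H (\<lambda>x u. (x \<otimes>\<^bsub>H\<^esub> ?S u) \<otimes>\<^bsub>H\<^esub> (b \<otimes>\<^bsub>H\<^esub> v)) (?D y)"
      by (rule lift_cong[OF C C comult_closed[OF c(1)]]) (use c b in \<open>simp add: M.m_assoc\<close>)
    also have "\<dots> = counit H y \<odot>\<^bsub>H\<^esub> (\<one>\<^bsub>H\<^esub> \<otimes>\<^bsub>H\<^esub> (b \<otimes>\<^bsub>H\<^esub> v))"
      by (rule tlift_antipode_right[OF C _ c(1)]) (use c b in \<open>intro mlin; simp\<close>)
    finally show "tlift H (\<lambda>x u. ?G x u v) (?D y) = counit H y \<odot>\<^bsub>H\<^esub> (b \<otimes>\<^bsub>H\<^esub> v)" using b c by simp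
  qed
  also have "\<dots> = b \<otimes>\<^bsub>H\<^esub> a"
    by (rule tlift_counit_left[OF C _ a]) (use b in \<open>intro mlin; simp\<close>)
  finally show ?thesis .
qed

end

section \<open>Hopf subalgebras as Hopf algebras\<close>

lemma tensor_cong:
  assumes "carrier M = carrier M'" "add M = add M'" "smult M = smult M'"
    and "carrier N = carrier N'" "add N = add N'" "smult N = smult N'"
  shows tensor_group_cong: "tensor_group K M N = tensor_group K M' N'"
    and pure_tensor_cong: "pure_tensor K M N = pure_tensor K M' N'"
    and tensor_map_cong_modules: "tensor_map K M N = tensor_map K M' N'"
proof -
  have r: "tensor_rel K M N = tensor_rel K M' N'" using assms by (simp add: tensor_rel_def)
  show g: "tensor_group K M N = tensor_group K M' N'" using assms r by (simp add: tensor_group_def)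
  show p: "pure_tensor K M N = pure_tensor K M' N'" using assms r by (simp add: pure_tensor_def fun_eq_iff)
  show "tensor_map K M N = tensor_map K M' N'" by (simp add: tensor_map_def fun_eq_iff g p)
qed

lemma abelian_group_cong:
  assumes M: "abelian_group M" and e: "carrier M' = carrier M" "add M' = add M" "zero M' = zero M"
  shows "abelian_group M'"
proof -
  interpret M: abelian_group M by fact
  show ?thesis
  proof (rule abelian_groupI)
    show "\<exists>y\<in>carrier M'. y \<oplus>\<^bsub>M'\<^esub> x = \<zero>\<^bsub>M'\<^esub>" if "x \<in> carrier M'" for x
      using that e M.l_neg by (metis M.a_inv_closed)
  qed (use e M.a_assoc M.a_comm in simp_all)
qed

lemma module_cong:
  assumes M: "module K M" and e: "carrier M' = carrier M" "add M' = add M" "zero M' = zero M" "smult M' = smult M"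
  shows "module K M'"
proof -
  interpret M: module K M by fact
  show ?thesis
    by (rule moduleI[OF M.is_cring abelian_group_cong[OF M.abelian_group_axioms e(1-3)]])
      (simp_all add: e M.smult_l_distr M.smult_r_distr M.smult_assoc1)
qed

lemma ring_cong:
  assumes M: "ring M" and e: "carrier M' = carrier M" "add M' = add M" "zero M' = zero M" "mult M' = mult M" "one M' = one M"
  shows "ring M'"
proof -
  interpret M: ring M by fact
  show ?thesis
    by (rule ringI[OF abelian_group_cong[OF M.abelian_group_axioms e(1-3)]], rule monoidI)
      (simp_all add: e M.m_assoc M.l_distr M.r_distr)
qed

lemma hopf_restrict_simps [simp]:
  "carrier (hopf_restrict K H A) = A" "mult (hopf_restrict K H A) = mult H" "one (hopf_restrict K H A) = one H"
  "add (hopf_restrict K H A) = add H" "zero (hopf_restrict K H A) = zero H" "smult (hopf_restrict K H A) = smult H"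
  "counit (hopf_restrict K H A) = counit H" "antipode (hopf_restrict K H A) = antipode H"
  by (simp_all add: hopf_restrict_def)

locale hopf_sub = hopf_algebra K H for K :: "('k, 'w) ring_scheme" and H :: "('k, 'h) hopf_alg" +
  fixes A :: "'h set"
  assumes hopf_subalgebra: "hopf_subalgebra K H A"
begin

abbreviation "HA \<equiv> hopf_restrict K H A"

lemma sub_ring: "subring A H" and sub_mod: "submodule A K H"
  using hopf_subalgebra by (simp_all add: hopf_subalgebra_def)

lemma sub_carrier: "A \<subseteq> carrier H" by (rule submoduleE(1)[OF sub_mod])

lemma sub_closed [simp]: "x \<in> A \<Longrightarrow> x \<in> carrier H" using sub_carrier by blast

lemma sub_one [simp]: "\<one>\<^bsub>H\<^esub> \<in> A" and sub_mult [simp]: "x \<in> A \<Longrightarrow> y \<in> A \<Longrightarrow> x \<otimes>\<^bsub>H\<^esub> y \<in> A"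
  using subringE(3,6)[OF sub_ring] by auto

lemma sub_add [simp]: "x \<in> A \<Longrightarrow> y \<in> A \<Longrightarrow> x \<oplus>\<^bsub>H\<^esub> y \<in> A"
  and sub_smult [simp]: "k \<in> carrier K \<Longrightarrow> x \<in> A \<Longrightarrow> k \<odot>\<^bsub>H\<^esub> x \<in> A"
  using submoduleE(4,5)[OF sub_mod] by auto

lemma sub_antipode [simp]: "x \<in> A \<Longrightarrow> antipode H x \<in> A"
  and comult_sub: "x \<in> A \<Longrightarrow> comult H x \<in> sub_tensor K H H A A"
  using hopf_subalgebra by (simp_all add: hopf_subalgebra_def)

lemma module_HA [simp, mlin]: "module K HA"
  by (rule module_cong[OF submodule.submodule_is_module[OF sub_mod module_C]]) simp_all

lemma linear_incl [simp, mlin]: "(\<lambda>x. x) \<in> linear_maps K HA H"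
  by (auto simp: linear_maps_def)

lemma linear_restrict: "f \<in> linear_maps K H P \<Longrightarrow> f \<in> linear_maps K HA P"
  by (auto simp: linear_maps_def)

lemma linear_into: "f \<in> linear_maps K X H \<Longrightarrow> (\<And>x. x \<in> carrier X \<Longrightarrow> f x \<in> A) \<Longrightarrow> f \<in> linear_maps K X HA"
  by (auto simp: linear_maps_def)

lemma bilinear_restrict: "bilinear_map K H H P \<phi> \<Longrightarrow> bilinear_map K HA HA P \<phi>"
  by (auto simp: bilinear_map_def linear_restrict)

lemma exists_projection_HA: "\<exists>p\<in>linear_maps K H HA. \<forall>a\<in>A. p a = a"
proof -
  obtain p where p: "p\<in>linear_maps K H H" and pA: "\<forall>x\<in>carrier H. p x \<in> A" and pi: "\<forall>x\<in>A. p x = x"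
    using exists_projection[OF R.field_axioms module_C sub_mod carrier_is_submodule] by (elim bexE conjE)
  show ?thesis using linear_into[OF p] pA pi by (intro bexI[of _ p]) auto
qed

text \<open>
  For a projection \<open>p\<close> onto \<open>A\<close> the tensor \<open>(p \<otimes> p) \<Delta>(a)\<close> maps to \<open>\<Delta>(a)\<close>, since \<open>p \<otimes> p\<close> is the identity
  on the image of \<open>A \<otimes> A\<close>; and it is the only such tensor because \<open>p \<otimes> p\<close> is left inverse to
  \<open>A \<otimes> A \<rightarrow> H \<otimes> H\<close>. The explicit formula replaces the definite description from here on.
\<close>
lemma comult_restrict:
  assumes p: "p \<in> linear_maps K H HA" and pi: "\<And>x. x \<in> A \<Longrightarrow> p x = x" and a: "a \<in> A"
  shows "comult HA a = tensor_map K HA HA p p (comult H a)"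
    and "tensor_map K H H (\<lambda>x. x) (\<lambda>x. x) (comult HA a) = comult H a"
proof -
  note C = module_C and A = module_HA
  let ?t = "tensor_map K HA HA p p (comult H a)"
  have pH: "p \<in> linear_maps K H H" using linear_comp[OF linear_incl p] by simp
  have ac: "a \<in> carrier H" using a by simp
  have tc: "?t \<in> carrier (tensor_prod K HA HA)"
    by (rule tensor_map_closed[OF C C A A p p comult_closed[OF ac]])
  have i: "tensor_map K H H (\<lambda>x. x) (\<lambda>x. x) ?t = comult H a"
  proof -
    have "tensor_map K H H (\<lambda>x. x) (\<lambda>x. x) ?t = tensor_map K H H p p (comult H a)"
      by (rule tensor_map_comp[OF C C A A C C p p linear_incl linear_incl comult_closed[OF ac]])
    also have "\<dots> = comult H a"
      by (rule tensor_map_sub_tensor_id[OF C C pH pH sub_carrier sub_carrier pi pi comult_sub[OF a]])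
    finally show ?thesis .
  qed
  have u: "s = ?t" if s: "s \<in> carrier (tensor_prod K HA HA)" "tensor_map K H H (\<lambda>x. x) (\<lambda>x. x) s = comult H a" for s
  proof -
    have "?t = tensor_map K HA HA p p (tensor_map K H H (\<lambda>x. x) (\<lambda>x. x) s)" using s by simp
    also have "\<dots> = tensor_map K HA HA p p s"
      by (rule tensor_map_comp[OF A A C C A A linear_incl linear_incl p p s(1)])
    also have "\<dots> = s" by (rule tensor_map_id[OF A A _ _ s(1)]) (simp_all add: pi)
    finally show ?thesis by simp
  qed
  have g: "tensor_group K (H\<lparr>carrier := A\<rparr>) (H\<lparr>carrier := A\<rparr>) = tensor_group K HA HA"
    by (rule tensor_group_cong) simp_all
  show c: "comult HA a = ?t"
  proof -
    have "comult HA a = (THE t. t \<in> carrier (tensor_group K (H\<lparr>carrier := A\<rparr>) (H\<lparr>carrier := A\<rparr>)) \<and>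
        tensor_map K H H (\<lambda>x. x) (\<lambda>x. x) t = comult H a)"
      by (simp add: hopf_restrict_def del: carrier_tensor_group)
    also have "\<dots> = ?t"
      unfolding g carrier_tensor_group using tc i u by (intro the_equality conjI) blast+
    finally show ?thesis .
  qed
  show "tensor_map K H H (\<lambda>x. x) (\<lambda>x. x) (comult HA a) = comult H a" using i c by simp
qed

lemma comult_HA_closed [simp]: "a \<in> A \<Longrightarrow> comult HA a \<in> carrier (tensor_prod K HA HA)"
proof -
  assume a: "a \<in> A"
  obtain p where p: "p\<in>linear_maps K H HA" "\<forall>a\<in>A. p a = a" using exists_projection_HA by (elim bexE)
  show ?thesis
    using comult_restrict(1)[OF p(1) _ a] p(2) tensor_map_closed[OF module_C module_C module_HA module_HA p(1) p(1) comult_closed[of a]] a by simp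
qed

lemma incl_comult_HA: "a \<in> A \<Longrightarrow> tensor_map K H H (\<lambda>x. x) (\<lambda>x. x) (comult HA a) = comult H a"
proof -
  assume a: "a \<in> A"
  obtain p where p: "p\<in>linear_maps K H HA" "\<forall>a\<in>A. p a = a" using exists_projection_HA by (elim bexE)
  show ?thesis by (rule comult_restrict(2)[OF p(1) _ a]) (use p(2) in simp)
qed

text \<open>
  Sweedler sums over the comultiplication of a Hopf subalgebra can be computed in the large Hopf
  algebra.
\<close>
lemma tlift_comult_HA:
  assumes P: "module K P" and \<phi>: "bilinear_map K HA HA P \<phi>" and \<psi>: "bilinear_map K H H P \<psi>"
    and e: "\<And>x y. x \<in> A \<Longrightarrow> y \<in> A \<Longrightarrow> \<phi> x y = \<psi> x y" and a: "a \<in> A"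
  shows "tlift P \<phi> (comult HA a) = tlift P \<psi> (comult H a)"
proof -
  note C = module_C and A = module_HA
  have "tlift P \<psi> (comult H a) = tlift P \<psi> (tensor_map K H H (\<lambda>x. x) (\<lambda>x. x) (comult HA a))"
    by (simp add: incl_comult_HA a)
  also have "\<dots> = tlift P \<psi> (comult HA a)"
    by (rule lift_tensor_map[OF A A C C P linear_incl linear_incl \<psi> comult_HA_closed[OF a]])
  also have "\<dots> = tlift P \<phi> (comult HA a)"
    by (rule lift_cong[OF A A comult_HA_closed[OF a], symmetric]) (simp add: e)
  finally show ?thesis by simp
qed

lemma tlift_into_HA:
  assumes \<phi>: "bilinear_map K HA HA HA \<phi>" and t: "t \<in> carrier (tensor_prod K HA HA)"
  shows "tlift HA \<phi> t = tlift H \<phi> t"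
  by (rule linear_lift_lift[OF module_HA module_HA module_HA module_C \<phi> linear_incl t])

lemma ring_HA: "ring HA"
proof -
  have "ring (H\<lparr>carrier := A\<rparr>)" by (rule subring_is_ring[OF sub_ring])
  then show ?thesis by (rule ring_cong) simp_all
qed

text \<open>
  Each axiom is an equation between Sweedler sums over \<open>\<Delta>\<^sub>A\<close>, which are sums over \<open>\<Delta>\<^sub>H\<close>. For
  coassociativity the values lie in \<open>A \<otimes> (A \<otimes> A)\<close>, so the summand is extended to \<open>H\<close> by composing
  with a projection \<open>p\<close>.
\<close>
theorem hopf_algebra_HA: "hopf_algebra K HA"
proof -
  note C = module_C and A = module_HA
  obtain p where p: "p\<in>linear_maps K H HA" and pi: "\<forall>a\<in>A. p a = a" using exists_projection_HA by (elim bexE)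
  have pi [simp]: "p x = x" if "x \<in> A" for x using pi that by blast
  have pc [simp]: "p x \<in> A" if "x \<in> carrier H" for x using linear_closed[OF p that] by simp
  note lp = linear_comp[OF p]
  let ?T2 = "tensor_prod K HA HA" and ?T3 = "tensor_prod K HA (tensor_prod K HA HA)"
  have T2: "module K ?T2" and T3: "module K ?T3" by simp_all
  have Dlin: "comult HA \<in> linear_maps K HA ?T2"
  proof (rule linear_cong[OF linear_restrict[OF linear_comp[OF linear_tensor_map(1)[OF C C A A p p] comult_linear]] _ A])
    show "tensor_map K HA HA p p (comult H x) = comult HA x" if "x \<in> carrier HA" for x
      using comult_restrict(1)[OF p pi] that by simp
  qed
  have coassoc': "tensor_assoc K HA HA HA (tensor_map K ?T2 HA (comult HA) (\<lambda>y. y) (comult HA x))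
          = tensor_map K HA ?T2 (\<lambda>y. y) (comult HA) (comult HA x)" if x: "x \<in> A" for x
  proof -
    let ?\<tau> = "\<lambda>u v z. pure_tensor K HA ?T2 u (pure_tensor K HA HA v z)"
    let ?\<sigma> = "\<lambda>u v z. ?\<tau> (p u) (p v) (p z)"
    have tri: "trilinear_map K HA HA HA ?T3 ?\<tau>" by (rule trilinear_pure[OF A A A])
    have tris: "trilinear_map K H H H ?T3 ?\<sigma>" by (intro mlin lp; simp)
    have bl: "bilinear_map K H H ?T3 (\<lambda>y z. tlift ?T3 (\<lambda>u v. ?\<sigma> u v z) (comult H y))"
      and br: "bilinear_map K H H ?T3 (\<lambda>y z. tlift ?T3 (\<lambda>u v. ?\<sigma> y u v) (comult H z))"
      by (intro mlin lp; simp)+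
    have "tensor_assoc K HA HA HA (tensor_map K ?T2 HA (comult HA) (\<lambda>y. y) (comult HA x))
      = tlift ?T3 (\<lambda>y z. tlift ?T3 (\<lambda>u v. ?\<tau> u v z) (comult HA y)) (comult HA x)"
      by (rule assoc_coaction_tlift[OF A A A Dlin A comult_HA_closed[OF x]])
    also have "\<dots> = tlift ?T3 (\<lambda>y z. tlift ?T3 (\<lambda>u v. ?\<sigma> u v z) (comult H y)) (comult H x)"
    proof (rule tlift_comult_HA[OF T3 _ bl _ x])
      show "bilinear_map K HA HA ?T3 (\<lambda>y z. tlift ?T3 (\<lambda>u v. ?\<tau> u v z) (comult HA y))"
        using bilinear_left_comp[OF bilinear_tlift_left[OF A A A T3 tri] Dlin] bilinear_right[OF bilinear_tlift_left[OF A A A T3 tri] comult_HA_closed]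
        by (intro bilinearI) auto
      show "tlift ?T3 (\<lambda>u v. ?\<tau> u v z) (comult HA y) = tlift ?T3 (\<lambda>u v. ?\<sigma> u v z) (comult H y)" if "y \<in> A" "z \<in> A" for y z
        by (rule tlift_comult_HA[OF T3 trilinearD(3)[OF tri] trilinearD(3)[OF tris]]) (use that in simp_all)
    qed
    also have "\<dots> = tlift ?T3 (\<lambda>y z. tlift ?T3 (?\<sigma> y) (comult H z)) (comult H x)"
      by (rule tlift_coassoc[OF T3 tris]) (use x in simp)
    also have "\<dots> = tlift ?T3 (\<lambda>y z. tlift ?T3 (?\<tau> y) (comult HA z)) (comult HA x)"
    proof (rule tlift_comult_HA[OF T3 _ br _ x, symmetric])
      show "bilinear_map K HA HA ?T3 (\<lambda>y z. tlift ?T3 (?\<tau> y) (comult HA z))"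
        using bilinear_right_comp[OF bilinear_tlift_right[OF A A A T3 tri] Dlin] bilinear_left[OF bilinear_tlift_right[OF A A A T3 tri] comult_HA_closed]
        by (intro bilinearI) auto
      show "tlift ?T3 (?\<tau> y) (comult HA z) = tlift ?T3 (?\<sigma> y) (comult H z)" if "y \<in> A" "z \<in> A" for y z
        by (rule tlift_comult_HA[OF T3 trilinearD(1)[OF tri] trilinearD(1)[OF tris]]) (use that in simp_all)
    qed
    also have "\<dots> = tensor_map K HA ?T2 (\<lambda>y. y) (comult HA) (comult HA x)"
      by (rule tensor_map_coaction_tlift[OF A A A A Dlin comult_HA_closed[OF x], symmetric])
    finally show ?thesis .
  qed
  have cl: "tensor_lift (add_monoid HA) (\<lambda>y z. counit H y \<odot>\<^bsub>H\<^esub> z) (comult HA x) = x"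
    and cr: "tensor_lift (add_monoid HA) (\<lambda>y z. counit H z \<odot>\<^bsub>H\<^esub> y) (comult HA x) = x"
    and al: "tensor_lift (add_monoid HA) (\<lambda>y z. antipode H y \<otimes>\<^bsub>H\<^esub> z) (comult HA x) = counit H x \<odot>\<^bsub>H\<^esub> \<one>\<^bsub>H\<^esub>"
    and ar: "tensor_lift (add_monoid HA) (\<lambda>y z. y \<otimes>\<^bsub>H\<^esub> antipode H z) (comult HA x) = counit H x \<odot>\<^bsub>H\<^esub> \<one>\<^bsub>H\<^esub>"
    if x: "x \<in> A" for x
  proof -
    have *: "tlift HA \<phi> (comult HA x) = tlift H \<phi> (comult H x)"
      if b: "bilinear_map K H H H \<phi>" and c: "\<And>x y. x \<in> A \<Longrightarrow> y \<in> A \<Longrightarrow> \<phi> x y \<in> A" for \<phi>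
    proof -
      have "bilinear_map K HA HA HA \<phi>"
        using b c bilinear_restrict[OF b] by (auto simp: bilinear_map_def intro: linear_restrict linear_into)
      then show ?thesis
        using tlift_into_HA[of \<phi> "comult HA x"] tlift_comult_HA[OF C bilinear_restrict[OF b] b _ x] x by simp
    qed
    show "tensor_lift (add_monoid HA) (\<lambda>y z. counit H y \<odot>\<^bsub>H\<^esub> z) (comult HA x) = x"
      using *[of "\<lambda>y z. counit H y \<odot>\<^bsub>H\<^esub> z"] tlift_counit_left[OF C linear_id] bilinear_counit_left[OF C linear_id] x by (simp add: tlift_def)
    show "tensor_lift (add_monoid HA) (\<lambda>y z. counit H z \<odot>\<^bsub>H\<^esub> y) (comult HA x) = x"
      using *[of "\<lambda>y z. counit H z \<odot>\<^bsub>H\<^esub> y"] tlift_counit_right[OF C linear_id] bilinear_counit_right[OF C linear_id] x by (simp add: tlift_def)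
    have "bilinear_map K H H H (\<lambda>y z. antipode H y \<otimes>\<^bsub>H\<^esub> z)" "bilinear_map K H H H (\<lambda>y z. y \<otimes>\<^bsub>H\<^esub> antipode H z)" by (intro mlin; simp)+
    then show "tensor_lift (add_monoid HA) (\<lambda>y z. antipode H y \<otimes>\<^bsub>H\<^esub> z) (comult HA x) = counit H x \<odot>\<^bsub>H\<^esub> \<one>\<^bsub>H\<^esub>"
      "tensor_lift (add_monoid HA) (\<lambda>y z. y \<otimes>\<^bsub>H\<^esub> antipode H z) (comult HA x) = counit H x \<odot>\<^bsub>H\<^esub> \<one>\<^bsub>H\<^esub>"
      using *[of "\<lambda>y z. antipode H y \<otimes>\<^bsub>H\<^esub> z"] *[of "\<lambda>y z. y \<otimes>\<^bsub>H\<^esub> antipode H z"] antipode_left antipode_right x by (simp_all add: tlift_def)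
  qed
  have ring_hom: "comult HA \<in> ring_hom HA ?T2"
  proof (rule ring_hom_memI)
    show "comult HA x \<in> carrier ?T2" if "x \<in> carrier HA" for x using that by simp
    show "comult HA (x \<oplus>\<^bsub>HA\<^esub> y) = comult HA x \<oplus>\<^bsub>?T2\<^esub> comult HA y" if "x \<in> carrier HA" "y \<in> carrier HA" for x y
      using linear_add[OF Dlin that] by simp
    show "comult HA \<one>\<^bsub>HA\<^esub> = \<one>\<^bsub>?T2\<^esub>"
    proof -
      have "comult HA \<one>\<^bsub>H\<^esub> = tlift ?T2 (\<lambda>m n. pure_tensor K HA HA (p m) (p n)) (comult H \<one>\<^bsub>H\<^esub>)"
        using comult_restrict(1)[OF p pi sub_one] by (simp add: tensor_map_lift)
      also have "\<dots> = pure_tensor K HA HA \<one>\<^bsub>H\<^esub> \<one>\<^bsub>H\<^esub>"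
        using tlift_comult_one[OF T2 bilinear_tensor_map[OF A A p p]] by simp
      finally show ?thesis by (simp add: one_tensor_prod)
    qed
    fix x y assume xy: "x \<in> carrier HA" "y \<in> carrier HA"
    then have x: "x \<in> A" "x \<in> carrier H" and y: "y \<in> A" "y \<in> carrier H" by auto
    let ?\<phi> = "\<lambda>m n. pure_tensor K HA HA (p m) (p n)"
    have b1: "bilinear_map K H H ?T2 (\<lambda>c d. ?\<phi> (a \<otimes>\<^bsub>H\<^esub> c) (b \<otimes>\<^bsub>H\<^esub> d))" if "a \<in> carrier H" "b \<in> carrier H" for a b
      using that by (intro mlin lp; simp)
    have b2: "bilinear_map K H H ?T2 (\<lambda>a b. tlift ?T2 (\<lambda>c d. ?\<phi> (a \<otimes>\<^bsub>H\<^esub> c) (b \<otimes>\<^bsub>H\<^esub> d)) (comult H y))"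
      using y by (intro mlin lp; simp)
    have lm: "(\<lambda>c. a \<otimes>\<^bsub>H\<^esub> c) \<in> linear_maps K HA HA" "(\<lambda>c. c \<otimes>\<^bsub>H\<^esub> a) \<in> linear_maps K HA HA" if "a \<in> A" for a
      using that by (intro linear_into linear_restrict linear_mult linear_id; simp)+
    have b1': "bilinear_map K HA HA ?T2 (\<lambda>c d. pure_tensor K HA HA (a \<otimes>\<^bsub>H\<^esub> c) (b \<otimes>\<^bsub>H\<^esub> d))" if "a \<in> A" "b \<in> A" for a b
      by (rule bilinear_tensor_map[OF A A lm(1)[OF that(1)] lm(1)[OF that(2)]])
    have b2': "bilinear_map K HA HA ?T2 (\<lambda>a b. tlift ?T2 (\<lambda>c d. pure_tensor K HA HA (a \<otimes>\<^bsub>H\<^esub> c) (b \<otimes>\<^bsub>H\<^esub> d)) (comult HA y))"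
      by (intro bilinearI linear_lift_param[OF A A T2 A] b1' comult_HA_closed y linear_pure_left[OF A A lm(2)] linear_pure_right[OF A A lm(2)]) auto
    have "comult HA (x \<otimes>\<^bsub>H\<^esub> y) = tlift ?T2 ?\<phi> (comult H (x \<otimes>\<^bsub>H\<^esub> y))"
      using comult_restrict(1)[OF p pi] x y by (simp add: tensor_map_lift)
    also have "\<dots> = tlift ?T2 (\<lambda>a b. tlift ?T2 (\<lambda>c d. ?\<phi> (a \<otimes>\<^bsub>H\<^esub> c) (b \<otimes>\<^bsub>H\<^esub> d)) (comult H y)) (comult H x)"
      by (rule tlift_comult_mult[OF T2 bilinear_tensor_map[OF A A p p] x(2) y(2)])
    also have "\<dots> = tlift ?T2 (\<lambda>a b. tlift ?T2 (\<lambda>c d. pure_tensor K HA HA (a \<otimes>\<^bsub>H\<^esub> c) (b \<otimes>\<^bsub>H\<^esub> d)) (comult HA y)) (comult HA x)"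
      by (rule tlift_comult_HA[OF T2 b2' b2 _ x(1), symmetric], rule tlift_comult_HA[OF T2 b1' b1 _ y(1)]) auto
    finally show "comult HA (x \<otimes>\<^bsub>HA\<^esub> y) = comult HA x \<otimes>\<^bsub>?T2\<^esub> comult HA y"
      by (simp add: mult_tensor_prod)
  qed
  have "coalgebra K HA"
    by (intro coalgebra.intro coalgebra_axioms.intro A R.field_axioms Dlin)
      (simp_all add: counit_add counit_smult coassoc' cl[simplified] cr[simplified])
  moreover have "counit HA \<in> ring_hom HA K"
    by (rule ring_hom_memI) (simp_all add: counit_add)
  moreover have "antipode HA \<in> linear_maps K HA HA"
    using linear_into[OF linear_restrict[OF antipode_linear]] by simp
  ultimately show ?thesis
    by (intro hopf_algebra.intro hopf_algebra_axioms.intro ring_HA ring_hom)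
      (simp_all add: al[simplified] ar[simplified] smult_mult_left smult_mult_right)
qed

end

section \<open>The product of two Hopf subalgebras\<close>

lemma tlift_add:
  assumes M: "module K M" and N: "module K N" and P: "module K P"
    and b: "bilinear_map K M N P \<phi>" "bilinear_map K M N P \<psi>" and t: "t \<in> carrier (tensor_prod K M N)"
  shows "tlift P (\<lambda>m n. \<phi> m n \<oplus>\<^bsub>P\<^esub> \<psi> m n) t = tlift P \<phi> t \<oplus>\<^bsub>P\<^esub> tlift P \<psi> t"
proof -
  have s: "bilinear_map K M N P (\<lambda>m n. \<phi> m n \<oplus>\<^bsub>P\<^esub> \<psi> m n)"
    using b by (intro bilinearI linear_sum[OF P]) (auto simp: bilinear_map_def)
  show ?thesis
    by (rule linear_eq_on_tensors[OF M N P linear_lift(1)[OF M N P s] linear_sum[OF P linear_lift(1)[OF M N P b(1)] linear_lift(1)[OF M N P b(2)]] _ t])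
      (simp add: lift_pure[OF M N P s] lift_pure[OF M N P b(1)] lift_pure[OF M N P b(2)])
qed

lemma linear_difference:
  assumes "module K P" "f \<in> linear_maps K X P" "g \<in> linear_maps K X P"
  shows "(\<lambda>x. f x \<ominus>\<^bsub>P\<^esub> g x) \<in> linear_maps K X P"
proof -
  interpret P: module K P by fact
  show ?thesis
    using assms(2,3)
    by (auto simp: linear_maps_def Pi_iff P.smult_r_distr P.smult_r_minus a_minus_def P.minus_add P.M.add.m_ac)
qed

context hopf_algebra
begin

lemma submodule_span_prod: "U \<subseteq> carrier H \<Longrightarrow> V \<subseteq> carrier H \<Longrightarrow> submodule (span_prod K H U V) K H"
  unfolding span_prod_def by (rule submodule_linear_span[OF module_C]) auto

lemma mult_in_span_prod: "u \<in> U \<Longrightarrow> v \<in> V \<Longrightarrow> u \<otimes>\<^bsub>H\<^esub> v \<in> span_prod K H U V"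
  unfolding span_prod_def by (rule subsetD[OF subset_linear_span]) blast

lemma span_prod_least:
  "submodule W K H \<Longrightarrow> (\<And>u v. u \<in> U \<Longrightarrow> v \<in> V \<Longrightarrow> u \<otimes>\<^bsub>H\<^esub> v \<in> W) \<Longrightarrow> span_prod K H U V \<subseteq> W"
  unfolding span_prod_def by (rule linear_span_least) auto

lemma linear_span_prod_mem:
  assumes f: "f \<in> linear_maps K H P" and P: "module K P" and W: "submodule W K P"
    and UV: "U \<subseteq> carrier H" "V \<subseteq> carrier H" and uv: "\<And>u v. u \<in> U \<Longrightarrow> v \<in> V \<Longrightarrow> f (u \<otimes>\<^bsub>H\<^esub> v) \<in> W"
    and x: "x \<in> span_prod K H U V"
  shows "f x \<in> W"
proof -
  have "span_prod K H U V \<subseteq> {x \<in> carrier H. f x \<in> W}"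
    by (rule span_prod_least[OF linear_submodule_vimage[OF f module_C W P]]) (use UV uv in auto)
  then show ?thesis using x by auto
qed

lemma submodule_kernel_counit: "submodule {x \<in> carrier H. counit H x = \<zero>\<^bsub>K\<^esub>} K H"
proof (rule submoduleI)
  show z: "\<zero>\<^bsub>H\<^esub> \<in> {x \<in> carrier H. counit H x = \<zero>\<^bsub>K\<^esub>}"
    using counit_smult[of "\<zero>\<^bsub>K\<^esub>" "\<zero>\<^bsub>H\<^esub>"] by simp
  show "\<ominus>\<^bsub>H\<^esub> a \<in> {x \<in> carrier H. counit H x = \<zero>\<^bsub>K\<^esub>}" if "a \<in> {x \<in> carrier H. counit H x = \<zero>\<^bsub>K\<^esub>}" for a
    using that counit_add[of a "\<ominus>\<^bsub>H\<^esub> a"] z by (simp add: M.r_neg)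
qed (auto simp: counit_add counit_smult)

end

lemma (in hopf_sub) minus_counit_in_augmentation:
  assumes "b \<in> A" shows "b \<ominus>\<^bsub>H\<^esub> counit H b \<odot>\<^bsub>H\<^esub> \<one>\<^bsub>H\<^esub> \<in> augmentation K H A"
proof -
  have "b \<ominus>\<^bsub>H\<^esub> counit H b \<odot>\<^bsub>H\<^esub> \<one>\<^bsub>H\<^esub> = b \<oplus>\<^bsub>H\<^esub> (\<ominus>\<^bsub>K\<^esub> counit H b) \<odot>\<^bsub>H\<^esub> \<one>\<^bsub>H\<^esub>"
    using assms by (simp add: a_minus_def smult_l_minus)
  then show ?thesis using assms by (simp add: augmentation_def counit_add counit_smult R.r_neg)
qed

locale hopf_normal = hopf_algebra K H + A: hopf_sub K H A + B: hopf_sub K H B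
  for K :: "('k, 'w) ring_scheme" and H :: "('k, 'h) hopf_alg" and A B :: "'h set" +
  assumes right_normalizes: "right_normalizes H A B"
begin

abbreviation "Bp \<equiv> augmentation K H B"
abbreviation "AB \<equiv> span_prod K H A B"
abbreviation "J \<equiv> span_prod K H A Bp"

abbreviation "adj a b \<equiv> tlift H (\<lambda>u v. antipode H u \<otimes>\<^bsub>H\<^esub> b \<otimes>\<^bsub>H\<^esub> v) (comult H a)"

lemma Bp_sub: "b \<in> Bp \<Longrightarrow> b \<in> B" and Bp_counit: "b \<in> Bp \<Longrightarrow> counit H b = \<zero>\<^bsub>K\<^esub>"
  and BpI: "b \<in> B \<Longrightarrow> counit H b = \<zero>\<^bsub>K\<^esub> \<Longrightarrow> b \<in> Bp"
  by (auto simp: augmentation_def)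

lemma Bp_carrier: "Bp \<subseteq> carrier H" using B.sub_carrier by (auto simp: augmentation_def)

lemma submodule_AB: "submodule AB K H" by (rule submodule_span_prod[OF A.sub_carrier B.sub_carrier])
lemma submodule_J: "submodule J K H" by (rule submodule_span_prod[OF A.sub_carrier Bp_carrier])
lemma AB_carrier: "AB \<subseteq> carrier H" by (rule submoduleE(1)[OF submodule_AB])

lemma adj_mem: "a \<in> A \<Longrightarrow> b \<in> B \<Longrightarrow> adj a b \<in> B"
  using right_normalizes by (simp add: right_normalizes_def tlift_def)

text \<open>\<open>\<epsilon>(S(a\<^sub>1) b a\<^sub>2) = \<epsilon>(a\<^sub>1) \<epsilon>(b) \<epsilon>(a\<^sub>2)\<close> has the factor \<open>\<epsilon>(b)\<close>.\<close>
lemma adj_augmentation: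
  assumes a: "a \<in> A" and b: "b \<in> Bp" shows "adj a b \<in> Bp"
proof -
  have bc: "b \<in> carrier H" using b Bp_carrier by blast
  have "adj a b \<in> {x \<in> carrier H. counit H x = \<zero>\<^bsub>K\<^esub>}"
    by (rule tlift_sub_tensor_mem[OF module_C module_C A.sub_carrier A.sub_carrier module_C _ submodule_kernel_counit _ A.comult_sub[OF a]])
     ((use bc in \<open>intro mlin; simp\<close>)[1], use bc Bp_counit[OF b] in simp)
  then show ?thesis using adj_mem[OF a Bp_sub[OF b]] by (auto intro: BpI)
qed

lemma mult_swap_mem:
  assumes a: "a \<in> A" and b: "b \<in> B" and W: "submodule W K H"
    and m: "\<And>x y. x \<in> A \<Longrightarrow> y \<in> A \<Longrightarrow> x \<otimes>\<^bsub>H\<^esub> adj y b \<in> W"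
  shows "b \<otimes>\<^bsub>H\<^esub> a \<in> W"
proof -
  have "tlift H (\<lambda>x y. x \<otimes>\<^bsub>H\<^esub> adj y b) (comult H a) \<in> W"
    by (rule tlift_sub_tensor_mem[OF module_C module_C A.sub_carrier A.sub_carrier module_C _ W m A.comult_sub[OF a]])
      (use b in \<open>intro mlin; simp\<close>)
  then show ?thesis using mult_eq_right_adjoint[of a b] a b by simp
qed

lemma mult_BA: "b \<in> B \<Longrightarrow> a \<in> A \<Longrightarrow> b \<otimes>\<^bsub>H\<^esub> a \<in> AB"
  by (rule mult_swap_mem[OF _ _ submodule_AB]) (auto intro!: mult_in_span_prod adj_mem)

lemma mult_BpA: "b \<in> Bp \<Longrightarrow> a \<in> A \<Longrightarrow> b \<otimes>\<^bsub>H\<^esub> a \<in> J"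
  by (rule mult_swap_mem[OF _ Bp_sub submodule_J]) (auto intro!: mult_in_span_prod adj_augmentation)

lemma Bp_mult: "b \<in> Bp \<Longrightarrow> c \<in> B \<Longrightarrow> b \<otimes>\<^bsub>H\<^esub> c \<in> Bp" "c \<in> B \<Longrightarrow> b \<in> Bp \<Longrightarrow> c \<otimes>\<^bsub>H\<^esub> b \<in> Bp"
  by (auto simp: augmentation_def)

lemma mult_left_mem:
  assumes V: "V \<subseteq> carrier H" and a: "a \<in> A" and x: "x \<in> span_prod K H A V"
  shows "a \<otimes>\<^bsub>H\<^esub> x \<in> span_prod K H A V"
proof (rule linear_span_prod_mem[OF linear_mult(2)[OF linear_id] module_C submodule_span_prod A.sub_carrier V _ x])
  fix u v assume uv: "u \<in> A" "v \<in> V"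
  then have "a \<otimes>\<^bsub>H\<^esub> (u \<otimes>\<^bsub>H\<^esub> v) = (a \<otimes>\<^bsub>H\<^esub> u) \<otimes>\<^bsub>H\<^esub> v" using a V by (auto simp: M.m_assoc)
  then show "a \<otimes>\<^bsub>H\<^esub> (u \<otimes>\<^bsub>H\<^esub> v) \<in> span_prod K H A V" using a uv by (auto intro: mult_in_span_prod)
qed (use a V A.sub_carrier in auto)

lemma mult_right_mem:
  assumes VV: "V \<subseteq> carrier H" "V' \<subseteq> carrier H" and b: "b \<in> carrier H" and m: "\<And>v. v \<in> V \<Longrightarrow> v \<otimes>\<^bsub>H\<^esub> b \<in> V'" and x: "x \<in> span_prod K H A V"
  shows "x \<otimes>\<^bsub>H\<^esub> b \<in> span_prod K H A V'"
proof (rule linear_span_prod_mem[OF linear_mult(1)[OF linear_id b] module_C submodule_span_prod A.sub_carrier VV(1) _ x])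
  fix u v assume uv: "u \<in> A" "v \<in> V"
  then have "(u \<otimes>\<^bsub>H\<^esub> v) \<otimes>\<^bsub>H\<^esub> b = u \<otimes>\<^bsub>H\<^esub> (v \<otimes>\<^bsub>H\<^esub> b)" using b VV by (auto simp: M.m_assoc)
  then show "(u \<otimes>\<^bsub>H\<^esub> v) \<otimes>\<^bsub>H\<^esub> b \<in> span_prod K H A V'" using uv m by (auto intro: mult_in_span_prod)
qed (use VV A.sub_carrier in auto)

lemma AB_mult_A:
  assumes x: "x \<in> AB" and a: "a \<in> A" shows "x \<otimes>\<^bsub>H\<^esub> a \<in> AB"
proof (rule linear_span_prod_mem[OF linear_mult(1)[OF linear_id] module_C submodule_AB A.sub_carrier B.sub_carrier _ x])
  fix u v assume uv: "u \<in> A" "v \<in> B"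
  then have "(u \<otimes>\<^bsub>H\<^esub> v) \<otimes>\<^bsub>H\<^esub> a = u \<otimes>\<^bsub>H\<^esub> (v \<otimes>\<^bsub>H\<^esub> a)" using a by (auto simp: M.m_assoc)
  then show "(u \<otimes>\<^bsub>H\<^esub> v) \<otimes>\<^bsub>H\<^esub> a \<in> AB" using mult_left_mem[OF B.sub_carrier uv(1) mult_BA[OF uv(2) a]] by simp
qed (use a in simp)

lemma J_mult_A:
  assumes x: "x \<in> J" and a: "a \<in> A" shows "x \<otimes>\<^bsub>H\<^esub> a \<in> J"
proof (rule linear_span_prod_mem[OF linear_mult(1)[OF linear_id] module_C submodule_J A.sub_carrier Bp_carrier _ x])
  fix u v assume uv: "u \<in> A" "v \<in> Bp"
  then have "(u \<otimes>\<^bsub>H\<^esub> v) \<otimes>\<^bsub>H\<^esub> a = u \<otimes>\<^bsub>H\<^esub> (v \<otimes>\<^bsub>H\<^esub> a)" using a Bp_sub by (auto simp: M.m_assoc)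
  then show "(u \<otimes>\<^bsub>H\<^esub> v) \<otimes>\<^bsub>H\<^esub> a \<in> J" using mult_left_mem[OF Bp_carrier uv(1) mult_BpA[OF uv(2) a]] by simp
qed (use a in simp)

text \<open>
  Splits multiplication by \<open>A V\<close> into multiplication by \<open>A\<close> and then by \<open>V\<close>, so that the next three
  lemmas follow from \<open>B A \<subseteq> A B\<close> and \<open>B\<^sup>+ A \<subseteq> A B\<^sup>+\<close>.
\<close>
lemma mult_span_prod_mem:
  assumes x: "x \<in> carrier H" and W: "submodule W K H" and V: "V \<subseteq> carrier H" and y: "y \<in> span_prod K H A V"
    and m: "\<And>a v. a \<in> A \<Longrightarrow> v \<in> V \<Longrightarrow> (x \<otimes>\<^bsub>H\<^esub> a) \<otimes>\<^bsub>H\<^esub> v \<in> W"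
  shows "x \<otimes>\<^bsub>H\<^esub> y \<in> W"
proof (rule linear_span_prod_mem[OF linear_mult(2)[OF linear_id x] module_C W A.sub_carrier V _ y])
  fix u v assume uv: "u \<in> A" "v \<in> V"
  then have "x \<otimes>\<^bsub>H\<^esub> (u \<otimes>\<^bsub>H\<^esub> v) = (x \<otimes>\<^bsub>H\<^esub> u) \<otimes>\<^bsub>H\<^esub> v" using x V by (auto simp: M.m_assoc)
  then show "x \<otimes>\<^bsub>H\<^esub> (u \<otimes>\<^bsub>H\<^esub> v) \<in> W" using m[OF uv] by simp
qed

lemma AB_mult:
  assumes x: "x \<in> AB" and y: "y \<in> AB" shows "x \<otimes>\<^bsub>H\<^esub> y \<in> AB"
proof (rule mult_span_prod_mem[OF _ submodule_AB B.sub_carrier y])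
  show "x \<otimes>\<^bsub>H\<^esub> a \<otimes>\<^bsub>H\<^esub> v \<in> AB" if "a \<in> A" "v \<in> B" for a v
    by (rule mult_right_mem[OF B.sub_carrier B.sub_carrier _ _ AB_mult_A[OF x that(1)]]) (use that in auto)
qed (use x AB_carrier in auto)

lemma AB_mult_J:
  assumes x: "x \<in> AB" and y: "y \<in> J" shows "x \<otimes>\<^bsub>H\<^esub> y \<in> J"
proof (rule mult_span_prod_mem[OF _ submodule_J Bp_carrier y])
  show "x \<otimes>\<^bsub>H\<^esub> a \<otimes>\<^bsub>H\<^esub> v \<in> J" if "a \<in> A" "v \<in> Bp" for a v
    by (rule mult_right_mem[OF B.sub_carrier Bp_carrier _ _ AB_mult_A[OF x that(1)]]) (use that Bp_carrier Bp_mult in auto)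
qed (use x AB_carrier in auto)

lemma J_mult_AB:
  assumes x: "x \<in> J" and y: "y \<in> AB" shows "x \<otimes>\<^bsub>H\<^esub> y \<in> J"
proof (rule mult_span_prod_mem[OF _ submodule_J B.sub_carrier y])
  show "x \<otimes>\<^bsub>H\<^esub> a \<otimes>\<^bsub>H\<^esub> v \<in> J" if "a \<in> A" "v \<in> B" for a v
    by (rule mult_right_mem[OF Bp_carrier Bp_carrier _ _ J_mult_A[OF x that(1)]]) (use that Bp_mult in auto)
qed (use x submoduleE(1)[OF submodule_J] in auto)

lemma A_sub_AB: "a \<in> A \<Longrightarrow> a \<in> AB" using mult_in_span_prod[of a A "\<one>\<^bsub>H\<^esub>" B] by simp
lemma B_sub_AB: "b \<in> B \<Longrightarrow> b \<in> AB" using mult_in_span_prod[of "\<one>\<^bsub>H\<^esub>" A b B] by simp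
lemma J_sub_AB: "J \<subseteq> AB"
  by (rule span_prod_least[OF submodule_AB]) (auto intro: mult_in_span_prod Bp_sub)

lemma antipode_AB: "x \<in> AB \<Longrightarrow> antipode H x \<in> AB"
  by (rule linear_span_prod_mem[OF antipode_linear module_C submodule_AB A.sub_carrier B.sub_carrier])
    (auto simp: antipode_mult intro: mult_BA)

lemma antipode_J: "x \<in> J \<Longrightarrow> antipode H x \<in> J"
proof (rule linear_span_prod_mem[OF antipode_linear module_C submodule_J A.sub_carrier Bp_carrier])
  fix u v assume uv: "u \<in> A" "v \<in> Bp"
  then have "antipode H v \<in> Bp" by (auto intro!: BpI simp: Bp_counit Bp_sub)
  then show "antipode H (u \<otimes>\<^bsub>H\<^esub> v) \<in> J" using uv Bp_sub by (simp add: antipode_mult mult_BpA)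
qed

lemma counit_J: "x \<in> J \<Longrightarrow> counit H x = \<zero>\<^bsub>K\<^esub>"
  using span_prod_least[OF submodule_kernel_counit, of A Bp] by (auto simp: Bp_counit Bp_sub)

text \<open>
  \<open>\<Delta>(a b) = a\<^sub>1 b\<^sub>1 \<otimes> a\<^sub>2 b\<^sub>2\<close>, where the indexed elements can be taken in \<open>A\<close> and \<open>B\<close>.
\<close>
lemma comult_AB: assumes x: "x \<in> AB" shows "comult H x \<in> sub_tensor K H H AB AB"
proof -
  note C = module_C
  let ?T = "tensor_prod K H H"
  have W: "submodule (sub_tensor K H H AB AB) K ?T"
    by (rule submodule_sub_tensor[OF C C AB_carrier AB_carrier]) (rule submoduleE(4)[OF submodule_AB])
  show ?thesis
  proof (rule linear_span_prod_mem[OF comult_linear _ W A.sub_carrier B.sub_carrier _ x])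
    fix a b assume a: "a \<in> A" and b: "b \<in> B"
    have T: "module K ?T" by simp
    have "comult H (a \<otimes>\<^bsub>H\<^esub> b) = tlift ?T (pure_tensor K H H) (comult H (a \<otimes>\<^bsub>H\<^esub> b))"
      by (rule lift_pure_id[OF C C, symmetric]) (use a b in simp)
    also have "\<dots> = tlift ?T (\<lambda>a1 a2. tlift ?T (\<lambda>b1 b2. pure_tensor K H H (a1 \<otimes>\<^bsub>H\<^esub> b1) (a2 \<otimes>\<^bsub>H\<^esub> b2)) (comult H b)) (comult H a)"
      by (rule tlift_comult_mult[OF T bilinear_pure[OF C C]]) (use a b in simp_all)
    also have "\<dots> \<in> sub_tensor K H H AB AB"
    proof (rule tlift_sub_tensor_mem[OF C C A.sub_carrier A.sub_carrier T _ W _ A.comult_sub[OF a]])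
      show "bilinear_map K H H ?T (\<lambda>a1 a2. tlift ?T (\<lambda>b1 b2. pure_tensor K H H (a1 \<otimes>\<^bsub>H\<^esub> b1) (a2 \<otimes>\<^bsub>H\<^esub> b2)) (comult H b))"
        using b by (intro mlin; simp)
      fix a1 a2 assume a12: "a1 \<in> A" "a2 \<in> A"
      show "tlift ?T (\<lambda>b1 b2. pure_tensor K H H (a1 \<otimes>\<^bsub>H\<^esub> b1) (a2 \<otimes>\<^bsub>H\<^esub> b2)) (comult H b) \<in> sub_tensor K H H AB AB"
        by (rule tlift_sub_tensor_mem[OF C C B.sub_carrier B.sub_carrier T _ W _ B.comult_sub[OF b]])
          ((use a12 in \<open>intro mlin; simp\<close>)[1], intro pure_in_sub_tensor[OF C C AB_carrier AB_carrier] mult_in_span_prod a12)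
    qed
    finally show "comult H (a \<otimes>\<^bsub>H\<^esub> b) \<in> sub_tensor K H H AB AB" .
  qed simp
qed

theorem hopf_subalgebra_AB: "hopf_subalgebra K H AB"
  unfolding hopf_subalgebra_def
proof (intro conjI ballI submodule_AB comult_AB antipode_AB)
  show "subring AB H"
    using submoduleE[OF submodule_AB] AB_mult A_sub_AB[OF A.sub_one] by (intro M.subringI) auto
qed

sublocale T: hopf_sub K H AB
  by unfold_locales (rule hopf_subalgebra_AB)

text \<open>
  The ideal property comes from \<open>B A \<subseteq> A B\<close> and \<open>B\<^sup>+ A \<subseteq> A B\<^sup>+\<close>. For the coideal property
  let \<open>b \<in> B\<^sup>+\<close> and split \<open>b\<^sub>1 = (b\<^sub>1 - \<epsilon>(b\<^sub>1) 1) + \<epsilon>(b\<^sub>1) 1\<close> in \<open>\<Delta>(a b) = a\<^sub>1 b\<^sub>1 \<otimes> a\<^sub>2 b\<^sub>2\<close>. The first part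
  gives a sum of elements of \<open>A B\<^sup>+ \<otimes> A B\<close>, the second one gives \<open>a\<^sub>1 \<otimes> a\<^sub>2 b\<close>, which lies in
  \<open>A \<otimes> A B\<^sup>+\<close>.
\<close>
theorem hopf_ideal_J: "hopf_ideal K T.HA J"
proof -
  note C = module_C and TA = T.module_HA
  let ?Q = "tensor_prod K T.HA T.HA"
  have JT: "submodule J K T.HA"
    using submoduleE[OF submodule_J] submodule_zero[OF submodule_J] J_sub_AB
  proof (intro module.submoduleI[OF TA])
    show "\<ominus>\<^bsub>T.HA\<^esub> a \<in> J" if "a \<in> J" for a
      using linear_minus[OF T.linear_incl TA C, of a] that submoduleE(3)[OF submodule_J] J_sub_AB by auto
  qed auto
  have id: "ideal J T.HA"
  proof (rule idealI[OF T.ring_HA])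
    show "subgroup J (add_monoid T.HA)" by (rule submodule.axioms(1)[OF JT])
  qed (use AB_mult_J J_mult_AB in auto)
  let ?W = "sub_tensor K T.HA T.HA J AB <+>\<^bsub>?Q\<^esub> sub_tensor K T.HA T.HA AB J"
  have JA: "J \<subseteq> carrier T.HA" "AB \<subseteq> carrier T.HA" using J_sub_AB by auto
  have s1: "submodule (sub_tensor K T.HA T.HA J AB) K ?Q"
    by (rule submodule_sub_tensor[OF TA TA JA]) (use submoduleE(4)[OF submodule_J] in simp)
  have s2: "submodule (sub_tensor K T.HA T.HA AB J) K ?Q"
    by (rule submodule_sub_tensor[OF TA TA JA(2,1)]) simp
  have Q: "module K ?Q" by simp
  have W: "submodule ?W K ?Q" by (rule submodule_set_add[OF Q s1 s2])
  have W1: "pure_tensor K T.HA T.HA x y \<in> ?W" if "x \<in> J" "y \<in> AB" for x y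
    using subset_set_add(1)[OF Q s1 s2] pure_in_sub_tensor[OF TA TA JA that] by blast
  have W2: "pure_tensor K T.HA T.HA x y \<in> ?W" if "x \<in> AB" "y \<in> J" for x y
    using subset_set_add(2)[OF Q s1 s2] pure_in_sub_tensor[OF TA TA JA(2,1) that] by blast
  obtain p where p: "p\<in>linear_maps K H T.HA" and pi: "\<forall>a\<in>AB. p a = a" using T.exists_projection_HA by (elim bexE)
  have pi [simp]: "p x = x" if "x \<in> AB" for x using pi that by blast
  have pc [simp]: "p x \<in> AB" if "x \<in> carrier H" for x using linear_closed[OF p that] by simp
  note lp = linear_comp[OF p]
  have com: "comult T.HA x \<in> ?W" if x: "x \<in> J" for x
  proof -
    have "comult T.HA x = tensor_map K T.HA T.HA p p (comult H x)"
      by (rule T.comult_restrict(1)[OF p pi]) (use x J_sub_AB in auto)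
    moreover have "tensor_map K T.HA T.HA p p (comult H x) \<in> ?W"
    proof (rule linear_span_prod_mem[OF linear_comp[OF linear_tensor_map(1)[OF C C TA TA p p] comult_linear] Q W A.sub_carrier Bp_carrier _ x])
      fix a b assume a: "a \<in> A" and b: "b \<in> Bp"
      have ac: "a \<in> carrier H" and bB: "b \<in> B" and bc: "b \<in> carrier H" using a b Bp_sub by auto
      let ?\<phi> = "\<lambda>m n. pure_tensor K T.HA T.HA (p m) (p n)"
      let ?e = "\<lambda>b1. b1 \<ominus>\<^bsub>H\<^esub> counit H b1 \<odot>\<^bsub>H\<^esub> \<one>\<^bsub>H\<^esub>"
      have le: "?e \<in> linear_maps K H H"
        by (rule linear_difference[OF C linear_id]) (intro mlin; simp)
      have "tensor_map K T.HA T.HA p p (comult H (a \<otimes>\<^bsub>H\<^esub> b)) =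
         tlift ?Q (\<lambda>a1 a2. tlift ?Q (\<lambda>b1 b2. ?\<phi> (a1 \<otimes>\<^bsub>H\<^esub> b1) (a2 \<otimes>\<^bsub>H\<^esub> b2)) (comult H b)) (comult H a)"
        unfolding tensor_map_lift
        by (rule tlift_comult_mult[OF Q bilinear_tensor_map[OF TA TA p p] ac bc])
      also have "\<dots> \<in> ?W"
      proof (rule tlift_sub_tensor_mem[OF C C A.sub_carrier A.sub_carrier Q _ W _ A.comult_sub[OF a]])
        show "bilinear_map K H H ?Q (\<lambda>a1 a2. tlift ?Q (\<lambda>b1 b2. ?\<phi> (a1 \<otimes>\<^bsub>H\<^esub> b1) (a2 \<otimes>\<^bsub>H\<^esub> b2)) (comult H b))"
          using bc by (intro mlin lp; simp)
        fix a1 a2 assume a12: "a1 \<in> A" "a2 \<in> A"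
        let ?\<phi>1 = "\<lambda>b1 b2. ?\<phi> (a1 \<otimes>\<^bsub>H\<^esub> ?e b1) (a2 \<otimes>\<^bsub>H\<^esub> b2)"
        let ?\<phi>2 = "\<lambda>b1 b2. counit H b1 \<odot>\<^bsub>?Q\<^esub> ?\<phi> a1 (a2 \<otimes>\<^bsub>H\<^esub> b2)"
        have b1: "bilinear_map K H H ?Q ?\<phi>1"
          using a12 linear_closed[OF le] by (intro mlin lp le; simp)
        have l2: "(\<lambda>b2. ?\<phi> a1 (a2 \<otimes>\<^bsub>H\<^esub> b2)) \<in> linear_maps K H ?Q"
          using a12 by (intro mlin lp; simp)
        have b2: "bilinear_map K H H ?Q ?\<phi>2"
          by (rule bilinear_counit_left[OF Q l2])
        have "tlift ?Q (\<lambda>b1 b2. ?\<phi> (a1 \<otimes>\<^bsub>H\<^esub> b1) (a2 \<otimes>\<^bsub>H\<^esub> b2)) (comult H b) = tlift ?Q (\<lambda>m n. ?\<phi>1 m n \<oplus>\<^bsub>?Q\<^esub> ?\<phi>2 m n) (comult H b)"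
        proof (rule lift_cong[OF C C comult_closed[OF bc]])
          fix m n assume mn: "m \<in> carrier H" "n \<in> carrier H"
          have l: "(\<lambda>z. ?\<phi> (a1 \<otimes>\<^bsub>H\<^esub> z) (a2 \<otimes>\<^bsub>H\<^esub> n)) \<in> linear_maps K H ?Q"
            using a12 mn by (intro mlin lp; simp)
          have "m = ?e m \<oplus>\<^bsub>H\<^esub> counit H m \<odot>\<^bsub>H\<^esub> \<one>\<^bsub>H\<^esub>"
            using mn by (simp add: a_minus_def M.a_assoc M.l_neg)
          then have "?\<phi> (a1 \<otimes>\<^bsub>H\<^esub> m) (a2 \<otimes>\<^bsub>H\<^esub> n) = ?\<phi> (a1 \<otimes>\<^bsub>H\<^esub> (?e m \<oplus>\<^bsub>H\<^esub> counit H m \<odot>\<^bsub>H\<^esub> \<one>\<^bsub>H\<^esub>)) (a2 \<otimes>\<^bsub>H\<^esub> n)"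
            by simp
          also have "\<dots> = ?\<phi>1 m n \<oplus>\<^bsub>?Q\<^esub> counit H m \<odot>\<^bsub>?Q\<^esub> ?\<phi> (a1 \<otimes>\<^bsub>H\<^esub> \<one>\<^bsub>H\<^esub>) (a2 \<otimes>\<^bsub>H\<^esub> n)"
            using mn linear_closed[OF le mn(1)] linear_add[OF l, of "?e m" "counit H m \<odot>\<^bsub>H\<^esub> \<one>\<^bsub>H\<^esub>"] linear_smult[OF l, of "counit H m" "\<one>\<^bsub>H\<^esub>"]
            by simp
          finally show "?\<phi> (a1 \<otimes>\<^bsub>H\<^esub> m) (a2 \<otimes>\<^bsub>H\<^esub> n) = ?\<phi>1 m n \<oplus>\<^bsub>?Q\<^esub> ?\<phi>2 m n"
            using a12 by simp
        qed
        also have "\<dots> = tlift ?Q ?\<phi>1 (comult H b) \<oplus>\<^bsub>?Q\<^esub> tlift ?Q ?\<phi>2 (comult H b)"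
          by (rule tlift_add[OF C C Q b1 b2 comult_closed[OF bc]])
        also have "tlift ?Q ?\<phi>2 (comult H b) = ?\<phi> a1 (a2 \<otimes>\<^bsub>H\<^esub> b)"
          by (rule tlift_counit_left[OF Q l2 bc])
        also have "tlift ?Q ?\<phi>1 (comult H b) \<oplus>\<^bsub>?Q\<^esub> ?\<phi> a1 (a2 \<otimes>\<^bsub>H\<^esub> b) \<in> ?W"
        proof (rule module.submoduleE(5)[OF Q W])
          show "tlift ?Q ?\<phi>1 (comult H b) \<in> ?W"
          proof (rule tlift_sub_tensor_mem[OF C C B.sub_carrier B.sub_carrier Q b1 W _ B.comult_sub[OF bB]])
            fix u v assume uv: "u \<in> B" "v \<in> B"
            have "a1 \<otimes>\<^bsub>H\<^esub> ?e u \<in> J" by (rule mult_in_span_prod[OF a12(1) B.minus_counit_in_augmentation[OF uv(1)]])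
            moreover have "a2 \<otimes>\<^bsub>H\<^esub> v \<in> AB" by (rule mult_in_span_prod[OF a12(2) uv(2)])
            ultimately show "?\<phi>1 u v \<in> ?W" using W1 J_sub_AB by auto
          qed
          have "a2 \<otimes>\<^bsub>H\<^esub> b \<in> J" by (rule mult_in_span_prod[OF a12(2) b])
          then show "?\<phi> a1 (a2 \<otimes>\<^bsub>H\<^esub> b) \<in> ?W" using W2 A_sub_AB[OF a12(1)] J_sub_AB by auto
        qed
        finally show "tlift ?Q (\<lambda>b1 b2. ?\<phi> (a1 \<otimes>\<^bsub>H\<^esub> b1) (a2 \<otimes>\<^bsub>H\<^esub> b2)) (comult H b) \<in> ?W" .
      qed
      finally show "tensor_map K T.HA T.HA p p (comult H (a \<otimes>\<^bsub>H\<^esub> b)) \<in> ?W" .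
    qed
    ultimately show ?thesis by simp
  qed
  show ?thesis
    unfolding hopf_ideal_def using id JT com counit_J antipode_J by simp
qed

end

section \<open>The intersection of two Hopf subalgebras\<close>

lemma (in hopf_normal) hopf_subalgebra_Int: "hopf_subalgebra K H (A \<inter> B)"
  unfolding hopf_subalgebra_def
proof (intro conjI ballI)
  show "submodule (A \<inter> B) K H" by (rule submodule_Int[OF module_C A.sub_mod B.sub_mod])
  then show "subring (A \<inter> B) H"
    using submoduleE[of "A \<inter> B"] by (intro M.subringI) auto
  show "comult H a \<in> sub_tensor K H H (A \<inter> B) (A \<inter> B)" if "a \<in> A \<inter> B" for a
    using sub_tensor_Int[OF R.field_axioms module_C A.sub_mod B.sub_mod A.comult_sub B.comult_sub] that by blast
qed auto

text \<open>
  \<open>S(a\<^sub>1) b a\<^sub>2\<close> lies in \<open>A\<close> for \<open>a, b \<in> A\<close>. So the results on \<open>A\<close> and \<open>B\<close> apply to \<open>A\<close> and \<open>A \<inter> B\<close>, and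
  the product of these two is \<open>A\<close>.
\<close>
lemma (in hopf_normal) hopf_normal_Int: "hopf_normal K H A (A \<inter> B)"
proof (unfold_locales)
  show "hopf_subalgebra K H (A \<inter> B)" by (rule hopf_subalgebra_Int)
  show "right_normalizes H A (A \<inter> B)"
    unfolding right_normalizes_def tlift_def[symmetric]
  proof (intro ballI IntI)
    fix a b assume a: "a \<in> A" and b: "b \<in> A \<inter> B"
    then show "adj a b \<in> B" using adj_mem by blast
    show "adj a b \<in> A"
      by (rule tlift_sub_tensor_mem[OF module_C module_C A.sub_carrier A.sub_carrier module_C _ A.sub_mod _ A.comult_sub[OF a]])
       ((use b in \<open>intro mlin; simp\<close>)[1], use b in simp)
  qed
qed

lemma (in hopf_normal) span_prod_Int: "span_prod K H A (A \<inter> B) = A"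
proof
  show "span_prod K H A (A \<inter> B) \<subseteq> A" by (rule span_prod_least[OF A.sub_mod]) auto
  show "A \<subseteq> span_prod K H A (A \<inter> B)"
    using mult_in_span_prod[of _ A "\<one>\<^bsub>H\<^esub>" "A \<inter> B"] by fastforce
qed

section \<open>Coactions\<close>

text \<open>
  A coalgebra map \<open>f : E \<rightarrow> C\<close> makes \<open>E\<close> a left \<open>C\<close>-comodule with the coaction \<open>(f \<otimes> id) \<Delta>\<close>. It is read
  through a linear bijection \<open>e\<close> of \<open>E\<close> with a module \<open>M\<close> whose elements may have another type.
\<close>
lemma induced_left_comodule:
  assumes E: "coalgebra K E" and C: "coalgebra K C" and f: "f \<in> linear_maps K E C"
    and fc: "\<And>x. x \<in> carrier E \<Longrightarrow> comult C (f x) = tensor_map K C C f f (comult E x)"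
    and fe: "\<And>x. x \<in> carrier E \<Longrightarrow> counit C (f x) = counit E x"
    and M: "module K M" and e: "e \<in> linear_maps K E M" and e': "e' \<in> linear_maps K M E"
    and ee': "\<And>m. m \<in> carrier M \<Longrightarrow> e (e' m) = m" and e'e: "\<And>x. x \<in> carrier E \<Longrightarrow> e' (e x) = x"
  shows "left_comodule K C M (\<lambda>m. tensor_map K C M f e (comult E (e' m)))"
proof -
  interpret E: coalgebra K E by fact
  interpret C: coalgebra K C by fact
  note mE = E.module_C and mC = C.module_C
  let ?\<rho> = "\<lambda>m. tensor_map K C M f e (comult E (e' m))"
  have T: "module K (tensor_prod K C (tensor_prod K C M))" using mC M by simp
  let ?T = "tensor_prod K C (tensor_prod K C M)"
  let ?\<tau> = "\<lambda>x y z. pure_tensor K C (tensor_prod K C M) x (pure_tensor K C M y z)"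
  have \<rho>: "?\<rho> \<in> linear_maps K M (tensor_prod K C M)"
    by (intro linear_comp[OF linear_tensor_map(1)[OF mE mE mC M f e]] linear_comp[OF E.comult_linear e'])
  note lf = linear_comp[OF f] and le = linear_comp[OF e]
  note fcl = linear_closed[OF f] and ecl = linear_closed[OF e]
  have tri: "trilinear_map K C C M ?T ?\<tau>" by (rule trilinear_pure[OF mC mC M])
  have tri': "trilinear_map K E E E ?T (\<lambda>x y z. ?\<tau> (f x) (f y) (e z))"
    using M by (intro mlin lf le; simp add: fcl ecl mC)
  show ?thesis
    unfolding left_comodule_def
  proof (intro conjI ballI M \<rho>)
    fix m assume m: "m \<in> carrier M"
    let ?x = "e' m"
    have x: "?x \<in> carrier E" using e' m by (rule linear_closed)
    have \<rho>m: "?\<rho> m \<in> carrier (tensor_prod K C M)" by (rule linear_closed[OF \<rho> m])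
    have bl: "bilinear_map K C M ?T (\<lambda>v m. tlift ?T (\<lambda>x c. ?\<tau> x c m) (comult C v))"
      using bilinear_left_comp[OF bilinear_tlift_left[OF mC mC M T tri] C.comult_linear] bilinear_right[OF bilinear_tlift_left[OF mC mC M T tri] C.comult_closed]
      by (intro bilinearI) auto
    have br: "bilinear_map K C M ?T (\<lambda>v m. tlift ?T (?\<tau> v) (?\<rho> m))"
      using bilinear_right_comp[OF bilinear_tlift_right[OF mC mC M T tri] \<rho>] bilinear_left[OF bilinear_tlift_right[OF mC mC M T tri] linear_closed[OF \<rho>]]
      by (intro bilinearI) auto
    have "tensor_assoc K C C M (tensor_map K (tensor_prod K C C) M (comult C) (\<lambda>x. x) (?\<rho> m))
      = tlift ?T (\<lambda>v m. tlift ?T (\<lambda>x c. ?\<tau> x c m) (comult C v)) (?\<rho> m)"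
      by (rule assoc_coaction_tlift[OF mC mC M C.comult_linear mC \<rho>m])
    also have "\<dots> = tlift ?T (\<lambda>y z. tlift ?T (\<lambda>x c. ?\<tau> x c (e z)) (comult C (f y))) (comult E ?x)"
      by (rule lift_tensor_map[OF mE mE mC M T f e bl E.comult_closed[OF x]])
    also have "\<dots> = tlift ?T (\<lambda>y z. tlift ?T (\<lambda>u v. ?\<tau> (f u) (f v) (e z)) (comult E y)) (comult E ?x)"
    proof (rule lift_cong[OF mE mE E.comult_closed[OF x]])
      show "tlift ?T (\<lambda>x c. ?\<tau> x c (e z)) (comult C (f y)) = tlift ?T (\<lambda>u v. ?\<tau> (f u) (f v) (e z)) (comult E y)"
        if "y \<in> carrier E" "z \<in> carrier E" for y z
        unfolding fc[OF that(1)]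
        by (rule lift_tensor_map[OF mE mE mC mC T f f trilinearD(3)[OF tri ecl[OF that(2)]] E.comult_closed[OF that(1)]])
    qed
    also have "\<dots> = tlift ?T (\<lambda>y z. tlift ?T (\<lambda>u v. ?\<tau> (f y) (f u) (e v)) (comult E z)) (comult E ?x)"
      by (rule E.tlift_coassoc[OF T tri' x])
    also have "\<dots> = tlift ?T (\<lambda>y z. tlift ?T (?\<tau> (f y)) (?\<rho> (e z))) (comult E ?x)"
    proof (rule lift_cong[OF mE mE E.comult_closed[OF x], symmetric])
      show "tlift ?T (?\<tau> (f y)) (?\<rho> (e z)) = tlift ?T (\<lambda>u v. ?\<tau> (f y) (f u) (e v)) (comult E z)"
        if "y \<in> carrier E" "z \<in> carrier E" for y z
        unfolding e'e[OF that(2)]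
        by (rule lift_tensor_map[OF mE mE mC M T f e trilinearD(1)[OF tri fcl[OF that(1)]] E.comult_closed[OF that(2)]])
    qed
    also have "\<dots> = tlift ?T (\<lambda>v m. tlift ?T (?\<tau> v) (?\<rho> m)) (?\<rho> m)"
      by (rule lift_tensor_map[OF mE mE mC M T f e br E.comult_closed[OF x], symmetric])
    also have "\<dots> = tensor_map K C (tensor_prod K C M) (\<lambda>c. c) ?\<rho> (?\<rho> m)"
      by (rule tensor_map_coaction_tlift[OF mC mC M M \<rho> \<rho>m, symmetric])
    finally show "tensor_assoc K C C M (tensor_map K (tensor_prod K C C) M (comult C) (\<lambda>x. x) (?\<rho> m))
       = tensor_map K C (tensor_prod K C M) (\<lambda>c. c) ?\<rho> (?\<rho> m)" .
    have bc: "bilinear_map K C M M (\<lambda>c x. counit C c \<odot>\<^bsub>M\<^esub> x)"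
      by (intro bilinearI C.linear_counit_smult M linear_smult_left linear_id C.counit_closed)
    have "tlift M (\<lambda>c x. counit C c \<odot>\<^bsub>M\<^esub> x) (?\<rho> m) = tlift M (\<lambda>y z. counit C (f y) \<odot>\<^bsub>M\<^esub> e z) (comult E ?x)"
      by (rule lift_tensor_map[OF mE mE mC M M f e bc E.comult_closed[OF x]])
    also have "\<dots> = tlift M (\<lambda>y z. counit E y \<odot>\<^bsub>M\<^esub> e z) (comult E ?x)"
      by (rule lift_cong[OF mE mE E.comult_closed[OF x], symmetric]) (simp add: fe)
    also have "\<dots> = m" using E.tlift_counit_left[OF M e x] ee'[OF m] by simp
    finally show "tensor_lift (add_monoid M) (\<lambda>c x. counit C c \<odot>\<^bsub>M\<^esub> x) (?\<rho> m) = m" by (simp add: tlift_def)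
  qed
qed

text \<open>
  A coalgebra map \<open>g : E \<rightarrow> E2\<close> over \<open>C\<close> is a map of the induced comodules, again read through the
  bijections \<open>e\<close> and \<open>e2\<close> with the modules \<open>M\<close> and \<open>M2\<close>.
\<close>
lemma induced_left_comodule_hom:
  assumes E: "coalgebra K E" and E2: "coalgebra K E2" and C: "module K C"
    and f: "f \<in> linear_maps K E C" and f2: "f2 \<in> linear_maps K E2 C" and g: "g \<in> linear_maps K E E2"
    and gc: "\<And>x. x \<in> carrier E \<Longrightarrow> comult E2 (g x) = tensor_map K E2 E2 g g (comult E x)"
    and fg: "\<And>x. x \<in> carrier E \<Longrightarrow> f2 (g x) = f x"
    and M: "module K M" and M2: "module K M2"
    and e: "e \<in> linear_maps K E M" and e': "e' \<in> linear_maps K M E" and e2: "e2 \<in> linear_maps K E2 M2"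
    and e'e: "\<And>x. x \<in> carrier E \<Longrightarrow> e' (e x) = x" and e2'e2: "\<And>x. x \<in> carrier E2 \<Longrightarrow> e2' (e2 x) = x"
  shows "(\<lambda>m. e2 (g (e' m))) \<in> left_comodule_hom K C M (\<lambda>m. tensor_map K C M f e (comult E (e' m)))
     M2 (\<lambda>m. tensor_map K C M2 f2 e2 (comult E2 (e2' m)))"
  unfolding left_comodule_hom_def
proof (intro CollectI conjI ballI)
  interpret E: coalgebra K E by fact
  interpret E2: coalgebra K E2 by fact
  note mE = E.module_C and mE2 = E2.module_C
  note id = linear_id[where K = K and M = C]
  have h: "(\<lambda>m. e2 (g (e' m))) \<in> linear_maps K M M2" by (intro linear_comp[OF e2] linear_comp[OF g] e')
  show "(\<lambda>m. e2 (g (e' m))) \<in> linear_maps K M M2" by (rule h)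
  fix m assume m: "m \<in> carrier M"
  have x: "e' m \<in> carrier E" using e' m by (rule linear_closed)
  have gx: "g (e' m) \<in> carrier E2" using g x by (rule linear_closed)
  have D: "comult E (e' m) \<in> carrier (tensor_prod K E E)" by (rule E.comult_closed[OF x])
  have "tensor_map K C M2 f2 e2 (comult E2 (e2' (e2 (g (e' m))))) = tensor_map K C M2 f2 e2 (tensor_map K E2 E2 g g (comult E (e' m)))"
    by (simp add: e2'e2 gx gc x)
  also have "\<dots> = tensor_map K C M2 (\<lambda>x. f2 (g x)) (\<lambda>x. e2 (g x)) (comult E (e' m))"
    by (rule tensor_map_comp[OF mE mE mE2 mE2 C M2 g g f2 e2 D])
  also have "\<dots> = tensor_map K C M2 (\<lambda>x. f x) (\<lambda>x. e2 (g (e' (e x)))) (comult E (e' m))"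
    by (rule tensor_map_cong[OF mE mE C M2 linear_comp[OF f2 g] linear_comp[OF e2 g] _ _ D]) (simp_all add: fg e'e)
  also have "\<dots> = tensor_map K C M2 (\<lambda>c. c) (\<lambda>m. e2 (g (e' m))) (tensor_map K C M f e (comult E (e' m)))"
    by (rule tensor_map_comp[OF mE mE C M C M2 f e id h D, symmetric])
  finally show "tensor_map K C M2 f2 e2 (comult E2 (e2' (e2 (g (e' m))))) =
     tensor_map K C M2 (\<lambda>c. c) (\<lambda>m. e2 (g (e' m))) (tensor_map K C M f e (comult E (e' m)))" .
qed

text \<open>
  A surjective linear map that is compatible with the operations carries the coalgebra axioms over to
  its target. In particular the linearity of the comultiplication of \<open>C\<close> is a consequence.
\<close>
lemma coalgebra_image:
  assumes E: "coalgebra K E" and C: "module K C" and f: "f \<in> linear_maps K E C" and surj: "carrier C = f ` carrier E"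
    and fc: "\<And>x. x \<in> carrier E \<Longrightarrow> comult C (f x) = tensor_map K C C f f (comult E x)"
    and fe: "\<And>x. x \<in> carrier E \<Longrightarrow> counit C (f x) = counit E x"
  shows "coalgebra K C"
proof -
  interpret E: coalgebra K E by fact
  interpret C: module K C by fact
  note mE = E.module_C
  have T: "module K (tensor_prod K C (tensor_prod K C C))" using C by simp
  let ?T = "tensor_prod K C (tensor_prod K C C)"
  let ?\<tau> = "\<lambda>x y z. pure_tensor K C (tensor_prod K C C) x (pure_tensor K C C y z)"
  note fcl = linear_closed[OF f] and lf = linear_comp[OF f]
  have tri: "trilinear_map K C C C ?T ?\<tau>" by (rule trilinear_pure[OF C C C])
  have tri': "trilinear_map K E E E ?T (\<lambda>x y z. ?\<tau> (f x) (f y) (f z))"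
    by (intro mlin lf; simp add: fcl C)
  have ff: "tensor_map K C C f f \<in> linear_maps K (tensor_prod K E E) (tensor_prod K C C)"
    by (rule linear_tensor_map(1)[OF mE mE C C f f])
  have D: "comult C \<in> linear_maps K C (tensor_prod K C C)"
  proof (rule linearI)
    show "comult C X \<in> carrier (tensor_prod K C C)" if "X \<in> carrier C" for X
      using that linear_closed[OF ff] by (auto simp: surj fc)
    show "comult C (X \<oplus>\<^bsub>C\<^esub> Y) = comult C X \<oplus>\<^bsub>tensor_prod K C C\<^esub> comult C Y" if XY: "X \<in> carrier C" "Y \<in> carrier C" for X Y
    proof -
      obtain x y where xy: "x \<in> carrier E" "X = f x" "y \<in> carrier E" "Y = f y" using XY unfolding surj by (elim imageE) blast
      have "comult C (f (x \<oplus>\<^bsub>E\<^esub> y)) = comult C (f x) \<oplus>\<^bsub>tensor_prod K C C\<^esub> comult C (f y)"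
        using xy by (simp add: fc linear_add[OF E.comult_linear] linear_add[OF ff])
      then show ?thesis using xy by (simp add: linear_add[OF f])
    qed
    show "comult C (r \<odot>\<^bsub>C\<^esub> X) = r \<odot>\<^bsub>tensor_prod K C C\<^esub> comult C X" if r: "r \<in> carrier K" and X: "X \<in> carrier C" for r X
    proof -
      obtain x where x: "x \<in> carrier E" "X = f x" using X unfolding surj by (elim imageE) blast
      have "comult C (f (r \<odot>\<^bsub>E\<^esub> x)) = r \<odot>\<^bsub>tensor_prod K C C\<^esub> comult C (f x)"
        using x r by (simp add: fc linear_smult[OF E.comult_linear] linear_smult[OF ff])
      then show ?thesis using x r by (simp add: linear_smult[OF f])
    qed
  qed
  have Q: "tlift P \<phi> (comult C (f x)) = tlift P (\<lambda>y z. \<phi> (f y) (f z)) (comult E x)"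
    if "module K P" "bilinear_map K C C P \<phi>" "x \<in> carrier E" for P \<phi> x
    unfolding fc[OF that(3)] by (rule lift_tensor_map[OF mE mE C C that(1) f f that(2) E.comult_closed[OF that(3)]])
  have co: "tensor_assoc K C C C (tensor_map K (tensor_prod K C C) C (comult C) (\<lambda>y. y) (comult C (f x)))
    = tensor_map K C (tensor_prod K C C) (\<lambda>y. y) (comult C) (comult C (f x))" if x: "x \<in> carrier E" for x
  proof -
    have Dx: "comult C (f x) \<in> carrier (tensor_prod K C C)" by (rule linear_closed[OF D fcl[OF x]])
    have bl: "bilinear_map K C C ?T (\<lambda>v m. tlift ?T (\<lambda>x c. ?\<tau> x c m) (comult C v))"
      using bilinear_left_comp[OF bilinear_tlift_left[OF C C C T tri] D] bilinear_right[OF bilinear_tlift_left[OF C C C T tri] linear_closed[OF D]]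
      by (intro bilinearI) auto
    have br: "bilinear_map K C C ?T (\<lambda>v m. tlift ?T (?\<tau> v) (comult C m))"
      using bilinear_right_comp[OF bilinear_tlift_right[OF C C C T tri] D] bilinear_left[OF bilinear_tlift_right[OF C C C T tri] linear_closed[OF D]]
      by (intro bilinearI) auto
    have "tensor_assoc K C C C (tensor_map K (tensor_prod K C C) C (comult C) (\<lambda>y. y) (comult C (f x)))
      = tlift ?T (\<lambda>v m. tlift ?T (\<lambda>x c. ?\<tau> x c m) (comult C v)) (comult C (f x))"
      by (rule assoc_coaction_tlift[OF C C C D C Dx])
    also have "\<dots> = tlift ?T (\<lambda>y z. tlift ?T (\<lambda>x c. ?\<tau> x c (f z)) (comult C (f y))) (comult E x)"
      by (rule Q[OF T bl x])
    also have "\<dots> = tlift ?T (\<lambda>y z. tlift ?T (\<lambda>u v. ?\<tau> (f u) (f v) (f z)) (comult E y)) (comult E x)"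
      by (rule lift_cong[OF mE mE E.comult_closed[OF x]]) (rule Q[OF T trilinearD(3)[OF tri fcl]])
    also have "\<dots> = tlift ?T (\<lambda>y z. tlift ?T (\<lambda>u v. ?\<tau> (f y) (f u) (f v)) (comult E z)) (comult E x)"
      by (rule E.tlift_coassoc[OF T tri' x])
    also have "\<dots> = tlift ?T (\<lambda>y z. tlift ?T (?\<tau> (f y)) (comult C (f z))) (comult E x)"
      by (rule lift_cong[OF mE mE E.comult_closed[OF x], symmetric]) (rule Q[OF T trilinearD(1)[OF tri fcl]])
    also have "\<dots> = tlift ?T (\<lambda>v m. tlift ?T (?\<tau> v) (comult C m)) (comult C (f x))"
      by (rule Q[OF T br x, symmetric])
    also have "\<dots> = tensor_map K C (tensor_prod K C C) (\<lambda>c. c) (comult C) (comult C (f x))"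
      by (rule tensor_map_coaction_tlift[OF C C C C D Dx, symmetric])
    finally show ?thesis .
  qed
  have ca: "counit C (X \<oplus>\<^bsub>C\<^esub> Y) = counit C X \<oplus>\<^bsub>K\<^esub> counit C Y" if XY: "X \<in> carrier C" "Y \<in> carrier C" for X Y
  proof -
    obtain x y where xy: "x \<in> carrier E" "X = f x" "y \<in> carrier E" "Y = f y" using XY unfolding surj by (elim imageE) blast
    then show ?thesis using fe[of "x \<oplus>\<^bsub>E\<^esub> y"] by (simp add: linear_add[OF f] fe E.counit_add)
  qed
  have cs: "counit C (k \<odot>\<^bsub>C\<^esub> X) = k \<otimes>\<^bsub>K\<^esub> counit C X" if kX: "k \<in> carrier K" "X \<in> carrier C" for k X
  proof -
    obtain x where x: "x \<in> carrier E" "X = f x" using kX(2) unfolding surj by (elim imageE) blast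
    then show ?thesis using fe[of "k \<odot>\<^bsub>E\<^esub> x"] kX by (simp add: linear_smult[OF f] fe E.counit_smult)
  qed
  have cc: "counit C X \<in> carrier K" if "X \<in> carrier C" for X
    using that by (auto simp: surj fe)
  have b1: "bilinear_map K C C C (\<lambda>y z. counit C y \<odot>\<^bsub>C\<^esub> z)" and b2: "bilinear_map K C C C (\<lambda>y z. counit C z \<odot>\<^bsub>C\<^esub> y)"
    by (intro bilinearI linear_smult_scalar[OF C] linear_smult_left[OF C linear_id]; simp add: ca cs cc)+
  have cl: "tlift C (\<lambda>y z. counit C y \<odot>\<^bsub>C\<^esub> z) (comult C (f x)) = f x"
    and cr: "tlift C (\<lambda>y z. counit C z \<odot>\<^bsub>C\<^esub> y) (comult C (f x)) = f x" if x: "x \<in> carrier E" for x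
  proof -
    have "tlift C (\<lambda>y z. counit C (f y) \<odot>\<^bsub>C\<^esub> f z) (comult E x) = tlift C (\<lambda>y z. counit E y \<odot>\<^bsub>C\<^esub> f z) (comult E x)"
      by (rule lift_cong[OF mE mE E.comult_closed[OF x], symmetric]) (simp add: fe)
    then show "tlift C (\<lambda>y z. counit C y \<odot>\<^bsub>C\<^esub> z) (comult C (f x)) = f x"
      using Q[OF C b1 x] E.tlift_counit_left[OF C f x] by simp
    have "tlift C (\<lambda>y z. counit C (f z) \<odot>\<^bsub>C\<^esub> f y) (comult E x) = tlift C (\<lambda>y z. counit E z \<odot>\<^bsub>C\<^esub> f y) (comult E x)"
      by (rule lift_cong[OF mE mE E.comult_closed[OF x], symmetric]) (simp add: fe)
    then show "tlift C (\<lambda>y z. counit C z \<odot>\<^bsub>C\<^esub> y) (comult C (f x)) = f x"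
      using Q[OF C b2 x] E.tlift_counit_right[OF C f x] by simp
  qed
  show ?thesis
  proof (intro coalgebra.intro coalgebra_axioms.intro E.R.field_axioms C D cc ca cs)
    fix X assume "X \<in> carrier C"
    then obtain x where x: "x \<in> carrier E" "X = f x" unfolding surj by (elim imageE) blast
    show "tensor_assoc K C C C (tensor_map K (tensor_prod K C C) C (comult C) (\<lambda>y. y) (comult C X))
      = tensor_map K C (tensor_prod K C C) (\<lambda>y. y) (comult C) (comult C X)" using co x by simp
    show "tensor_lift (add_monoid C) (\<lambda>y z. counit C y \<odot>\<^bsub>C\<^esub> z) (comult C X) = X" using cl x by (simp add: tlift_def)
    show "tensor_lift (add_monoid C) (\<lambda>y z. counit C z \<odot>\<^bsub>C\<^esub> y) (comult C X) = X" using cr x by (simp add: tlift_def)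
  qed
qed

section \<open>Quotients by Hopf ideals\<close>

locale hopf_quotient = hopf_algebra K G for K :: "('k, 'w) ring_scheme" and G :: "('k, 'h) hopf_alg" +
  fixes I :: "'h set"
  assumes hopf_ideal: "hopf_ideal K G I"
begin

abbreviation "Q \<equiv> hopf_quot K G I"
abbreviation "proj \<equiv> a_r_coset G I"

lemma ideal_I: "ideal I G" and submodule_I: "submodule I K G"
  and counit_I: "x \<in> I \<Longrightarrow> counit G x = \<zero>\<^bsub>K\<^esub>" and antipode_I: "x \<in> I \<Longrightarrow> antipode G x \<in> I"
  using hopf_ideal by (simp_all add: hopf_ideal_def)

lemma comult_I: "x \<in> I \<Longrightarrow> comult G x \<in>
        sub_tensor K G G I (carrier G) <+>\<^bsub>tensor_prod K G G\<^esub> sub_tensor K G G (carrier G) I"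
  using hopf_ideal by (simp add: hopf_ideal_def)

sublocale I: ideal I G by (rule ideal_I)

lemma I_carrier: "I \<subseteq> carrier G" by (rule submoduleE(1)[OF submodule_I])

lemma carrier_Q: "carrier Q = proj ` carrier G"
  by (auto simp: hopf_quot_def quot_module_def FactRing_def A_RCOSETS_def')

lemma proj_closed [simp]: "x \<in> carrier G \<Longrightarrow> proj x \<in> carrier Q"
  by (simp add: carrier_Q)

lemma quot_module_simps: "carrier (quot_module G I) = carrier Q" "add (quot_module G I) = add Q" "zero (quot_module G I) = zero Q"
    "smult (quot_module G I) = smult Q" "mult (quot_module G I) = mult Q" "one (quot_module G I) = one Q"
  by (simp_all add: hopf_quot_def)

lemma proj_add: "x \<in> carrier G \<Longrightarrow> y \<in> carrier G \<Longrightarrow> proj (x \<oplus>\<^bsub>G\<^esub> y) = proj x \<oplus>\<^bsub>Q\<^esub> proj y"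
  using ring_hom_add[OF I.rcos_ring_hom] by (simp add: hopf_quot_def quot_module_def)

lemma proj_mult: "x \<in> carrier G \<Longrightarrow> y \<in> carrier G \<Longrightarrow> proj (x \<otimes>\<^bsub>G\<^esub> y) = proj x \<otimes>\<^bsub>Q\<^esub> proj y"
  using ring_hom_mult[OF I.rcos_ring_hom] by (simp add: hopf_quot_def quot_module_def)

lemma proj_one: "proj \<one>\<^bsub>G\<^esub> = \<one>\<^bsub>Q\<^esub>"
  by (simp add: hopf_quot_def quot_module_def FactRing_def)

lemma zero_Q: "\<zero>\<^bsub>Q\<^esub> = I"
  by (simp add: hopf_quot_def quot_module_def FactRing_def)

lemma proj_eq_iff: "x \<in> carrier G \<Longrightarrow> y \<in> carrier G \<Longrightarrow> proj x = proj y \<longleftrightarrow> x \<ominus>\<^bsub>G\<^esub> y \<in> I"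
  using M.quotient_eq_iff_same_a_r_cos[OF ideal_I] by simp

lemma proj_eq_zero_iff: "x \<in> carrier G \<Longrightarrow> proj x = \<zero>\<^bsub>Q\<^esub> \<longleftrightarrow> x \<in> I"
  by (metis I.a_rcos_const I.a_rcos_self zero_Q)

lemma proj_I: "x \<in> I \<Longrightarrow> proj x = \<zero>\<^bsub>Q\<^esub>"
  using proj_eq_zero_iff I_carrier by blast

lemma in_projE:
  assumes "y \<in> proj x" "x \<in> carrier G"
  shows "y \<in> carrier G" "proj y = proj x"
  using M.a_repr_independence[OF assms I.a_subgroup] assms I.a_elemrcos_carrier by auto

lemma proj_self: "x \<in> carrier G \<Longrightarrow> x \<in> proj x" by (rule I.a_rcos_self)

lemma smult_proj:
  assumes k: "k \<in> carrier K" and x: "x \<in> carrier G"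
  shows "k \<odot>\<^bsub>Q\<^esub> proj x = proj (k \<odot>\<^bsub>G\<^esub> x)"
proof -
  have s: "proj (k \<odot>\<^bsub>G\<^esub> y) = proj (k \<odot>\<^bsub>G\<^esub> x)" if y: "y \<in> proj x" for y
  proof -
    have yc: "y \<in> carrier G" and e: "proj y = proj x" using in_projE[OF y x] .
    have "y \<ominus>\<^bsub>G\<^esub> x \<in> I" using e proj_eq_iff yc x by simp
    then have "k \<odot>\<^bsub>G\<^esub> (y \<ominus>\<^bsub>G\<^esub> x) \<in> I" using submoduleE(4)[OF submodule_I k] by simp
    then show ?thesis using k x yc by (subst proj_eq_iff) (simp_all add: a_minus_def smult_r_distr smult_r_minus)
  qed
  have "k \<odot>\<^bsub>Q\<^esub> proj x = (\<Union>y\<in>proj x. proj (k \<odot>\<^bsub>G\<^esub> y))"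
    by (simp add: hopf_quot_def quot_module_def)
  also have "\<dots> = (\<Union>y\<in>proj x. proj (k \<odot>\<^bsub>G\<^esub> x))" by (rule SUP_cong[OF refl s])
  also have "\<dots> = proj (k \<odot>\<^bsub>G\<^esub> x)" using proj_self[OF x] by blast
  finally show ?thesis .
qed

lemma ring_Q: "ring Q"
  by (rule ring_cong[OF I.quotient_is_ring]) (simp_all add: hopf_quot_def quot_module_def)

lemma module_Q [simp, mlin]: "module K Q"
proof (rule moduleI[OF R.is_cring])
  interpret Q: ring Q by (rule ring_Q)
  show "abelian_group Q" by (rule Q.abelian_group_axioms)
qed (auto simp: carrier_Q smult_proj smult_l_distr smult_r_distr smult_assoc1 simp flip: proj_add)

lemma proj_linear: "proj \<in> linear_maps K G Q"
  by (rule linearI) (simp_all add: proj_add smult_proj)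

lemma tensor_map_quot_module: "tensor_map K (quot_module G I) (quot_module G I) = tensor_map K Q Q"
  by (rule tensor_map_cong_modules) (simp_all add: quot_module_simps)

text \<open>
  \<open>\<Delta>(I) \<subseteq> I \<otimes> G + G \<otimes> I\<close>, and \<open>\<pi> \<otimes> \<pi>\<close> vanishes on both summands.
\<close>
lemma proj_proj_comult_I:
  assumes "x \<in> I" shows "tensor_map K Q Q proj proj (comult G x) = \<zero>\<^bsub>tensor_prod K Q Q\<^esub>"
proof -
  let ?T = "tensor_prod K Q Q"
  interpret T: module K ?T by simp
  interpret GG: module K "tensor_prod K G G" by simp
  note C = module_C and MQ = module_Q
  note l = linear_tensor_map(1)[OF C C MQ MQ proj_linear proj_linear]
  have z: "submodule {\<zero>\<^bsub>?T\<^esub>} K ?T" by (rule T.submoduleI) auto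
  let ?W = "{t \<in> carrier (tensor_prod K G G). tensor_map K Q Q proj proj t \<in> {\<zero>\<^bsub>?T\<^esub>}}"
  have W: "submodule ?W K (tensor_prod K G G)"
    by (rule linear_submodule_vimage[OF l GG.module_axioms z T.module_axioms])
  have pz: "pure_tensor K Q Q \<zero>\<^bsub>Q\<^esub> X = \<zero>\<^bsub>?T\<^esub>" "pure_tensor K Q Q X \<zero>\<^bsub>Q\<^esub> = \<zero>\<^bsub>?T\<^esub>" if "X \<in> carrier Q" for X
    using linear_zero[OF bilinear_left[OF bilinear_pure[OF MQ MQ] that] MQ T.module_axioms]
      linear_zero[OF bilinear_right[OF bilinear_pure[OF MQ MQ] that] MQ T.module_axioms] by simp_all
  have pc: "pure_tensor K G G x y \<in> carrier (tensor_prod K G G)" if "x \<in> carrier G" "y \<in> carrier G" for x y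
    using pure_closed[OF C C that] by simp
  have "sub_tensor K G G I (carrier G) \<subseteq> ?W"
    by (rule sub_tensor_least[OF C C I_carrier subset_refl W])
      (use I_carrier in \<open>auto simp: subset_iff pc pz tensor_map_pure[OF C C MQ MQ proj_linear proj_linear] proj_I\<close>)
  moreover have "sub_tensor K G G (carrier G) I \<subseteq> ?W"
    by (rule sub_tensor_least[OF C C subset_refl I_carrier W])
      (use I_carrier in \<open>auto simp: subset_iff pc pz tensor_map_pure[OF C C MQ MQ proj_linear proj_linear] proj_I\<close>)
  ultimately have sub: "s \<in> ?W" "u \<in> ?W" if "s \<in> sub_tensor K G G I (carrier G)" "u \<in> sub_tensor K G G (carrier G) I" for s u
    using that by (auto dest: subsetD)
  obtain s u where su: "s \<in> sub_tensor K G G I (carrier G)" "u \<in> sub_tensor K G G (carrier G) I" "comult G x = s \<oplus>\<^bsub>tensor_prod K G G\<^esub> u"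
    using comult_I[OF assms] by (auto simp: set_add_def set_mult_def)
  have "comult G x \<in> ?W" unfolding su(3) by (rule GG.submoduleE(5)[OF W sub[OF su(1,2)]])
  then show ?thesis by simp
qed

text \<open>
  The definite description in \<^const>\<open>hopf_quot\<close> has a value because elements of one coset differ by an
  element of \<open>I\<close>, which \<open>(\<pi> \<otimes> \<pi>) \<Delta>\<close> kills.
\<close>
lemma comult_proj:
  assumes x: "x \<in> carrier G" shows "comult Q (proj x) = tensor_map K Q Q proj proj (comult G x)"
proof -
  note C = module_C and MQ = module_Q
  note l = linear_tensor_map(1)[OF C C MQ MQ proj_linear proj_linear]
  interpret T: module K "tensor_prod K Q Q" by simp
  have lin: "(\<lambda>y. tensor_map K Q Q proj proj (comult G y)) \<in> linear_maps K G (tensor_prod K Q Q)"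
    by (rule linear_comp[OF l comult_linear])
  have e: "tensor_map K Q Q proj proj (comult G y) = tensor_map K Q Q proj proj (comult G x)" if y: "y \<in> proj x" for y
  proof -
    have yc: "y \<in> carrier G" and "y \<ominus>\<^bsub>G\<^esub> x \<in> I" using in_projE[OF y x] proj_eq_iff x by simp_all
    then have "tensor_map K Q Q proj proj (comult G (y \<ominus>\<^bsub>G\<^esub> x)) = \<zero>\<^bsub>tensor_prod K Q Q\<^esub>" by (intro proj_proj_comult_I)
    then show ?thesis
      using linear_diff[OF lin C T.module_axioms yc x] T.minus_eq_zero_iff linear_closed[OF lin] yc x by simp
  qed
  have "comult Q (proj x) = (THE t. \<exists>y\<in>proj x. t = tensor_map K Q Q proj proj (comult G y))"
    unfolding tensor_map_quot_module[symmetric] by (simp add: hopf_quot_def)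
  also have "\<dots> = tensor_map K Q Q proj proj (comult G x)"
    using e proj_self[OF x] by (intro the_equality) blast+
  finally show ?thesis .
qed

lemma counit_proj:
  assumes x: "x \<in> carrier G" shows "counit Q (proj x) = counit G x"
proof -
  have e: "counit G y = counit G x" if y: "y \<in> proj x" for y
  proof -
    have yc: "y \<in> carrier G" and i: "y \<ominus>\<^bsub>G\<^esub> x \<in> I" using in_projE[OF y x] proj_eq_iff x by simp_all
    have "y = (y \<ominus>\<^bsub>G\<^esub> x) \<oplus>\<^bsub>G\<^esub> x" using yc x by (simp add: a_minus_def M.a_assoc M.l_neg)
    then have "counit G y = counit G (y \<ominus>\<^bsub>G\<^esub> x) \<oplus>\<^bsub>K\<^esub> counit G x" using yc x by (metis counit_add M.minus_closed)
    then show ?thesis using counit_I[OF i] x by simp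
  qed
  have "counit Q (proj x) = (THE c. \<exists>y\<in>proj x. c = counit G y)" by (simp add: hopf_quot_def)
  also have "\<dots> = counit G x" using e proj_self[OF x] by (intro the_equality) blast+
  finally show ?thesis .
qed

lemma antipode_proj:
  assumes x: "x \<in> carrier G" shows "antipode Q (proj x) = proj (antipode G x)"
proof -
  have e: "proj (antipode G y) = proj (antipode G x)" if y: "y \<in> proj x" for y
  proof -
    have yc: "y \<in> carrier G" and i: "y \<ominus>\<^bsub>G\<^esub> x \<in> I" using in_projE[OF y x] proj_eq_iff x by simp_all
    then show ?thesis
      using antipode_I[OF i] linear_diff[OF antipode_linear module_C module_C yc x] x by (simp add: proj_eq_iff)
  qed
  have "antipode Q (proj x) = (\<Union>y\<in>proj x. proj (antipode G y))" by (simp add: hopf_quot_def)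
  also have "\<dots> = (\<Union>y\<in>proj x. proj (antipode G x))" by (rule SUP_cong[OF refl e])
  also have "\<dots> = proj (antipode G x)" using proj_self[OF x] by blast
  finally show ?thesis .
qed

lemma coalgebra_Q: "coalgebra K Q"
  by (rule coalgebra_image[OF coalgebra_axioms module_Q proj_linear carrier_Q comult_proj counit_proj])

text \<open>
  Linear maps that vanish on \<open>I\<close> are factored through the quotient by evaluating them at
  representatives.
\<close>
definition rep :: "'h set \<Rightarrow> 'h" where "rep X = (SOME x. x \<in> carrier G \<and> proj x = X)"

lemma rep: "X \<in> carrier Q \<Longrightarrow> rep X \<in> carrier G \<and> proj (rep X) = X"
  unfolding rep_def by (rule someI_ex) (auto simp: carrier_Q)

lemma
  assumes P: "module K P" and g: "g \<in> linear_maps K G P" and z: "\<And>i. i \<in> I \<Longrightarrow> g i = \<zero>\<^bsub>P\<^esub>"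
  shows linear_rep: "(\<lambda>X. g (rep X)) \<in> linear_maps K Q P"
    and rep_proj: "x \<in> carrier G \<Longrightarrow> g (rep (proj x)) = g x"
proof -
  interpret P: module K P by fact
  show e: "g (rep (proj x)) = g x" if x: "x \<in> carrier G" for x
  proof -
    have "rep (proj x) \<ominus>\<^bsub>G\<^esub> x \<in> I" using proj_eq_iff[of "rep (proj x)" x] rep[of "proj x"] x by simp
    then have "g (rep (proj x) \<ominus>\<^bsub>G\<^esub> x) = \<zero>\<^bsub>P\<^esub>" by (rule z)
    then show ?thesis
      using linear_diff[OF g module_C P _ x] rep[of "proj x"] x linear_closed[OF g] P.minus_eq_zero_iff by simp
  qed
  show "(\<lambda>X. g (rep X)) \<in> linear_maps K Q P"
  proof (rule linearI)
    show "g (rep X) \<in> carrier P" if "X \<in> carrier Q" for X using rep[OF that] linear_closed[OF g] by simp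
    fix X Y assume "X \<in> carrier Q" "Y \<in> carrier Q"
    then obtain x y where xy: "x \<in> carrier G" "y \<in> carrier G" "X = proj x" "Y = proj y" by (auto simp: carrier_Q)
    have "g (rep (proj (x \<oplus>\<^bsub>G\<^esub> y))) = g (rep (proj x)) \<oplus>\<^bsub>P\<^esub> g (rep (proj y))"
      using xy linear_add[OF g] by (simp add: e)
    then show "g (rep (X \<oplus>\<^bsub>Q\<^esub> Y)) = g (rep X) \<oplus>\<^bsub>P\<^esub> g (rep Y)" using xy by (simp add: proj_add)
  next
    fix k X assume k: "k \<in> carrier K" and "X \<in> carrier Q"
    then obtain x where x: "x \<in> carrier G" "X = proj x" by (auto simp: carrier_Q)
    have "g (rep (proj (k \<odot>\<^bsub>G\<^esub> x))) = k \<odot>\<^bsub>P\<^esub> g (rep (proj x))"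
      using x k linear_smult[OF g] by (simp add: e)
    then show "g (rep (k \<odot>\<^bsub>Q\<^esub> X)) = k \<odot>\<^bsub>P\<^esub> g (rep X)" using x k by (simp add: smult_proj)
  qed
qed

lemma bilinear_factor:
  assumes N: "module K N" and P: "module K P" and b: "bilinear_map K G N P \<phi>"
    and z: "\<And>i n. i \<in> I \<Longrightarrow> n \<in> carrier N \<Longrightarrow> \<phi> i n = \<zero>\<^bsub>P\<^esub>"
  shows "\<exists>\<psi>. bilinear_map K Q N P \<psi> \<and> (\<forall>x\<in>carrier G. \<forall>n\<in>carrier N. \<psi> (proj x) n = \<phi> x n)"
proof (intro exI[of _ "\<lambda>X n. \<phi> (rep X) n"] conjI ballI bilinearI)
  fix n assume n: "n \<in> carrier N"
  note bn = bilinear_left[OF b n]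
  show "(\<lambda>X. \<phi> (rep X) n) \<in> linear_maps K Q P" by (rule linear_rep[OF P bn z[OF _ n]])
  show "\<phi> (rep (proj x)) n = \<phi> x n" if "x \<in> carrier G" for x by (rule rep_proj[OF P bn z[OF _ n] that])
next
  fix X assume "X \<in> carrier Q"
  then show "(\<lambda>n. \<phi> (rep X) n) \<in> linear_maps K N P" using rep[of X] bilinear_right[OF b] by simp
qed

lemma linear_mult_Q:
  assumes X: "X \<in> carrier Q"
  shows "(\<lambda>Y. X \<otimes>\<^bsub>Q\<^esub> Y) \<in> linear_maps K Q Q" "(\<lambda>Y. Y \<otimes>\<^bsub>Q\<^esub> X) \<in> linear_maps K Q Q"
proof -
  interpret Q: ring Q by (rule ring_Q)
  obtain x where x: "x \<in> carrier G" "X = proj x" using X by (auto simp: carrier_Q)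
  have s: "X \<otimes>\<^bsub>Q\<^esub> (k \<odot>\<^bsub>Q\<^esub> Y) = k \<odot>\<^bsub>Q\<^esub> (X \<otimes>\<^bsub>Q\<^esub> Y)" "(k \<odot>\<^bsub>Q\<^esub> Y) \<otimes>\<^bsub>Q\<^esub> X = k \<odot>\<^bsub>Q\<^esub> (Y \<otimes>\<^bsub>Q\<^esub> X)"
    if "k \<in> carrier K" "Y \<in> carrier Q" for k Y
  proof -
    obtain y where y: "y \<in> carrier G" "Y = proj y" using \<open>Y \<in> carrier Q\<close> by (auto simp: carrier_Q)
    show "X \<otimes>\<^bsub>Q\<^esub> (k \<odot>\<^bsub>Q\<^esub> Y) = k \<odot>\<^bsub>Q\<^esub> (X \<otimes>\<^bsub>Q\<^esub> Y)" "(k \<odot>\<^bsub>Q\<^esub> Y) \<otimes>\<^bsub>Q\<^esub> X = k \<odot>\<^bsub>Q\<^esub> (Y \<otimes>\<^bsub>Q\<^esub> X)"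
      using x y \<open>k \<in> carrier K\<close> by (simp_all add: smult_proj smult_mult_left smult_mult_right flip: proj_mult)
  qed
  show "(\<lambda>Y. X \<otimes>\<^bsub>Q\<^esub> Y) \<in> linear_maps K Q Q" "(\<lambda>Y. Y \<otimes>\<^bsub>Q\<^esub> X) \<in> linear_maps K Q Q"
    by (rule linearI; simp add: X s Q.r_distr Q.l_distr)+
qed

end

section \<open>Faithful flatness and coinvariants\<close>

lemma tlift_eq_zero:
  assumes M: "module K M" and N: "module K N" and P: "module K P" and b: "bilinear_map K M N P \<phi>"
    and z: "\<And>m n. m \<in> carrier M \<Longrightarrow> n \<in> carrier N \<Longrightarrow> \<phi> m n = \<zero>\<^bsub>P\<^esub>" and t: "t \<in> carrier (tensor_prod K M N)"
  shows "tlift P \<phi> t = \<zero>\<^bsub>P\<^esub>"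
proof -
  interpret P: module K P by fact
  have "(\<lambda>_. \<zero>\<^bsub>P\<^esub>) \<in> linear_maps K (tensor_prod K M N) P" by (rule linearI) auto
  then show ?thesis
    by (intro linear_eq_on_tensors[OF M N P linear_lift(1)[OF M N P b] _ _ t]) (simp_all add: lift_pure[OF M N P b] z)
qed

lemma tensor_map_hom:
  assumes "tensor_pair R M N" "tensor_pair R M' N" and f: "f \<in> linear_maps R M M'"
  shows "tensor_map R M' N f (\<lambda>n. n) \<in> hom (tensor_group R M N) (tensor_group R M' N)"
    and "m \<in> carrier M \<Longrightarrow> n \<in> carrier N \<Longrightarrow> tensor_map R M' N f (\<lambda>n. n) (pure_tensor R M N m n) = pure_tensor R M' N (f m) n"
proof -
  interpret A: tensor_pair R M N by fact
  interpret B: tensor_pair R M' N by fact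
  have b: "balanced R M N (tensor_group R M' N) (\<lambda>m n. pure_tensor R M' N (f m) n)"
    using B.pure_balanced f by (simp add: balanced_def linear_maps_def Pi_iff)
  show "tensor_map R M' N f (\<lambda>n. n) \<in> hom (tensor_group R M N) (tensor_group R M' N)"
    unfolding tensor_map_def by (rule A.lift_hom[OF B.comm_group_T b])
  show "m \<in> carrier M \<Longrightarrow> n \<in> carrier N \<Longrightarrow> tensor_map R M' N f (\<lambda>n. n) (pure_tensor R M N m n) = pure_tensor R M' N (f m) n"
    unfolding tensor_map_def by (rule A.lift_pure[OF B.comm_group_T b])
qed

lemma (in hopf_algebra) antipode_one: "antipode H \<one>\<^bsub>H\<^esub> = \<one>\<^bsub>H\<^esub>"
proof -
  have b: "bilinear_map K H H H (\<lambda>y z. antipode H y \<otimes>\<^bsub>H\<^esub> z)" by (intro mlin; simp)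
  show ?thesis
    using tlift_antipode_left[OF module_C linear_id M.one_closed] tlift_comult_one[OF module_C b] by simp
qed

text \<open>
  \<open>R\<close> is the ring \<open>B\<close>. It is a separate record so that \<open>B\<close> may carry the structure restricted from a
  Hopf algebra that is larger than \<open>T\<close>.
\<close>
locale hopf_quotient_by_sub = hopf_quotient K T J + B: hopf_sub K T B
  for K :: "('k, 'w) ring_scheme" and T :: "('k, 'h) hopf_alg" and J B :: "'h set" +
  fixes R :: "('h, 'z) ring_scheme"
  assumes J_span: "J \<subseteq> span_prod K T (carrier T) (augmentation K T B)"
    and R: "ring R" "carrier R = B" "mult R = mult T" "one R = one T" "add R = add T" "zero R = zero T"
begin

abbreviation "N \<equiv> left_mult_module T"

text \<open>Elements of \<open>T\<close> as elements of the universe in which faithful flatness is tested.\<close>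
definition code :: "'h \<Rightarrow> (nat \<Rightarrow> 'h) set" where "code x = {\<lambda>_. x}"
definition decode :: "(nat \<Rightarrow> 'h) set \<Rightarrow> 'h" where "decode X = the_elem X 0"

lemma decode_code [simp]: "decode (code x) = x" by (simp add: code_def decode_def)
lemma code_inject [simp]: "code x = code y \<longleftrightarrow> x = y" by (metis decode_code)

text \<open>A right \<open>B\<close>-submodule of \<open>T\<close> in coded form.\<close>
definition right_mult_module :: "'h set \<Rightarrow> ('h, (nat \<Rightarrow> 'h) set) module" where
  "right_mult_module S = \<lparr>carrier = code ` S, mult = (\<lambda>_ _. {}), one = {}, zero = code \<zero>\<^bsub>T\<^esub>,
     add = (\<lambda>X Y. code (decode X \<oplus>\<^bsub>T\<^esub> decode Y)), smult = (\<lambda>b X. code (decode X \<otimes>\<^bsub>T\<^esub> b))\<rparr>"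

lemma right_mult_module_simps [simp]:
  "carrier (right_mult_module S) = code ` S" "zero (right_mult_module S) = code \<zero>\<^bsub>T\<^esub>"
  "code x \<oplus>\<^bsub>right_mult_module S\<^esub> code y = code (x \<oplus>\<^bsub>T\<^esub> y)" "b \<odot>\<^bsub>right_mult_module S\<^esub> code x = code (x \<otimes>\<^bsub>T\<^esub> b)"
  by (simp_all add: right_mult_module_def)

definition right_submodule where
  "right_submodule S \<longleftrightarrow> S \<subseteq> carrier T \<and> \<zero>\<^bsub>T\<^esub> \<in> S \<and> (\<forall>x\<in>S. \<forall>y\<in>S. x \<oplus>\<^bsub>T\<^esub> y \<in> S) \<and> (\<forall>x\<in>S. \<forall>b\<in>B. x \<otimes>\<^bsub>T\<^esub> b \<in> S)"

lemma right_module_right_mult: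
  assumes S: "right_submodule S" shows "right_module R (right_mult_module S)"
proof -
  have Sc: "\<And>x. x \<in> S \<Longrightarrow> x \<in> carrier T" and S0: "\<zero>\<^bsub>T\<^esub> \<in> S"
    and Sa: "\<And>x y. x \<in> S \<Longrightarrow> y \<in> S \<Longrightarrow> x \<oplus>\<^bsub>T\<^esub> y \<in> S" and Sb: "\<And>x b. x \<in> S \<Longrightarrow> b \<in> B \<Longrightarrow> x \<otimes>\<^bsub>T\<^esub> b \<in> S"
    using S by (auto simp: right_submodule_def)
  have Si: "\<ominus>\<^bsub>T\<^esub> x \<in> S" if "x \<in> S" for x
  proof -
    have "\<ominus>\<^bsub>T\<^esub> \<one>\<^bsub>T\<^esub> \<in> B" using submoduleE(3)[OF B.sub_mod B.sub_one] .
    then have "x \<otimes>\<^bsub>T\<^esub> (\<ominus>\<^bsub>T\<^esub> \<one>\<^bsub>T\<^esub>) \<in> S" using Sb that by blast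
    then show ?thesis using Sc[OF that] by (simp add: M.r_minus)
  qed
  have "abelian_group (right_mult_module S)"
  proof (rule abelian_groupI)
    fix X assume "X \<in> carrier (right_mult_module S)"
    then obtain x where x: "x \<in> S" "X = code x" by auto
    have "code (\<ominus>\<^bsub>T\<^esub> x) \<in> carrier (right_mult_module S)" using Si x by simp
    moreover have "code (\<ominus>\<^bsub>T\<^esub> x) \<oplus>\<^bsub>right_mult_module S\<^esub> X = \<zero>\<^bsub>right_mult_module S\<^esub>"
      using x Sc by (simp add: M.l_neg)
    ultimately show "\<exists>y\<in>carrier (right_mult_module S). y \<oplus>\<^bsub>right_mult_module S\<^esub> X = \<zero>\<^bsub>right_mult_module S\<^esub>" by blast
  qed (auto simp: Sa S0 Sc M.a_ac)
  then show ?thesis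
    using R by (intro right_module.intro right_module_axioms.intro R(1))
      (auto simp: Sb Sc M.l_distr M.r_distr M.m_assoc)
qed

lemma left_module_N: "left_module R N"
proof -
  have "abelian_group N"
    by (rule abelian_group_cong[OF M.abelian_group_axioms]) (simp_all add: left_mult_module_def)
  then show ?thesis
    using R by (intro left_module.intro left_module_axioms.intro R(1))
      (auto simp: left_mult_module_def M.l_distr M.r_distr M.m_assoc)
qed

lemma N_simps [simp]: "carrier N = carrier T" "add N = add T" "zero N = zero T" "smult N = mult T"
  by (simp_all add: left_mult_module_def)

lemma tensor_pair_right_mult:
  assumes "right_submodule S" shows "tensor_pair R (right_mult_module S) N"
proof -
  interpret S: right_module R "right_mult_module S" by (rule right_module_right_mult[OF assms])
  interpret N: left_module R N by (rule left_module_N)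
  show ?thesis
    by (intro tensor_pair.intro tensor_pair_axioms.intro S.M.abelian_group_axioms N.M.abelian_group_axioms S.rsmult_closed N.lsmult_closed)
qed

lemma right_submodule_T: "right_submodule (carrier T)"
  and right_submodule_B: "right_submodule B"
  and right_submodule_0: "right_submodule {\<zero>\<^bsub>T\<^esub>}"
  using submodule_zero[OF B.sub_mod] by (auto simp: right_submodule_def)

abbreviation "MT \<equiv> right_mult_module (carrier T)"

text \<open>\<open>T \<otimes>\<^sub>B T\<close> as a vector space\<close>
definition TT :: "('k, ((nat \<Rightarrow> 'h) set, 'h) tensor) module" where
  "TT = \<lparr>carrier = carrier (tensor_group R MT N), mult = (\<lambda>_ _. {}), one = {}, zero = one (tensor_group R MT N),
     add = mult (tensor_group R MT N), smult = (\<lambda>k. tensor_map R MT N (\<lambda>X. code (k \<odot>\<^bsub>T\<^esub> decode X)) (\<lambda>n. n))\<rparr>"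

abbreviation "pt x y \<equiv> pure_tensor R MT N (code x) y"

lemma module_TT [simp, mlin]: "module K TT"
  and smult_TT: "k \<in> carrier K \<Longrightarrow> x \<in> carrier T \<Longrightarrow> y \<in> carrier T \<Longrightarrow> k \<odot>\<^bsub>TT\<^esub> pt x y = pt (k \<odot>\<^bsub>T\<^esub> x) y"
proof -
  interpret tp: tensor_pair R MT N by (rule tensor_pair_right_mult[OF right_submodule_T])
  have *: "module K TT" "\<And>k m n. k \<in> carrier K \<Longrightarrow> m \<in> carrier MT \<Longrightarrow> n \<in> carrier N \<Longrightarrow>
     k \<odot>\<^bsub>TT\<^esub> pure_tensor R MT N m n = pure_tensor R MT N (code (k \<odot>\<^bsub>T\<^esub> decode m)) n"
    by (rule tp.tensor_module[where K = K and \<sigma> = "\<lambda>k X. code (k \<odot>\<^bsub>T\<^esub> decode X)"];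
      auto simp: TT_def R R.is_cring smult_r_distr smult_l_distr smult_assoc1 smult_mult_left)+
  show "module K TT" by fact
  show "k \<in> carrier K \<Longrightarrow> x \<in> carrier T \<Longrightarrow> y \<in> carrier T \<Longrightarrow> k \<odot>\<^bsub>TT\<^esub> pt x y = pt (k \<odot>\<^bsub>T\<^esub> x) y"
    using *(2)[of k "code x" y] by simp
qed

lemma pt_balanced: "x \<in> carrier T \<Longrightarrow> b \<in> B \<Longrightarrow> y \<in> carrier T \<Longrightarrow> pt (x \<otimes>\<^bsub>T\<^esub> b) y = pt x (b \<otimes>\<^bsub>T\<^esub> y)"
proof -
  assume a: "x \<in> carrier T" "b \<in> B" "y \<in> carrier T"
  interpret tp: tensor_pair R MT N by (rule tensor_pair_right_mult[OF right_submodule_T])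
  have "pure_tensor R MT N (b \<odot>\<^bsub>MT\<^esub> code x) y = pure_tensor R MT N (code x) (b \<odot>\<^bsub>N\<^esub> y)"
    using tp.pure_balanced[unfolded balanced_def] a R(2) by simp
  then show ?thesis by simp
qed

lemma bilinear_pt: "bilinear_map K T T TT pt"
proof -
  interpret tp: tensor_pair R MT N by (rule tensor_pair_right_mult[OF right_submodule_T])
  have c: "pt x y \<in> carrier TT" if "x \<in> carrier T" "y \<in> carrier T" for x y
    using tp.pure_closed[of "code x" y] that by (simp add: TT_def)
  have aL: "pt (x \<oplus>\<^bsub>T\<^esub> x') y = pt x y \<oplus>\<^bsub>TT\<^esub> pt x' y" if "x \<in> carrier T" "x' \<in> carrier T" "y \<in> carrier T" for x x' y
  proof -
    have "pure_tensor R MT N (code x \<oplus>\<^bsub>MT\<^esub> code x') y = pt x y \<otimes>\<^bsub>tensor_group R MT N\<^esub> pt x' y"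
      using tp.pure_balanced[unfolded balanced_def] that by simp
    then show ?thesis by (simp add: TT_def)
  qed
  have aR: "pt x (y \<oplus>\<^bsub>T\<^esub> y') = pt x y \<oplus>\<^bsub>TT\<^esub> pt x y'" if "x \<in> carrier T" "y \<in> carrier T" "y' \<in> carrier T" for x y y'
  proof -
    have "pure_tensor R MT N (code x) (y \<oplus>\<^bsub>N\<^esub> y') = pt x y \<otimes>\<^bsub>tensor_group R MT N\<^esub> pt x y'"
      using tp.pure_balanced[unfolded balanced_def] that by simp
    then show ?thesis by (simp add: TT_def)
  qed
  have sR: "pt x (k \<odot>\<^bsub>T\<^esub> y) = k \<odot>\<^bsub>TT\<^esub> pt x y" if "k \<in> carrier K" "x \<in> carrier T" "y \<in> carrier T" for k x y
    using pt_balanced[of x "k \<odot>\<^bsub>T\<^esub> \<one>\<^bsub>T\<^esub>" y] that by (simp add: smult_TT smult_mult_left smult_mult_right)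
  show ?thesis
    by (intro bilinearI linearI) (simp_all add: c aL aR sR smult_TT)
qed

lemmas linear_pt [mlin] = bilinear_left_comp[OF bilinear_pt] bilinear_right_comp[OF bilinear_pt]
lemmas pt_closed [mlin, simp] = bilinear_closed[OF bilinear_pt]

text \<open>
  The canonical map \<open>T \<otimes>\<^sub>B T \<rightarrow> Q \<otimes> T\<close>, \<open>x \<otimes> y \<mapsto> \<pi>(x\<^sub>1) \<otimes> x\<^sub>2 y\<close>, has the inverse
  \<open>\<pi>(x) \<otimes> y \<mapsto> x\<^sub>1 \<otimes> S(x\<^sub>2) y\<close>, which is well-defined because \<open>J\<close> is generated by \<open>B\<^sup>+\<close> as a left ideal.
  Applied to the equation of a coinvariant it moves a coinvariant through the tensor product.
\<close>
lemma coinvariant_pt: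
  assumes t: "t \<in> carrier T" and z: "z \<in> carrier T"
    and co: "tensor_map K Q T proj (\<lambda>x. x) (comult T t) = pure_tensor K Q T (proj \<one>\<^bsub>T\<^esub>) t"
  shows "pt t z = pt \<one>\<^bsub>T\<^esub> (t \<otimes>\<^bsub>T\<^esub> z)"
proof -
  note C = module_C
  let ?S = "antipode T" and ?D = "comult T"
  interpret TT: module K TT by simp
  \<comment> \<open>the inverse of the canonical map, followed by multiplication with \<open>z\<close> in the second factor\<close>
  define \<phi> where "\<phi> = (\<lambda>x y. tlift TT (\<lambda>u v. pt u (?S v \<otimes>\<^bsub>T\<^esub> y \<otimes>\<^bsub>T\<^esub> z)) (?D x))"
  have b: "bilinear_map K T T TT \<phi>" unfolding \<phi>_def using z by (intro mlin; simp)
  have "\<phi> x y \<in> {\<zero>\<^bsub>TT\<^esub>}" if x: "x \<in> J" and y: "y \<in> carrier T" for x y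
  proof (rule linear_span_prod_mem[OF bilinear_left[OF b y] module_TT _ subset_refl])
    show "submodule {\<zero>\<^bsub>TT\<^esub>} K TT" by (rule TT.submoduleI) auto
    show "augmentation K T B \<subseteq> carrier T" using B.sub_carrier by (auto simp: augmentation_def)
    show "x \<in> span_prod K T (carrier T) (augmentation K T B)" using x J_span by blast
    fix w b assume w: "w \<in> carrier T" and bb: "b \<in> augmentation K T B"
    have bB: "b \<in> B" and be: "counit T b = \<zero>\<^bsub>K\<^esub>" using bb by (auto simp: augmentation_def)
    have bc: "b \<in> carrier T" using bB by simp
    \<comment> \<open>\<open>\<phi>(w b, y) = w\<^sub>1 b\<^sub>1 \<otimes> S(b\<^sub>2) S(w\<^sub>2) y z = w\<^sub>1 \<otimes> b\<^sub>1 S(b\<^sub>2) S(w\<^sub>2) y z\<close>, which has the factor \<open>\<epsilon>(b)\<close>\<close>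
    let ?\<psi> = "\<lambda>u1 u2 b1 b2. pt (u1 \<otimes>\<^bsub>T\<^esub> b1) (?S (u2 \<otimes>\<^bsub>T\<^esub> b2) \<otimes>\<^bsub>T\<^esub> y \<otimes>\<^bsub>T\<^esub> z)"
    have "\<phi> (w \<otimes>\<^bsub>T\<^esub> b) y = tlift TT (\<lambda>u1 u2. tlift TT (?\<psi> u1 u2) (?D b)) (?D w)"
      unfolding \<phi>_def by (rule tlift_comult_mult[OF module_TT _ w bc]) (use y z in \<open>intro mlin; simp\<close>)
    also have "\<dots> = \<zero>\<^bsub>TT\<^esub>"
    proof (rule tlift_eq_zero[OF C C module_TT _ _ comult_closed[OF w]])
      show "bilinear_map K T T TT (\<lambda>u1 u2. tlift TT (?\<psi> u1 u2) (?D b))"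
        using y z bc by (intro mlin; simp)
      fix u1 u2 assume u: "u1 \<in> carrier T" "u2 \<in> carrier T"
      let ?f = "\<lambda>x. pt u1 (x \<otimes>\<^bsub>T\<^esub> (?S u2 \<otimes>\<^bsub>T\<^esub> (y \<otimes>\<^bsub>T\<^esub> z)))"
      have b1: "bilinear_map K T T TT (?\<psi> u1 u2)" using u y z by (intro mlin; simp)
      have b2: "bilinear_map K T T TT (\<lambda>b1 b2. ?f (b1 \<otimes>\<^bsub>T\<^esub> ?S b2))" using u y z by (intro mlin; simp)
      have "tlift TT (?\<psi> u1 u2) (?D b) = tlift TT (\<lambda>b1 b2. ?f (b1 \<otimes>\<^bsub>T\<^esub> ?S b2)) (?D b)"
      proof (rule linear_eq_on_sub_tensor[OF C C B.sub_carrier B.sub_carrier module_TT linear_lift(1)[OF C C module_TT b1] linear_lift(1)[OF C C module_TT b2] _ B.comult_sub[OF bB]])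
        fix b1' b2' assume bs: "b1' \<in> B" "b2' \<in> B"
        have "?\<psi> u1 u2 b1' b2' = ?f (b1' \<otimes>\<^bsub>T\<^esub> ?S b2')"
          using bs u y z by (simp add: pt_balanced antipode_mult M.m_assoc)
        then show "tlift TT (?\<psi> u1 u2) (pure_tensor K T T b1' b2') = tlift TT (\<lambda>b1 b2. ?f (b1 \<otimes>\<^bsub>T\<^esub> ?S b2)) (pure_tensor K T T b1' b2')"
          using bs by (simp add: lift_pure[OF C C module_TT b1] lift_pure[OF C C module_TT b2])
      qed
      also have "\<dots> = counit T b \<odot>\<^bsub>TT\<^esub> ?f \<one>\<^bsub>T\<^esub>"
        by (rule tlift_antipode_right[OF module_TT _ bc]) (use u y z in \<open>intro mlin; simp\<close>)
      finally show "tlift TT (?\<psi> u1 u2) (?D b) = \<zero>\<^bsub>TT\<^esub>" using be u y z by simp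
    qed
    finally show "\<phi> (w \<otimes>\<^bsub>T\<^esub> b) y \<in> {\<zero>\<^bsub>TT\<^esub>}" by simp
  qed
  then obtain \<psi> where \<psi>: "bilinear_map K Q T TT \<psi>" and \<psi>\<phi>: "\<forall>x\<in>carrier T. \<forall>n\<in>carrier T. \<psi> (proj x) n = \<phi> x n"
    using bilinear_factor[OF C module_TT b] by auto
  \<comment> \<open>apply the factored map \<open>\<psi>\<close> to both sides of the coinvariance equation\<close>
  have "tlift TT \<psi> (tensor_map K Q T proj (\<lambda>x. x) (?D t)) = tlift TT (\<lambda>x y. \<psi> (proj x) y) (?D t)"
    by (rule lift_tensor_map[OF C C module_Q C module_TT proj_linear linear_id \<psi> comult_closed[OF t]])
  also have "\<dots> = tlift TT (\<lambda>x y. tlift TT (\<lambda>u v. pt u (?S v \<otimes>\<^bsub>T\<^esub> y \<otimes>\<^bsub>T\<^esub> z)) (?D x)) (?D t)"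
    by (rule lift_cong[OF C C comult_closed[OF t], unfolded \<phi>_def, symmetric]) (use \<psi>\<phi> in \<open>simp add: \<phi>_def\<close>)
  also have "\<dots> = tlift TT (\<lambda>u r. tlift TT (\<lambda>v y. pt u (?S v \<otimes>\<^bsub>T\<^esub> y \<otimes>\<^bsub>T\<^esub> z)) (?D r)) (?D t)"
    by (rule tlift_coassoc[OF module_TT _ t]) (use z in \<open>intro mlin; simp\<close>)
  also have "\<dots> = tlift TT (\<lambda>u r. counit T r \<odot>\<^bsub>TT\<^esub> pt u (\<one>\<^bsub>T\<^esub> \<otimes>\<^bsub>T\<^esub> z)) (?D t)"
  proof (rule lift_cong[OF C C comult_closed[OF t]])
    show "tlift TT (\<lambda>v y. pt u (?S v \<otimes>\<^bsub>T\<^esub> y \<otimes>\<^bsub>T\<^esub> z)) (?D r) = counit T r \<odot>\<^bsub>TT\<^esub> pt u (\<one>\<^bsub>T\<^esub> \<otimes>\<^bsub>T\<^esub> z)"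
      if "u \<in> carrier T" "r \<in> carrier T" for u r
      by (rule tlift_antipode_left[OF module_TT _ that(2), where f = "\<lambda>x. pt u (x \<otimes>\<^bsub>T\<^esub> z)"]) (use z that in \<open>intro mlin; simp\<close>)
  qed
  also have "\<dots> = pt t (\<one>\<^bsub>T\<^esub> \<otimes>\<^bsub>T\<^esub> z)"
    by (rule tlift_counit_right[OF module_TT _ t]) (use z in \<open>intro mlin; simp\<close>)
  finally have 1: "tlift TT \<psi> (tensor_map K Q T proj (\<lambda>x. x) (?D t)) = pt t z" using z by simp
  have "tlift TT \<psi> (pure_tensor K Q T (proj \<one>\<^bsub>T\<^esub>) t) = \<psi> (proj \<one>\<^bsub>T\<^esub>) t"
    by (rule lift_pure[OF module_Q C module_TT \<psi>]) (use t in simp_all)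
  also have "\<dots> = \<phi> \<one>\<^bsub>T\<^esub> t" using \<psi>\<phi> t by simp
  also have "\<dots> = pt \<one>\<^bsub>T\<^esub> (?S \<one>\<^bsub>T\<^esub> \<otimes>\<^bsub>T\<^esub> t \<otimes>\<^bsub>T\<^esub> z)"
    unfolding \<phi>_def by (rule tlift_comult_one[OF module_TT]) (use z t in \<open>intro mlin; simp\<close>)
  finally show ?thesis using 1 co t z by (simp add: antipode_one)
qed

lemma linear_maps_right_mult_incl: "S \<subseteq> S' \<Longrightarrow> (\<lambda>X. X) \<in> linear_maps R (right_mult_module S) (right_mult_module S')"
  by (auto simp: linear_maps_def)

lemma tensor_zero_right_mult:
  assumes "s \<in> carrier (tensor_group R (right_mult_module {\<zero>\<^bsub>T\<^esub>}) N)"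
  shows "s = \<one>\<^bsub>tensor_group R (right_mult_module {\<zero>\<^bsub>T\<^esub>}) N\<^esub>"
proof -
  interpret tp: tensor_pair R "right_mult_module {\<zero>\<^bsub>T\<^esub>}" N by (rule tensor_pair_right_mult[OF right_submodule_0])
  interpret G: comm_group "tensor_group R (right_mult_module {\<zero>\<^bsub>T\<^esub>}) N" by (rule tp.comm_group_T)
  show ?thesis using assms
  proof (induction rule: tp.tensor_induct)
    case (pure m n)
    then show ?case using tp.pure_zero_left[of n] by simp
  next
    case (add s t)
    then show ?case by simp
  qed
qed

text \<open>
  Descent for the coinvariant \<open>t\<close> along \<open>B \<subseteq> B + t B\<close>: after tensoring with \<open>T\<close> the inclusion becomes
  surjective because \<open>t \<otimes> z = 1 \<otimes> t z\<close>. All modules in the argument are submodules of \<open>T\<close>, so that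
  \<^const>\<open>code\<close> embeds them into the universe of the flatness hypothesis.
\<close>
lemma coinvariant_mem:
  assumes flat: "left_faithfully_flat R N" and t: "t \<in> carrier T"
    and co: "tensor_map K Q T proj (\<lambda>x. x) (comult T t) = pure_tensor K Q T (proj \<one>\<^bsub>T\<^esub>) t"
  shows "t \<in> B"
proof -
  let ?mm = right_mult_module and ?Z = "{\<zero>\<^bsub>T\<^esub>}"
  define S where "S = {b \<oplus>\<^bsub>T\<^esub> t \<otimes>\<^bsub>T\<^esub> b' | b b'. b \<in> B \<and> b' \<in> B}"
  have memS: "b \<oplus>\<^bsub>T\<^esub> t \<otimes>\<^bsub>T\<^esub> b' \<in> S" if "b \<in> B" "b' \<in> B" for b b' using that by (auto simp: S_def)
  have B0: "\<zero>\<^bsub>T\<^esub> \<in> B" by (rule submodule_zero[OF B.sub_mod])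
  have BS: "b \<in> S" if "b \<in> B" for b using memS[OF that B0] that t by simp
  have tS: "t \<in> S" using memS[OF B0 B.sub_one] t by simp
  have S: "right_submodule S"
    unfolding right_submodule_def
  proof (intro conjI ballI)
    show "S \<subseteq> carrier T" using t by (auto simp: S_def)
    show "\<zero>\<^bsub>T\<^esub> \<in> S" by (rule BS[OF B0])
    fix x assume "x \<in> S"
    then obtain b b' where x: "b \<in> B" "b' \<in> B" "x = b \<oplus>\<^bsub>T\<^esub> t \<otimes>\<^bsub>T\<^esub> b'" by (auto simp: S_def)
    show "x \<otimes>\<^bsub>T\<^esub> c \<in> S" if "c \<in> B" for c
      using memS[of "b \<otimes>\<^bsub>T\<^esub> c" "b' \<otimes>\<^bsub>T\<^esub> c"] x that t by (simp add: M.l_distr M.m_assoc)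
    fix y assume "y \<in> S"
    then obtain c c' where y: "c \<in> B" "c' \<in> B" "y = c \<oplus>\<^bsub>T\<^esub> t \<otimes>\<^bsub>T\<^esub> c'" by (auto simp: S_def)
    show "x \<oplus>\<^bsub>T\<^esub> y \<in> S"
      using memS[of "b \<oplus>\<^bsub>T\<^esub> c" "b' \<oplus>\<^bsub>T\<^esub> c'"] x y t by (simp add: M.r_distr M.a_ac)
  qed
  have ST: "S \<subseteq> carrier T" using S by (simp add: right_submodule_def)
  have BS': "B \<subseteq> S" using BS by blast
  have ex: "exact_at (carrier M1) f (carrier M2) g \<zero>\<^bsub>M3\<^esub> \<longleftrightarrow>
         exact_at (carrier (tensor_group R M1 N)) (tensor_map R M2 N f (\<lambda>n. n))
                  (carrier (tensor_group R M2 N)) (tensor_map R M3 N g (\<lambda>n. n)) \<one>\<^bsub>tensor_group R M3 N\<^esub>"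
    if "right_module R M1" "right_module R M2" "right_module R M3" "f \<in> linear_maps R M1 M2" "g \<in> linear_maps R M2 M3"
    for M1 M2 M3 :: "('h, (nat \<Rightarrow> 'h) set) module" and f g
    using flat that unfolding left_faithfully_flat_def by simp
  note rm = right_module_right_mult and tpr = tensor_pair_right_mult
  interpret tS: tensor_pair R "?mm S" N by (rule tpr[OF S])
  interpret tB: tensor_pair R "?mm B" N by (rule tpr[OF right_submodule_B])
  interpret tT: tensor_pair R MT N by (rule tpr[OF right_submodule_T])
  interpret t0: tensor_pair R "?mm ?Z" N by (rule tpr[OF right_submodule_0])
  interpret GS: comm_group "tensor_group R (?mm S) N" by (rule tS.comm_group_T)
  interpret GT: comm_group "tensor_group R MT N" by (rule tT.comm_group_T)
  interpret G0: comm_group "tensor_group R (?mm ?Z) N" by (rule t0.comm_group_T)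
  interpret GB: comm_group "tensor_group R (?mm B) N" by (rule tB.comm_group_T)
  let ?i = "tensor_map R MT N (\<lambda>X. X) (\<lambda>n. n)"
  have Z: "?Z \<subseteq> S" using BS[OF B0] by simp
  note li = linear_maps_right_mult_incl
  note hi = tensor_map_hom[OF tS.tensor_pair_axioms tT.tensor_pair_axioms li[OF ST]]
  interpret hi: group_hom "tensor_group R (?mm S) N" "tensor_group R MT N" ?i
    using hi(1) by (simp add: group_hom_def group_hom_axioms_def GS.is_group GT.is_group)
  \<comment> \<open>flatness applied to \<open>0 \<rightarrow> B + t B \<rightarrow> T\<close>: the equation \<open>t \<otimes> z = 1 \<otimes> t z\<close> descends to \<open>(B + t B) \<otimes>\<^sub>B T\<close>\<close>
  have inj: "exact_at (carrier (tensor_group R (?mm ?Z) N)) (tensor_map R (?mm S) N (\<lambda>X. X) (\<lambda>n. n))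
     (carrier (tensor_group R (?mm S) N)) ?i \<one>\<^bsub>tensor_group R MT N\<^esub>"
    using Z by (subst ex[symmetric]) (auto simp: exact_at_def intro!: rm li S right_submodule_0 right_submodule_T ST)
  have ker: "y = \<one>\<^bsub>tensor_group R (?mm S) N\<^esub>"
    if y: "y \<in> carrier (tensor_group R (?mm S) N)" "?i y = \<one>\<^bsub>tensor_group R MT N\<^esub>" for y
  proof -
    obtain s where s: "s \<in> carrier (tensor_group R (?mm ?Z) N)" "y = tensor_map R (?mm S) N (\<lambda>X. X) (\<lambda>n. n) s"
      using inj y unfolding exact_at_def by blast
    have h: "tensor_map R (?mm S) N (\<lambda>X. X) (\<lambda>n. n) \<in> hom (tensor_group R (?mm ?Z) N) (tensor_group R (?mm S) N)"
      by (rule tensor_map_hom(1)[OF t0.tensor_pair_axioms tS.tensor_pair_axioms li[OF Z]])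
    show ?thesis
      unfolding s(2) using tensor_zero_right_mult[OF s(1)] hom_one[OF h G0.is_group GS.is_group] by simp
  qed
  let ?ps = "\<lambda>x y. pure_tensor R (?mm S) N (code x) y"
  have eq: "?ps t z = ?ps \<one>\<^bsub>T\<^esub> (t \<otimes>\<^bsub>T\<^esub> z)" if z: "z \<in> carrier T" for z
  proof -
    have c: "?ps t z \<in> carrier (tensor_group R (?mm S) N)" "?ps \<one>\<^bsub>T\<^esub> (t \<otimes>\<^bsub>T\<^esub> z) \<in> carrier (tensor_group R (?mm S) N)"
      using tS BS tS.pure_closed t z by auto
    have "?i (?ps t z) = pt t z" "?i (?ps \<one>\<^bsub>T\<^esub> (t \<otimes>\<^bsub>T\<^esub> z)) = pt \<one>\<^bsub>T\<^esub> (t \<otimes>\<^bsub>T\<^esub> z)"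
      using hi(2) tS BS t z by simp_all
    then have ii: "?i (?ps t z) = ?i (?ps \<one>\<^bsub>T\<^esub> (t \<otimes>\<^bsub>T\<^esub> z))" using coinvariant_pt[OF t z co] by simp
    have "?i (?ps t z \<otimes>\<^bsub>tensor_group R (?mm S) N\<^esub> inv\<^bsub>tensor_group R (?mm S) N\<^esub> ?ps \<one>\<^bsub>T\<^esub> (t \<otimes>\<^bsub>T\<^esub> z)) = \<one>\<^bsub>tensor_group R MT N\<^esub>"
      using c ii hi.hom_closed[OF c(2)] by (simp del: carrier_tensor_group)
    then have "?ps t z \<otimes>\<^bsub>tensor_group R (?mm S) N\<^esub> inv\<^bsub>tensor_group R (?mm S) N\<^esub> ?ps \<one>\<^bsub>T\<^esub> (t \<otimes>\<^bsub>T\<^esub> z) = \<one>\<^bsub>tensor_group R (?mm S) N\<^esub>"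
      using c by (intro ker) (simp_all del: carrier_tensor_group)
    then show ?thesis using c by (metis GS.inv_equality GS.inv_inv GS.inv_closed)
  qed
  let ?j = "tensor_map R (?mm S) N (\<lambda>X. X) (\<lambda>n. n)"
  note hj = tensor_map_hom[OF tB.tensor_pair_axioms tS.tensor_pair_axioms li[OF BS']]
  interpret hj: group_hom "tensor_group R (?mm B) N" "tensor_group R (?mm S) N" ?j
    using hj(1) by (simp add: group_hom_def group_hom_axioms_def GS.is_group GB.is_group)
  have psB: "?ps b z \<in> ?j ` carrier (tensor_group R (?mm B) N)" if "b \<in> B" "z \<in> carrier T" for b z
    using hj(2)[of "code b" z] tB.pure_closed[of "code b" z] that by (metis N_simps(1) image_eqI right_mult_module_simps(1))
  have imm: "x \<otimes>\<^bsub>tensor_group R (?mm S) N\<^esub> y \<in> ?j ` carrier (tensor_group R (?mm B) N)"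
    if xy: "x \<in> ?j ` carrier (tensor_group R (?mm B) N)" "y \<in> ?j ` carrier (tensor_group R (?mm B) N)" for x y
  proof -
    obtain x' y' where "x' \<in> carrier (tensor_group R (?mm B) N)" "x = ?j x'" "y' \<in> carrier (tensor_group R (?mm B) N)" "y = ?j y'"
      using xy by blast
    then show ?thesis
      using hj.hom_mult[of x' y'] GB.m_closed[of x' y'] by (metis image_eqI)
  qed
  \<comment> \<open>\<open>(b + t b') \<otimes> z = b \<otimes> z + 1 \<otimes> t b' z\<close>\<close>
  have onto: "y \<in> ?j ` carrier (tensor_group R (?mm B) N)" if "y \<in> carrier (tensor_group R (?mm S) N)" for y
    using that
  proof (induction rule: tS.tensor_induct)
    case (pure m z)
    then obtain b b' where m: "m = code (b \<oplus>\<^bsub>T\<^esub> t \<otimes>\<^bsub>T\<^esub> b')" "b \<in> B" "b' \<in> B" and z: "z \<in> carrier T" by (auto simp: S_def)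
    have tb: "t \<otimes>\<^bsub>T\<^esub> b' \<in> S" using S tS m by (simp add: right_submodule_def)
    have "pure_tensor R (?mm S) N m z = pure_tensor R (?mm S) N (code b \<oplus>\<^bsub>?mm S\<^esub> (b' \<odot>\<^bsub>?mm S\<^esub> code t)) z"
      by (simp add: m)
    also have "\<dots> = ?ps b z \<otimes>\<^bsub>tensor_group R (?mm S) N\<^esub> pure_tensor R (?mm S) N (b' \<odot>\<^bsub>?mm S\<^esub> code t) z"
      using tS.pure_balanced[unfolded balanced_def] BS[OF m(2)] tb z by simp
    also have "pure_tensor R (?mm S) N (b' \<odot>\<^bsub>?mm S\<^esub> code t) z = ?ps t (b' \<otimes>\<^bsub>T\<^esub> z)"
      using tS.pure_balanced[unfolded balanced_def] tS m(3) z R(2) by (simp del: right_mult_module_simps(4))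
    also have "\<dots> = ?ps \<one>\<^bsub>T\<^esub> (t \<otimes>\<^bsub>T\<^esub> (b' \<otimes>\<^bsub>T\<^esub> z))" using m z by (intro eq) simp
    finally show ?case using imm[OF psB[OF m(2) z] psB[OF B.sub_one]] m z t by simp
  next
    case (add s t)
    then show ?case by (intro imm)
  qed
  have g: "(\<lambda>_. code \<zero>\<^bsub>T\<^esub>) \<in> linear_maps R (?mm S) (?mm ?Z)"
    using R(2) by (auto simp: linear_maps_def)
  have "exact_at (carrier (tensor_group R (?mm B) N)) ?j (carrier (tensor_group R (?mm S) N))
     (tensor_map R (?mm ?Z) N (\<lambda>_. code \<zero>\<^bsub>T\<^esub>) (\<lambda>n. n)) \<one>\<^bsub>tensor_group R (?mm ?Z) N\<^esub>"
  proof -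
    have "tensor_map R (?mm ?Z) N (\<lambda>_. code \<zero>\<^bsub>T\<^esub>) (\<lambda>n. n) y = \<one>\<^bsub>tensor_group R (?mm ?Z) N\<^esub>"
      if "y \<in> carrier (tensor_group R (?mm S) N)" for y
      by (rule tensor_zero_right_mult[OF hom_in_carrier[OF tensor_map_hom(1)[OF tS.tensor_pair_axioms t0.tensor_pair_axioms g] that]])
    then show ?thesis unfolding exact_at_def using onto hj.hom_closed by (auto simp del: carrier_tensor_group)
  qed
  \<comment> \<open>faithfulness reflects the surjectivity of \<open>B \<otimes>\<^sub>B T \<rightarrow> (B + t B) \<otimes>\<^sub>B T\<close>\<close>
  then have "exact_at (carrier (?mm B)) (\<lambda>X. X) (carrier (?mm S)) (\<lambda>_. code \<zero>\<^bsub>T\<^esub>) \<zero>\<^bsub>?mm ?Z\<^esub>"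
    by (subst ex) (auto intro!: rm li S right_submodule_B right_submodule_0 g BS)
  then have "code ` B = code ` S" by (simp add: exact_at_def)
  then have "code t \<in> code ` B" using tS by simp
  then show ?thesis by auto
qed

end

section \<open>Cancelling antipodes\<close>

context hopf_algebra
begin

text \<open>
  \<open>\<Sum> h(x\<^sub>1, x\<^sub>2 S(x\<^sub>3)) = h(x, 1)\<close>, and similarly for \<open>S(x\<^sub>2) x\<^sub>3\<close> and for \<open>S(x\<^sub>1) x\<^sub>2\<close> in the next two
  lemmas. They show that pairs of maps such as \<open>x \<otimes> y \<mapsto> x\<^sub>1 \<otimes> x\<^sub>2 y\<close> and \<open>x \<otimes> y \<mapsto> x\<^sub>1 \<otimes> S(x\<^sub>2) y\<close> are
  mutually inverse.
\<close>
lemma tlift_cancel_right: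
  assumes P: "module K P" and h: "bilinear_map K H H P h" and x: "x \<in> carrier H"
  shows "tlift P (\<lambda>u v. tlift P (\<lambda>a b. h a (b \<otimes>\<^bsub>H\<^esub> antipode H v)) (comult H u)) (comult H x) = h x \<one>\<^bsub>H\<^esub>"
proof -
  note C = module_C and hl = bilinear_left_comp[OF h] and hr = bilinear_right_comp[OF h]
  have "tlift P (\<lambda>u v. tlift P (\<lambda>a b. h a (b \<otimes>\<^bsub>H\<^esub> antipode H v)) (comult H u)) (comult H x)
    = tlift P (\<lambda>a q. tlift P (\<lambda>b v. h a (b \<otimes>\<^bsub>H\<^esub> antipode H v)) (comult H q)) (comult H x)"
    by (rule tlift_coassoc[OF P _ x]) (intro mlin hl hr; simp)
  also have "\<dots> = tlift P (\<lambda>a q. counit H q \<odot>\<^bsub>P\<^esub> h a \<one>\<^bsub>H\<^esub>) (comult H x)"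
    by (rule lift_cong[OF C C comult_closed[OF x]])
      (rule tlift_antipode_right[OF P bilinear_right[OF h]])
  also have "\<dots> = h x \<one>\<^bsub>H\<^esub>"
    by (rule tlift_counit_right[OF P _ x]) (intro mlin hl; simp)
  finally show ?thesis .
qed

lemma tlift_cancel_left:
  assumes P: "module K P" and h: "bilinear_map K H H P h" and x: "x \<in> carrier H"
  shows "tlift P (\<lambda>u v. tlift P (\<lambda>a b. h a (antipode H b \<otimes>\<^bsub>H\<^esub> v)) (comult H u)) (comult H x) = h x \<one>\<^bsub>H\<^esub>"
proof -
  note C = module_C and hl = bilinear_left_comp[OF h] and hr = bilinear_right_comp[OF h]
  have "tlift P (\<lambda>u v. tlift P (\<lambda>a b. h a (antipode H b \<otimes>\<^bsub>H\<^esub> v)) (comult H u)) (comult H x)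
    = tlift P (\<lambda>a q. tlift P (\<lambda>b v. h a (antipode H b \<otimes>\<^bsub>H\<^esub> v)) (comult H q)) (comult H x)"
    by (rule tlift_coassoc[OF P _ x]) (intro mlin hl hr; simp)
  also have "\<dots> = tlift P (\<lambda>a q. counit H q \<odot>\<^bsub>P\<^esub> h a \<one>\<^bsub>H\<^esub>) (comult H x)"
    by (rule lift_cong[OF C C comult_closed[OF x]])
      (rule tlift_antipode_left[OF P bilinear_right[OF h]])
  also have "\<dots> = h x \<one>\<^bsub>H\<^esub>"
    by (rule tlift_counit_right[OF P _ x]) (intro mlin hl; simp)
  finally show ?thesis .
qed

lemma tlift_cancel_left':
  assumes P: "module K P" and h: "bilinear_map K H H P h" and x: "x \<in> carrier H"
  shows "tlift P (\<lambda>u r. tlift P (\<lambda>a b. h (antipode H u \<otimes>\<^bsub>H\<^esub> a) b) (comult H r)) (comult H x) = h \<one>\<^bsub>H\<^esub> x"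
proof -
  note C = module_C and hl = bilinear_left_comp[OF h] and hr = bilinear_right_comp[OF h]
  have "tlift P (\<lambda>u r. tlift P (\<lambda>a b. h (antipode H u \<otimes>\<^bsub>H\<^esub> a) b) (comult H r)) (comult H x)
    = tlift P (\<lambda>q b. tlift P (\<lambda>u a. h (antipode H u \<otimes>\<^bsub>H\<^esub> a) b) (comult H q)) (comult H x)"
    by (rule tlift_coassoc[OF P _ x, symmetric]) (intro mlin hl hr; simp)
  also have "\<dots> = tlift P (\<lambda>q b. counit H q \<odot>\<^bsub>P\<^esub> h \<one>\<^bsub>H\<^esub> b) (comult H x)"
    by (rule lift_cong[OF C C comult_closed[OF x]])
      (rule tlift_antipode_left[OF P bilinear_left[OF h]])
  also have "\<dots> = h \<one>\<^bsub>H\<^esub> x"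
    by (rule tlift_counit_left[OF P _ x]) (intro mlin hr; simp)
  finally show ?thesis .
qed

end

section \<open>The cotensor square of a Hopf algebra over a quotient\<close>

text \<open>
  The setting in which coflatness is used: \<open>E\<close> stands for \<open>A\<close>, \<open>C\<close> for \<open>A B / A B\<^sup>+\<close>, \<open>p\<close> for the canonical map
  and \<open>I\<close> for \<open>A (A \<inter> B)\<^sup>+\<close>. Faithful flatness enters through the last assumption, which says that left
  coinvariants are scalars modulo \<open>I\<close>.
\<close>
locale coinvariant_quotient = hopf_quotient K E I + C: coalgebra K C
  for K :: "('k, 'w) ring_scheme" and E :: "('k, 'h) hopf_alg" and I :: "'h set" and C :: "('k, 'h set) hopf_alg" +
  fixes p :: "'h \<Rightarrow> 'h set"
  assumes p: "p \<in> linear_maps K E C"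
    and p_comult: "x \<in> carrier E \<Longrightarrow> comult C (p x) = tensor_map K C C p p (comult E x)"
    and p_counit: "x \<in> carrier E \<Longrightarrow> counit C (p x) = counit E x"
    and p_mult: "x \<in> carrier E \<Longrightarrow> y \<in> carrier E \<Longrightarrow> p (x \<otimes>\<^bsub>E\<^esub> y) = p x \<otimes>\<^bsub>C\<^esub> p y"
    and C_ring: "ring C" and p_one: "p \<one>\<^bsub>E\<^esub> = \<one>\<^bsub>C\<^esub>"
    and C_mult: "c \<in> carrier C \<Longrightarrow> (\<lambda>d. c \<otimes>\<^bsub>C\<^esub> d) \<in> linear_maps K C C" "c \<in> carrier C \<Longrightarrow> (\<lambda>d. d \<otimes>\<^bsub>C\<^esub> c) \<in> linear_maps K C C"
    and p_I: "i \<in> I \<Longrightarrow> p i = \<zero>\<^bsub>C\<^esub>"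
    and coinvariant: "b \<in> carrier E \<Longrightarrow> tensor_map K C E p (\<lambda>x. x) (comult E b) = pure_tensor K C E (p \<one>\<^bsub>E\<^esub>) b \<Longrightarrow>
       b \<ominus>\<^bsub>E\<^esub> counit E b \<odot>\<^bsub>E\<^esub> \<one>\<^bsub>E\<^esub> \<in> I"
begin

interpretation CR: ring C by (rule C_ring)

abbreviation "\<delta> \<equiv> induced_coaction K E C p"

lemmas lp = linear_comp[OF p]
lemmas lC = linear_comp[OF C_mult(1)] linear_comp[OF C_mult(2)]
lemmas p_closed [simp] = linear_closed[OF p]

lemma \<delta>_linear: "\<delta> \<in> linear_maps K E (tensor_prod K E C)"
  unfolding induced_coaction_def
  by (rule linear_comp[OF linear_tensor_map(1)[OF module_C module_C module_C C.module_C linear_id p] comult_linear])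

text \<open>
  An element \<open>t = \<Sum> x \<otimes> y\<close> of \<open>E \<box>\<^sub>C E\<close> has the form \<open>\<Sum> a\<^sub>1 \<otimes> a\<^sub>2 b\<close> with \<open>\<Sum> a \<otimes> b = \<Sum> x\<^sub>1 \<otimes> S(x\<^sub>2) y\<close>, where
  the elements \<open>b\<close> can be chosen coinvariant. Since \<open>b\<close> is then \<open>\<epsilon>(b) 1\<close> modulo \<open>I\<close>, a map \<open>g\<close> that vanishes
  on \<open>E I\<close> does not distinguish \<open>t\<close> from \<open>\<Sum> w\<^sub>1 \<otimes> w\<^sub>2\<close> with \<open>w = \<Sum> \<epsilon>(b) a\<close>.
  The left comodule \<open>E\<close> is replaced by a copy \<open>M\<close>.
\<close>
lemma cotensor_element:
  assumes M: "module K M" and e: "e \<in> linear_maps K E M" and e': "e' \<in> linear_maps K M E"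
    and ee': "\<And>m. m \<in> carrier M \<Longrightarrow> e (e' m) = m" and e'e: "\<And>x. x \<in> carrier E \<Longrightarrow> e' (e x) = x"
    and t: "t \<in> cotensor K C E \<delta> M (\<lambda>m. tensor_map K C M p e (comult E (e' m)))"
  shows "\<exists>w\<in>carrier E. \<forall>(X :: ('k, 'x) module) g. module K X \<longrightarrow> g \<in> linear_maps K E X \<longrightarrow>
    (\<forall>a\<in>carrier E. \<forall>i\<in>I. g (a \<otimes>\<^bsub>E\<^esub> i) = \<zero>\<^bsub>X\<^esub>) \<longrightarrow>
    tensor_map K E X (\<lambda>x. x) (\<lambda>m. g (e' m)) t = tensor_map K E X (\<lambda>x. x) g (comult E w)"
proof -
  note mE = module_C and mC = C.module_C
  let ?S = "antipode E" and ?D = "comult E"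
  let ?\<rho> = "\<lambda>m. tensor_map K C M p e (?D (e' m))"
  have CM: "module K (tensor_prod K C M)" and ECM: "module K (tensor_prod K E (tensor_prod K C M))"
    and CE: "module K (tensor_prod K C E)" and ECE: "module K (tensor_prod K E (tensor_prod K C E))"
    and EE: "module K (tensor_prod K E E)" and EM: "module K (tensor_prod K E M)" using M by simp_all
  let ?EE = "tensor_prod K E E" and ?EM = "tensor_prod K E M"
  let ?U = "tensor_prod K E (tensor_prod K C M)" and ?V = "tensor_prod K E (tensor_prod K C E)"
  let ?u = "\<lambda>x c m. pure_tensor K E (tensor_prod K C M) x (pure_tensor K C M c m)"
  let ?v = "\<lambda>x c d. pure_tensor K E (tensor_prod K C E) x (pure_tensor K C E c d)"
  note le = linear_comp[OF e] and le' = linear_comp[OF e']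
  note [simp] = linear_closed[OF e] linear_closed[OF e'] M
  have tu: "trilinear_map K E C M ?U ?u" by (rule trilinear_pure[OF mE mC M])
  have tv: "trilinear_map K E C E ?V ?v" by (rule trilinear_pure[OF mE mC mE])

  have \<rho>: "?\<rho> \<in> linear_maps K M (tensor_prod K C M)"
    by (intro linear_comp[OF linear_tensor_map(1)[OF mE mE mC M p e]] linear_comp[OF comult_linear e'])
  have tc: "t \<in> carrier ?EM" using t by (simp add: cotensor_def)

  \<comment> \<open>\<open>r = \<Sum> x\<^sub>1 \<otimes> S(x\<^sub>2) y\<close>, and \<open>t\<close> is recovered from \<open>r\<close> by \<open>a \<otimes> b \<mapsto> a\<^sub>1 \<otimes> a\<^sub>2 b\<close>\<close>
  define W where "W = (\<lambda>x m. tlift ?EE (\<lambda>u v. pure_tensor K E E u (?S v \<otimes>\<^bsub>E\<^esub> e' m)) (?D x))"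
  have W: "bilinear_map K E M ?EE W" unfolding W_def by (intro mlin le'; simp)
  define r where "r = tlift ?EE W t"
  have r: "r \<in> carrier ?EE" unfolding r_def by (rule lift_closed[OF mE M EE W tc])
  define L where "L = (\<lambda>a b. tlift ?EM (\<lambda>u v. pure_tensor K E M u (e (v \<otimes>\<^bsub>E\<^esub> b))) (?D a))"
  have L: "bilinear_map K E E ?EM L" unfolding L_def by (intro mlin le; simp)
  have lL: "tlift ?EM L \<in> linear_maps K ?EE ?EM" by (rule linear_lift(1)[OF mE mE EM L])
  have tr: "t = tlift ?EM L r"
  proof -
    have "tlift ?EM L r = tlift ?EM (\<lambda>x m. tlift ?EM L (W x m)) t"
      unfolding r_def by (rule linear_lift_lift[OF mE M EE EM W lL tc])
    also have "\<dots> = tlift ?EM (pure_tensor K E M) t"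
    proof (rule lift_cong[OF mE M tc, symmetric])
      fix x m assume x: "x \<in> carrier E" and m: "m \<in> carrier M"
      have h: "bilinear_map K E E ?EM (\<lambda>a b. pure_tensor K E M a (e (b \<otimes>\<^bsub>E\<^esub> e' m)))" using m by (intro mlin le; simp)
      have bw: "bilinear_map K E E ?EE (\<lambda>u v. pure_tensor K E E u (?S v \<otimes>\<^bsub>E\<^esub> e' m))" using m by (intro mlin; simp)
      have "tlift ?EM L (W x m) = tlift ?EM (\<lambda>u v. tlift ?EM L (pure_tensor K E E u (?S v \<otimes>\<^bsub>E\<^esub> e' m))) (?D x)"
        unfolding W_def by (rule linear_lift_lift[OF mE mE EE EM bw lL comult_closed[OF x]])
      also have "\<dots> = tlift ?EM (\<lambda>u v. tlift ?EM (\<lambda>a b. pure_tensor K E M a (e (b \<otimes>\<^bsub>E\<^esub> ?S v \<otimes>\<^bsub>E\<^esub> e' m))) (?D u)) (?D x)"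
      proof (rule lift_cong[OF mE mE comult_closed[OF x], symmetric])
        fix u v assume uv: "u \<in> carrier E" "v \<in> carrier E"
        have "tlift ?EM L (pure_tensor K E E u (?S v \<otimes>\<^bsub>E\<^esub> e' m)) = L u (?S v \<otimes>\<^bsub>E\<^esub> e' m)"
          by (rule lift_pure[OF mE mE EM L]) (use uv m in simp_all)
        also have "\<dots> = tlift ?EM (\<lambda>a b. pure_tensor K E M a (e (b \<otimes>\<^bsub>E\<^esub> ?S v \<otimes>\<^bsub>E\<^esub> e' m))) (?D u)"
          unfolding L_def
          by (rule lift_cong[OF mE mE comult_closed[OF uv(1)]])
            (use uv m in \<open>simp add: M.m_assoc\<close>)
        finally show "tlift ?EM (\<lambda>a b. pure_tensor K E M a (e (b \<otimes>\<^bsub>E\<^esub> ?S v \<otimes>\<^bsub>E\<^esub> e' m))) (?D u)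
            = tlift ?EM L (pure_tensor K E E u (?S v \<otimes>\<^bsub>E\<^esub> e' m))" by simp
      qed
      also have "\<dots> = pure_tensor K E M x (e (\<one>\<^bsub>E\<^esub> \<otimes>\<^bsub>E\<^esub> e' m))"
        by (rule tlift_cancel_right[OF EM h x])
      finally show "pure_tensor K E M x m = tlift ?EM L (W x m)" using m by (simp add: ee')
    qed
    also have "\<dots> = t" by (rule lift_pure_id[OF mE M tc])
    finally show ?thesis by simp
  qed

  \<comment> \<open>For \<open>t = a\<^sub>1 \<otimes> a\<^sub>2 b\<close> both sides of the equation defining \<open>E \<box>\<^sub>C E\<close> are values of the map
      \<open>\<Theta>(a, c, d) = a\<^sub>1 \<otimes> p(a\<^sub>2) c \<otimes> a\<^sub>3 d\<close>: at \<open>(a, 1, b)\<close> and at \<open>(a, p(b\<^sub>1), b\<^sub>2)\<close>. It has a left inverse: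
      \<open>F1\<close> replaces \<open>x \<otimes> c \<otimes> d\<close> by \<open>x\<^sub>1 \<otimes> p(S(x\<^sub>2)) c \<otimes> d\<close>, which leads to \<open>a\<^sub>1 \<otimes> c \<otimes> a\<^sub>2 d\<close>, and \<open>F2\<close> replaces it by
      \<open>x\<^sub>1 \<otimes> c \<otimes> S(x\<^sub>2) d\<close>.\<close>
  define \<Theta> where "\<Theta> = (\<lambda>a c d. tlift ?U (\<lambda>x q. tlift ?U (\<lambda>y z. ?u x (p y \<otimes>\<^bsub>C\<^esub> c) (e (z \<otimes>\<^bsub>E\<^esub> d))) (?D q)) (?D a))"
  define F1 where "F1 = tlift ?V (\<lambda>x. tlift ?V (\<lambda>c m. tlift ?V (\<lambda>u1 u2. ?v u1 (p (?S u2) \<otimes>\<^bsub>C\<^esub> c) (e' m)) (?D x)))"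
  define F2 where "F2 = tlift ?V (\<lambda>x. tlift ?V (\<lambda>c d. tlift ?V (\<lambda>u1 u2. ?v u1 c (?S u2 \<otimes>\<^bsub>E\<^esub> d)) (?D x)))"
  have t1: "trilinear_map K E C M ?V (\<lambda>x c m. tlift ?V (\<lambda>u1 u2. ?v u1 (p (?S u2) \<otimes>\<^bsub>C\<^esub> c) (e' m)) (?D x))"
    by (intro mlin le' lp lC; simp)
  have t2: "trilinear_map K E C E ?V (\<lambda>x c d. tlift ?V (\<lambda>u1 u2. ?v u1 c (?S u2 \<otimes>\<^bsub>E\<^esub> d)) (?D x))"
    by (intro mlin; simp)
  have F1: "F1 \<in> linear_maps K ?U ?V" unfolding F1_def by (rule linear_lift(1)[OF mE CM ECE bilinear_tlift_right[OF mE mC M ECE t1]])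
  have F2: "F2 \<in> linear_maps K ?V ?V" unfolding F2_def by (rule linear_lift(1)[OF mE CE ECE bilinear_tlift_right[OF mE mC mE ECE t2]])
  have F1p: "F1 (?u x c m) = tlift ?V (\<lambda>u1 u2. ?v u1 (p (?S u2) \<otimes>\<^bsub>C\<^esub> c) (e' m)) (?D x)"
    if "x \<in> carrier E" "c \<in> carrier C" "m \<in> carrier M" for x c m
    unfolding F1_def using that pure_closed[OF mC M, of c m]
    by (simp add: lift_pure[OF mE CM ECE bilinear_tlift_right[OF mE mC M ECE t1]] lift_pure[OF mC M ECE trilinearD(1)[OF t1]])
  have F2p: "F2 (?v x c d) = tlift ?V (\<lambda>u1 u2. ?v u1 c (?S u2 \<otimes>\<^bsub>E\<^esub> d)) (?D x)"
    if "x \<in> carrier E" "c \<in> carrier C" "d \<in> carrier E" for x c d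
    unfolding F2_def using that pure_closed[OF mC mE, of c d]
    by (simp add: lift_pure[OF mE CE ECE bilinear_tlift_right[OF mE mC mE ECE t2]] lift_pure[OF mC mE ECE trilinearD(1)[OF t2]])
  have F\<Theta>: "F2 (F1 (\<Theta> a c d)) = ?v a c d" if a: "a \<in> carrier E" and c: "c \<in> carrier C" and d: "d \<in> carrier E" for a c d
  proof -
    have i1: "bilinear_map K E E ?U (\<lambda>y z. ?u x (p y \<otimes>\<^bsub>C\<^esub> c) (e (z \<otimes>\<^bsub>E\<^esub> d)))" if "x \<in> carrier E" for x
      using that c d by (intro mlin le lp lC; simp)
    have i2: "bilinear_map K E E ?U (\<lambda>x q. tlift ?U (\<lambda>y z. ?u x (p y \<otimes>\<^bsub>C\<^esub> c) (e (z \<otimes>\<^bsub>E\<^esub> d))) (?D q))"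
      using c d by (intro mlin le lp lC; simp)
    let ?G = "\<lambda>u1 u2 y z. ?v u1 (p (?S u2 \<otimes>\<^bsub>E\<^esub> y) \<otimes>\<^bsub>C\<^esub> c) (z \<otimes>\<^bsub>E\<^esub> d)"
    have "F1 (\<Theta> a c d) = tlift ?V (\<lambda>x q. F1 (tlift ?U (\<lambda>y z. ?u x (p y \<otimes>\<^bsub>C\<^esub> c) (e (z \<otimes>\<^bsub>E\<^esub> d))) (?D q))) (?D a)"
      unfolding \<Theta>_def by (rule linear_lift_lift[OF mE mE ECM ECE i2 F1 comult_closed[OF a]])
    also have "\<dots> = tlift ?V (\<lambda>x q. tlift ?V (\<lambda>u1 u2. tlift ?V (?G u1 u2) (?D q)) (?D x)) (?D a)"
    proof (rule lift_cong[OF mE mE comult_closed[OF a], symmetric])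
      fix x q assume x: "x \<in> carrier E" and q: "q \<in> carrier E"
      have "F1 (tlift ?U (\<lambda>y z. ?u x (p y \<otimes>\<^bsub>C\<^esub> c) (e (z \<otimes>\<^bsub>E\<^esub> d))) (?D q))
        = tlift ?V (\<lambda>y z. F1 (?u x (p y \<otimes>\<^bsub>C\<^esub> c) (e (z \<otimes>\<^bsub>E\<^esub> d)))) (?D q)"
        by (rule linear_lift_lift[OF mE mE ECM ECE i1[OF x] F1 comult_closed[OF q]])
      also have "\<dots> = tlift ?V (\<lambda>y z. tlift ?V (\<lambda>u1 u2. ?G u1 u2 y z) (?D x)) (?D q)"
      proof (rule lift_cong[OF mE mE comult_closed[OF q], symmetric])
        fix y z assume yz: "y \<in> carrier E" "z \<in> carrier E"
        show "tlift ?V (\<lambda>u1 u2. ?G u1 u2 y z) (?D x) = F1 (?u x (p y \<otimes>\<^bsub>C\<^esub> c) (e (z \<otimes>\<^bsub>E\<^esub> d)))"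
          unfolding F1p[OF x CR.m_closed[OF p_closed[OF yz(1)] c] linear_closed[OF e M.m_closed[OF yz(2) d]]]
          by (rule lift_cong[OF mE mE comult_closed[OF x]])
            (use yz c d in \<open>simp add: p_mult CR.m_assoc e'e\<close>)
      qed
      also have "\<dots> = tlift ?V (\<lambda>u1 u2. tlift ?V (?G u1 u2) (?D q)) (?D x)"
        by (rule lift_fubini[OF mE mE mE mE ECE _ _ comult_closed[OF q] comult_closed[OF x]]) (use c d in \<open>intro mlin lp lC; simp\<close>)+
      finally show "tlift ?V (\<lambda>u1 u2. tlift ?V (?G u1 u2) (?D q)) (?D x)
        = F1 (tlift ?U (\<lambda>y z. ?u x (p y \<otimes>\<^bsub>C\<^esub> c) (e (z \<otimes>\<^bsub>E\<^esub> d))) (?D q))" by simp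
    qed
    also have "\<dots> = tlift ?V (\<lambda>u1 q. tlift ?V (\<lambda>u2 r. tlift ?V (?G u1 u2) (?D r)) (?D q)) (?D a)"
      by (rule tlift_coassoc[OF ECE _ a]) (use c d in \<open>intro mlin lp lC; simp\<close>)
    also have "\<dots> = tlift ?V (\<lambda>u1 q. ?v u1 c (q \<otimes>\<^bsub>E\<^esub> d)) (?D a)"
    proof (rule lift_cong[OF mE mE comult_closed[OF a]])
      fix u1 q assume u1: "u1 \<in> carrier E" and q: "q \<in> carrier E"
      have h: "bilinear_map K E E ?V (\<lambda>y z. ?v u1 (p y \<otimes>\<^bsub>C\<^esub> c) (z \<otimes>\<^bsub>E\<^esub> d))"
        using u1 c d by (intro mlin lp lC; simp)
      show "tlift ?V (\<lambda>u2 r. tlift ?V (?G u1 u2) (?D r)) (?D q) = ?v u1 c (q \<otimes>\<^bsub>E\<^esub> d)"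
        using tlift_cancel_left'[OF ECE h q] c by (simp add: p_one)
    qed
    finally have 1: "F1 (\<Theta> a c d) = tlift ?V (\<lambda>u1 q. ?v u1 c (q \<otimes>\<^bsub>E\<^esub> d)) (?D a)" .
    have b1: "bilinear_map K E E ?V (\<lambda>u1 q. ?v u1 c (q \<otimes>\<^bsub>E\<^esub> d))" using c d by (intro mlin; simp)
    have "F2 (F1 (\<Theta> a c d)) = tlift ?V (\<lambda>u1 q. F2 (?v u1 c (q \<otimes>\<^bsub>E\<^esub> d))) (?D a)"
      unfolding 1 by (rule linear_lift_lift[OF mE mE ECE ECE b1 F2 comult_closed[OF a]])
    also have "\<dots> = tlift ?V (\<lambda>u q. tlift ?V (\<lambda>u1 u2. ?v u1 c (?S u2 \<otimes>\<^bsub>E\<^esub> q \<otimes>\<^bsub>E\<^esub> d)) (?D u)) (?D a)"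
    proof (rule lift_cong[OF mE mE comult_closed[OF a], symmetric])
      show "tlift ?V (\<lambda>u1 u2. ?v u1 c (?S u2 \<otimes>\<^bsub>E\<^esub> q \<otimes>\<^bsub>E\<^esub> d)) (?D u) = F2 (?v u c (q \<otimes>\<^bsub>E\<^esub> d))"
        if "u \<in> carrier E" "q \<in> carrier E" for u q
        unfolding F2p[OF that(1) c M.m_closed[OF that(2) d]]
        by (rule lift_cong[OF mE mE comult_closed[OF that(1)]])
          (use that c d in \<open>simp add: M.m_assoc\<close>)
    qed
    also have "\<dots> = ?v a c (\<one>\<^bsub>E\<^esub> \<otimes>\<^bsub>E\<^esub> d)"
      by (rule tlift_cancel_left[OF ECE _ a, where h = "\<lambda>u1 z. ?v u1 c (z \<otimes>\<^bsub>E\<^esub> d)"]) (use c d in \<open>intro mlin; simp\<close>)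
    finally show ?thesis using d by simp
  qed

  let ?lhs = "tlift ?U (\<lambda>v m. tlift ?U (\<lambda>x c. ?u x c m) (\<delta> v))"
  let ?rhs = "tlift ?U (\<lambda>v m. tlift ?U (?u v) (?\<rho> m))"
  have bl: "bilinear_map K E M ?U (\<lambda>v m. tlift ?U (\<lambda>x c. ?u x c m) (\<delta> v))"
    using bilinear_left_comp[OF bilinear_tlift_left[OF mE mC M ECM tu] \<delta>_linear] bilinear_right[OF bilinear_tlift_left[OF mE mC M ECM tu] linear_closed[OF \<delta>_linear]]
    by (intro bilinearI) auto
  have br: "bilinear_map K E M ?U (\<lambda>v m. tlift ?U (?u v) (?\<rho> m))"
    using bilinear_right_comp[OF bilinear_tlift_right[OF mE mC M ECM tu] \<rho>] bilinear_left[OF bilinear_tlift_right[OF mE mC M ECM tu] linear_closed[OF \<rho>]]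
    by (intro bilinearI) auto
  have llhs: "?lhs \<in> linear_maps K ?EM ?U" and lrhs: "?rhs \<in> linear_maps K ?EM ?U"
    by (rule linear_lift(1)[OF mE M ECM bl], rule linear_lift(1)[OF mE M ECM br])
  have eq: "?lhs t = ?rhs t"
    using t assoc_coaction_tlift[OF mE mC M \<delta>_linear mE tc] tensor_map_coaction_tlift[OF mE mC M M \<rho> tc] by (simp add: cotensor_def)
  have lL_pure: "bilinear_map K E E ?EM (\<lambda>u v. pure_tensor K E M u (e (v \<otimes>\<^bsub>E\<^esub> b)))" if "b \<in> carrier E" for b
    using that by (intro mlin le; simp)
  have lhsL: "?lhs (L a b) = \<Theta> a (p \<one>\<^bsub>E\<^esub>) b" if a: "a \<in> carrier E" and b: "b \<in> carrier E" for a b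
  proof -
    have "?lhs (L a b) = tlift ?U (\<lambda>u v. ?lhs (pure_tensor K E M u (e (v \<otimes>\<^bsub>E\<^esub> b)))) (?D a)"
      unfolding L_def by (rule linear_lift_lift[OF mE mE EM ECM lL_pure[OF b] llhs comult_closed[OF a]])
    also have "\<dots> = tlift ?U (\<lambda>u v. tlift ?U (\<lambda>x y. ?u x (p y) (e (v \<otimes>\<^bsub>E\<^esub> b))) (?D u)) (?D a)"
    proof (rule lift_cong[OF mE mE comult_closed[OF a], symmetric])
      fix u v assume uv: "u \<in> carrier E" "v \<in> carrier E"
      have m: "e (v \<otimes>\<^bsub>E\<^esub> b) \<in> carrier M" using uv b by simp
      have "?lhs (pure_tensor K E M u (e (v \<otimes>\<^bsub>E\<^esub> b))) = tlift ?U (\<lambda>x c. ?u x c (e (v \<otimes>\<^bsub>E\<^esub> b))) (\<delta> u)"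
        by (rule lift_pure[OF mE M ECM bl uv(1) m])
      also have "\<dots> = tlift ?U (\<lambda>x y. ?u x (p y) (e (v \<otimes>\<^bsub>E\<^esub> b))) (?D u)"
        unfolding induced_coaction_def
        by (rule lift_tensor_map[OF mE mE mE mC ECM linear_id p trilinearD(3)[OF tu m] comult_closed[OF uv(1)]])
      finally show "tlift ?U (\<lambda>x y. ?u x (p y) (e (v \<otimes>\<^bsub>E\<^esub> b))) (?D u) = ?lhs (pure_tensor K E M u (e (v \<otimes>\<^bsub>E\<^esub> b)))" by simp
    qed
    also have "\<dots> = tlift ?U (\<lambda>x q. tlift ?U (\<lambda>y v. ?u x (p y) (e (v \<otimes>\<^bsub>E\<^esub> b))) (?D q)) (?D a)"
      by (rule tlift_coassoc[OF ECM _ a]) (use b in \<open>intro mlin lp le; simp\<close>)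
    also have "\<dots> = \<Theta> a (p \<one>\<^bsub>E\<^esub>) b"
      unfolding \<Theta>_def
    proof (rule lift_cong[OF mE mE comult_closed[OF a]])
      show "tlift ?U (\<lambda>y v. ?u x (p y) (e (v \<otimes>\<^bsub>E\<^esub> b))) (?D q) = tlift ?U (\<lambda>y z. ?u x (p y \<otimes>\<^bsub>C\<^esub> p \<one>\<^bsub>E\<^esub>) (e (z \<otimes>\<^bsub>E\<^esub> b))) (?D q)"
        if "x \<in> carrier E" "q \<in> carrier E" for x q
        by (rule lift_cong[OF mE mE comult_closed[OF that(2)]])
          (simp add: p_one)
    qed
    finally show ?thesis .
  qed
  have rhsL: "?rhs (L a b) = tlift ?U (\<lambda>b1 b2. \<Theta> a (p b1) b2) (?D b)" if a: "a \<in> carrier E" and b: "b \<in> carrier E" for a b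
  proof -
    let ?H = "\<lambda>a1 a2 a3 b1 b2. ?u a1 (p a2 \<otimes>\<^bsub>C\<^esub> p b1) (e (a3 \<otimes>\<^bsub>E\<^esub> b2))"
    have "?rhs (L a b) = tlift ?U (\<lambda>u v. ?rhs (pure_tensor K E M u (e (v \<otimes>\<^bsub>E\<^esub> b)))) (?D a)"
      unfolding L_def by (rule linear_lift_lift[OF mE mE EM ECM lL_pure[OF b] lrhs comult_closed[OF a]])
    also have "\<dots> = tlift ?U (\<lambda>u v. tlift ?U (\<lambda>b1 b2. tlift ?U (\<lambda>y z. ?H u y z b1 b2) (?D v)) (?D b)) (?D a)"
    proof (rule lift_cong[OF mE mE comult_closed[OF a], symmetric])
      fix u v assume uv: "u \<in> carrier E" "v \<in> carrier E"
      have vb: "v \<otimes>\<^bsub>E\<^esub> b \<in> carrier E" using uv b by simp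
      have bp: "bilinear_map K E E ?U (\<lambda>y z. ?u u (p y) (e z))" using uv by (intro mlin lp le; simp)
      have "?rhs (pure_tensor K E M u (e (v \<otimes>\<^bsub>E\<^esub> b))) = tlift ?U (?u u) (?\<rho> (e (v \<otimes>\<^bsub>E\<^esub> b)))"
        by (rule lift_pure[OF mE M ECM br uv(1) linear_closed[OF e vb]])
      also have "\<dots> = tlift ?U (\<lambda>y z. ?u u (p y) (e z)) (?D (v \<otimes>\<^bsub>E\<^esub> b))"
        unfolding e'e[OF vb]
        by (rule lift_tensor_map[OF mE mE mC M ECM p e trilinearD(1)[OF tu uv(1)] comult_closed[OF vb]])
      also have "\<dots> = tlift ?U (\<lambda>y z. tlift ?U (\<lambda>b1 b2. ?u u (p (y \<otimes>\<^bsub>E\<^esub> b1)) (e (z \<otimes>\<^bsub>E\<^esub> b2))) (?D b)) (?D v)"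
        by (rule tlift_comult_mult[OF ECM bp uv(2) b])
      also have "\<dots> = tlift ?U (\<lambda>y z. tlift ?U (\<lambda>b1 b2. ?H u y z b1 b2) (?D b)) (?D v)"
      proof (rule lift_cong[OF mE mE comult_closed[OF uv(2)]])
        show "tlift ?U (\<lambda>b1 b2. ?u u (p (y \<otimes>\<^bsub>E\<^esub> b1)) (e (z \<otimes>\<^bsub>E\<^esub> b2))) (?D b) = tlift ?U (\<lambda>b1 b2. ?H u y z b1 b2) (?D b)"
          if "y \<in> carrier E" "z \<in> carrier E" for y z
          by (rule lift_cong[OF mE mE comult_closed[OF b]])
            (use that in \<open>simp add: p_mult\<close>)
      qed
      also have "\<dots> = tlift ?U (\<lambda>b1 b2. tlift ?U (\<lambda>y z. ?H u y z b1 b2) (?D v)) (?D b)"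
        by (rule lift_fubini[OF mE mE mE mE ECM _ _ comult_closed[OF uv(2)] comult_closed[OF b]]) (use uv in \<open>intro mlin lp le lC; simp\<close>)+
      finally show "tlift ?U (\<lambda>b1 b2. tlift ?U (\<lambda>y z. ?H u y z b1 b2) (?D v)) (?D b) = ?rhs (pure_tensor K E M u (e (v \<otimes>\<^bsub>E\<^esub> b)))" by simp
    qed
    also have "\<dots> = tlift ?U (\<lambda>b1 b2. \<Theta> a (p b1) b2) (?D b)"
      unfolding \<Theta>_def
      by (rule lift_fubini[OF mE mE mE mE ECM _ _ comult_closed[OF a] comult_closed[OF b]]) (use a b in \<open>intro mlin lp le lC; simp\<close>)+
    finally show ?thesis .
  qed

  \<comment> \<open>Cancelling \<open>\<Theta>\<close> leaves \<open>a \<otimes> 1 \<otimes> b = a \<otimes> p(b\<^sub>1) \<otimes> b\<^sub>2\<close> summed over \<open>r\<close>, so \<open>r\<close> lies in the kernel of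
      \<open>id \<otimes> h\<close> for the linear map \<open>h\<close> whose kernel is the space of coinvariants.\<close>
  let ?CE = "tensor_prod K C E"
  define l where "l = (\<lambda>b. tensor_map K C E p (\<lambda>x. x) (?D b))"
  define l1 where "l1 = (\<lambda>b. pure_tensor K C E (p \<one>\<^bsub>E\<^esub>) b)"
  have l: "l \<in> linear_maps K E ?CE" unfolding l_def by (rule linear_comp[OF linear_tensor_map(1)[OF mE mE mC mE p linear_id] comult_linear])
  have l1: "l1 \<in> linear_maps K E ?CE" unfolding l1_def by (intro mlin; simp)
  define h where "h = (\<lambda>b. l b \<ominus>\<^bsub>?CE\<^esub> l1 b)"
  have h: "h \<in> linear_maps K E ?CE" unfolding h_def by (rule linear_difference[OF CE l l1])
  have F12: "(\<lambda>s. F2 (F1 s)) \<in> linear_maps K ?U ?V" by (rule linear_comp[OF F2 F1])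
  have key: "tensor_map K E ?CE (\<lambda>x. x) l1 r = tensor_map K E ?CE (\<lambda>x. x) l r"
  proof -
    have flhs: "(\<lambda>s. F2 (F1 (?lhs s))) \<in> linear_maps K ?EM ?V" and frhs: "(\<lambda>s. F2 (F1 (?rhs s))) \<in> linear_maps K ?EM ?V"
      by (rule linear_comp[OF F12 llhs], rule linear_comp[OF F12 lrhs])
    have "tensor_map K E ?CE (\<lambda>x. x) l1 r = tlift ?V (\<lambda>a b. F2 (F1 (?lhs (L a b)))) r"
      unfolding tensor_map_lift[of K E ?CE]
      by (rule lift_cong[OF mE mE r]) (simp add: lhsL F\<Theta> l1_def)
    also have "\<dots> = F2 (F1 (?lhs t))"
      unfolding tr by (rule linear_lift_lift[OF mE mE EM ECE L flhs r, symmetric])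
    also have "\<dots> = F2 (F1 (?rhs t))" using eq by simp
    also have "\<dots> = tlift ?V (\<lambda>a b. F2 (F1 (?rhs (L a b)))) r"
      unfolding tr by (rule linear_lift_lift[OF mE mE EM ECE L frhs r])
    also have "\<dots> = tensor_map K E ?CE (\<lambda>x. x) l r"
      unfolding tensor_map_lift[of K E ?CE]
    proof (rule lift_cong[OF mE mE r, symmetric])
      fix a b assume a: "a \<in> carrier E" and b: "b \<in> carrier E"
      have b\<Theta>: "bilinear_map K E E ?U (\<lambda>b1 b2. \<Theta> a (p b1) b2)"
        unfolding \<Theta>_def using a by (intro mlin lp le lC; simp)
      have bv: "bilinear_map K C E ?V (\<lambda>c d. ?v a c d)" by (rule trilinearD(1)[OF tv a])
      have "F2 (F1 (?rhs (L a b))) = tlift ?V (\<lambda>b1 b2. F2 (F1 (\<Theta> a (p b1) b2))) (?D b)"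
        unfolding rhsL[OF a b] by (rule linear_lift_lift[OF mE mE ECM ECE b\<Theta> F12 comult_closed[OF b]])
      also have "\<dots> = tlift ?V (\<lambda>b1 b2. ?v a (p b1) b2) (?D b)"
        by (rule lift_cong[OF mE mE comult_closed[OF b], symmetric]) (simp add: F\<Theta> a)
      also have "\<dots> = tlift ?V (?v a) (l b)"
        unfolding l_def by (rule lift_tensor_map[OF mE mE mC mE ECE p linear_id bv comult_closed[OF b], symmetric])
      also have "\<dots> = pure_tensor K E ?CE a (tlift ?CE (pure_tensor K C E) (l b))"
        by (rule linear_lift_lift[OF mC mE CE ECE bilinear_pure[OF mC mE] bilinear_right[OF bilinear_pure[OF mE CE] a] linear_closed[OF l b], symmetric])
      also have "\<dots> = pure_tensor K E ?CE a (l b)"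
        by (simp add: lift_pure_id[OF mC mE linear_closed[OF l b]])
      finally show "pure_tensor K E ?CE a (l b) = F2 (F1 (?rhs (L a b)))" by simp
    qed
    finally show ?thesis .
  qed
  have hz: "tensor_map K E ?CE (\<lambda>x. x) h r = \<zero>\<^bsub>?V\<^esub>"
  proof -
    interpret V: module K ?V by (rule ECE)
    note ll = linear_tensor_map(1)[OF mE mE mE CE linear_id l] and ll1 = linear_tensor_map(1)[OF mE mE mE CE linear_id l1]
    have "tensor_map K E ?CE (\<lambda>x. x) h r = tensor_map K E ?CE (\<lambda>x. x) l r \<ominus>\<^bsub>?V\<^esub> tensor_map K E ?CE (\<lambda>x. x) l1 r"
    proof (rule linear_eq_on_tensors[OF mE mE ECE linear_tensor_map(1)[OF mE mE mE CE linear_id h] linear_difference[OF ECE ll ll1] _ r])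
      fix m n assume mn: "m \<in> carrier E" "n \<in> carrier E"
      show "tensor_map K E ?CE (\<lambda>x. x) h (pure_tensor K E E m n) =
        tensor_map K E ?CE (\<lambda>x. x) l (pure_tensor K E E m n) \<ominus>\<^bsub>?V\<^esub> tensor_map K E ?CE (\<lambda>x. x) l1 (pure_tensor K E E m n)"
        using mn linear_diff[OF bilinear_right[OF bilinear_pure[OF mE CE] mn(1)] CE ECE linear_closed[OF l mn(2)] linear_closed[OF l1 mn(2)]]
        by (simp add: tensor_map_pure[OF mE mE mE CE linear_id] h l l1) (simp add: h_def)
    qed
    then show ?thesis using key linear_closed[OF ll r] by (simp add: V.minus_eq_zero_iff)
  qed
  \<comment> \<open>a map \<open>\<kappa>\<close> into the coinvariants with \<open>(id \<otimes> \<kappa>) r = r\<close> stands in for choosing a representation of \<open>r\<close>\<close>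
  obtain \<kappa> where \<kappa>: "\<kappa> \<in> linear_maps K E E" and h\<kappa>: "\<forall>x\<in>carrier E. h (\<kappa> x) = \<zero>\<^bsub>?CE\<^esub>"
    and \<kappa>t: "\<forall>t\<in>carrier ?EE. tensor_map K E ?CE (\<lambda>x. x) h t = \<zero>\<^bsub>?V\<^esub> \<longrightarrow> tensor_map K E E (\<lambda>x. x) \<kappa> t = t"
    using exists_kernel_projection[OF R.field_axioms mE CE mE h] by (elim bexE conjE)
  have r\<kappa>: "tensor_map K E E (\<lambda>x. x) \<kappa> r = r" by (rule mp[OF bspec[OF \<kappa>t r] hz])
  have \<kappa>I: "\<kappa> b \<ominus>\<^bsub>E\<^esub> counit E (\<kappa> b) \<odot>\<^bsub>E\<^esub> \<one>\<^bsub>E\<^esub> \<in> I" if b: "b \<in> carrier E" for b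
  proof -
    interpret CE: module K ?CE by (rule CE)
    have \<kappa>b: "\<kappa> b \<in> carrier E" using \<kappa> b by (rule linear_closed)
    have "l (\<kappa> b) = l1 (\<kappa> b)"
      using bspec[OF h\<kappa> b] linear_closed[OF l \<kappa>b] linear_closed[OF l1 \<kappa>b] by (simp add: h_def CE.minus_eq_zero_iff)
    then show ?thesis using coinvariant[OF \<kappa>b] by (simp add: l_def l1_def)
  qed

  \<comment> \<open>modulo \<open>I\<close> the coinvariant \<open>\<kappa>(b)\<close> is the scalar \<open>\<epsilon>(\<kappa>(b))\<close>\<close>
  define w where "w = tlift E (\<lambda>a b. counit E (\<kappa> b) \<odot>\<^bsub>E\<^esub> a) r"
  have bw: "bilinear_map K E E E (\<lambda>a b. counit E (\<kappa> b) \<odot>\<^bsub>E\<^esub> a)"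
    using linear_closed[OF \<kappa>] by (intro mlin \<kappa>; simp)
  have w: "w \<in> carrier E" unfolding w_def by (rule lift_closed[OF mE mE mE bw r])
  have "tensor_map K E X (\<lambda>x. x) (\<lambda>m. g (e' m)) t = tensor_map K E X (\<lambda>x. x) g (?D w)"
    if X: "module K X" and g: "g \<in> linear_maps K E X" and gI: "\<forall>a\<in>carrier E. \<forall>i\<in>I. g (a \<otimes>\<^bsub>E\<^esub> i) = \<zero>\<^bsub>X\<^esub>"
    for X :: "('k, 'x) module" and g
  proof -
    interpret X: module K X by fact
    note lg = linear_comp[OF g]
    note [simp] = linear_closed[OF g] linear_closed[OF \<kappa>] X
    have EX: "module K (tensor_prod K E X)" by simp
    let ?EX = "tensor_prod K E X"
    have g\<kappa>: "g (a \<otimes>\<^bsub>E\<^esub> \<kappa> b) = counit E (\<kappa> b) \<odot>\<^bsub>X\<^esub> g a" if a: "a \<in> carrier E" and b: "b \<in> carrier E" for a b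
    proof -
      let ?c = "counit E (\<kappa> b) \<odot>\<^bsub>E\<^esub> \<one>\<^bsub>E\<^esub>"
      have k: "\<kappa> b \<in> carrier E" using b by simp
      then have c: "?c \<in> carrier E" by simp
      have lm: "(\<lambda>z. g (a \<otimes>\<^bsub>E\<^esub> z)) \<in> linear_maps K E X" using a by (intro lg mlin; simp)
      have "g (a \<otimes>\<^bsub>E\<^esub> \<kappa> b) \<ominus>\<^bsub>X\<^esub> g (a \<otimes>\<^bsub>E\<^esub> ?c) = \<zero>\<^bsub>X\<^esub>"
        by (rule trans[OF linear_diff[OF lm mE X k c, symmetric] bspec[OF bspec[OF gI a] \<kappa>I[OF b]]])
      then have "g (a \<otimes>\<^bsub>E\<^esub> \<kappa> b) = g (a \<otimes>\<^bsub>E\<^esub> ?c)"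
        by (rule iffD1[OF X.minus_eq_zero_iff, rotated 2]) (use a k c in simp_all)
      then show ?thesis using a k by (simp add: smult_mult_right linear_smult[OF g])
    qed
    have ge': "(\<lambda>m. g (e' m)) \<in> linear_maps K M X" by (rule linear_comp[OF g e'])
    have l1: "tensor_map K E X (\<lambda>x. x) (\<lambda>m. g (e' m)) \<in> linear_maps K ?EM ?EX"
      by (rule linear_tensor_map(1)[OF mE M mE X linear_id ge'])
    let ?\<Omega> = "\<lambda>a. tensor_map K E X (\<lambda>x. x) g (?D a)"
    have \<Omega>: "?\<Omega> \<in> linear_maps K E ?EX" by (rule linear_comp[OF linear_tensor_map(1)[OF mE mE mE X linear_id g] comult_linear])
    have Lg: "tensor_map K E X (\<lambda>x. x) (\<lambda>m. g (e' m)) (L a b) = tlift ?EX (\<lambda>u v. pure_tensor K E X u (g (v \<otimes>\<^bsub>E\<^esub> b))) (?D a)"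
      if a: "a \<in> carrier E" and b: "b \<in> carrier E" for a b
    proof -
      have "tensor_map K E X (\<lambda>x. x) (\<lambda>m. g (e' m)) (L a b)
        = tlift ?EX (\<lambda>u v. tensor_map K E X (\<lambda>x. x) (\<lambda>m. g (e' m)) (pure_tensor K E M u (e (v \<otimes>\<^bsub>E\<^esub> b)))) (?D a)"
        unfolding L_def by (rule linear_lift_lift[OF mE mE EM EX lL_pure[OF b] l1 comult_closed[OF a]])
      also have "\<dots> = tlift ?EX (\<lambda>u v. pure_tensor K E X u (g (v \<otimes>\<^bsub>E\<^esub> b))) (?D a)"
        by (rule lift_cong[OF mE mE comult_closed[OF a], symmetric])
          (use b in \<open>simp add: tensor_map_pure[OF mE M mE X linear_id ge'] e'e\<close>)
      finally show ?thesis .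
    qed
    have "tensor_map K E X (\<lambda>x. x) (\<lambda>m. g (e' m)) t = tlift ?EX (\<lambda>a b. tensor_map K E X (\<lambda>x. x) (\<lambda>m. g (e' m)) (L a b)) r"
      unfolding tr by (rule linear_lift_lift[OF mE mE EM EX L l1 r])
    also have "\<dots> = tlift ?EX (\<lambda>a b. tlift ?EX (\<lambda>u v. pure_tensor K E X u (g (v \<otimes>\<^bsub>E\<^esub> b))) (?D a)) r"
      by (rule lift_cong[OF mE mE r, symmetric]) (simp add: Lg)
    also have "\<dots> = tlift ?EX (\<lambda>a b. tlift ?EX (\<lambda>u v. pure_tensor K E X u (g (v \<otimes>\<^bsub>E\<^esub> \<kappa> b))) (?D a)) r"
    proof -
      have bb: "bilinear_map K E E ?EX (\<lambda>a b. tlift ?EX (\<lambda>u v. pure_tensor K E X u (g (v \<otimes>\<^bsub>E\<^esub> b))) (?D a))" by (intro mlin lg; simp)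
      show ?thesis using lift_tensor_map[OF mE mE mE mE EX linear_id \<kappa> bb r] r\<kappa> by simp
    qed
    also have "\<dots> = tlift ?EX (\<lambda>a b. ?\<Omega> (counit E (\<kappa> b) \<odot>\<^bsub>E\<^esub> a)) r"
    proof (rule lift_cong[OF mE mE r])
      fix a b assume a: "a \<in> carrier E" and b: "b \<in> carrier E"
      let ?k = "counit E (\<kappa> b)"
      have k: "?k \<in> carrier K" using b by simp
      have bp: "bilinear_map K E E ?EX (\<lambda>u v. pure_tensor K E X u (g v))" by (intro mlin lg; simp)
      have "tlift ?EX (\<lambda>u v. pure_tensor K E X u (g (v \<otimes>\<^bsub>E\<^esub> \<kappa> b))) (?D a) = tlift ?EX (\<lambda>u v. ?k \<odot>\<^bsub>?EX\<^esub> pure_tensor K E X u (g v)) (?D a)"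
        by (rule lift_cong[OF mE mE comult_closed[OF a]])
          (use b k in \<open>simp add: g\<kappa> smult_pure'[OF mE X]\<close>)
      also have "\<dots> = ?k \<odot>\<^bsub>?EX\<^esub> tlift ?EX (\<lambda>u v. pure_tensor K E X u (g v)) (?D a)"
        by (rule linear_lift_lift[OF mE mE EX EX bp linear_smult_left[OF EX linear_id k] comult_closed[OF a], symmetric])
      also have "\<dots> = ?\<Omega> (?k \<odot>\<^bsub>E\<^esub> a)"
        using linear_smult[OF \<Omega> k a] by (simp add: tensor_map_lift)
      finally show "tlift ?EX (\<lambda>u v. pure_tensor K E X u (g (v \<otimes>\<^bsub>E\<^esub> \<kappa> b))) (?D a) = ?\<Omega> (?k \<odot>\<^bsub>E\<^esub> a)" .
    qed
    also have "\<dots> = ?\<Omega> w"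
      unfolding w_def by (rule linear_lift_lift[OF mE mE mE EX bw \<Omega> r, symmetric])
    finally show ?thesis .
  qed
  then show ?thesis using w by blast
qed

end

section \<open>Faithful coflatness and the kernel\<close>

text \<open>
  A module carried along an injection \<open>e\<close> with left inverse \<open>e'\<close> into another type, used to move comodules
  into the universe in which coflatness is tested.
\<close>
definition transport :: "('m \<Rightarrow> 'u) \<Rightarrow> ('u \<Rightarrow> 'm) \<Rightarrow> ('k, 'm, 'x) module_scheme \<Rightarrow> ('k, 'u) module" where
  "transport e e' M = \<lparr>carrier = e ` carrier M, mult = (\<lambda>X Y. X), one = e \<zero>\<^bsub>M\<^esub>, zero = e \<zero>\<^bsub>M\<^esub>,
     add = (\<lambda>X Y. e (e' X \<oplus>\<^bsub>M\<^esub> e' Y)), smult = (\<lambda>k X. e (k \<odot>\<^bsub>M\<^esub> e' X))\<rparr>"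

lemma
  assumes M: "module K M" and e: "\<And>x. x \<in> carrier M \<Longrightarrow> e' (e x) = x"
  shows module_transport: "module K (transport e e' M)"
    and linear_transport: "e \<in> linear_maps K M (transport e e' M)"
    and linear_transport': "e' \<in> linear_maps K (transport e e' M) M"
    and transport_inverse: "m \<in> carrier (transport e e' M) \<Longrightarrow> e (e' m) = m"
proof -
  interpret M: module K M by fact
  let ?T = "transport e e' M"
  have car: "carrier ?T = e ` carrier M" and z: "\<zero>\<^bsub>?T\<^esub> = e \<zero>\<^bsub>M\<^esub>" by (simp_all add: transport_def)
  have a: "e x \<oplus>\<^bsub>?T\<^esub> e y = e (x \<oplus>\<^bsub>M\<^esub> y)" if "x \<in> carrier M" "y \<in> carrier M" for x y
    using that by (simp add: transport_def e)
  have s: "k \<odot>\<^bsub>?T\<^esub> e x = e (k \<odot>\<^bsub>M\<^esub> x)" if "x \<in> carrier M" for k x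
    using that by (simp add: transport_def e)
  show "module K ?T"
  proof (rule moduleI[OF M.is_cring])
    show "abelian_group ?T"
    proof (rule abelian_groupI)
      fix X assume "X \<in> carrier ?T"
      then obtain x where x: "x \<in> carrier M" "X = e x" by (auto simp: car)
      show "\<exists>Y\<in>carrier ?T. Y \<oplus>\<^bsub>?T\<^esub> X = \<zero>\<^bsub>?T\<^esub>"
        by (rule bexI[of _ "e (\<ominus>\<^bsub>M\<^esub> x)"]) (use x in \<open>simp_all add: a z car M.l_neg\<close>)
      show "\<zero>\<^bsub>?T\<^esub> \<oplus>\<^bsub>?T\<^esub> X = X" using x by (simp add: z a)
      fix Y assume "Y \<in> carrier ?T"
      then obtain y where y: "y \<in> carrier M" "Y = e y" by (auto simp: car)
      show "X \<oplus>\<^bsub>?T\<^esub> Y \<in> carrier ?T" using x y by (simp add: a car)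
      show "X \<oplus>\<^bsub>?T\<^esub> Y = Y \<oplus>\<^bsub>?T\<^esub> X" using x y by (simp add: a M.a_comm)
      fix Z assume "Z \<in> carrier ?T"
      then obtain z where z: "z \<in> carrier M" "Z = e z" by (auto simp: car)
      show "X \<oplus>\<^bsub>?T\<^esub> Y \<oplus>\<^bsub>?T\<^esub> Z = X \<oplus>\<^bsub>?T\<^esub> (Y \<oplus>\<^bsub>?T\<^esub> Z)" using x y z by (simp add: a M.a_assoc)
    qed (simp add: z car)
  qed (auto simp: car a s M.smult_l_distr M.smult_r_distr M.smult_assoc1)
  show "e \<in> linear_maps K M ?T" by (rule linearI) (simp_all add: car a s)
  show "e' \<in> linear_maps K ?T M" by (rule linearI) (auto simp: car a s e)
  show "m \<in> carrier ?T \<Longrightarrow> e (e' m) = m" by (auto simp: car e)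
qed

lemma transport_simps: "carrier (transport e e' M) = e ` carrier M" "zero (transport e e' M) = e \<zero>\<^bsub>M\<^esub>"
  by (simp_all add: transport_def)

definition zero_module :: "'u \<Rightarrow> ('k, 'u) module" where
  "zero_module z = \<lparr>carrier = {z}, mult = (\<lambda>_ _. z), one = z, zero = z, add = (\<lambda>_ _. z), smult = (\<lambda>_ _. z)\<rparr>"

lemma module_zero_module: "cring K \<Longrightarrow> module K (zero_module z)"
  by (intro moduleI abelian_groupI) (simp_all add: zero_module_def)

lemma tensor_zero_module:
  fixes K :: "('k, 'w) ring_scheme" and z :: 'u
  assumes V: "module K V" and t: "t \<in> carrier (tensor_prod K V (zero_module z :: ('k, 'u) module))"
  shows "t = \<zero>\<^bsub>tensor_prod K V (zero_module z)\<^esub>"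
proof -
  interpret V: module K V by fact
  let ?Z = "zero_module z :: ('k, 'u) module"
  have Z: "module K ?Z" by (rule module_zero_module[OF V.is_cring])
  have VZ: "module K (tensor_prod K V ?Z)" using V Z by simp
  interpret VZ: module K "tensor_prod K V ?Z" by (rule VZ)
  have zero: "(\<lambda>_. \<zero>\<^bsub>tensor_prod K V ?Z\<^esub>) \<in> linear_maps K (tensor_prod K V ?Z) (tensor_prod K V ?Z)"
    by (rule linearI) auto
  show ?thesis
  proof (rule linear_eq_on_tensors[OF V Z VZ linear_id zero _ t])
    fix m n assume "m \<in> carrier V" "n \<in> carrier ?Z"
    then show "pure_tensor K V ?Z m n = \<zero>\<^bsub>tensor_prod K V ?Z\<^esub>"
      using linear_zero[OF bilinear_right[OF bilinear_pure[OF V Z]] Z VZ, of m] by (simp add: zero_module_def)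
  qed
qed

lemma linear_const_zero: "module K M \<Longrightarrow> module K P \<Longrightarrow> (\<lambda>_. \<zero>\<^bsub>P\<^esub>) \<in> linear_maps K M P"
proof -
  assume "module K P" then interpret P: module K P .
  show "(\<lambda>_. \<zero>\<^bsub>P\<^esub>) \<in> linear_maps K M P" by (rule linearI) auto
qed

lemma zero_mem_cotensor:
  assumes V: "module K V" and C: "module K C" and M: "module K M"
    and \<delta>: "\<delta> \<in> linear_maps K V (tensor_prod K V C)" and \<rho>: "\<rho> \<in> linear_maps K M (tensor_prod K C M)"
  shows "\<zero>\<^bsub>tensor_prod K V M\<^esub> \<in> cotensor K C V \<delta> M \<rho>"
proof -
  have VC: "module K (tensor_prod K V C)" and CM: "module K (tensor_prod K C M)" and VM: "module K (tensor_prod K V M)"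
    and VCM: "module K (tensor_prod K (tensor_prod K V C) M)" and T: "module K (tensor_prod K V (tensor_prod K C M))"
    using V C M by simp_all
  interpret VM: module K "tensor_prod K V M" by (rule VM)
  have "tensor_map K (tensor_prod K V C) M \<delta> (\<lambda>m. m) \<zero>\<^bsub>tensor_prod K V M\<^esub> = \<zero>\<^bsub>tensor_prod K (tensor_prod K V C) M\<^esub>"
    by (rule linear_zero[OF linear_tensor_map(1)[OF V M VC M \<delta> linear_id] VM VCM])
  moreover have "tensor_assoc K V C M \<zero>\<^bsub>tensor_prod K (tensor_prod K V C) M\<^esub> = \<zero>\<^bsub>tensor_prod K V (tensor_prod K C M)\<^esub>"
    by (rule linear_zero[OF linear_assoc[OF V C M] VCM T])
  moreover have "tensor_map K V (tensor_prod K C M) (\<lambda>v. v) \<rho> \<zero>\<^bsub>tensor_prod K V M\<^esub> = \<zero>\<^bsub>tensor_prod K V (tensor_prod K C M)\<^esub>"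
    by (rule linear_zero[OF linear_tensor_map(1)[OF V M V CM linear_id \<rho>] VM T])
  ultimately show ?thesis by (simp add: cotensor_def)
qed

lemma (in coalgebra) left_comodule_zero_module:
  fixes z :: 'u
  defines "Z \<equiv> zero_module z :: ('k, 'u) module"
  shows "left_comodule K C Z (\<lambda>_. \<zero>\<^bsub>tensor_prod K C Z\<^esub>)"
proof -
  note C = module_C
  have Z: "module K Z" unfolding Z_def by (rule module_zero_module[OF R.is_cring])
  have CC: "module K (tensor_prod K C C)" and CZ: "module K (tensor_prod K C Z)"
    and CCZ: "module K (tensor_prod K (tensor_prod K C C) Z)" and T: "module K (tensor_prod K C (tensor_prod K C Z))"
    using Z by simp_all
  interpret CZ: module K "tensor_prod K C Z" by (rule CZ)
  interpret Z: module K Z by (rule Z)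
  have r: "(\<lambda>_. \<zero>\<^bsub>tensor_prod K C Z\<^esub>) \<in> linear_maps K Z (tensor_prod K C Z)" by (rule linear_const_zero[OF Z CZ])
  have 1: "tensor_map K (tensor_prod K C C) Z (comult C) (\<lambda>m. m) \<zero>\<^bsub>tensor_prod K C Z\<^esub> = \<zero>\<^bsub>tensor_prod K (tensor_prod K C C) Z\<^esub>"
    by (rule linear_zero[OF linear_tensor_map(1)[OF C Z CC Z comult_linear linear_id] CZ CCZ])
  have 2: "tensor_assoc K C C Z \<zero>\<^bsub>tensor_prod K (tensor_prod K C C) Z\<^esub> = \<zero>\<^bsub>tensor_prod K C (tensor_prod K C Z)\<^esub>"
    by (rule linear_zero[OF linear_assoc[OF C C Z] CCZ T])
  have 3: "tensor_map K C (tensor_prod K C Z) (\<lambda>c. c) (\<lambda>_. \<zero>\<^bsub>tensor_prod K C Z\<^esub>) \<zero>\<^bsub>tensor_prod K C Z\<^esub> = \<zero>\<^bsub>tensor_prod K C (tensor_prod K C Z)\<^esub>"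
    by (rule linear_zero[OF linear_tensor_map(1)[OF C Z C CZ linear_id r] CZ T])
  have 4: "tlift Z (\<lambda>c x. counit C c \<odot>\<^bsub>Z\<^esub> x) \<zero>\<^bsub>tensor_prod K C Z\<^esub> = \<zero>\<^bsub>Z\<^esub>"
    by (rule linear_zero[OF linear_lift(1)[OF C Z Z] CZ Z])
      (intro bilinearI linear_counit_smult Z linear_smult_left linear_id counit_closed)
  have 5: "m = \<zero>\<^bsub>Z\<^esub>" if "m \<in> carrier Z" for m using that by (simp add: Z_def zero_module_def)
  show ?thesis
    unfolding left_comodule_def
  proof (intro conjI ballI Z r)
    fix m assume m: "m \<in> carrier Z"
    show "tensor_assoc K C C Z (tensor_map K (tensor_prod K C C) Z (comult C) (\<lambda>x. x) \<zero>\<^bsub>tensor_prod K C Z\<^esub>)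
      = tensor_map K C (tensor_prod K C Z) (\<lambda>c. c) (\<lambda>_. \<zero>\<^bsub>tensor_prod K C Z\<^esub>) \<zero>\<^bsub>tensor_prod K C Z\<^esub>"
      by (simp only: 1 2 3)
    show "tensor_lift (add_monoid Z) (\<lambda>c x. counit C c \<odot>\<^bsub>Z\<^esub> x) \<zero>\<^bsub>tensor_prod K C Z\<^esub> = m"
      using 4 5[OF m] by (simp only: tlift_def)
  qed
qed

context coinvariant_quotient
begin

text \<open>
  Injections of \<open>E\<close> and of sets of its elements (such as cosets) into the universe over which
  \<^const>\<open>right_faithfully_coflat\<close> quantifies.
\<close>
definition codeE :: "'h \<Rightarrow> (nat \<Rightarrow> 'h set) set" where "codeE x = {\<lambda>_. {x}}"
definition decodeE :: "(nat \<Rightarrow> 'h set) set \<Rightarrow> 'h" where "decodeE X = the_elem (the_elem X 0)"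
definition codeQ :: "'h set \<Rightarrow> (nat \<Rightarrow> 'h set) set" where "codeQ x = {\<lambda>_. x}"
definition decodeQ :: "(nat \<Rightarrow> 'h set) set \<Rightarrow> 'h set" where "decodeQ X = the_elem X 0"

lemma decodeE_codeE [simp]: "decodeE (codeE x) = x" by (simp add: codeE_def decodeE_def)
lemma decodeQ_codeQ [simp]: "decodeQ (codeQ x) = x" by (simp add: codeQ_def decodeQ_def)
lemma codeQ_inject [simp]: "codeQ x = codeQ y \<longleftrightarrow> x = y" by (metis decodeQ_codeQ)

abbreviation "pbar \<equiv> \<lambda>X. p (rep X)"

lemma pbar_linear: "pbar \<in> linear_maps K Q C"
  by (rule linear_rep[OF C.module_C p p_I])

lemma pbar_proj: "x \<in> carrier E \<Longrightarrow> pbar (proj x) = p x"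
  by (rule rep_proj[OF C.module_C p p_I])

lemma pbar_comult:
  assumes X: "X \<in> carrier Q" shows "comult C (pbar X) = tensor_map K C C pbar pbar (comult Q X)"
proof -
  note mE = module_C and mC = C.module_C and mQ = module_Q
  obtain y where y: "y \<in> carrier E" "X = proj y" using X by (auto simp: carrier_Q)
  have "tensor_map K C C pbar pbar (comult Q X) = tensor_map K C C (\<lambda>x. pbar (proj x)) (\<lambda>x. pbar (proj x)) (comult E y)"
    unfolding y(2) comult_proj[OF y(1)]
    by (rule tensor_map_comp[OF mE mE mQ mQ mC mC proj_linear proj_linear pbar_linear pbar_linear comult_closed[OF y(1)]])
  also have "\<dots> = tensor_map K C C p p (comult E y)"
    by (rule tensor_map_cong[OF mE mE mC mC p p _ _ comult_closed[OF y(1)], symmetric]) (simp_all add: pbar_proj)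
  finally show ?thesis using y by (simp add: pbar_proj p_comult)
qed

lemma pbar_counit: "X \<in> carrier Q \<Longrightarrow> counit C (pbar X) = counit Q X"
  by (auto simp: carrier_Q pbar_proj p_counit counit_proj)

text \<open>
  The map \<open>E/I \<rightarrow> C\<close> becomes injective after applying \<open>E \<box>\<^sub>C -\<close>: an element of \<open>E \<box>\<^sub>C E/I\<close> lifts to
  \<open>E \<box>\<^sub>C E\<close> because the functor is exact, and there the element \<open>w\<close> determines the image in \<open>E \<otimes> E/I\<close>
  and is determined by the image in \<open>E \<otimes> C\<close>.
\<close>
theorem kernel_eq:
  assumes coflat: "right_faithfully_coflat K C E \<delta>" and x: "x \<in> carrier E" and px: "p x = \<zero>\<^bsub>C\<^esub>"
  shows "x \<in> I"
proof -
  note mE = module_C and mC = C.module_C and mQ = module_Q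
  let ?f = pbar
  note f = pbar_linear and fp = pbar_proj and f_comult = pbar_comult and f_counit = pbar_counit
  let ?ME = "transport codeE decodeE E" and ?MQ = "transport codeQ decodeQ Q" and ?MC = "transport codeQ decodeQ C"
  note ME = module_transport[where e = codeE and e' = decodeE, OF mE decodeE_codeE] linear_transport[where e = codeE and e' = decodeE, OF mE decodeE_codeE] linear_transport'[where e = codeE and e' = decodeE, OF mE decodeE_codeE] transport_inverse[where e = codeE and e' = decodeE, OF mE decodeE_codeE]
  note MQ = module_transport[where e = codeQ and e' = decodeQ, OF mQ decodeQ_codeQ] linear_transport[where e = codeQ and e' = decodeQ, OF mQ decodeQ_codeQ] linear_transport'[where e = codeQ and e' = decodeQ, OF mQ decodeQ_codeQ] transport_inverse[where e = codeQ and e' = decodeQ, OF mQ decodeQ_codeQ]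
  note MC = module_transport[where e = codeQ and e' = decodeQ, OF mC decodeQ_codeQ] linear_transport[where e = codeQ and e' = decodeQ, OF mC decodeQ_codeQ] linear_transport'[where e = codeQ and e' = decodeQ, OF mC decodeQ_codeQ] transport_inverse[where e = codeQ and e' = decodeQ, OF mC decodeQ_codeQ]
  let ?\<rho>E = "\<lambda>m. tensor_map K C ?ME p codeE (comult E (decodeE m))"
  let ?\<rho>Q = "\<lambda>m. tensor_map K C ?MQ ?f codeQ (comult Q (decodeQ m))"
  let ?\<rho>C = "\<lambda>m. tensor_map K C ?MC (\<lambda>c. c) codeQ (comult C (decodeQ m))"
  have cE: "left_comodule K C ?ME ?\<rho>E"
    by (rule induced_left_comodule[OF coalgebra_axioms C.coalgebra_axioms p p_comult p_counit ME(1-4) decodeE_codeE])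
  have cQ: "left_comodule K C ?MQ ?\<rho>Q"
    by (rule induced_left_comodule[OF coalgebra_Q C.coalgebra_axioms f f_comult f_counit MQ(1-4) decodeQ_codeQ])
  have cC: "left_comodule K C ?MC ?\<rho>C"
    by (rule induced_left_comodule[OF C.coalgebra_axioms C.coalgebra_axioms linear_id _ _ MC(1-4) decodeQ_codeQ])
      (simp_all add: tensor_map_id[OF mC mC])
  have \<rho>Q: "?\<rho>Q \<in> linear_maps K ?MQ (tensor_prod K C ?MQ)" using cQ unfolding left_comodule_def by (elim conjE)
  let ?z = "{} :: (nat \<Rightarrow> 'h set) set"
  define Z where "Z = (zero_module ?z :: ('k, (nat \<Rightarrow> 'h set) set) module)"
  have mZ: "module K Z" unfolding Z_def by (rule module_zero_module[OF R.is_cring])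
  have Zc: "carrier Z = {?z}" and Z0: "\<zero>\<^bsub>Z\<^esub> = ?z" by (simp_all add: Z_def zero_module_def)
  have tZ: "t = \<zero>\<^bsub>tensor_prod K V Z\<^esub>" if "module K V" "t \<in> carrier (tensor_prod K V Z)" for V :: "('k, 'v, 'y) module_scheme" and t
    using that unfolding Z_def by (rule tensor_zero_module)
  let ?\<rho>Z = "\<lambda>_ :: (nat \<Rightarrow> 'h set) set. \<zero>\<^bsub>tensor_prod K C Z\<^esub>"
  have cZ: "left_comodule K C Z ?\<rho>Z" unfolding Z_def by (rule C.left_comodule_zero_module)
  have CZ: "module K (tensor_prod K C Z)" and CMQ: "module K (tensor_prod K C ?MQ)" and EZ: "module K (tensor_prod K E Z)"
    and EMQ: "module K (tensor_prod K E ?MQ)" and EMC: "module K (tensor_prod K E ?MC)"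
    using mZ MQ(1) MC(1) mC mE by simp_all
  interpret MQ: module K ?MQ by (rule MQ(1))
  interpret EMQ: module K "tensor_prod K E ?MQ" by (rule EMQ)
  let ?g1 = "\<lambda>m. codeQ (proj (decodeE m))" and ?g2 = "\<lambda>m. codeQ (?f (decodeQ m))"
  have g1: "?g1 \<in> left_comodule_hom K C ?ME ?\<rho>E ?MQ ?\<rho>Q"
    by (rule induced_left_comodule_hom[OF coalgebra_axioms coalgebra_Q mC p f proj_linear comult_proj fp ME(1) MQ(1) ME(2,3) MQ(2) decodeE_codeE decodeQ_codeQ])
  have g2: "?g2 \<in> left_comodule_hom K C ?MQ ?\<rho>Q ?MC ?\<rho>C"
    by (rule induced_left_comodule_hom[OF coalgebra_Q C.coalgebra_axioms mC f linear_id f f_comult _ MQ(1) MC(1) MQ(2,3) MC(2) decodeQ_codeQ decodeQ_codeQ]) simp_all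
  have lQZ: "(\<lambda>_. ?z) \<in> linear_maps K ?MQ Z" using linear_const_zero[OF MQ(1) mZ] by (simp add: Z0)
  have gQZ: "(\<lambda>_. ?z) \<in> left_comodule_hom K C ?MQ ?\<rho>Q Z ?\<rho>Z"
    unfolding left_comodule_hom_def
  proof (intro CollectI conjI ballI lQZ)
    fix m assume m: "m \<in> carrier ?MQ"
    have "tensor_map K C Z (\<lambda>c. c) (\<lambda>_. ?z) (?\<rho>Q m) \<in> carrier (tensor_prod K C Z)"
      by (rule tensor_map_closed[OF mC MQ(1) mC mZ linear_id lQZ linear_closed[OF \<rho>Q m]])
    then show "\<zero>\<^bsub>tensor_prod K C Z\<^esub> = tensor_map K C Z (\<lambda>c. c) (\<lambda>_. ?z) (?\<rho>Q m)"
      by (rule tZ[OF mC, symmetric])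
  qed
  let ?o = "\<lambda>_ :: (nat \<Rightarrow> 'h set) set. \<zero>\<^bsub>?MQ\<^esub>"
  have lZQ: "?o \<in> linear_maps K Z ?MQ" by (rule linear_const_zero[OF mZ MQ(1)])
  have gZQ: "?o \<in> left_comodule_hom K C Z ?\<rho>Z ?MQ ?\<rho>Q"
    unfolding left_comodule_hom_def
    using lZQ linear_zero[OF \<rho>Q MQ(1) CMQ] linear_zero[OF linear_tensor_map(1)[OF mC mZ mC MQ(1) linear_id lZQ] CZ CMQ] by simp
  have ex: "exact_at (carrier M1) f (carrier M2) g \<zero>\<^bsub>M3\<^esub> \<longleftrightarrow>
         exact_at (cotensor K C E \<delta> M1 \<rho>1) (tensor_map K E M2 (\<lambda>v. v) f)
                  (cotensor K C E \<delta> M2 \<rho>2) (tensor_map K E M3 (\<lambda>v. v) g) \<zero>\<^bsub>tensor_prod K E M3\<^esub>"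
    if "left_comodule K C M1 \<rho>1" "left_comodule K C M2 \<rho>2" "left_comodule K C M3 \<rho>3"
      "f \<in> left_comodule_hom K C M1 \<rho>1 M2 \<rho>2" "g \<in> left_comodule_hom K C M2 \<rho>2 M3 \<rho>3"
    for M1 M2 M3 :: "('k, (nat \<Rightarrow> 'h set) set) module" and \<rho>1 \<rho>2 \<rho>3 f g
    using coflat that unfolding right_faithfully_coflat_def by simp
  have lg1: "?g1 \<in> linear_maps K ?ME ?MQ" and lg2: "?g2 \<in> linear_maps K ?MQ ?MC"
    using g1 g2 by (simp_all add: left_comodule_hom_def)

  \<comment> \<open>exactness of the functor at \<open>E \<rightarrow> E/I \<rightarrow> 0\<close>\<close>
  have onto: "\<exists>t\<in>cotensor K C E \<delta> ?ME ?\<rho>E. \<xi> = tensor_map K E ?MQ (\<lambda>v. v) ?g1 t"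
    if \<xi>: "\<xi> \<in> cotensor K C E \<delta> ?MQ ?\<rho>Q" for \<xi>
  proof -
    have "exact_at (carrier ?ME) ?g1 (carrier ?MQ) (\<lambda>_. ?z) \<zero>\<^bsub>Z\<^esub>"
      by (auto simp: exact_at_def transport_simps Z0 carrier_Q image_image)
    then have "exact_at (cotensor K C E \<delta> ?ME ?\<rho>E) (tensor_map K E ?MQ (\<lambda>v. v) ?g1)
                  (cotensor K C E \<delta> ?MQ ?\<rho>Q) (tensor_map K E Z (\<lambda>v. v) (\<lambda>_. ?z)) \<zero>\<^bsub>tensor_prod K E Z\<^esub>"
      using ex[OF cE cQ cZ g1 gQZ] by (rule iffD1[rotated])
    moreover have "tensor_map K E Z (\<lambda>v. v) (\<lambda>_. ?z) \<xi> = \<zero>\<^bsub>tensor_prod K E Z\<^esub>"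
    proof -
      have "\<xi> \<in> carrier (tensor_prod K E ?MQ)" using \<xi> by (simp add: cotensor_def)
      then have "tensor_map K E Z (\<lambda>v. v) (\<lambda>_. ?z) \<xi> \<in> carrier (tensor_prod K E Z)"
        by (rule tensor_map_closed[OF mE MQ(1) mE mZ linear_id lQZ])
      then show ?thesis by (rule tZ[OF mE])
    qed
    ultimately have "\<xi> \<in> tensor_map K E ?MQ (\<lambda>v. v) ?g1 ` cotensor K C E \<delta> ?ME ?\<rho>E"
      using \<xi> by (simp add: exact_at_def)
    then show ?thesis by (rule imageE) (rule bexI)
  qed
  have inj: "\<xi> = \<zero>\<^bsub>tensor_prod K E ?MQ\<^esub>"
    if \<xi>: "\<xi> \<in> cotensor K C E \<delta> ?MQ ?\<rho>Q" and z: "tensor_map K E ?MC (\<lambda>v. v) ?g2 \<xi> = \<zero>\<^bsub>tensor_prod K E ?MC\<^esub>" for \<xi>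
  proof -
    obtain t where t: "t \<in> cotensor K C E \<delta> ?ME ?\<rho>E" "\<xi> = tensor_map K E ?MQ (\<lambda>v. v) ?g1 t" using onto[OF \<xi>] by (rule bexE)
    have tc: "t \<in> carrier (tensor_prod K E ?ME)" using t by (simp add: cotensor_def)
    obtain w where w: "w \<in> carrier E" and W: "\<forall>(X :: ('k, (nat \<Rightarrow> 'h set) set) module) g. module K X \<longrightarrow> g \<in> linear_maps K E X \<longrightarrow>
        (\<forall>a\<in>carrier E. \<forall>i\<in>I. g (a \<otimes>\<^bsub>E\<^esub> i) = \<zero>\<^bsub>X\<^esub>) \<longrightarrow>
        tensor_map K E X (\<lambda>x. x) (\<lambda>m. g (decodeE m)) t = tensor_map K E X (\<lambda>x. x) g (comult E w)"
      using cotensor_element[OF ME(1-4) decodeE_codeE t(1)] by (rule bexE)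
    have lp': "(\<lambda>x. codeQ (p x)) \<in> linear_maps K E ?MC" by (rule linear_comp[OF MC(2) p])
    have lq': "(\<lambda>x. codeQ (proj x)) \<in> linear_maps K E ?MQ" by (rule linear_comp[OF MQ(2) proj_linear])
    have "p (a \<otimes>\<^bsub>E\<^esub> i) = \<zero>\<^bsub>C\<^esub>" if "a \<in> carrier E" "i \<in> I" for a i
      using I.I_l_closed[OF that(2,1)] p_I by simp
    then have "tensor_map K E ?MC (\<lambda>x. x) (\<lambda>m. codeQ (p (decodeE m))) t = tensor_map K E ?MC (\<lambda>x. x) (\<lambda>x. codeQ (p x)) (comult E w)"
      using W[rule_format, OF MC(1) lp'] by (simp add: transport_simps)
    moreover have "tensor_map K E ?MC (\<lambda>v. v) ?g2 \<xi> = tensor_map K E ?MC (\<lambda>x. x) (\<lambda>m. codeQ (p (decodeE m))) t"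
    proof -
      have "tensor_map K E ?MC (\<lambda>v. v) ?g2 \<xi> = tensor_map K E ?MC (\<lambda>v. v) (\<lambda>m. ?g2 (?g1 m)) t"
        unfolding t(2) by (rule tensor_map_comp[OF mE ME(1) mE MQ(1) mE MC(1) linear_id lg1 linear_id lg2 tc])
      also have "\<dots> = tensor_map K E ?MC (\<lambda>x. x) (\<lambda>m. codeQ (p (decodeE m))) t"
        by (rule tensor_map_cong[OF mE ME(1) mE MC(1) linear_id linear_comp[OF lg2 lg1] _ _ tc])
          (use linear_closed[OF ME(3)] in \<open>simp_all add: fp\<close>)
      finally show ?thesis .
    qed
    ultimately have z': "tensor_map K E ?MC (\<lambda>x. x) (\<lambda>x. codeQ (p x)) (comult E w) = \<zero>\<^bsub>tensor_prod K E ?MC\<^esub>" using z by simp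
    \<comment> \<open>apply \<open>id \<otimes> \<epsilon>\<close> to \<open>\<Sum> w\<^sub>1 \<otimes> p(w\<^sub>2) = 0\<close>\<close>
    have "w = \<zero>\<^bsub>E\<^esub>"
    proof -
      let ?c = "\<lambda>x c. counit C (decodeQ c) \<odot>\<^bsub>E\<^esub> x"
      have bc: "bilinear_map K E ?MC E ?c"
        by (intro bilinearI C.linear_counit_smult[OF mE _ MC(3)] linear_smult_left[OF mE linear_id] C.counit_closed linear_closed[OF MC(3)])
      have "tlift E ?c (tensor_map K E ?MC (\<lambda>x. x) (\<lambda>x. codeQ (p x)) (comult E w)) = tlift E (\<lambda>x y. counit C (p y) \<odot>\<^bsub>E\<^esub> x) (comult E w)"
        using lift_tensor_map[OF mE mE mE MC(1) mE linear_id lp' bc comult_closed[OF w]] by simp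
      also have "\<dots> = tlift E (\<lambda>x y. counit E y \<odot>\<^bsub>E\<^esub> x) (comult E w)"
        by (rule lift_cong[OF mE mE comult_closed[OF w], symmetric]) (simp add: p_counit)
      also have "\<dots> = w" by (rule tlift_counit_right[OF mE linear_id w])
      finally show ?thesis
        using z' linear_zero[OF linear_lift(1)[OF mE MC(1) mE bc] EMC mE] by simp
    qed
    moreover have "codeQ (proj (a \<otimes>\<^bsub>E\<^esub> i)) = \<zero>\<^bsub>?MQ\<^esub>" if "a \<in> carrier E" "i \<in> I" for a i
      using I.I_l_closed[OF that(2,1)] by (simp add: proj_I transport_simps)
    ultimately have "\<xi> = tensor_map K E ?MQ (\<lambda>x. x) (\<lambda>x. codeQ (proj x)) (comult E \<zero>\<^bsub>E\<^esub>)"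
      using W[rule_format, OF MQ(1) lq'] t(2) by simp
    also have "\<dots> = \<zero>\<^bsub>tensor_prod K E ?MQ\<^esub>"
      by (rule linear_zero[OF linear_comp[OF linear_tensor_map(1)[OF mE mE mE MQ(1) linear_id lq'] comult_linear] mE EMQ])
    finally show ?thesis .
  qed
  \<comment> \<open>the functor reflects the exactness of \<open>0 \<rightarrow> E/I \<rightarrow> C\<close>\<close>
  have zQ: "\<zero>\<^bsub>tensor_prod K E ?MQ\<^esub> \<in> cotensor K C E \<delta> ?MQ ?\<rho>Q"
    by (rule zero_mem_cotensor[OF mE mC MQ(1) \<delta>_linear \<rho>Q])
  have \<rho>Z: "?\<rho>Z \<in> linear_maps K Z (tensor_prod K C Z)" using cZ unfolding left_comodule_def by (elim conjE)
  have Zcot: "cotensor K C E \<delta> Z ?\<rho>Z = {\<zero>\<^bsub>tensor_prod K E Z\<^esub>}"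
  proof
    show "cotensor K C E \<delta> Z ?\<rho>Z \<subseteq> {\<zero>\<^bsub>tensor_prod K E Z\<^esub>}"
      using tZ[OF mE] by (auto simp: cotensor_def)
    show "{\<zero>\<^bsub>tensor_prod K E Z\<^esub>} \<subseteq> cotensor K C E \<delta> Z ?\<rho>Z"
      using zero_mem_cotensor[OF mE mC mZ \<delta>_linear \<rho>Z] by simp
  qed
  have i1: "tensor_map K E ?MQ (\<lambda>v. v) ?o \<zero>\<^bsub>tensor_prod K E Z\<^esub> = \<zero>\<^bsub>tensor_prod K E ?MQ\<^esub>"
    by (rule linear_zero[OF linear_tensor_map(1)[OF mE mZ mE MQ(1) linear_id lZQ] EZ EMQ])
  have i2: "tensor_map K E ?MC (\<lambda>v. v) ?g2 \<zero>\<^bsub>tensor_prod K E ?MQ\<^esub> = \<zero>\<^bsub>tensor_prod K E ?MC\<^esub>"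
    by (rule linear_zero[OF linear_tensor_map(1)[OF mE MQ(1) mE MC(1) linear_id lg2] EMQ EMC])
  have "exact_at (cotensor K C E \<delta> Z ?\<rho>Z) (tensor_map K E ?MQ (\<lambda>v. v) ?o)
                  (cotensor K C E \<delta> ?MQ ?\<rho>Q) (tensor_map K E ?MC (\<lambda>v. v) ?g2) \<zero>\<^bsub>tensor_prod K E ?MC\<^esub>"
    unfolding exact_at_def Zcot image_insert image_empty i1
  proof (rule equalityI)
    show "{y \<in> cotensor K C E \<delta> ?MQ ?\<rho>Q. tensor_map K E ?MC (\<lambda>v. v) ?g2 y = \<zero>\<^bsub>tensor_prod K E ?MC\<^esub>} \<subseteq> {\<zero>\<^bsub>tensor_prod K E ?MQ\<^esub>}"
      by (intro subsetI singletonI) (elim CollectE conjE, drule (1) inj, simp only: singleton_iff)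
  qed (simp add: zQ i2)
  then have "exact_at (carrier Z) ?o (carrier ?MQ) ?g2 \<zero>\<^bsub>?MC\<^esub>"
    using ex[OF cZ cQ cC gZQ g2] by (rule iffD2[rotated])
  moreover have "codeQ (proj x) \<in> carrier ?MQ" using x by (simp add: transport_simps)
  moreover have "?g2 (codeQ (proj x)) = \<zero>\<^bsub>?MC\<^esub>" using x px by (simp add: fp transport_simps)
  ultimately have "codeQ (proj x) = \<zero>\<^bsub>?MQ\<^esub>" unfolding exact_at_def Zc by blast
  then show ?thesis using proj_eq_zero_iff[OF x] by (simp add: transport_simps)
qed

end

section \<open>The isomorphism\<close>

context hopf_sub
begin

lemma minus_HA: "x \<in> A \<Longrightarrow> \<ominus>\<^bsub>HA\<^esub> x = \<ominus>\<^bsub>H\<^esub> x"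
  using linear_minus[OF linear_incl module_HA module_C, of x] by simp

lemma submodule_HA_trans:
  assumes W: "submodule W K HA" shows "submodule W K H"
proof -
  note E = module.submoduleE[OF module_HA W]
  have "W \<subseteq> A" using E(1) by simp
  then show ?thesis
    using E submodule_zero[OF W] sub_carrier minus_HA by (intro submoduleI) (auto simp: subset_iff)
qed

lemma hopf_subalgebra_HA:
  assumes S: "hopf_subalgebra K H S" and SA: "S \<subseteq> A"
  shows "hopf_subalgebra K HA S"
proof -
  interpret S: hopf_sub K H S by unfold_locales (rule S)
  interpret HA: ring HA by (rule ring_HA)
  obtain p where p: "p\<in>linear_maps K H HA" and pi: "\<forall>a\<in>A. p a = a" using exists_projection_HA by (elim bexE)
  have Sm: "\<ominus>\<^bsub>HA\<^esub> x \<in> S" if "x \<in> S" for x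
    using submoduleE(3)[OF S.sub_mod that] minus_HA[of x] SA that by auto
  have sm: "submodule S K HA"
    using SA submodule_zero[OF S.sub_mod] Sm by (intro module.submoduleI[OF module_HA]) auto
  show ?thesis
    unfolding hopf_subalgebra_def
  proof (intro conjI ballI sm)
    show "subring S HA" using SA Sm by (intro HA.subringI) auto
    fix a assume a: "a \<in> S"
    have "tensor_map K HA HA p p (comult H a) \<in> sub_tensor K HA HA S S"
      by (rule tensor_map_mem_sub_tensor[OF module_C module_C module_HA module_HA p p S.sub_carrier S.sub_carrier sm _ _ _ S.comult_sub[OF a]])
        (use SA pi in auto)
    then show "comult HA a \<in> sub_tensor K HA HA S S"
      using comult_restrict(1)[OF p _ subsetD[OF SA a]] pi by simp
    show "antipode HA a \<in> S" using a by simp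
  qed
qed

end

lemma augmentation_restrict: "augmentation K (hopf_restrict K H A) S = augmentation K H S"
  by (simp add: augmentation_def)

context hopf_normal
begin

abbreviation "I \<equiv> span_prod K H A (augmentation K H (A \<inter> B))"

lemma hopf_ideal_I: "hopf_ideal K A.HA I"
  using hopf_normal.hopf_ideal_J[OF hopf_normal_Int] by (simp add: span_prod_Int)

lemma I_sub_J: "I \<subseteq> J"
  by (rule span_prod_least[OF submodule_J]) (auto intro!: mult_in_span_prod simp: augmentation_def)

text \<open>
  Sums over the comultiplications of \<open>A\<close> and of \<open>A B\<close> agree, as both are sums over that of \<open>H\<close>.
\<close>
lemma tlift_comult_A_AB:
  assumes P: "module K P" and \<phi>: "bilinear_map K T.HA T.HA P \<phi>" and a: "a \<in> A"
  shows "tlift P \<phi> (comult A.HA a) = tlift P \<phi> (comult T.HA a)"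
proof -
  obtain p where p: "p\<in>linear_maps K H T.HA" and pi: "\<forall>a\<in>AB. p a = a" using T.exists_projection_HA by (elim bexE)
  have \<psi>: "bilinear_map K H H P (\<lambda>x y. \<phi> (p x) (p y))"
    using bilinear_left_comp[OF \<phi> p] bilinear_right_comp[OF \<phi> p] linear_closed[OF p] by (intro bilinearI) auto
  have \<phi>A: "bilinear_map K A.HA A.HA P \<phi>"
    using \<phi> A_sub_AB by (auto simp: bilinear_map_def linear_maps_def Pi_iff)
  have "tlift P \<phi> (comult A.HA a) = tlift P (\<lambda>x y. \<phi> (p x) (p y)) (comult H a)"
    by (rule A.tlift_comult_HA[OF P \<phi>A \<psi> _ a]) (use pi A_sub_AB in simp)
  also have "\<dots> = tlift P \<phi> (comult T.HA a)"
    by (rule T.tlift_comult_HA[OF P \<phi> \<psi> _ A_sub_AB[OF a], symmetric]) (use pi in simp)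
  finally show ?thesis .
qed

text \<open>
  The map is induced by \<open>p : A \<rightarrow> A B / A B\<^sup>+\<close>. A \<open>b \<in> A\<close> that is coinvariant for \<open>p\<close> is a coinvariant of
  \<open>A B\<close>, hence lies in \<open>A \<inter> B\<close>, and so \<open>b - \<epsilon>(b) 1\<close> belongs to \<open>(A \<inter> B)\<^sup>+\<close>. This makes the description of
  the kernel of \<open>p\<close> applicable and gives injectivity. The map is onto because \<open>a b - \<epsilon>(b) a\<close> belongs to
  \<open>A B\<^sup>+\<close>.
\<close>
theorem quotient_iso:
  assumes flat: "left_faithfully_flat B.HA (left_mult_module T.HA)"
    and coflat: "right_faithfully_coflat K (hopf_quot K T.HA J) A.HA (induced_coaction K A.HA (hopf_quot K T.HA J) (a_r_coset T.HA J))"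
  shows "\<exists>\<phi>\<in>hopf_iso K (hopf_quot K A.HA I) (hopf_quot K T.HA J). \<forall>a\<in>A. \<phi> (I +>\<^bsub>A.HA\<^esub> a) = J +>\<^bsub>T.HA\<^esub> a"
proof -
  interpret Q: hopf_quotient K T.HA J
    by (intro hopf_quotient.intro hopf_quotient_axioms.intro T.hopf_algebra_HA hopf_ideal_J)
  interpret D: hopf_quotient K A.HA I
    by (intro hopf_quotient.intro hopf_quotient_axioms.intro A.hopf_algebra_HA hopf_ideal_I)
  interpret TB: hopf_sub K T.HA B
    by (intro hopf_sub.intro hopf_sub_axioms.intro T.hopf_algebra_HA T.hopf_subalgebra_HA B.hopf_subalgebra) (auto intro: B_sub_AB)
  interpret AI: hopf_sub K A.HA "A \<inter> B"
    by (intro hopf_sub.intro hopf_sub_axioms.intro A.hopf_algebra_HA A.hopf_subalgebra_HA hopf_subalgebra_Int) auto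
  have J_span: "J \<subseteq> span_prod K T.HA (carrier T.HA) (augmentation K T.HA B)"
  proof (rule span_prod_least)
    have c: "augmentation K T.HA B \<subseteq> carrier T.HA" by (auto simp: augmentation_def B_sub_AB)
    show "submodule (span_prod K T.HA (carrier T.HA) (augmentation K T.HA B)) K H"
      by (rule T.submodule_HA_trans[OF Q.submodule_span_prod[OF subset_refl c]])
    fix u v assume "u \<in> A" "v \<in> Bp"
    then show "u \<otimes>\<^bsub>H\<^esub> v \<in> span_prod K T.HA (carrier T.HA) (augmentation K T.HA B)"
      using Q.mult_in_span_prod[of u "carrier T.HA" v "augmentation K T.HA B"] A_sub_AB by (simp add: augmentation_restrict)
  qed
  interpret F: hopf_quotient_by_sub K T.HA J B B.HA
    by (intro hopf_quotient_by_sub.intro hopf_quotient_by_sub_axioms.intro Q.hopf_quotient_axioms TB.hopf_sub_axioms J_span B.ring_HA) simp_all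
  let ?C = "hopf_quot K T.HA J" and ?p = "a_r_coset T.HA J"
  note mC = Q.module_Q and mT = T.module_HA and mA = A.module_HA
  have p: "?p \<in> linear_maps K A.HA ?C"
    using Q.proj_linear A_sub_AB by (auto simp: linear_maps_def Pi_iff)
  have pA: "?p x \<in> carrier ?C" if "x \<in> A" for x using Q.proj_closed A_sub_AB that by simp
  have coinv: "b \<ominus>\<^bsub>A.HA\<^esub> counit A.HA b \<odot>\<^bsub>A.HA\<^esub> \<one>\<^bsub>A.HA\<^esub> \<in> I"
    if b: "b \<in> A" and co: "tensor_map K ?C A.HA ?p (\<lambda>x. x) (comult A.HA b) = pure_tensor K ?C A.HA (?p \<one>\<^bsub>H\<^esub>) b" for b
  proof -
    have inc: "(\<lambda>x. x) \<in> linear_maps K A.HA T.HA" using A_sub_AB by (auto simp: linear_maps_def)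
    have "tensor_map K ?C T.HA ?p (\<lambda>x. x) (comult T.HA b) = tensor_map K ?C T.HA ?p (\<lambda>x. x) (comult A.HA b)"
      unfolding tensor_map_lift
      by (rule tlift_comult_A_AB[OF _ bilinear_tensor_map[OF mC mT Q.proj_linear linear_id] b, symmetric]) (simp add: mC)
    also have "\<dots> = tensor_map K ?C T.HA (\<lambda>x. x) (\<lambda>x. x) (tensor_map K ?C A.HA ?p (\<lambda>x. x) (comult A.HA b))"
      by (rule tensor_map_comp[OF mA mA mC mA mC mT p linear_id linear_id inc A.comult_HA_closed[OF b], symmetric])
    also have "\<dots> = pure_tensor K ?C T.HA (?p \<one>\<^bsub>H\<^esub>) b"
      unfolding co by (rule tensor_map_pure[OF mC mA mC mT linear_id inc]) (use b pA in simp_all)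
    finally have "b \<in> B" using F.coinvariant_mem[OF flat, of b] A_sub_AB[OF b] by simp
    then have "b \<ominus>\<^bsub>A.HA\<^esub> counit A.HA b \<odot>\<^bsub>A.HA\<^esub> \<one>\<^bsub>A.HA\<^esub> \<in> augmentation K H (A \<inter> B)"
      using AI.minus_counit_in_augmentation[of b] b by (simp add: augmentation_restrict)
    then show ?thesis
      using mult_in_span_prod[OF A.sub_one, of _ "augmentation K H (A \<inter> B)"] by (auto simp: augmentation_def)
  qed
  have p_comult: "comult ?C (?p x) = tensor_map K ?C ?C ?p ?p (comult A.HA x)" if x: "x \<in> A" for x
    using Q.comult_proj[of x] tlift_comult_A_AB[OF _ bilinear_tensor_map[OF mC mC Q.proj_linear Q.proj_linear] x] A_sub_AB[OF x] mC
    by (simp add: tensor_map_lift)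
  interpret S: coinvariant_quotient K A.HA I ?C ?p
  proof (intro coinvariant_quotient.intro coinvariant_quotient_axioms.intro D.hopf_quotient_axioms Q.coalgebra_Q p Q.ring_Q Q.linear_mult_Q)
    fix x y b i
    show "comult ?C (?p x) = tensor_map K ?C ?C ?p ?p (comult A.HA x)" if "x \<in> carrier A.HA"
      using p_comult that by simp
    show "counit ?C (?p x) = counit A.HA x" if "x \<in> carrier A.HA" using Q.counit_proj[of x] A_sub_AB that by simp
    show "?p (x \<otimes>\<^bsub>A.HA\<^esub> y) = ?p x \<otimes>\<^bsub>?C\<^esub> ?p y" if "x \<in> carrier A.HA" "y \<in> carrier A.HA"
      using Q.proj_mult[of x y] A_sub_AB that by simp
    show "?p \<one>\<^bsub>A.HA\<^esub> = \<one>\<^bsub>?C\<^esub>" using Q.proj_one by simp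
    show "?p i = \<zero>\<^bsub>?C\<^esub>" if "i \<in> I" by (rule Q.proj_I) (use that I_sub_J in blast)
    show "b \<ominus>\<^bsub>A.HA\<^esub> counit A.HA b \<odot>\<^bsub>A.HA\<^esub> \<one>\<^bsub>A.HA\<^esub> \<in> I"
      if "b \<in> carrier A.HA" "tensor_map K ?C A.HA ?p (\<lambda>x. x) (comult A.HA b) = pure_tensor K ?C A.HA (?p \<one>\<^bsub>A.HA\<^esub>) b"
      using coinv that by simp
  qed
  let ?D = "hopf_quot K A.HA I"
  have val: "S.pbar (I +>\<^bsub>A.HA\<^esub> a) = J +>\<^bsub>T.HA\<^esub> a" if "a \<in> A" for a using S.pbar_proj[of a] that by simp
  note Dc = D.carrier_Q[simplified] and Qc = Q.carrier_Q[simplified]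
  have hom: "S.pbar \<in> hopf_hom K ?D ?C"
    unfolding hopf_hom_def
  proof (intro CollectI conjI IntI ballI S.pbar_linear)
    show "S.pbar \<in> ring_hom ?D ?C"
    proof (rule ring_hom_memI)
      show "S.pbar X \<in> carrier ?C" if "X \<in> carrier ?D" for X by (rule linear_closed[OF S.pbar_linear that])
      show "S.pbar (X \<oplus>\<^bsub>?D\<^esub> Y) = S.pbar X \<oplus>\<^bsub>?C\<^esub> S.pbar Y" if "X \<in> carrier ?D" "Y \<in> carrier ?D" for X Y
        by (rule linear_add[OF S.pbar_linear that])
      show "S.pbar \<one>\<^bsub>?D\<^esub> = \<one>\<^bsub>?C\<^esub>" using val[OF A.sub_one] D.proj_one Q.proj_one by simp
      fix X Y assume "X \<in> carrier ?D" "Y \<in> carrier ?D"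
      then obtain x y where x: "x \<in> A" "X = I +>\<^bsub>A.HA\<^esub> x" and y: "y \<in> A" "Y = I +>\<^bsub>A.HA\<^esub> y"
        unfolding Dc by (elim imageE) blast
      have "X \<otimes>\<^bsub>?D\<^esub> Y = I +>\<^bsub>A.HA\<^esub> (x \<otimes>\<^bsub>H\<^esub> y)" using D.proj_mult[of x y] x y by simp
      then show "S.pbar (X \<otimes>\<^bsub>?D\<^esub> Y) = S.pbar X \<otimes>\<^bsub>?C\<^esub> S.pbar Y"
        using Q.proj_mult[of x y] x y val A_sub_AB by simp
    qed
    fix X assume X: "X \<in> carrier ?D"
    show "comult ?C (S.pbar X) = tensor_map K ?C ?C S.pbar S.pbar (comult ?D X)" by (rule S.pbar_comult[OF X])
    show "counit ?C (S.pbar X) = counit ?D X" by (rule S.pbar_counit[OF X])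
    obtain x where x: "x \<in> A" "X = I +>\<^bsub>A.HA\<^esub> x" using X unfolding Dc by (elim imageE) blast
    have "antipode ?D X = I +>\<^bsub>A.HA\<^esub> antipode H x" using D.antipode_proj[of x] x by simp
    then show "antipode ?C (S.pbar X) = S.pbar (antipode ?D X)"
      using Q.antipode_proj[of x] x val A_sub_AB by simp
  qed
  have inj: "inj_on S.pbar (carrier ?D)"
  proof (rule inj_onI)
    fix X Y assume X: "X \<in> carrier ?D" and Y: "Y \<in> carrier ?D" and e: "S.pbar X = S.pbar Y"
    have XY: "X \<ominus>\<^bsub>?D\<^esub> Y \<in> carrier ?D" by (rule abelian_group.minus_closed[OF ring.is_abelian_group[OF D.ring_Q] X Y])
    then obtain x where x: "x \<in> A" "X \<ominus>\<^bsub>?D\<^esub> Y = I +>\<^bsub>A.HA\<^esub> x" unfolding Dc by (elim imageE) blast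
    have "S.pbar (X \<ominus>\<^bsub>?D\<^esub> Y) = \<zero>\<^bsub>?C\<^esub>"
      using linear_diff[OF S.pbar_linear D.module_Q mC X Y] e module.minus_eq_zero_iff[OF mC] linear_closed[OF S.pbar_linear] X Y by simp
    then have "x \<in> I" using S.kernel_eq[OF coflat, of x] x val by simp
    then show "X = Y" using D.proj_I x X Y module.minus_eq_zero_iff[OF D.module_Q] by simp
  qed
  have surj: "J +>\<^bsub>T.HA\<^esub> x \<in> S.pbar ` carrier ?D" if x: "x \<in> AB" for x
  proof -
    obtain q where q: "q\<in>linear_maps K H T.HA" and qi: "\<forall>a\<in>AB. q a = a" using T.exists_projection_HA by (elim bexE)
    have W: "submodule (S.pbar ` carrier ?D) K ?C"
      by (rule submodule_image[OF S.pbar_linear D.module_Q mC])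
    have l: "(\<lambda>x. J +>\<^bsub>T.HA\<^esub> q x) \<in> linear_maps K H ?C" by (rule linear_comp[OF Q.proj_linear q])
    have "J +>\<^bsub>T.HA\<^esub> q x \<in> S.pbar ` carrier ?D"
    proof (rule linear_span_prod_mem[OF l mC W A.sub_carrier B.sub_carrier _ x])
      fix a b assume a: "a \<in> A" and b: "b \<in> B"
      have ab: "a \<otimes>\<^bsub>H\<^esub> b \<in> AB" using a b by (rule mult_in_span_prod)
      let ?k = "counit H b"
      have ka: "?k \<odot>\<^bsub>H\<^esub> a \<in> A" using a b by simp
      have "a \<otimes>\<^bsub>H\<^esub> (b \<ominus>\<^bsub>H\<^esub> ?k \<odot>\<^bsub>H\<^esub> \<one>\<^bsub>H\<^esub>) \<in> J"
        by (rule mult_in_span_prod[OF a B.minus_counit_in_augmentation[OF b]])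
      also have "a \<otimes>\<^bsub>H\<^esub> (b \<ominus>\<^bsub>H\<^esub> ?k \<odot>\<^bsub>H\<^esub> \<one>\<^bsub>H\<^esub>) = a \<otimes>\<^bsub>H\<^esub> b \<ominus>\<^bsub>H\<^esub> ?k \<odot>\<^bsub>H\<^esub> a"
        using linear_diff[OF linear_mult(2)[OF linear_id] module_C module_C, of a b "?k \<odot>\<^bsub>H\<^esub> \<one>\<^bsub>H\<^esub>"] a b by (simp add: smult_mult_right)
      also have "\<dots> = a \<otimes>\<^bsub>H\<^esub> b \<ominus>\<^bsub>T.HA\<^esub> ?k \<odot>\<^bsub>H\<^esub> a"
        using T.minus_HA[OF A_sub_AB[OF ka]] by (simp add: a_minus_def)
      finally have "J +>\<^bsub>T.HA\<^esub> (a \<otimes>\<^bsub>H\<^esub> b) = J +>\<^bsub>T.HA\<^esub> (?k \<odot>\<^bsub>H\<^esub> a)"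
        using Q.proj_eq_iff[of "a \<otimes>\<^bsub>H\<^esub> b" "?k \<odot>\<^bsub>H\<^esub> a"] ab A_sub_AB[OF ka] by simp
      also have "\<dots> = S.pbar (I +>\<^bsub>A.HA\<^esub> (?k \<odot>\<^bsub>H\<^esub> a))" using val[OF ka] by simp
      finally show "J +>\<^bsub>T.HA\<^esub> q (a \<otimes>\<^bsub>H\<^esub> b) \<in> S.pbar ` carrier ?D"
        using ka ab qi Dc by simp
    qed
    then show ?thesis using x qi by simp
  qed
  have "S.pbar ` carrier ?D = carrier ?C"
  proof
    show "S.pbar ` carrier ?D \<subseteq> carrier ?C" using linear_closed[OF S.pbar_linear] by blast
    show "carrier ?C \<subseteq> S.pbar ` carrier ?D" unfolding Qc using surj by (intro image_subsetI)
  qed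
  then have "S.pbar \<in> hopf_iso K ?D ?C"
    using hom inj by (simp add: hopf_iso_def bij_betw_def)
  then show ?thesis using val by (intro bexI[of _ S.pbar] ballI)
qed

end

theorem theorem3p4:
  fixes K :: "('k, 'x) ring_scheme"
    and H :: "('k, 'h) hopf_alg"
    and A B :: "'h set"
  assumes "hopf_algebra K H"
    and "hopf_subalgebra K H A"
    and "hopf_subalgebra K H B"
    and "right_normalizes H A B"
  defines "AB \<equiv> span_prod K H A B"
    and "I \<equiv> span_prod K H A (augmentation K H (A \<inter> B))"
    and "J \<equiv> span_prod K H A (augmentation K H B)"
  shows "hopf_subalgebra K H AB \<and>
    (hopf_ideal K (hopf_restrict K H A) I \<and> hopf_ideal K (hopf_restrict K H AB) J) \<and>
    (let HA = hopf_restrict K H A; HB = hopf_restrict K H B; HAB = hopf_restrict K H AB;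
         C = hopf_quot K HAB J; \<pi>' = a_r_coset HAB J
     in left_faithfully_flat HB (left_mult_module HAB) \<and>
        right_faithfully_coflat K C HA (induced_coaction K HA C \<pi>') \<longrightarrow>
        (\<exists>\<phi>\<in>hopf_iso K (hopf_quot K HA I) C. \<forall>a\<in>A. \<phi> (I +>\<^bsub>HA\<^esub> a) = J +>\<^bsub>HAB\<^esub> a))"
proof -
  interpret hopf_normal K H A B
    using assms(1-4) by (intro hopf_normal.intro hopf_sub.intro hopf_sub_axioms.intro hopf_normal_axioms.intro)
  show ?thesis
    unfolding Let_def AB_def I_def J_def
    by (intro conjI impI hopf_subalgebra_AB hopf_ideal_I hopf_ideal_J quotient_iso) (elim conjE, assumption)+
qed

end
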